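(* Let $0<p,q<1$ with $p+q=1$; $0<p'<p$, $q'=1-p'$, $0<r\le\frac{1-\alpha q'}{\alpha q'}$; $0\le\widehat q<q$, $\widehat p=1-\widehat q$, $0<\widehat r\le\frac{1-\alpha}{\alpha}$. Suppose $\varphi\in D(L^{\beta(p+\widehat q)})$, $k\in C[0,T]$, $F(t,\cdot,\mathbf 0)=\mathbf 0$ and $\|F(t_1,\cdot,v_1)-F(t_2,\cdot,v_2)\|\le\Upsilon^*(|t_1-t_2|+\|v_1-v_2\|)$ for all $v_1,v_2\in L_2(\Omega)$ and $t,t_1,t_2\in(0,T)$, with a constant $\Upsilon^*>0$, and $\Theta(T)<1$. Then the nonlocal problem $$\partial_t^\alpha u+L^\beta u+k(t)u=F(t,x,u)\ \text{in }(0,T)\times\Omega,\quad \mathbf Bu=0\ \text{on }(0,T)\times\partial\Omega,\quad u(T,x)=\kappa u(0,x)+\varphi(x),\ x\in\Omega,$$ has a unique (mild) solution $u$, it satisfies $\partial_t^\alpha u\in C^\alpha((0,T];D(L^{-\beta q}))$, and there exists a constant $C_9>0$ such that $$\|\partial_t^\alpha u\|_{C^\alpha((0,T];D(L^{-\beta q}))}\le C_9\,\|\varphi\|_{D(L^{\beta(p+\widehat q)})}.$$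
   Context: Setting. $0<\alpha<1$, $0<\beta\le1$, $T>0$, $\kappa$ a real number; $\Omega\subset\mathbb R^N$ ($N\ge1$) is open and bounded with boundary $\partial\Omega$; $\|\cdot\|$, $(\cdot,\cdot)$ are the norm and inner product of $L_2(\Omega)$. The Caputo derivative is $\partial_t^\alpha u=\frac1{\Gamma(1-\alpha)}\int_0^t(t-\tau)^{-\alpha}u_\tau(\tau)\,d\tau$. $Lu=-\sum_i\partial_{x_i}\bigl(\sum_jA_{ij}\partial_{x_j}u\bigr)+bu$ with $A_{ij}=A_{ji}\in C^1(\bar\Omega)$, $b\in C(\bar\Omega)$, $b\ge0$, and $\xi^T[A_{ij}(x)]\xi\ge L_0|\xi|^2$ for some $L_0>0$. The boundary operator is $\mathbf Bv=v$ or $\mathbf Bv=([A_{ij}]\nabla v)\cdot\vec n$. $L$ has eigenvalues $0<\lambda_1\le\lambda_2\le\dots\to\infty$ and eigenfunctions $e_j\in\{v\in H^2(\Omega):\mathbf Bv=0\}$ forming an orthonormal basis of $L_2(\Omega)$. For $\gamma\ge0$, $L^\gamma v=\sum_j\lambda_j^\gamma(v,e_j)e_j$, $D(L^\gamma)=\{v\in L_2(\Omega):\|L^\gamma v\|<\infty\}$, $\|v\|_{D(L^\gamma)}=\|L^\gamma v\|$; $D(L^{-\gamma})$ is the dual of $D(L^\gamma)$ (with $L_2(\Omega)$ identified with its dual), with norm $\|v\|_{D(L^{-\gamma})}=\bigl(\sum_j(v,e_j)_{-\gamma,\gamma}^2\lambda_j^{-2\gamma}\bigr)^{1/2}$, $(\cdot,\cdot)_{-\gamma,\gamma}$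 being the duality pairing. For a Banach space $Y$ and $\rho>0$, $C^\rho((0,T];Y)$ is the space of continuous $v:(0,T]\to Y$ with $\|v\|_{C^\rho((0,T];Y)}=\sup_{0<t\le T}t^\rho\|v(t)\|_Y<\infty$ (a weighted space, not a Hölder space). $E_{\alpha,\sigma}(z)=\sum_{k\ge0}z^k/\Gamma(\alpha k+\sigma)$; $B(\cdot,\cdot)$ with two numerical arguments is Euler's Beta function. $M_2>0$ is a constant with $|E_{\alpha,\sigma}(-z)|\le M_2/(1+z)$ for $z\ge0$, $\sigma\in\{\alpha-1,\alpha,1\}$. $\Psi_j(T)=\bigl(E_{\alpha,1}(-\lambda_j^\beta T^\alpha)-\kappa\bigr)^{-1}$. Standing assumption: $\kappa\notin(0,1)$, or $\kappa\in(0,1)$ and $\lambda_j\ne\lambda_0$ for all $j$, where $\lambda_0>0$ is the unique number with $E_{\alpha,1}(-\lambda_0^\beta T^\alpha)=\kappa$. $C_\kappa>0$ is a constant with $|\Psi_j(T)|\le C_\kappa$ for all $j$ (for $\kappa=0$ the paper's bound is $|\Psi_j(T)|\le C_\kappa\lambda_j^\beta T^\alpha$). Operators. With $h_j=(h,e_j)$: $\mathcal G_1(t)h=\sum_j\int_0^th_j(\tau)(t-\tau)^{\alpha-1}E_{\alpha,\alpha}(-\lambda_j^\beta(t-\tau)^\alpha)\,d\tau\,e_j$ for $h=h(t,x)$; $\mathcal G_2(t)v=\sum_jv_j\Psi_j(T)E_{\alpha,1}(-\lambda_j^\beta t^\alpha)e_j$ for $v=v(x)$; $\mathcal G_3(t)h=-\mathcal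 G_2(t)[\mathcal G_1(T)h]$. Mild solution: a function $u\in L^{m}(0,T;L^{l}(\Omega))$ for some $m,l\ge1$ satisfying $u=\mathcal G_2\varphi+\mathcal G_1F(\cdot,u)+\mathcal G_3F(\cdot,u)-\mathcal G_3(ku)-\mathcal G_1(ku)$. (C2): $F(t,\cdot,\mathbf 0)=\mathbf 0$ and there is $\Upsilon^*>0$ with $\|F(t_1,\cdot,v_1)-F(t_2,\cdot,v_2)\|\le\Upsilon^*(|t_1-t_2|+\|v_1-v_2\|)$ for all $v_1,v_2\in L_2(\Omega)$, $t_1,t_2\in(0,T)$. Constant, with $\Upsilon=\Upsilon^*$: $$\Theta(T)=\frac{M_2}{\lambda_1^{\beta p}}\Bigl(T^{\alpha q}\Upsilon+C_\kappa+C_\kappa M_2\Upsilon T^{\alpha q}+T^{\alpha q}\|k\|_{C[0,T]}+M_2C_\kappa T^{\alpha q}\|k\|_{C[0,T]}\Bigr)B(\alpha q,1-\alpha q).$$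
   Formalization: The Caputo derivative is taken in the generalised sense, the time derivative of the (1−α)-fractional integral of u−u(0), with values in D(L^{−βq}), since for merely continuous k the derivative u_τ in the literal formula need not exist. *)

theory Defs
  imports "HOL-Analysis.Analysis"
begin

section \<open>Lebesgue and Bochner-Lebesgue spaces\<close>

text \<open>Elements are represented by functions; equality in these spaces is equality almost everywhere.\<close>

definition Lp :: "(real ^ 'n) set \<Rightarrow> real \<Rightarrow> (real ^ 'n \<Rightarrow> real) set" where
  "Lp \<Omega> l = {f \<in> borel_measurable (lebesgue_on \<Omega>).
                integrable (lebesgue_on \<Omega>) (\<lambda>x. \<bar>f x\<bar> powr l)}"

definition Lp_norm :: "(real ^ 'n) set \<Rightarrow> real \<Rightarrow> (real ^ 'n \<Rightarrow> real) \<Rightarrow> real" where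
  "Lp_norm \<Omega> l f = (LINT x|lebesgue_on \<Omega>. \<bar>f x\<bar> powr l) powr (1 / l)"

abbreviation L2 :: "(real ^ 'n) set \<Rightarrow> (real ^ 'n \<Rightarrow> real) set" where
  "L2 \<Omega> \<equiv> Lp \<Omega> 2"

abbreviation L2_norm :: "(real ^ 'n) set \<Rightarrow> (real ^ 'n \<Rightarrow> real) \<Rightarrow> real" where
  "L2_norm \<Omega> \<equiv> Lp_norm \<Omega> 2"

definition L2_inner ::
  "(real ^ 'n) set \<Rightarrow> (real ^ 'n \<Rightarrow> real) \<Rightarrow> (real ^ 'n \<Rightarrow> real) \<Rightarrow> real" where
  "L2_inner \<Omega> f g = (LINT x|lebesgue_on \<Omega>. f x * g x)"

text \<open>\<open>Bochner_Lp T m \<Omega> l\<close> is \<open>L\<^sup>m(0,T; L\<^sup>l(\<Omega>))\<close>; strong measurability is spelled out as being an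
  almost-everywhere limit, in the norm of \<open>L\<^sup>l(\<Omega>)\<close>, of simple \<open>L\<^sup>l(\<Omega>)\<close>-valued functions.\<close>

definition Lp_simple ::
  "real \<Rightarrow> (real ^ 'n) set \<Rightarrow> real \<Rightarrow> (real \<Rightarrow> real ^ 'n \<Rightarrow> real) \<Rightarrow> bool" where
  "Lp_simple T \<Omega> l s \<longleftrightarrow>
     finite (s ` {0<..<T}) \<and> s ` {0<..<T} \<subseteq> Lp \<Omega> l \<and>
     (\<forall>v. {t \<in> {0<..<T}. s t = v} \<in> sets lebesgue)"

definition Bochner_Lp ::
  "real \<Rightarrow> real \<Rightarrow> (real ^ 'n) set \<Rightarrow> real \<Rightarrow> (real \<Rightarrow> real ^ 'n \<Rightarrow> real) set" where
  "Bochner_Lp T m \<Omega> l = {u.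
     (AE t in lebesgue_on {0<..<T}. u t \<in> Lp \<Omega> l) \<and>
     (\<exists>s. (\<forall>n. Lp_simple T \<Omega> l (s n)) \<and>
          (AE t in lebesgue_on {0<..<T}.
             (\<lambda>n::nat. Lp_norm \<Omega> l (\<lambda>x. s n t x - u t x)) \<longlonglongrightarrow> 0)) \<and>
     integrable (lebesgue_on {0<..<T}) (\<lambda>t. Lp_norm \<Omega> l (u t) powr m)}"

section \<open>The elliptic operator and its boundary conditions\<close>

definition partial :: "'n \<Rightarrow> (real ^ 'n \<Rightarrow> real) \<Rightarrow> real ^ 'n \<Rightarrow> real" where
  "partial i f x = frechet_derivative f (at x) (axis i 1)"

definition C1_closure :: "(real ^ 'n) set \<Rightarrow> (real ^ 'n \<Rightarrow> real) \<Rightarrow> bool" where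
  "C1_closure \<Omega> f \<longleftrightarrow>
     continuous_on (closure \<Omega>) f \<and> (\<forall>x\<in>\<Omega>. f differentiable (at x)) \<and>
     (\<forall>i. \<exists>d. continuous_on (closure \<Omega>) d \<and> (\<forall>x\<in>\<Omega>. d x = partial i f x))"

definition C1_compact_support :: "(real ^ 'n) set \<Rightarrow> (real ^ 'n \<Rightarrow> real) set" where
  "C1_compact_support \<Omega> = {\<psi>.
     (\<forall>x. \<psi> differentiable (at x)) \<and> (\<forall>i. continuous_on UNIV (partial i \<psi>)) \<and>
     (\<exists>K. compact K \<and> K \<subseteq> \<Omega> \<and> (\<forall>x. x \<notin> K \<longrightarrow> \<psi> x = 0))}"

definition weak_partial ::
  "(real ^ 'n) set \<Rightarrow> 'n \<Rightarrow> (real ^ 'n \<Rightarrow> real) \<Rightarrow> (real ^ 'n \<Rightarrow> real) \<Rightarrow> bool" where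
  "weak_partial \<Omega> i v g \<longleftrightarrow>
     v \<in> L2 \<Omega> \<and> g \<in> L2 \<Omega> \<and>
     (\<forall>\<psi>\<in>C1_compact_support \<Omega>. L2_inner \<Omega> v (partial i \<psi>) = - L2_inner \<Omega> g \<psi>)"

definition H1 :: "(real ^ 'n) set \<Rightarrow> (real ^ 'n \<Rightarrow> real) set" where
  "H1 \<Omega> = {v \<in> L2 \<Omega>. \<forall>i. \<exists>g. weak_partial \<Omega> i v g}"

definition H2 :: "(real ^ 'n) set \<Rightarrow> (real ^ 'n \<Rightarrow> real) set" where
  "H2 \<Omega> = {v \<in> L2 \<Omega>. \<forall>i. \<exists>g\<in>H1 \<Omega>. weak_partial \<Omega> i v g}"

text \<open>\<open>div_form \<Omega> A v h\<close>: the field \<open>A \<nabla>v\<close> has the weak partial derivatives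
  \<open>h i = \<partial>\<^sub>i (\<Sum>j. A\<^sub>i\<^sub>j \<partial>\<^sub>j v)\<close>.\<close>

definition div_form ::
  "(real ^ 'n) set \<Rightarrow> (real ^ 'n \<Rightarrow> real ^ 'n ^ 'n) \<Rightarrow> (real ^ 'n \<Rightarrow> real)
     \<Rightarrow> ('n \<Rightarrow> real ^ 'n \<Rightarrow> real) \<Rightarrow> bool" where
  "div_form \<Omega> A v h \<longleftrightarrow>
     (\<exists>g. (\<forall>j. weak_partial \<Omega> j v (g j)) \<and>
          (\<forall>i. weak_partial \<Omega> i (\<lambda>x. \<Sum>j\<in>UNIV. A x $ i $ j * g j x) (h i)))"

definition elliptic_op ::
  "(real ^ 'n) set \<Rightarrow> (real ^ 'n \<Rightarrow> real ^ 'n ^ 'n) \<Rightarrow> (real ^ 'n \<Rightarrow> real)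
     \<Rightarrow> (real ^ 'n \<Rightarrow> real) \<Rightarrow> (real ^ 'n \<Rightarrow> real) \<Rightarrow> bool" where
  "elliptic_op \<Omega> A b v f \<longleftrightarrow>
     (\<exists>h. div_form \<Omega> A v h \<and>
          (AE x in lebesgue_on \<Omega>. f x = - (\<Sum>i\<in>UNIV. h i x) + b x * v x))"

definition elliptic_coefficients ::
  "(real ^ 'n) set \<Rightarrow> (real ^ 'n \<Rightarrow> real ^ 'n ^ 'n) \<Rightarrow> (real ^ 'n \<Rightarrow> real) \<Rightarrow> real \<Rightarrow> bool" where
  "elliptic_coefficients \<Omega> A b L0 \<longleftrightarrow>
     (\<forall>i j. C1_closure \<Omega> (\<lambda>x. A x $ i $ j)) \<and>
     (\<forall>x\<in>closure \<Omega>. \<forall>i j. A x $ i $ j = A x $ j $ i) \<and>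
     continuous_on (closure \<Omega>) b \<and> (\<forall>x\<in>closure \<Omega>. b x \<ge> 0) \<and>
     L0 > 0 \<and> (\<forall>x\<in>closure \<Omega>. \<forall>\<xi>. \<xi> \<bullet> (A x *v \<xi>) \<ge> L0 * (norm \<xi>)\<^sup>2)"

datatype boundary_operator = Dirichlet | Conormal

text \<open>No regularity of the boundary is assumed, so traces are understood weakly: \<open>v = 0\<close> on the
  boundary means that \<open>v\<close> is an \<open>H\<^sup>1\<close>-limit of compactly supported \<open>C\<^sup>1\<close> functions, and
  \<open>(A \<nabla>v) \<bullet> n = 0\<close> means that Green's formula for \<open>A \<nabla>v\<close> holds, without boundary term, against
  every function of \<open>H\<^sup>1\<close>.\<close>

fun boundary_condition ::
  "boundary_operator \<Rightarrow> (real ^ 'n) set \<Rightarrow> (real ^ 'n \<Rightarrow> real ^ 'n ^ 'n)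
     \<Rightarrow> (real ^ 'n \<Rightarrow> real) \<Rightarrow> bool" where
  "boundary_condition Dirichlet \<Omega> A v \<longleftrightarrow>
     (\<exists>g \<psi>. (\<forall>i. weak_partial \<Omega> i v (g i)) \<and>
        (\<forall>n::nat. \<psi> n \<in> C1_compact_support \<Omega>) \<and>
        (\<lambda>n. L2_norm \<Omega> (\<lambda>x. \<psi> n x - v x)) \<longlonglongrightarrow> 0 \<and>
        (\<forall>i. (\<lambda>n. L2_norm \<Omega> (\<lambda>x. partial i (\<psi> n) x - g i x)) \<longlonglongrightarrow> 0))"
| "boundary_condition Conormal \<Omega> A v \<longleftrightarrow>
     (\<exists>g h. (\<forall>j. weak_partial \<Omega> j v (g j)) \<and>
        (\<forall>i. weak_partial \<Omega> i (\<lambda>x. \<Sum>j\<in>UNIV. A x $ i $ j * g j x) (h i)) \<and>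
        (\<forall>w gw. (\<forall>i. weak_partial \<Omega> i w (gw i)) \<longrightarrow>
           (\<Sum>i\<in>UNIV. L2_inner \<Omega> (\<lambda>x. \<Sum>j\<in>UNIV. A x $ i $ j * g j x) (gw i)) =
           - (\<Sum>i\<in>UNIV. L2_inner \<Omega> (h i) w)))"

definition L2_sums ::
  "(real ^ 'n) set \<Rightarrow> (nat \<Rightarrow> real ^ 'n \<Rightarrow> real) \<Rightarrow> (nat \<Rightarrow> real) \<Rightarrow> (real ^ 'n \<Rightarrow> real) \<Rightarrow> bool"
  where
  "L2_sums \<Omega> e c w \<longleftrightarrow>
     w \<in> L2 \<Omega> \<and> (\<lambda>n. L2_norm \<Omega> (\<lambda>x. w x - (\<Sum>j<n. c j * e j x))) \<longlonglongrightarrow> 0"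

definition orthonormal_basis ::
  "(real ^ 'n) set \<Rightarrow> (nat \<Rightarrow> real ^ 'n \<Rightarrow> real) \<Rightarrow> bool" where
  "orthonormal_basis \<Omega> e \<longleftrightarrow>
     (\<forall>j. e j \<in> L2 \<Omega>) \<and> (\<forall>i j. L2_inner \<Omega> (e i) (e j) = (if i = j then 1 else 0)) \<and>
     (\<forall>v\<in>L2 \<Omega>. L2_sums \<Omega> e (\<lambda>j. L2_inner \<Omega> v (e j)) v)"

text \<open>Indices start at \<open>0\<close>: the smallest eigenvalue is \<open>lam 0\<close>.\<close>

definition eigensystem ::
  "(real ^ 'n) set \<Rightarrow> (real ^ 'n \<Rightarrow> real ^ 'n ^ 'n) \<Rightarrow> (real ^ 'n \<Rightarrow> real) \<Rightarrow> boundary_operator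
     \<Rightarrow> (nat \<Rightarrow> real) \<Rightarrow> (nat \<Rightarrow> real ^ 'n \<Rightarrow> real) \<Rightarrow> bool" where
  "eigensystem \<Omega> A b bc lam e \<longleftrightarrow>
     0 < lam 0 \<and> mono lam \<and> filterlim lam at_top sequentially \<and>
     (\<forall>j. e j \<in> H2 \<Omega> \<and> boundary_condition bc \<Omega> A (e j) \<and>
          elliptic_op \<Omega> A b (e j) (\<lambda>x. lam j * e j x)) \<and>
     orthonormal_basis \<Omega> e"

section \<open>Fractional power spaces and their duals\<close>

text \<open>By Parseval's identity the norm of \<open>L\<^sup>\<gamma> v = (\<Sum>j. \<lambda>\<^sub>j\<^sup>\<gamma> (v,e\<^sub>j) e\<^sub>j)\<close> is the square root of
  the series below.\<close>

definition pow_dom ::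
  "(real ^ 'n) set \<Rightarrow> (nat \<Rightarrow> real) \<Rightarrow> (nat \<Rightarrow> real ^ 'n \<Rightarrow> real) \<Rightarrow> real \<Rightarrow> (real ^ 'n \<Rightarrow> real) set"
  where
  "pow_dom \<Omega> lam e \<gamma> =
     {v \<in> L2 \<Omega>. summable (\<lambda>j. (lam j powr \<gamma> * L2_inner \<Omega> v (e j))\<^sup>2)}"

definition pow_norm ::
  "(real ^ 'n) set \<Rightarrow> (nat \<Rightarrow> real) \<Rightarrow> (nat \<Rightarrow> real ^ 'n \<Rightarrow> real) \<Rightarrow> real \<Rightarrow> (real ^ 'n \<Rightarrow> real) \<Rightarrow> real"
  where
  "pow_norm \<Omega> lam e \<gamma> v = sqrt (\<Sum>j. (lam j powr \<gamma> * L2_inner \<Omega> v (e j))\<^sup>2)"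

text \<open>The dual space \<open>D(L\<^sup>-\<^sup>\<gamma>)\<close> consists of the bounded linear functionals on \<open>D(L\<^sup>\<gamma>)\<close>; only the
  values of a functional on \<open>D(L\<^sup>\<gamma>)\<close> matter.\<close>

definition dual_dom ::
  "(real ^ 'n) set \<Rightarrow> (nat \<Rightarrow> real) \<Rightarrow> (nat \<Rightarrow> real ^ 'n \<Rightarrow> real) \<Rightarrow> real
     \<Rightarrow> ((real ^ 'n \<Rightarrow> real) \<Rightarrow> real) set" where
  "dual_dom \<Omega> lam e \<gamma> = {w.
     (\<forall>u\<in>pow_dom \<Omega> lam e \<gamma>. \<forall>v\<in>pow_dom \<Omega> lam e \<gamma>. \<forall>a c.
        w (\<lambda>x. a * u x + c * v x) = a * w u + c * w v) \<and>
     (\<exists>C. \<forall>v\<in>pow_dom \<Omega> lam e \<gamma>. \<bar>w v\<bar> \<le> C * pow_norm \<Omega> lam e \<gamma> v)}"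

definition dual_norm ::
  "(nat \<Rightarrow> real) \<Rightarrow> (nat \<Rightarrow> real ^ 'n \<Rightarrow> real) \<Rightarrow> real \<Rightarrow> ((real ^ 'n \<Rightarrow> real) \<Rightarrow> real) \<Rightarrow> real" where
  "dual_norm lam e \<gamma> w = sqrt (\<Sum>j. (w (e j))\<^sup>2 * lam j powr (- 2 * \<gamma>))"

section \<open>Weighted spaces of continuous functions\<close>

text \<open>\<open>weighted_C T \<rho> Y N\<close> is \<open>C\<^sup>\<rho>((0,T]; Y)\<close>, where \<open>Y\<close> is a space of real-valued functions
  (here: functionals) with norm \<open>N\<close>.\<close>

definition weighted_C ::
  "real \<Rightarrow> real \<Rightarrow> ('b \<Rightarrow> real) set \<Rightarrow> (('b \<Rightarrow> real) \<Rightarrow> real) \<Rightarrow> (real \<Rightarrow> 'b \<Rightarrow> real) set" where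
  "weighted_C T \<rho> Y N = {v.
     (\<forall>t\<in>{0<..T}. v t \<in> Y) \<and>
     (\<forall>t\<in>{0<..T}. ((\<lambda>s. N (\<lambda>\<psi>. v s \<psi> - v t \<psi>)) \<longlongrightarrow> 0) (at t within {0<..T})) \<and>
     bdd_above ((\<lambda>t. t powr \<rho> * N (v t)) ` {0<..T})}"

definition weighted_norm ::
  "real \<Rightarrow> real \<Rightarrow> (('b \<Rightarrow> real) \<Rightarrow> real) \<Rightarrow> (real \<Rightarrow> 'b \<Rightarrow> real) \<Rightarrow> real" where
  "weighted_norm T \<rho> N v = (SUP t\<in>{0<..T}. t powr \<rho> * N (v t))"

definition C_norm :: "real \<Rightarrow> (real \<Rightarrow> real) \<Rightarrow> real" where
  "C_norm T k = (SUP t\<in>{0..T}. \<bar>k t\<bar>)"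

section \<open>The Caputo derivative\<close>

definition frac_integral :: "real \<Rightarrow> (real \<Rightarrow> real) \<Rightarrow> real \<Rightarrow> real" where
  "frac_integral \<sigma> f t =
     1 / Gamma \<sigma> * (LINT \<tau>|lebesgue_on {0<..<t}. (t - \<tau>) powr (\<sigma> - 1) * f \<tau>)"

lemma frac_integral_reflect:
  assumes "continuous_on {0..T} f" "0 < s" "s \<le> T"
  shows "frac_integral (1 - \<alpha>) f s =
    1 / Gamma (1 - \<alpha>) * (\<integral>r. indicator {0<..<s} r * (r powr (- \<alpha>) * f (s - r)) \<partial>lborel)"
proof -
  define g where "g \<tau> = indicator {0<..<s} \<tau> * ((s - \<tau>) powr (- \<alpha>) * f \<tau>)" for \<tau>
  have "(\<lambda>\<tau>. indicator {0<..<s} \<tau> *\<^sub>R f \<tau>) \<in> borel_measurable borel"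
    by (rule borel_measurable_continuous_on_indicator)
       (use assms in \<open>auto intro: continuous_on_subset\<close>)
  then have "(\<lambda>\<tau>. (s - \<tau>) powr (- \<alpha>) * (indicator {0<..<s} \<tau> *\<^sub>R f \<tau>)) \<in> borel_measurable borel"
    by measurable
  also have "(\<lambda>\<tau>. (s - \<tau>) powr (- \<alpha>) * (indicator {0<..<s} \<tau> *\<^sub>R f \<tau>)) = g"
    by (auto simp: g_def indicator_def fun_eq_iff)
  finally have g: "g \<in> borel_measurable lborel" by simp
  have "(LINT \<tau>|lebesgue_on {0<..<s}. (s - \<tau>) powr (- \<alpha>) * f \<tau>) = (\<integral>\<tau>. g \<tau> \<partial>lebesgue)"
    by (subst integral_restrict_space) (auto simp: g_def[abs_def])
  also have "\<dots> = (\<integral>\<tau>. g \<tau> \<partial>lborel)"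
    by (rule integral_completion[OF g])
  also have "\<dots> = (\<integral>r. g (s + (-1) * r) \<partial>lborel)"
    by (subst lborel_integral_real_affine[of "-1" _ s]) auto
  also have "\<dots> = (\<integral>r. indicator {0<..<s} r * (r powr (- \<alpha>) * f (s - r)) \<partial>lborel)"
    by (rule Bochner_Integration.integral_cong) (auto simp: g_def indicator_def)
  finally show ?thesis by (simp add: frac_integral_def)
qed

lemma integrable_powr_0:
  fixes a T :: real
  assumes "a > -1" "T \<ge> 0"
  shows "integrable lborel (\<lambda>r. indicator {0<..<T} r * r powr a)"
proof -
  have "(\<lambda>x. x powr a) absolutely_integrable_on {0..T}"
    by (rule nonnegative_absolutely_integrable_1)
       (use integrable_on_powr_from_0[OF assms] in auto)
  then have "(\<lambda>x. x powr a) absolutely_integrable_on {0<..<T}"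
    by (rule set_integrable_subset) auto
  then have "integrable lebesgue (\<lambda>r. indicator {0<..<T} r * r powr a)"
    by (simp add: set_integrable_def)
  then show ?thesis
    by (subst (asm) integrable_completion) auto
qed

text \<open>For continuously differentiable functions the generalised Caputo derivative is the
  classical one.\<close>

lemma caputo_classical:
  assumes "0 < \<alpha>" "\<alpha> < 1" and t: "t \<in> {0<..T}"
    and deriv: "\<And>s. s \<in> {0..T} \<Longrightarrow> (y has_real_derivative y' s) (at s within {0..T})"
    and cont: "continuous_on {0..T} y'"
  shows "(frac_integral (1 - \<alpha>) (\<lambda>\<tau>. y \<tau> - y 0) has_real_derivative
          frac_integral (1 - \<alpha>) y' t) (at t within {0<..T})"
proof -
  from t have T: "0 < t" "t \<le> T" by auto
  have y_cont: "continuous_on {0..T} y"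
    by (rule continuous_on_vector_derivative)
       (use deriv in \<open>auto simp: has_real_derivative_iff_has_vector_derivative\<close>)
  obtain M where M: "\<And>s. s \<in> {0..T} \<Longrightarrow> \<bar>y' s\<bar> \<le> M"
    using compact_imp_bounded[OF compact_continuous_image[OF cont compact_Icc]]
    unfolding bounded_iff by (metis image_eqI real_norm_def)
  have lip0: "\<bar>y a - y c\<bar> \<le> M * \<bar>a - c\<bar>" if "a \<in> {0..T}" "c \<in> {0..T}" for a c
    using field_differentiable_bound[of "{0..T}" y y' M a c] deriv M that
    by (auto simp: real_norm_def)
  have M0: "M \<ge> 0" using M[of t] T by (smt (verit) atLeastAtMost_iff abs_ge_zero)
  define Y where "Y r = (if r < 0 then 0 else y r - y 0)" for r
  have lip: "\<bar>Y a - Y c\<bar> \<le> M * \<bar>a - c\<bar>" if "a \<le> T" "c \<le> T" for a c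
  proof -
    consider "a \<ge> 0" "c \<ge> 0" | "a < 0" "c < 0" | "a \<ge> 0" "c < 0" | "a < 0" "c \<ge> 0" by linarith
    then show ?thesis
    proof cases
      case 1 then show ?thesis using lip0[of a c] that by (auto simp: Y_def)
    next
      case 2 then show ?thesis using M0 by (auto simp: Y_def)
    next
      case 3
      then have "\<bar>Y a - Y c\<bar> \<le> M * a" using lip0[of a 0] that by (auto simp: Y_def)
      also have "\<dots> \<le> M * \<bar>a - c\<bar>" using 3 M0 by (intro mult_left_mono) auto
      finally show ?thesis .
    next
      case 4
      then have "\<bar>Y a - Y c\<bar> \<le> M * c" using lip0[of c 0] that by (auto simp: Y_def)
      also have "\<dots> \<le> M * \<bar>a - c\<bar>" using 4 M0 by (intro mult_left_mono) auto
      finally show ?thesis .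
    qed
  qed
  have Y_cont: "continuous_on {..T} Y"
  proof (rule continuous_onI)
    fix x e :: real assume "x \<in> {..T}" "e > 0"
    then show "\<exists>d>0. \<forall>x'\<in>{..T}. dist x' x < d \<longrightarrow> dist (Y x') (Y x) \<le> e"
    proof (intro exI[of _ "e / (M + 1)"] conjI ballI impI)
      show "e / (M + 1) > 0" using \<open>e > 0\<close> M0 by simp
      fix x' assume x': "x' \<in> {..T}" "dist x' x < e / (M + 1)"
      have "dist (Y x') (Y x) \<le> M * dist x' x"
        using lip[of x' x] x' \<open>x \<in> {..T}\<close> by (auto simp: dist_real_def)
      also have "\<dots> \<le> (M + 1) * (e / (M + 1))"
        using x' M0 by (intro mult_mono) auto
      finally show "dist (Y x') (Y x) \<le> e" using M0 by simp
    qed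
  qed
  have Ymeas[measurable]: "(\<lambda>r. indicator {0<..<T} r * Y (s - r)) \<in> borel_measurable borel"
    if "s \<le> T" for s
  proof -
    have "(\<lambda>r. indicator {0<..<T} r *\<^sub>R Y (s - r)) \<in> borel_measurable borel"
      by (rule borel_measurable_continuous_on_indicator)
         (use that in \<open>auto intro!: continuous_on_compose2[OF Y_cont] continuous_intros\<close>)
    then show ?thesis by simp
  qed
  define I where "I s r = indicator {0<..<T} r * (r powr (- \<alpha>) * Y (s - r))" for s r
  have Imeas: "I s \<in> borel_measurable lborel" if "s \<le> T" for s
  proof -
    have "(\<lambda>r. r powr (- \<alpha>) * (indicator {0<..<T} r * Y (s - r))) \<in> borel_measurable borel"
      using Ymeas[OF that] by measurable
    then show ?thesis by (simp add: I_def[abs_def] mult_ac)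
  qed
  have int_dom: "integrable lborel (\<lambda>r. M' * (indicator {0<..<T} r * r powr (- \<alpha>)))" for M'
    using integrable_powr_0[of "- \<alpha>" T] assms T by auto
  have Iint: "integrable lborel (I s)" if "s \<in> {0<..T}" for s
  proof (rule Bochner_Integration.integrable_bound[OF int_dom[of "M * T"] Imeas])
    show "AE r in lborel. norm (I s r) \<le> norm (M * T * (indicator {0<..<T} r * r powr - \<alpha>))"
    proof (rule AE_I2)
      fix r
      show "norm (I s r) \<le> norm (M * T * (indicator {0<..<T} r * r powr - \<alpha>))"
      proof (cases "r \<in> {0<..<T}")
        case True
        have "\<bar>Y (s - r)\<bar> \<le> M * T"
        proof (cases "s - r < 0")
          case True then show ?thesis using M0 T by (simp add: Y_def)
        next
          case False
          have "\<bar>Y (s - r)\<bar> \<le> M * \<bar>s - r\<bar>"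
            using lip[of "s - r" 0] that \<open>r \<in> _\<close> T by (auto simp: Y_def)
          also have "\<dots> \<le> M * T" using False that True M0 by (intro mult_left_mono) auto
          finally show ?thesis .
        qed
        then have "r powr (-\<alpha>) * \<bar>Y (s - r)\<bar> \<le> r powr (-\<alpha>) * (M * T)"
          by (intro mult_left_mono) auto
        then show ?thesis using True M0 T by (simp add: I_def abs_mult mult_ac)
      qed (simp add: I_def)
    qed
  qed (use that in auto)
  have frac: "frac_integral (1 - \<alpha>) (\<lambda>\<tau>. y \<tau> - y 0) s = 1 / Gamma (1 - \<alpha>) * (\<integral>r. I s r \<partial>lborel)"
    if "s \<in> {0<..T}" for s
  proof -
    have "(\<integral>r. indicator {0<..<s} r * (r powr (- \<alpha>) * (y (s - r) - y 0)) \<partial>lborel) = (\<integral>r. I s r \<partial>lborel)"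
    proof (rule Bochner_Integration.integral_cong)
      fix r
      show "indicator {0<..<s} r * (r powr (- \<alpha>) * (y (s - r) - y 0)) = I s r"
        using that by (cases "r = s") (auto simp: I_def Y_def indicator_def)
    qed simp
    moreover have "continuous_on {0..T} (\<lambda>\<tau>. y \<tau> - y 0)"
      by (intro continuous_intros y_cont)
    ultimately show ?thesis
      using frac_integral_reflect[of T "\<lambda>\<tau>. y \<tau> - y 0" s \<alpha>] that by auto
  qed
  define D where "D r = indicator {0<..<t} r * (r powr (- \<alpha>) * y' (t - r))" for r
  have D: "frac_integral (1 - \<alpha>) y' t = 1 / Gamma (1 - \<alpha>) * (\<integral>r. D r \<partial>lborel)"
    unfolding D_def by (rule frac_integral_reflect[OF cont]) (use T in auto)
  have "(\<lambda>r. indicator {0<..<t} r *\<^sub>R y' (t - r)) \<in> borel_measurable borel"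
    by (rule borel_measurable_continuous_on_indicator)
       (use T in \<open>auto intro!: continuous_on_compose2[OF cont] continuous_intros\<close>)
  then have "(\<lambda>r. r powr (- \<alpha>) * (indicator {0<..<t} r *\<^sub>R y' (t - r))) \<in> borel_measurable borel"
    by measurable
  then have Dmeas: "D \<in> borel_measurable lborel"
    by (simp add: D_def[abs_def] mult_ac)
  have quot: "(\<lambda>n. (Y (s n - r) - Y (t - r)) / (s n - t)) \<longlonglongrightarrow> (if r < t then y' (t - r) else 0)"
    if s: "\<And>n. s n \<in> {0<..T} - {t}" "s \<longlonglongrightarrow> t" and r: "r \<in> {0<..<T}" "r \<noteq> t" for s :: "nat \<Rightarrow> real" and r
  proof (cases "r < t")
    case True
    have ev: "\<forall>\<^sub>F n in sequentially. s n > r"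
      using s(2) True by (rule order_tendstoD)
    have "((\<lambda>z. (y z - y (t - r)) / (z - (t - r))) \<longlongrightarrow> y' (t - r)) (at (t - r) within {0..T})"
      using deriv[of "t - r"] True r T by (simp add: has_field_derivative_iff)
    moreover have "filterlim (\<lambda>n. s n - r) (at (t - r) within {0..T}) sequentially"
      unfolding filterlim_at
    proof
      show "(\<lambda>n. s n - r) \<longlonglongrightarrow> t - r" by (intro tendsto_intros s)
      show "\<forall>\<^sub>F n in sequentially. s n - r \<in> {0..T} \<and> s n - r \<noteq> t - r"
        using ev
      proof eventually_elim
        case (elim n)
        then show ?case using s(1)[of n] r by auto
      qed
    qed
    ultimately have "(\<lambda>n. (y (s n - r) - y (t - r)) / ((s n - r) - (t - r))) \<longlonglongrightarrow> y' (t - r)"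
      by (rule filterlim_compose)
    moreover have "\<forall>\<^sub>F n in sequentially. (y (s n - r) - y (t - r)) / ((s n - r) - (t - r)) =
        (Y (s n - r) - Y (t - r)) / (s n - t)"
      using ev by eventually_elim (use True in \<open>auto simp: Y_def\<close>)
    ultimately have "(\<lambda>n. (Y (s n - r) - Y (t - r)) / (s n - t)) \<longlonglongrightarrow> y' (t - r)"
      by (rule Lim_transform_eventually)
    then show ?thesis using True by simp
  next
    case False
    then have "t < r" using r by simp
    have ev: "\<forall>\<^sub>F n in sequentially. s n < r"
      using s(2) \<open>t < r\<close> by (rule order_tendstoD)
    have "\<forall>\<^sub>F n in sequentially. (Y (s n - r) - Y (t - r)) / (s n - t) = 0"
      using ev by eventually_elim (use \<open>t < r\<close> in \<open>auto simp: Y_def\<close>)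
    then show ?thesis using False by (simp add: tendsto_eventually)
  qed
  have "((\<lambda>s. ((\<integral>r. I s r \<partial>lborel) - (\<integral>r. I t r \<partial>lborel)) / (s - t)) \<longlongrightarrow> (\<integral>r. D r \<partial>lborel))
          (at t within {0<..T})"
    unfolding tendsto_at_iff_sequentially
  proof (intro allI impI)
    fix s :: "nat \<Rightarrow> real" assume s: "\<forall>i. s i \<in> {0<..T} - {t}" "s \<longlonglongrightarrow> t"
    have *: "((\<integral>r. I (s n) r \<partial>lborel) - (\<integral>r. I t r \<partial>lborel)) / (s n - t) =
        (\<integral>r. (I (s n) r - I t r) / (s n - t) \<partial>lborel)" for n
    proof -
      have "s n \<in> {0<..T}" using s by auto
      then show ?thesis
        using Iint[of "s n"] Iint[OF t] by simp
    qed
    have "(\<lambda>n. \<integral>r. (I (s n) r - I t r) / (s n - t) \<partial>lborel) \<longlonglongrightarrow> (\<integral>r. D r \<partial>lborel)"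
    proof (rule integral_dominated_convergence[OF Dmeas _ int_dom[of M]])
      show "(\<lambda>r. (I (s n) r - I t r) / (s n - t)) \<in> borel_measurable lborel" for n
      proof -
        have "s n \<le> T" using s(1) by (auto dest: spec[of _ n])
        then show ?thesis using Imeas[of "s n"] Imeas[of t] T by measurable
      qed
      have "AE r in lborel. r \<noteq> t"
        by (rule AE_lborel_singleton)
      then show "AE r in lborel. (\<lambda>n. (I (s n) r - I t r) / (s n - t)) \<longlonglongrightarrow> D r"
      proof eventually_elim
        case (elim r)
        show ?case
        proof (cases "r \<in> {0<..<T}")
          case True
          have "(\<lambda>n. r powr (- \<alpha>) * ((Y (s n - r) - Y (t - r)) / (s n - t))) \<longlonglongrightarrow>
              r powr (- \<alpha>) * (if r < t then y' (t - r) else 0)"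
            by (intro tendsto_mult_left quot) (use s True elim in auto)
          moreover have "r powr (- \<alpha>) * (if r < t then y' (t - r) else 0) = D r"
            using True by (auto simp: D_def)
          moreover have "(I (s n) r - I t r) / (s n - t) =
              r powr (- \<alpha>) * ((Y (s n - r) - Y (t - r)) / (s n - t))" for n
            using True by (simp add: I_def right_diff_distrib)
          ultimately show ?thesis by (simp only:)
        next
          case False
          then have "D r = 0" using T by (auto simp: D_def)
          moreover have "I x r = 0" for x using False by (simp add: I_def)
          ultimately show ?thesis by simp
        qed
      qed
      show "AE r in lborel. norm ((I (s n) r - I t r) / (s n - t)) \<le>
          M * (indicator {0<..<T} r * r powr - \<alpha>)" for n
      proof (rule AE_I2)
        fix r
        have sn: "s n \<in> {0<..T}" "s n \<noteq> t" using s(1) by (auto dest: spec[of _ n])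
        show "norm ((I (s n) r - I t r) / (s n - t)) \<le> M * (indicator {0<..<T} r * r powr - \<alpha>)"
        proof (cases "r \<in> {0<..<T}")
          case True
          have "\<bar>Y (s n - r) - Y (t - r)\<bar> \<le> M * \<bar>s n - t\<bar>"
            using lip[of "s n - r" "t - r"] sn True T by auto
          then have "\<bar>Y (s n - r) - Y (t - r)\<bar> / \<bar>s n - t\<bar> \<le> M"
            using sn by (simp add: divide_le_eq)
          then have "r powr (- \<alpha>) * (\<bar>Y (s n - r) - Y (t - r)\<bar> / \<bar>s n - t\<bar>) \<le> r powr (- \<alpha>) * M"
            by (intro mult_left_mono) auto
          moreover have "norm ((I (s n) r - I t r) / (s n - t)) =
              r powr (- \<alpha>) * (\<bar>Y (s n - r) - Y (t - r)\<bar> / \<bar>s n - t\<bar>)"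
            using True by (simp add: I_def abs_mult flip: right_diff_distrib)
          ultimately have "norm ((I (s n) r - I t r) / (s n - t)) \<le> r powr (- \<alpha>) * M"
            by (simp only:)
          then show ?thesis using True by (simp add: mult.commute)
        qed (simp add: I_def)
      qed
    qed
    then show "((\<lambda>s. ((\<integral>r. I s r \<partial>lborel) - (\<integral>r. I t r \<partial>lborel)) / (s - t)) \<circ> s) \<longlonglongrightarrow>
        (\<integral>r. D r \<partial>lborel)"
      by (simp add: o_def *)
  qed
  then have "((\<lambda>s. \<integral>r. I s r \<partial>lborel) has_real_derivative (\<integral>r. D r \<partial>lborel)) (at t within {0<..T})"
    by (simp add: has_field_derivative_iff)
  then have "((\<lambda>s. 1 / Gamma (1 - \<alpha>) * (\<integral>r. I s r \<partial>lborel)) has_real_derivative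
      1 / Gamma (1 - \<alpha>) * (\<integral>r. D r \<partial>lborel)) (at t within {0<..T})"
    by (rule DERIV_cmult)
  then show ?thesis
    unfolding D
    by (rule has_field_derivative_transform_within[OF _ zero_less_one t]) (use frac in auto)
qed

text \<open>\<open>has_caputo_derivative \<Omega> lam e \<gamma> \<alpha> T u w\<close>: the function \<open>w\<close> is the Caputo derivative
  \<open>\<partial>\<^sub>t\<^sup>\<alpha> u = J\<^sup>1\<^sup>-\<^sup>\<alpha> u\<^sub>t\<close> of \<open>u\<close> on \<open>(0,T]\<close>, as a function with values in \<open>D(L\<^sup>-\<^sup>\<gamma>)\<close>. As the data of the
  problem are only continuous in time, a mild solution need not have a time derivative that is a
  function. The derivative \<open>u\<^sub>t\<close> is therefore taken in the generalised sense, which turns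
  \<open>J\<^sup>1\<^sup>-\<^sup>\<alpha> u\<^sub>t\<close> into \<open>d/dt J\<^sup>1\<^sup>-\<^sup>\<alpha> (u - u(0))\<close>; the two agree for classical derivatives, see
  \<open>caputo_classical\<close>. The initial value \<open>u0\<close>, the continuity at \<open>0\<close> and the derivative in
  \<open>t\<close> are those of the norm of \<open>D(L\<^sup>-\<^sup>\<gamma>)\<close>, the fractional integral is a weak (Pettis) integral, and
  functions of \<open>L\<^sub>2(\<Omega>)\<close> are regarded as functionals through the inner product.\<close>

definition has_caputo_derivative ::
  "(real ^ 'n) set \<Rightarrow> (nat \<Rightarrow> real) \<Rightarrow> (nat \<Rightarrow> real ^ 'n \<Rightarrow> real) \<Rightarrow> real \<Rightarrow> real \<Rightarrow> real
     \<Rightarrow> (real \<Rightarrow> real ^ 'n \<Rightarrow> real) \<Rightarrow> (real \<Rightarrow> (real ^ 'n \<Rightarrow> real) \<Rightarrow> real) \<Rightarrow> bool" where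
  "has_caputo_derivative \<Omega> lam e \<gamma> \<alpha> T u w \<longleftrightarrow>
     (\<forall>t\<in>{0<..T}. u t \<in> L2 \<Omega> \<and> w t \<in> dual_dom \<Omega> lam e \<gamma>) \<and>
     (\<exists>u0\<in>dual_dom \<Omega> lam e \<gamma>. \<exists>J.
        ((\<lambda>t. dual_norm lam e \<gamma> (\<lambda>\<psi>. L2_inner \<Omega> (u t) \<psi> - u0 \<psi>)) \<longlongrightarrow> 0) (at_right 0) \<and>
        (\<forall>t\<in>{0<..T}. J t \<in> dual_dom \<Omega> lam e \<gamma> \<and>
           (\<forall>\<psi>\<in>pow_dom \<Omega> lam e \<gamma>.
              integrable (lebesgue_on {0<..<t})
                (\<lambda>\<tau>. (t - \<tau>) powr (- \<alpha>) * (L2_inner \<Omega> (u \<tau>) \<psi> - u0 \<psi>)) \<and>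
              J t \<psi> = frac_integral (1 - \<alpha>) (\<lambda>\<tau>. L2_inner \<Omega> (u \<tau>) \<psi> - u0 \<psi>) t)) \<and>
        (\<forall>t\<in>{0<..T}.
           ((\<lambda>s. dual_norm lam e \<gamma> (\<lambda>\<psi>. (J s \<psi> - J t \<psi>) / (s - t) - w t \<psi>)) \<longlongrightarrow> 0)
             (at t within {0<..T})))"

section \<open>Mittag-Leffler functions and the solution operators\<close>

text \<open>The library function \<open>rGamma\<close> is \<open>1/\<Gamma>\<close>, with value \<open>0\<close> at the poles of \<open>\<Gamma>\<close>.\<close>

definition mittag_leffler :: "real \<Rightarrow> real \<Rightarrow> real \<Rightarrow> real" where
  "mittag_leffler \<alpha> \<sigma> z = (\<Sum>n. z ^ n * rGamma (\<alpha> * real n + \<sigma>))"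

definition Psi :: "(nat \<Rightarrow> real) \<Rightarrow> real \<Rightarrow> real \<Rightarrow> real \<Rightarrow> real \<Rightarrow> nat \<Rightarrow> real" where
  "Psi lam \<alpha> \<beta> \<kappa> T j = 1 / (mittag_leffler \<alpha> 1 (- (lam j powr \<beta> * T powr \<alpha>)) - \<kappa>)"

text \<open>\<open>has_G1 \<dots> t h w\<close> states that \<open>\<G>\<^sub>1(t)h\<close> exists and equals \<open>w\<close>: the coefficient integrals
  exist and the series converges in \<open>L\<^sub>2(\<Omega>)\<close> to \<open>w\<close>; similarly for the other two operators.\<close>

definition G1_kernel :: "(nat \<Rightarrow> real) \<Rightarrow> real \<Rightarrow> real \<Rightarrow> nat \<Rightarrow> real \<Rightarrow> real" where
  "G1_kernel lam \<alpha> \<beta> j s =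
     s powr (\<alpha> - 1) * mittag_leffler \<alpha> \<alpha> (- (lam j powr \<beta> * s powr \<alpha>))"

definition has_G1 ::
  "(real ^ 'n) set \<Rightarrow> (nat \<Rightarrow> real) \<Rightarrow> (nat \<Rightarrow> real ^ 'n \<Rightarrow> real) \<Rightarrow> real \<Rightarrow> real
     \<Rightarrow> real \<Rightarrow> (real \<Rightarrow> real ^ 'n \<Rightarrow> real) \<Rightarrow> (real ^ 'n \<Rightarrow> real) \<Rightarrow> bool" where
  "has_G1 \<Omega> lam e \<alpha> \<beta> t h w \<longleftrightarrow>
     (\<forall>j. integrable (lebesgue_on {0<..<t})
            (\<lambda>\<tau>. L2_inner \<Omega> (h \<tau>) (e j) * G1_kernel lam \<alpha> \<beta> j (t - \<tau>))) \<and>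
     L2_sums \<Omega> e
       (\<lambda>j. LINT \<tau>|lebesgue_on {0<..<t}. L2_inner \<Omega> (h \<tau>) (e j) * G1_kernel lam \<alpha> \<beta> j (t - \<tau>)) w"

definition has_G2 ::
  "(real ^ 'n) set \<Rightarrow> (nat \<Rightarrow> real) \<Rightarrow> (nat \<Rightarrow> real ^ 'n \<Rightarrow> real) \<Rightarrow> real \<Rightarrow> real \<Rightarrow> real \<Rightarrow> real
     \<Rightarrow> real \<Rightarrow> (real ^ 'n \<Rightarrow> real) \<Rightarrow> (real ^ 'n \<Rightarrow> real) \<Rightarrow> bool" where
  "has_G2 \<Omega> lam e \<alpha> \<beta> \<kappa> T t v w \<longleftrightarrow>
     L2_sums \<Omega> e
       (\<lambda>j. L2_inner \<Omega> v (e j) * Psi lam \<alpha> \<beta> \<kappa> T j *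
            mittag_leffler \<alpha> 1 (- (lam j powr \<beta> * t powr \<alpha>))) w"

definition has_G3 ::
  "(real ^ 'n) set \<Rightarrow> (nat \<Rightarrow> real) \<Rightarrow> (nat \<Rightarrow> real ^ 'n \<Rightarrow> real) \<Rightarrow> real \<Rightarrow> real \<Rightarrow> real \<Rightarrow> real
     \<Rightarrow> real \<Rightarrow> (real \<Rightarrow> real ^ 'n \<Rightarrow> real) \<Rightarrow> (real ^ 'n \<Rightarrow> real) \<Rightarrow> bool" where
  "has_G3 \<Omega> lam e \<alpha> \<beta> \<kappa> T t h w \<longleftrightarrow>
     (\<exists>v. has_G1 \<Omega> lam e \<alpha> \<beta> T h v \<and> has_G2 \<Omega> lam e \<alpha> \<beta> \<kappa> T t v (\<lambda>x. - w x))"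

section \<open>Mild solutions\<close>

text \<open>The nonlinearity is an operator: \<open>F t v\<close> stands for \<open>F(t,\<cdot>,v)\<close>. The operators \<open>\<G>\<^sub>1\<close> and
  \<open>\<G>\<^sub>3\<close> are applied to elements of \<open>L\<^sup>1(0,T; L\<^sub>2(\<Omega>))\<close>. Like membership in \<open>L\<^sup>m(0,T; L\<^sup>l(\<Omega>))\<close>, the
  equation is one between classes of functions, hence required for almost every \<open>t\<close>.\<close>

definition mild_solution ::
  "(real ^ 'n) set \<Rightarrow> (nat \<Rightarrow> real) \<Rightarrow> (nat \<Rightarrow> real ^ 'n \<Rightarrow> real) \<Rightarrow> real \<Rightarrow> real \<Rightarrow> real \<Rightarrow> real
     \<Rightarrow> (real ^ 'n \<Rightarrow> real) \<Rightarrow> (real \<Rightarrow> real) \<Rightarrow> (real \<Rightarrow> (real ^ 'n \<Rightarrow> real) \<Rightarrow> real ^ 'n \<Rightarrow> real)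
     \<Rightarrow> (real \<Rightarrow> real ^ 'n \<Rightarrow> real) \<Rightarrow> bool" where
  "mild_solution \<Omega> lam e \<alpha> \<beta> \<kappa> T \<phi> k F u \<longleftrightarrow>
     (\<exists>m\<ge>1. \<exists>l\<ge>1. u \<in> Bochner_Lp T m \<Omega> l) \<and>
     (\<lambda>t. F t (u t)) \<in> Bochner_Lp T 1 \<Omega> 2 \<and>
     (\<lambda>t x. k t * u t x) \<in> Bochner_Lp T 1 \<Omega> 2 \<and>
     (AE t in lebesgue_on {0<..<T}. \<exists>a1 a2 a3 a4 a5.
        has_G2 \<Omega> lam e \<alpha> \<beta> \<kappa> T t \<phi> a1 \<and>
        has_G1 \<Omega> lam e \<alpha> \<beta> t (\<lambda>\<tau>. F \<tau> (u \<tau>)) a2 \<and>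
        has_G3 \<Omega> lam e \<alpha> \<beta> \<kappa> T t (\<lambda>\<tau>. F \<tau> (u \<tau>)) a3 \<and>
        has_G3 \<Omega> lam e \<alpha> \<beta> \<kappa> T t (\<lambda>\<tau> x. k \<tau> * u \<tau> x) a4 \<and>
        has_G1 \<Omega> lam e \<alpha> \<beta> t (\<lambda>\<tau> x. k \<tau> * u \<tau> x) a5 \<and>
        (AE x in lebesgue_on \<Omega>. u t x = a1 x + a2 x + a3 x - a4 x - a5 x))"

definition Theta ::
  "real \<Rightarrow> real \<Rightarrow> real \<Rightarrow> real \<Rightarrow> real \<Rightarrow> real \<Rightarrow> real \<Rightarrow> real \<Rightarrow> (real \<Rightarrow> real) \<Rightarrow> real \<Rightarrow> real" where
  "Theta \<alpha> \<beta> p q lam1 M2 C\<^sub>\<kappa> \<Upsilon> k T =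
     M2 / lam1 powr (\<beta> * p) *
     (T powr (\<alpha> * q) * \<Upsilon> + C\<^sub>\<kappa> + C\<^sub>\<kappa> * M2 * \<Upsilon> * T powr (\<alpha> * q)
        + T powr (\<alpha> * q) * C_norm T k + M2 * C\<^sub>\<kappa> * T powr (\<alpha> * q) * C_norm T k) *
     Beta (\<alpha> * q) (1 - \<alpha> * q)"

end

theory Submission
  imports Defs
begin

text \<open>Expansion in eigenfunctions turns the problem into a fixed point equation \<open>u = \<psi> + G(F(u) - k u)\<close> for
  square summable sequences, with \<open>\<psi> = \<G>\<^sub>2 \<phi>\<close> and a diagonal kernel \<open>K\<^sub>j(t - \<tau>) - e\<^sub>j(t) K\<^sub>j(T - \<tau>)\<close> for \<open>G\<close>.
  If \<open>\<kappa> \<noteq> 0\<close>, the Schur test with the weight \<open>t\<^bsup>-\<alpha>q\<^esup>\<close> makes the right-hand side a contraction as soon as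
  \<open>\<Theta>(T) < 1\<close>. If \<open>\<kappa> = 0\<close>, the factors \<open>\<Psi>\<^sub>j\<close> grow like \<open>\<mu>\<^sub>j = \<lambda>\<^sub>j\<^sup>\<beta>\<close>, and this weight may fail when
  \<open>\<lambda>\<^sub>1\<^sup>\<beta> T\<^sup>\<alpha>\<close> is large; then the weight \<open>sup\<^sub>j \<surd>\<mu>\<^sub>j / (1 + \<mu>\<^sub>j t\<^sup>\<alpha>)\<close> works, with the same constant.
  A mild solution is a priori only integrable in time, but the difference of two of them satisfies a singular
  Gronwall inequality and hence lies in the weighted space, where the contraction forces it to vanish.
  Every coordinate solves a scalar fractional equation, so that \<open>J\<^bsup>1-\<alpha>\<^esup>(u - u(0))\<close> is the primitive of
  \<open>F(u) - k u - L\<^sup>\<beta> u\<close>, which is continuous on \<open>(0,T]\<close> and \<open>O(t\<^bsup>-\<alpha>\<^esup>)\<close> in \<open>D(L\<^bsup>-\<beta>q\<^esup>)\<close>.\<close>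

section \<open>The sequence space\<close>

text \<open>The bound \<Theta>(T) < 1 fixes the constant of the Schur test, so constants cannot be
  generic. The terms of \<Theta>(T) proportional to \<Upsilon> + ||k|| add up to (\<Upsilon> +
  ||k||) \<open>A\<Theta>\<close>; the Beta factor is the convolution of s^(\<alpha>q-1) with
  \<tau>^(-\<alpha>q). If \<kappa> = 0, the majorant of the kernel of \<open>\<G>\<^sub>3\<close>
  contains \<mu>_j T^\<alpha> times two resolvent factors 1/(1 + \<mu>_j t^\<alpha>) and 1/(1 +
  \<mu>_j s^\<alpha>). With the power weight the supremum over j costs (p^p q^q)^2 Z^p relative to
  \<open>A\<Theta>\<close>, where Z = \<mu>_0 T^\<alpha>, and this exceeds 1 for large Z. Giving a
  square root of \<mu>_j to each resolvent factor yields a majorant that is a product of functions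
  of t and of s, and the function of t is taken as weight. Subadditivity of t^\<alpha> moves its
  Schur integrals to the variable \<mu>_0 t^\<alpha>, where they are bounded by square roots or
  logarithms of Z. The room for them is Z^q/q, because B(\<alpha>q, 1-\<alpha>q) \<ge>
  1/(\<alpha>q).\<close>

typedef ell2 = "{x :: nat \<Rightarrow> real. summable (\<lambda>n. (x n)\<^sup>2)}"
  morphisms coord Abs_ell2
  by (rule exI[of _ "\<lambda>_. 0"]) simp

lemma summable_coord_sq [simp]: "summable (\<lambda>n. (coord x n)\<^sup>2)"
  using coord[of x] by simp

lemma ell2_eqI: "(\<And>n. coord x n = coord y n) \<Longrightarrow> x = y"
  by (metis coord_inject ext)

text \<open>Outside of the square summable sequences the value is \<open>0\<close>.\<close>

definition ell2_of :: "(nat \<Rightarrow> real) \<Rightarrow> ell2" where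
  "ell2_of f = (if summable (\<lambda>n. (f n)\<^sup>2) then Abs_ell2 f else Abs_ell2 (\<lambda>_. 0))"

lemma coord_ell2_of: "summable (\<lambda>n. (f n)\<^sup>2) \<Longrightarrow> coord (ell2_of f) n = f n"
  by (simp add: ell2_of_def Abs_ell2_inverse)

lemma ell2_of_coord [simp]: "ell2_of (coord x) = x"
  by (simp add: ell2_of_def coord_inverse)

lemma summable_mult_of_squares:
  fixes f g :: "nat \<Rightarrow> real"
  assumes "summable (\<lambda>n. (f n)\<^sup>2)" "summable (\<lambda>n. (g n)\<^sup>2)"
  shows "summable (\<lambda>n. \<bar>f n * g n\<bar>)" "summable (\<lambda>n. f n * g n)"
proof -
  show "summable (\<lambda>n. \<bar>f n * g n\<bar>)"
  proof (rule summable_comparison_test'[OF summable_add[OF assms]])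
    fix n
    have "2 * \<bar>f n * g n\<bar> \<le> (f n)\<^sup>2 + (g n)\<^sup>2"
      using sum_squares_bound[of "\<bar>f n\<bar>" "\<bar>g n\<bar>"] by (simp add: abs_mult)
    then show "norm \<bar>f n * g n\<bar> \<le> (f n)\<^sup>2 + (g n)\<^sup>2" by simp
  qed
  then show "summable (\<lambda>n. f n * g n)"
    by (rule summable_rabs_cancel)
qed

lemma summable_add_squares:
  fixes f g :: "nat \<Rightarrow> real"
  assumes "summable (\<lambda>n. (f n)\<^sup>2)" "summable (\<lambda>n. (g n)\<^sup>2)"
  shows "summable (\<lambda>n. (f n + g n)\<^sup>2)"
proof -
  have "summable (\<lambda>n. ((f n)\<^sup>2 + (g n)\<^sup>2) + 2 * (f n * g n))"
    by (intro summable_add summable_mult summable_mult_of_squares assms)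
  then show ?thesis by (simp add: power2_sum algebra_simps)
qed

section \<open>Hilbert space structure of the square summable sequences\<close>

instantiation ell2 :: real_vector
begin

definition "0 = Abs_ell2 (\<lambda>_. 0)"
definition "x + y = Abs_ell2 (\<lambda>n. coord x n + coord y n)"
definition "r *\<^sub>R x = Abs_ell2 (\<lambda>n. r * coord x n)"
definition "- (x :: ell2) = (-1) *\<^sub>R x"
definition "(x :: ell2) - y = x + (- y)"

lemma coord_zero: "coord 0 n = 0"
  by (simp add: zero_ell2_def Abs_ell2_inverse)

lemma coord_add: "coord (x + y) n = coord x n + coord y n"
  unfolding plus_ell2_def
  by (subst Abs_ell2_inverse) (auto intro: summable_add_squares)

lemma coord_scaleR: "coord (r *\<^sub>R x) n = r * coord x n"
  unfolding scaleR_ell2_def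
  by (subst Abs_ell2_inverse) (auto simp: power_mult_distrib intro: summable_mult)

lemma coord_minus: "coord (- x) n = - coord x n"
  by (simp add: uminus_ell2_def coord_scaleR)

lemma coord_diff: "coord (x - y) n = coord x n - coord y n"
  by (simp add: minus_ell2_def coord_add coord_minus)

instance
  by standard (auto intro!: ell2_eqI simp: coord_zero coord_add coord_scaleR coord_minus coord_diff algebra_simps)

end

lemmas coord_simps [simp] = coord_zero coord_add coord_scaleR coord_minus coord_diff

instantiation ell2 :: real_inner
begin

definition "inner x y = (\<Sum>n. coord x n * coord y n)"
definition "norm (x :: ell2) = sqrt (inner x x)"
definition "sgn (x :: ell2) = x /\<^sub>R norm x"
definition "dist (x :: ell2) y = norm (x - y)"
definition [code del]: "(uniformity :: (ell2 \<times> ell2) filter) = (INF e\<in>{0<..}. principal {(x, y). dist x y < e})"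
definition [code del]: "open (U :: ell2 set) = (\<forall>x\<in>U. eventually (\<lambda>(x', y). x' = x \<longrightarrow> y \<in> U) uniformity)"

lemma inner_ell2_summable: "summable (\<lambda>n. coord x n * coord y n)"
  by (rule summable_mult_of_squares) auto

instance
proof
  fix x y z :: ell2 and r s :: real
  show "dist x y = norm (x - y)" by (rule dist_ell2_def)
  show "sgn x = x /\<^sub>R norm x" by (rule sgn_ell2_def)
  show "(uniformity :: (ell2 \<times> ell2) filter) = (INF e\<in>{0<..}. principal {(x, y). dist x y < e})"
    by (rule uniformity_ell2_def)
  show "open U = (\<forall>x\<in>U. eventually (\<lambda>(x', y). x' = x \<longrightarrow> y \<in> U) uniformity)" for U :: "ell2 set"
    by (rule open_ell2_def)
  show "inner x y = inner y x" by (simp add: inner_ell2_def mult.commute)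
  show "inner (x + y) z = inner x z + inner y z"
    using suminf_add[OF inner_ell2_summable[of x z] inner_ell2_summable[of y z]]
    by (simp add: inner_ell2_def coord_add algebra_simps)
  show "inner (r *\<^sub>R x) y = r * inner x y"
    using suminf_mult[OF inner_ell2_summable[of x y], of r]
    by (simp add: inner_ell2_def coord_scaleR algebra_simps)
  have sq: "summable (\<lambda>n. coord x n * coord x n)" by (rule inner_ell2_summable)
  show "0 \<le> inner x x"
    unfolding inner_ell2_def by (rule suminf_nonneg[OF sq]) simp
  show "(inner x x = 0) = (x = 0)"
    unfolding inner_ell2_def using suminf_eq_zero_iff[OF sq]
    by (auto intro!: ell2_eqI simp: coord_zero)
  show "norm x = sqrt (inner x x)" by (rule norm_ell2_def)
qed

end

lemma norm_ell2_sq: "(norm x)\<^sup>2 = (\<Sum>n. (coord x n)\<^sup>2)" for x :: ell2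
  by (subst power2_norm_eq_inner) (simp add: inner_ell2_def power2_eq_square)

lemma norm_ell2: "norm x = sqrt (\<Sum>n. (coord x n)\<^sup>2)" for x :: ell2
  by (metis norm_ell2_sq norm_ge_zero real_sqrt_abs abs_of_nonneg)

lemma sum_coord_le: "(\<Sum>j<n. (coord x j)\<^sup>2) \<le> (norm x)\<^sup>2"
  unfolding norm_ell2_sq by (rule sum_le_suminf) auto

lemma abs_coord_le: "\<bar>coord x n\<bar> \<le> norm x"
proof -
  have "(coord x n)\<^sup>2 \<le> (\<Sum>j<Suc n. (coord x j)\<^sup>2)"
    by (rule member_le_sum) auto
  also have "\<dots> \<le> (norm x)\<^sup>2" by (rule sum_coord_le)
  finally show ?thesis using abs_le_square_iff[of "coord x n" "norm x"] by simp
qed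

lemma bounded_linear_coord: "bounded_linear (\<lambda>x. coord x n)"
  by (rule bounded_linear_intro[of _ 1]) (auto intro: abs_coord_le)

lemmas continuous_on_coord [continuous_intros] = bounded_linear.continuous_on[OF bounded_linear_coord]
lemmas tendsto_coord [tendsto_intros] = bounded_linear.tendsto[OF bounded_linear_coord]

lemma measurable_coord [measurable]: "(\<lambda>x. coord x n) \<in> borel_measurable borel"
  by (intro borel_measurable_continuous_onI continuous_intros)

lemma coord_sum [simp]: "coord (sum f A) n = (\<Sum>a\<in>A. coord (f a) n)"
  by (rule linear_sum[OF bounded_linear.linear[OF bounded_linear_coord]])

text \<open>A bound on all finite sections passes to the whole sequence, so a coordinatewise limit
  can be estimated through finitely many coordinates at a time. Completeness is proved in this
  way.\<close>

lemma ell2_bounded_partial_sums: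
  assumes "\<And>n. (\<Sum>j<n. (f j)\<^sup>2) \<le> C\<^sup>2" "C \<ge> 0"
  shows "summable (\<lambda>n. (f n)\<^sup>2)" "norm (ell2_of f) \<le> C"
proof -
  show *: "summable (\<lambda>n. (f n)\<^sup>2)"
    by (rule bounded_imp_summable[of _ "C\<^sup>2"])
       (use assms(1)[of "Suc n" for n] in \<open>auto simp: lessThan_Suc_atMost\<close>)
  have "(norm (ell2_of f))\<^sup>2 \<le> C\<^sup>2"
    unfolding norm_ell2_sq by (subst coord_ell2_of[OF *]) (rule suminf_le_const[OF * assms(1)])
  then show "norm (ell2_of f) \<le> C" using assms(2) by (rule power2_le_imp_le)
qed

lemma ell2_dominated:
  assumes "\<And>n. \<bar>f n\<bar> \<le> C * \<bar>coord x n\<bar>"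
  shows "summable (\<lambda>n. (f n)\<^sup>2)" "C \<ge> 0 \<Longrightarrow> norm (ell2_of f) \<le> C * norm x"
proof -
  have *: "(f n)\<^sup>2 \<le> C\<^sup>2 * (coord x n)\<^sup>2" for n
    using power_mono[OF assms[of n], of 2] by (simp add: power_mult_distrib)
  show **: "summable (\<lambda>n. (f n)\<^sup>2)"
    by (rule summable_comparison_test'[OF summable_mult[OF summable_coord_sq, of "C\<^sup>2" x]])
       (use * in auto)
  assume "C \<ge> 0"
  have "(norm (ell2_of f))\<^sup>2 = (\<Sum>n. (f n)\<^sup>2)" by (simp add: norm_ell2_sq coord_ell2_of[OF **])
  also have "\<dots> \<le> (\<Sum>n. C\<^sup>2 * (coord x n)\<^sup>2)"
    by (rule suminf_le[OF * ** summable_mult]) simp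
  also have "\<dots> = (C * norm x)\<^sup>2"
    by (simp add: suminf_mult norm_ell2_sq power_mult_distrib)
  finally show "norm (ell2_of f) \<le> C * norm x"
    by (rule power2_le_imp_le) (use \<open>C \<ge> 0\<close> in auto)
qed

instance ell2 :: complete_space
proof
  fix X :: "nat \<Rightarrow> ell2" assume X: "Cauchy X"
  have "Cauchy (\<lambda>n. coord (X n) j)" for j
    by (rule bounded_linear.Cauchy[OF bounded_linear_coord X])
  then obtain l where l: "\<And>j. (\<lambda>n. coord (X n) j) \<longlonglongrightarrow> l j"
    unfolding Cauchy_convergent_iff convergent_def by metis
  \<comment> \<open>With the number k of coordinates fixed, m may tend to infinity in the Cauchy
    estimate; afterwards k is arbitrary. This yields at once that the difference to the
    coordinatewise limit is square summable and that its norm is small.\<close>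
  have tail: "summable (\<lambda>j. (coord (X n) j - l j)\<^sup>2) \<and> norm (ell2_of (\<lambda>j. coord (X n) j - l j)) \<le> e"
    if e: "e > 0" and n: "\<And>m. m \<ge> N \<Longrightarrow> norm (X n - X m) \<le> e" for n e N
  proof -
    have "(\<Sum>j<k. (coord (X n) j - l j)\<^sup>2) \<le> e\<^sup>2" for k
    proof (rule LIMSEQ_le_const2)
      show "(\<lambda>m. \<Sum>j<k. (coord (X n) j - coord (X m) j)\<^sup>2) \<longlonglongrightarrow> (\<Sum>j<k. (coord (X n) j - l j)\<^sup>2)"
        by (intro tendsto_intros l)
      show "\<exists>N. \<forall>m\<ge>N. (\<Sum>j<k. (coord (X n) j - coord (X m) j)\<^sup>2) \<le> e\<^sup>2"
      proof (intro exI[of _ N] allI impI)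
        fix m assume "m \<ge> N"
        have "(\<Sum>j<k. (coord (X n) j - coord (X m) j)\<^sup>2) \<le> (norm (X n - X m))\<^sup>2"
          using sum_coord_le[of "X n - X m" k] by simp
        also have "\<dots> \<le> e\<^sup>2" by (intro power_mono n \<open>m \<ge> N\<close>) auto
        finally show "(\<Sum>j<k. (coord (X n) j - coord (X m) j)\<^sup>2) \<le> e\<^sup>2" .
      qed
    qed
    from ell2_bounded_partial_sums[OF this] e show ?thesis by auto
  qed
  have near: "\<exists>N. \<forall>n\<ge>N. \<forall>m\<ge>N. norm (X n - X m) \<le> e" if "e > 0" for e
    using metric_CauchyD[OF X that] by (metis dist_norm less_imp_le)
  obtain N where "\<forall>n\<ge>N. \<forall>m\<ge>N. norm (X n - X m) \<le> 1" using near[of 1] by auto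
  then have "summable (\<lambda>j. (coord (X N) j - l j)\<^sup>2)" using tail[of 1 N N] by auto
  then have "summable (\<lambda>j. (coord (- X N) j + (coord (X N) j - l j))\<^sup>2)"
    by (intro summable_add_squares) (simp_all del: coord_simps)
  then have suml: "summable (\<lambda>j. (l j)\<^sup>2)" by simp
  have "X \<longlonglongrightarrow> ell2_of l"
  proof (rule LIMSEQ_I)
    fix r :: real assume "r > 0"
    then obtain N where N: "\<forall>n\<ge>N. \<forall>m\<ge>N. norm (X n - X m) \<le> r / 2" using near[of "r/2"] by auto
    have "norm (X n - ell2_of l) < r" if "n \<ge> N" for n
    proof -
      have s: "summable (\<lambda>j. (coord (X n) j - l j)\<^sup>2)" and b: "norm (ell2_of (\<lambda>j. coord (X n) j - l j)) \<le> r/2"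
        using tail[of "r/2" N n] N that \<open>r > 0\<close> by auto
      have "X n - ell2_of l = ell2_of (\<lambda>j. coord (X n) j - l j)"
        by (rule ell2_eqI) (simp add: coord_ell2_of suml s)
      then show ?thesis using b \<open>r > 0\<close> by simp
    qed
    then show "\<exists>N. \<forall>n\<ge>N. norm (X n - ell2_of l) < r" by blast
  qed
  then show "convergent X" by (auto simp: convergent_def)
qed

instance ell2 :: banach ..

definition ell2_trunc :: "nat \<Rightarrow> (nat \<Rightarrow> real) \<Rightarrow> ell2" where
  "ell2_trunc n f = ell2_of (\<lambda>j. if j < n then f j else 0)"

lemma coord_ell2_trunc [simp]: "coord (ell2_trunc n f) j = (if j < n then f j else 0)"
proof -
  have "summable (\<lambda>j. (if j < n then f j else 0)\<^sup>2)"
    by (rule summable_finite[of "{..<n}"]) auto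
  then show ?thesis by (simp add: ell2_trunc_def coord_ell2_of)
qed

lemma norm_ell2_trunc: "(norm (ell2_trunc n f))\<^sup>2 = (\<Sum>j<n. (f j)\<^sup>2)"
  unfolding norm_ell2_sq by (subst suminf_finite[of "{..<n}"]) auto

lemma ell2_trunc_tendsto: "(\<lambda>n. ell2_trunc n (coord x)) \<longlonglongrightarrow> x"
proof -
  have *: "(norm (x - ell2_trunc n (coord x)))\<^sup>2 = (norm x)\<^sup>2 - (\<Sum>j<n. (coord x j)\<^sup>2)" for n
  proof -
    have "(norm (x - ell2_trunc n (coord x)))\<^sup>2 =
        (\<Sum>j. (coord x j)\<^sup>2 - (if j < n then (coord x j)\<^sup>2 else 0))"
      unfolding norm_ell2_sq by (intro arg_cong[where f = suminf]) auto
    also have "\<dots> = (\<Sum>j. (coord x j)\<^sup>2) - (\<Sum>j. if j < n then (coord x j)\<^sup>2 else 0)"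
      by (rule suminf_diff[symmetric]) (auto intro: summable_finite[of "{..<n}"])
    also have "(\<Sum>j. if j < n then (coord x j)\<^sup>2 else 0) = (\<Sum>j<n. (coord x j)\<^sup>2)"
      by (subst suminf_finite[of "{..<n}"]) auto
    finally show ?thesis by (simp add: norm_ell2_sq)
  qed
  have "(\<lambda>n. (norm x)\<^sup>2 - (\<Sum>j<n. (coord x j)\<^sup>2)) \<longlonglongrightarrow> (norm x)\<^sup>2 - (\<Sum>j. (coord x j)\<^sup>2)"
    by (intro tendsto_intros summable_LIMSEQ summable_coord_sq)
  then have "(\<lambda>n. (norm (x - ell2_trunc n (coord x)))\<^sup>2) \<longlonglongrightarrow> 0"
    unfolding * norm_ell2_sq[of x] by simp
  then have "(\<lambda>n. sqrt ((norm (x - ell2_trunc n (coord x)))\<^sup>2)) \<longlonglongrightarrow> sqrt 0"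
    by (rule tendsto_real_sqrt)
  then have "(\<lambda>n. norm (x - ell2_trunc n (coord x))) \<longlonglongrightarrow> 0" by simp
  then show ?thesis
    by (subst (asm) norm_minus_commute) (simp add: tendsto_norm_zero_iff LIM_zero_iff)
qed

text \<open>The Bochner integral is formed in Banach spaces with a countable base. Here the base
  consists of the balls of radius 1/(k+1) about the finite rational sequences.\<close>

instance ell2 :: second_countable_topology
proof
  define D where "D = (\<lambda>l. ell2_trunc (length l) (\<lambda>j. of_rat (l ! j))) ` (UNIV :: rat list set)"
  have D: "countable D" unfolding D_def by simp
  have dense: "\<exists>y\<in>D. dist y x < r" if "r > 0" for x r
  proof -
    obtain n where n: "dist (ell2_trunc n (coord x)) x < r / 2"
      using ell2_trunc_tendsto[of x] \<open>r > 0\<close> by (metis LIMSEQ_iff_nz half_gt_zero le_refl metric_LIMSEQ_D)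
    \<comment> \<open>Each of the n coordinates is approximated within s, and n s^2 \<le> ((n+1)
      s)^2 keeps the norm of the error at r/2.\<close>
    define s where "s = r / (2 * (real n + 1))"
    have "s > 0" using \<open>r > 0\<close> by (simp add: s_def)
    then have "\<exists>q. \<bar>of_rat q - coord x j\<bar> < s" for j
      using of_rat_dense[of "coord x j - s" "coord x j + s"] by (auto simp: abs_diff_less_iff)
    then obtain q where q: "\<And>j. \<bar>of_rat (q j) - coord x j\<bar> < s" by metis
    define y where "y = ell2_trunc n (\<lambda>j. of_rat (q j))"
    have "y = (\<lambda>l. ell2_trunc (length l) (\<lambda>j. of_rat (l ! j))) (map q [0..<n])"
      by (auto intro!: ell2_eqI simp: y_def)
    then have "y \<in> D" unfolding D_def by blast
    have "(norm (y - ell2_trunc n (coord x)))\<^sup>2 = (\<Sum>j<n. (of_rat (q j) - coord x j)\<^sup>2)"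
      unfolding norm_ell2_trunc[symmetric]
      by (intro arg_cong[where f = "\<lambda>z. (norm z)\<^sup>2"] ell2_eqI) (auto simp: y_def)
    also have "\<dots> \<le> (\<Sum>j<n. s\<^sup>2)"
      by (intro sum_mono) (metis q less_imp_le abs_le_square_iff abs_of_nonneg abs_ge_zero order_trans)
    also have "\<dots> \<le> ((real n + 1) * s)\<^sup>2"
    proof -
      have "real n \<le> (real n + 1)\<^sup>2" by (simp add: power2_eq_square algebra_simps)
      then show ?thesis using mult_right_mono[of "real n" "(real n + 1)\<^sup>2" "s\<^sup>2"] by (simp add: power_mult_distrib)
    qed
    finally have "norm (y - ell2_trunc n (coord x)) \<le> (real n + 1) * s"
      by (rule power2_le_imp_le) (use \<open>s > 0\<close> in auto)
    also have "\<dots> = r / 2" by (simp add: s_def field_simps)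
    finally have "dist y x < r"
      using n dist_triangle[of y x "ell2_trunc n (coord x)"] by (simp add: dist_norm)
    then show ?thesis using \<open>y \<in> D\<close> by blast
  qed
  define B where "B = (\<lambda>(y, k :: nat). ball y (1 / (real k + 1))) ` (D \<times> UNIV)"
  have "topological_basis B"
  proof (rule topological_basisI)
    show "open b" if "b \<in> B" for b using that by (auto simp: B_def)
    fix U :: "ell2 set" and x assume "open U" "x \<in> U"
    then obtain r where r: "r > 0" "ball x r \<subseteq> U" by (auto simp: open_contains_ball)
    obtain k :: nat where k: "1 / (real k + 1) < r / 2"
      using reals_Archimedean[of "r/2"] r by (auto simp: inverse_eq_divide add.commute)
    obtain y where y: "y \<in> D" "dist y x < 1 / (real k + 1)" using dense[of "1 / (real k + 1)" x] by auto
    have "ball y (1 / (real k + 1)) \<subseteq> U"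
    proof
      fix z assume "z \<in> ball y (1 / (real k + 1))"
      then have "dist x z < r" using y k dist_triangle[of x z y] by (simp add: dist_commute)
      then show "z \<in> U" using r by auto
    qed
    then show "\<exists>B'\<in>B. x \<in> B' \<and> B' \<subseteq> U" using y(1) by (intro bexI[of _ "ball y (1 / (real k + 1))"]) (use y in \<open>auto simp: B_def\<close>)
  qed
  then show "\<exists>B :: ell2 set set. countable B \<and> open = generate_topology B"
    using D by (intro exI[of _ B]) (auto simp: B_def topological_basis_imp_subbasis)
qed

text \<open>A map into \<open>ell2\<close> is the pointwise limit of its truncations, and a
  truncation is a finite combination of unit vectors with measurable coefficients. The j-th unit
  vector is written \<open>ell2_trunc (Suc j) (\<lambda>i. if i = j then 1 else 0)\<close>.\<close>

lemma measurable_ell2: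
  assumes "\<And>j. (\<lambda>x. coord (f x) j) \<in> borel_measurable M"
  shows "f \<in> borel_measurable M"
proof (rule borel_measurable_LIMSEQ_metric)
  fix n
  have "(\<lambda>x. \<Sum>j<n. coord (f x) j *\<^sub>R ell2_trunc (Suc j) (\<lambda>i. if i = j then 1 else 0)) \<in> borel_measurable M"
    using assms by measurable
  moreover have "ell2_trunc n (coord (f x)) =
      (\<Sum>j<n. coord (f x) j *\<^sub>R ell2_trunc (Suc j) (\<lambda>i. if i = j then 1 else 0))" for x
  proof (rule ell2_eqI)
    fix i
    have "coord (\<Sum>j<n. coord (f x) j *\<^sub>R ell2_trunc (Suc j) (\<lambda>i. if i = j then 1 else 0)) i =
        (\<Sum>j<n. if i = j then coord (f x) i else 0)"
      unfolding coord_sum by (rule sum.cong) auto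
    then show "coord (ell2_trunc n (coord (f x))) i =
      coord (\<Sum>j<n. coord (f x) j *\<^sub>R ell2_trunc (Suc j) (\<lambda>i. if i = j then 1 else 0)) i" by auto
  qed
  ultimately show "(\<lambda>x. ell2_trunc n (coord (f x))) \<in> borel_measurable M" by (simp del: sum.lessThan_Suc)
qed (rule ell2_trunc_tendsto)

subsection \<open>Diagonal operators\<close>

text \<open>No bound on the symbol is built in: where the product is not square summable,
  \<open>ell2_of\<close> returns 0. The coordinate formula \<open>coord_diag\<close> is therefore
  stated under a uniform bound on the symbol.\<close>

definition diag :: "(nat \<Rightarrow> real) \<Rightarrow> ell2 \<Rightarrow> ell2" where
  "diag m x = ell2_of (\<lambda>n. m n * coord x n)"

lemma
  assumes "\<And>n. \<bar>m n\<bar> \<le> C"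
  shows coord_diag: "coord (diag m x) n = m n * coord x n"
    and norm_diag_le: "norm (diag m x) \<le> C * norm x"
proof -
  have b: "\<bar>m n * coord x n\<bar> \<le> C * \<bar>coord x n\<bar>" for n
    by (simp add: abs_mult assms mult_right_mono)
  show "coord (diag m x) n = m n * coord x n"
    unfolding diag_def by (rule coord_ell2_of[OF ell2_dominated(1)[OF b]])
  show "norm (diag m x) \<le> C * norm x"
    unfolding diag_def by (rule ell2_dominated(2)[OF b]) (use assms[of 0] in linarith)
qed

lemma bounded_linear_diag:
  assumes "\<And>n. \<bar>m n\<bar> \<le> C"
  shows "bounded_linear (diag m)"
  by (rule bounded_linear_intro[of _ C])
     (auto intro!: ell2_eqI simp: coord_diag[OF assms] algebra_simps norm_diag_le[OF assms])

text \<open>The symbols converge for each j separately, which does not give convergence in operator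
  norm. For a fixed vector the tail is small uniformly in s by the common bound, and finitely many
  coordinates remain.\<close>

lemma diag_tendsto_0:
  assumes m: "\<And>j. ((\<lambda>s. m s j) \<longlongrightarrow> 0) F" and b: "eventually (\<lambda>s. \<forall>j. \<bar>m s j\<bar> \<le> C) F"
  shows "((\<lambda>s. diag (m s) x) \<longlongrightarrow> 0) F"
proof (rule tendstoI)
  fix r :: real assume r: "r > 0"
  define D where "D = \<bar>C\<bar> + 1"
  have D: "D > 0" "C \<le> D" by (auto simp: D_def)
  obtain N where N: "norm (x - ell2_trunc N (coord x)) < r / (2 * D)"
    using LIMSEQ_D[OF ell2_trunc_tendsto[of x], of "r / (2 * D)"] r D
    by (metis divide_pos_pos le_refl mult_pos_pos norm_minus_commute zero_less_numeral)
  have "((\<lambda>s. sqrt (\<Sum>j<N. (m s j * coord x j)\<^sup>2)) \<longlongrightarrow> sqrt (\<Sum>j<N. (0 * coord x j)\<^sup>2)) F"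
    by (intro tendsto_intros m)
  then have "eventually (\<lambda>s. dist (sqrt (\<Sum>j<N. (m s j * coord x j)\<^sup>2)) 0 < r / 2) F"
    using r by (intro tendstoD) auto
  with b show "eventually (\<lambda>s. dist (diag (m s) x) 0 < r) F"
  proof eventually_elim
    case (elim s)
    then have bs: "\<bar>m s j\<bar> \<le> D" for j using D by (meson order_trans)
    have 1: "diag (m s) (ell2_trunc N (coord x)) = ell2_trunc N (\<lambda>j. m s j * coord x j)"
      by (rule ell2_eqI) (simp add: coord_diag[OF bs])
    have "norm (diag (m s) x) = norm (diag (m s) (x - ell2_trunc N (coord x)) + ell2_trunc N (\<lambda>j. m s j * coord x j))"
      unfolding 1[symmetric] by (simp flip: linear_add[OF bounded_linear.linear[OF bounded_linear_diag[OF bs]]])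
    also have "\<dots> \<le> D * norm (x - ell2_trunc N (coord x)) + norm (ell2_trunc N (\<lambda>j. m s j * coord x j))"
      by (rule norm_triangle_le) (intro add_right_mono norm_diag_le bs)
    also have "norm (ell2_trunc N (\<lambda>j. m s j * coord x j)) = sqrt (\<Sum>j<N. (m s j * coord x j)\<^sup>2)"
      by (simp flip: norm_ell2_trunc)
    also have "D * norm (x - ell2_trunc N (coord x)) + \<dots> < D * (r / (2 * D)) + r / 2"
      by (intro add_strict_mono mult_strict_left_mono N D) (use elim in simp)
    also have "\<dots> = r" using D by (simp add: field_simps)
    finally show ?case by simp
  qed
qed

text \<open>Symbol and vector vary together. The difference is split into (m s - m0) h0 and m s (h s
  - h0), so strong convergence is needed at the limit vector only.\<close>

lemma diag_tendsto:
  assumes m: "\<And>j. ((\<lambda>s. m s j) \<longlongrightarrow> m0 j) F" and b: "eventually (\<lambda>s. \<forall>j. \<bar>m s j\<bar> \<le> C) F"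
    and m0: "\<And>j. \<bar>m0 j\<bar> \<le> C" and h: "(h \<longlongrightarrow> h0) F"
  shows "((\<lambda>s. diag (m s) (h s)) \<longlongrightarrow> diag m0 h0) F"
proof -
  have "((\<lambda>s. diag (\<lambda>j. m s j - m0 j) h0) \<longlongrightarrow> 0) F"
  proof (rule diag_tendsto_0[of _ _ "C + C"])
    show "((\<lambda>s. m s j - m0 j) \<longlongrightarrow> 0) F" for j
      using tendsto_diff[OF m[of j] tendsto_const, of "m0 j"] by simp
    show "eventually (\<lambda>s. \<forall>j. \<bar>m s j - m0 j\<bar> \<le> C + C) F"
      using b by eventually_elim (metis m0 abs_triangle_ineq4 add_mono order_trans)
  qed
  moreover have "((\<lambda>s. diag (m s) (h s - h0)) \<longlongrightarrow> 0) F"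
  proof (rule Lim_null_comparison)
    show "eventually (\<lambda>s. norm (diag (m s) (h s - h0)) \<le> C * norm (h s - h0)) F"
      using b by eventually_elim (auto intro: norm_diag_le)
    show "((\<lambda>s. C * norm (h s - h0)) \<longlongrightarrow> 0) F"
      using h by (intro tendsto_mult_right_zero) (simp add: tendsto_norm_zero_iff LIM_zero_iff)
  qed
  ultimately have "((\<lambda>s. diag (\<lambda>j. m s j - m0 j) h0 + diag (m s) (h s - h0)) \<longlongrightarrow> 0 + 0) F"
    by (rule tendsto_add)
  moreover have "eventually (\<lambda>s. diag (\<lambda>j. m s j - m0 j) h0 + diag (m s) (h s - h0) = diag (m s) (h s) - diag m0 h0) F"
    using b
  proof eventually_elim
    case (elim s)
    then have bs: "\<bar>m s j\<bar> \<le> C" for j by simp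
    have bd: "\<bar>m s j - m0 j\<bar> \<le> C + C" for j using bs[of j] m0[of j] by linarith
    show ?case
      by (rule ell2_eqI) (simp add: coord_diag[OF bs] coord_diag[OF bd] coord_diag[OF m0] algebra_simps)
  qed
  ultimately have "((\<lambda>s. diag (m s) (h s) - diag m0 h0) \<longlongrightarrow> 0) F"
    by (simp add: tendsto_cong)
  then show ?thesis by (rule LIM_zero_cancel)
qed

section \<open>Square integrable functions\<close>

lemma powr_2_abs [simp]: "\<bar>x\<bar> powr 2 = x\<^sup>2" for x :: real
  by (cases "x = 0") auto

lemma L2_iff: "f \<in> L2 \<Omega> \<longleftrightarrow>
    f \<in> borel_measurable (lebesgue_on \<Omega>) \<and> integrable (lebesgue_on \<Omega>) (\<lambda>x. (f x)\<^sup>2)"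
  by (simp add: Lp_def)

lemma L2_norm_eq: "L2_norm \<Omega> f = sqrt (LINT x|lebesgue_on \<Omega>. (f x)\<^sup>2)"
  by (simp add: Lp_norm_def powr_half_sqrt)

lemma L2_norm_nonneg [simp]: "L2_norm \<Omega> f \<ge> 0"
  by (simp add: L2_norm_eq)

lemma L2_norm_sq: "(L2_norm \<Omega> f)\<^sup>2 = L2_inner \<Omega> f f"
  by (simp add: L2_norm_eq L2_inner_def power2_eq_square)

lemma L2_meas: "f \<in> L2 \<Omega> \<Longrightarrow> f \<in> borel_measurable (lebesgue_on \<Omega>)"
  by (simp add: L2_iff)

lemma L2_mult_integrable:
  assumes "f \<in> L2 \<Omega>" "g \<in> L2 \<Omega>"
  shows "integrable (lebesgue_on \<Omega>) (\<lambda>x. f x * g x)"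
proof (rule Bochner_Integration.integrable_bound)
  show "integrable (lebesgue_on \<Omega>) (\<lambda>x. (f x)\<^sup>2 + (g x)\<^sup>2)"
    using assms by (auto simp: L2_iff)
  show "AE x in lebesgue_on \<Omega>. norm (f x * g x) \<le> norm ((f x)\<^sup>2 + (g x)\<^sup>2)"
  proof (rule AE_I2)
    fix x
    have "2 * \<bar>f x * g x\<bar> \<le> (f x)\<^sup>2 + (g x)\<^sup>2"
      using sum_squares_bound[of "\<bar>f x\<bar>" "\<bar>g x\<bar>"] by (simp add: abs_mult)
    then show "norm (f x * g x) \<le> norm ((f x)\<^sup>2 + (g x)\<^sup>2)" by simp
  qed
qed (use assms in \<open>auto intro: borel_measurable_times simp: L2_iff\<close>)

lemma L2_lincomb:
  assumes "f \<in> L2 \<Omega>" "g \<in> L2 \<Omega>"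
  shows "(\<lambda>x. a * f x + c * g x) \<in> L2 \<Omega>"
proof -
  have "integrable (lebesgue_on \<Omega>) (\<lambda>x. a\<^sup>2 * (f x)\<^sup>2 + c\<^sup>2 * (g x)\<^sup>2 + 2 * a * c * (f x * g x))"
    using assms L2_mult_integrable[OF assms] by (auto simp: L2_iff)
  then show ?thesis
    using assms by (auto simp: L2_iff power2_sum power_mult_distrib algebra_simps)
qed

lemma L2_zero [simp]: "(\<lambda>_. 0) \<in> L2 \<Omega>"
  by (simp add: L2_iff)

lemma L2_add: "f \<in> L2 \<Omega> \<Longrightarrow> g \<in> L2 \<Omega> \<Longrightarrow> (\<lambda>x. f x + g x) \<in> L2 \<Omega>"
  using L2_lincomb[of f \<Omega> g 1 1] by simp

lemma L2_diff: "f \<in> L2 \<Omega> \<Longrightarrow> g \<in> L2 \<Omega> \<Longrightarrow> (\<lambda>x. f x - g x) \<in> L2 \<Omega>"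
  using L2_lincomb[of f \<Omega> g 1 "-1"] by simp

lemma L2_cmult: "f \<in> L2 \<Omega> \<Longrightarrow> (\<lambda>x. a * f x) \<in> L2 \<Omega>"
  using L2_lincomb[of f \<Omega> f a 0] by simp

lemma L2_sum: "(\<And>i. i \<in> A \<Longrightarrow> f i \<in> L2 \<Omega>) \<Longrightarrow> (\<lambda>x. \<Sum>i\<in>A. f i x) \<in> L2 \<Omega>"
  by (induction A rule: infinite_finite_induct) (auto intro: L2_add)

lemma L2_inner_commute: "L2_inner \<Omega> f g = L2_inner \<Omega> g f"
  by (simp add: L2_inner_def mult.commute)

lemma L2_inner_lincomb:
  assumes "f \<in> L2 \<Omega>" "g \<in> L2 \<Omega>" "h \<in> L2 \<Omega>"
  shows "L2_inner \<Omega> (\<lambda>x. a * f x + c * g x) h = a * L2_inner \<Omega> f h + c * L2_inner \<Omega> g h"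
  using L2_mult_integrable[OF assms(1,3)] L2_mult_integrable[OF assms(2,3)]
  by (simp add: L2_inner_def distrib_right mult.assoc)

lemma L2_inner_add:
  "f \<in> L2 \<Omega> \<Longrightarrow> g \<in> L2 \<Omega> \<Longrightarrow> h \<in> L2 \<Omega> \<Longrightarrow>
    L2_inner \<Omega> (\<lambda>x. f x + g x) h = L2_inner \<Omega> f h + L2_inner \<Omega> g h"
  using L2_inner_lincomb[of f \<Omega> g h 1 1] by simp

lemma L2_inner_diff:
  "f \<in> L2 \<Omega> \<Longrightarrow> g \<in> L2 \<Omega> \<Longrightarrow> h \<in> L2 \<Omega> \<Longrightarrow>
    L2_inner \<Omega> (\<lambda>x. f x - g x) h = L2_inner \<Omega> f h - L2_inner \<Omega> g h"
  using L2_inner_lincomb[of f \<Omega> g h 1 "-1"] by simp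

lemma L2_inner_zero [simp]: "L2_inner \<Omega> (\<lambda>_. 0) h = 0"
  by (simp add: L2_inner_def)

lemma L2_inner_cmult: "L2_inner \<Omega> (\<lambda>x. a * f x) h = a * L2_inner \<Omega> f h"
  by (simp add: L2_inner_def mult.assoc)

lemma L2_inner_sum:
  assumes "\<And>i. i \<in> A \<Longrightarrow> f i \<in> L2 \<Omega>" "h \<in> L2 \<Omega>"
  shows "L2_inner \<Omega> (\<lambda>x. \<Sum>i\<in>A. f i x) h = (\<Sum>i\<in>A. L2_inner \<Omega> (f i) h)"
  using assms(1)
  by (induction A rule: infinite_finite_induct) (auto simp: L2_inner_add L2_sum assms(2))

lemma L2_Cauchy_Schwarz:
  assumes f: "f \<in> L2 \<Omega>" and g: "g \<in> L2 \<Omega>"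
  shows "\<bar>L2_inner \<Omega> f g\<bar> \<le> L2_norm \<Omega> f * L2_norm \<Omega> g"
proof -
  define a b c where "a = L2_inner \<Omega> f f" "b = L2_inner \<Omega> f g" "c = L2_inner \<Omega> g g"
  have q: "0 \<le> a + 2 * s * b + s\<^sup>2 * c" for s
  proof -
    have fs: "(\<lambda>x. 1 * f x + s * g x) \<in> L2 \<Omega>" by (rule L2_lincomb[OF f g])
    have "L2_inner \<Omega> (\<lambda>x. 1 * f x + s * g x) (\<lambda>x. 1 * f x + s * g x) =
        1 * (1 * a + s * b) + s * (1 * b + s * c)"
      unfolding L2_inner_lincomb[OF f g fs] L2_inner_commute[of \<Omega> f "\<lambda>x. 1 * f x + s * g x"]
        L2_inner_commute[of \<Omega> g "\<lambda>x. 1 * f x + s * g x"] L2_inner_lincomb[OF f g f] L2_inner_lincomb[OF f g g]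
      by (simp add: a_b_c_def L2_inner_commute[of \<Omega> g f])
    then have "(L2_norm \<Omega> (\<lambda>x. 1 * f x + s * g x))\<^sup>2 = a + 2 * s * b + s\<^sup>2 * c"
      unfolding L2_norm_sq by (simp add: power2_eq_square algebra_simps)
    then show ?thesis using zero_le_power2[of "L2_norm \<Omega> (\<lambda>x. 1 * f x + s * g x)"] by simp
  qed
  have "b\<^sup>2 \<le> a * c"
  proof (cases "c = 0")
    case True
    have "b = 0"
    proof (rule ccontr)
      assume "b \<noteq> 0"
      \<comment> \<open>For c = 0 the quadratic is affine in s, and at this s its value is
        -1.\<close>
      then show False using q[of "- (a + 1) / (2 * b)"] True by (simp add: field_simps)
    qed
    then show ?thesis using True by simp
  next
    case False
    moreover have "c \<ge> 0" unfolding a_b_c_def L2_norm_sq[symmetric] by simp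
    ultimately have "c > 0" by simp
    have "0 \<le> (a + 2 * (- b / c) * b + (- b / c)\<^sup>2 * c) * c"
      using q[of "- b / c"] \<open>c > 0\<close> by (intro mult_nonneg_nonneg) auto
    also have "\<dots> = a * c - b\<^sup>2" using \<open>c > 0\<close> by (simp add: field_simps power2_eq_square)
    finally show ?thesis by simp
  qed
  then have "\<bar>b\<bar>\<^sup>2 \<le> (L2_norm \<Omega> f * L2_norm \<Omega> g)\<^sup>2"
    by (simp add: power_mult_distrib L2_norm_sq a_b_c_def)
  then show ?thesis
    unfolding a_b_c_def by (rule power2_le_imp_le) simp
qed

lemma L2_norm_eq_0_iff:
  assumes "f \<in> L2 \<Omega>"
  shows "L2_norm \<Omega> f = 0 \<longleftrightarrow> (AE x in lebesgue_on \<Omega>. f x = 0)"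
proof -
  have "L2_norm \<Omega> f = 0 \<longleftrightarrow> (LINT x|lebesgue_on \<Omega>. (f x)\<^sup>2) = 0" by (simp add: L2_norm_eq)
  also have "\<dots> \<longleftrightarrow> (AE x in lebesgue_on \<Omega>. (f x)\<^sup>2 = 0)"
    by (rule integral_nonneg_eq_0_iff_AE) (use assms in \<open>auto simp: L2_iff\<close>)
  finally show ?thesis by simp
qed

text \<open>Lebesgue measure is complete, so a change on a null set preserves measurability. This
  allows arbitrary representatives of classes in time and in space.\<close>

lemma borel_measurable_AE_lebesgue_on:
  fixes f g :: "'a::euclidean_space \<Rightarrow> 'b::euclidean_space"
  assumes S: "S \<in> sets lebesgue" and f: "f \<in> borel_measurable (lebesgue_on S)"
    and ae: "AE x in lebesgue_on S. f x = g x"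
  shows "g \<in> borel_measurable (lebesgue_on S)"
proof -
  have "AE x in lebesgue. (if x \<in> S then f x else 0) = (if x \<in> S then g x else 0)"
    using ae S by (subst (asm) AE_restrict_space_iff) auto
  with f[folded borel_measurable_if[OF S]] show ?thesis
    unfolding borel_measurable_if[OF S, symmetric] by (rule borel_measurable_AE)
qed

lemma L2_cong_AE:
  assumes "\<Omega> \<in> sets lebesgue" "f \<in> L2 \<Omega>" "AE x in lebesgue_on \<Omega>. f x = g x"
  shows "g \<in> L2 \<Omega>"
proof -
  have g: "g \<in> borel_measurable (lebesgue_on \<Omega>)"
    using borel_measurable_AE_lebesgue_on[OF assms(1) L2_meas[OF assms(2)] assms(3)] .
  have "integrable (lebesgue_on \<Omega>) (\<lambda>x. (g x)\<^sup>2)"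
    by (rule integrable_cong_AE_imp[of _ "\<lambda>x. (f x)\<^sup>2"]) (use assms g in \<open>auto simp: L2_iff\<close>)
  with g show ?thesis by (simp add: L2_iff)
qed

section \<open>Coefficients with respect to an orthonormal basis\<close>

locale L2_basis =
  fixes \<Omega> :: "(real ^ 'n) set" and e :: "nat \<Rightarrow> real ^ 'n \<Rightarrow> real"
  assumes basis: "orthonormal_basis \<Omega> e"
begin

lemma e_L2 [simp]: "e j \<in> L2 \<Omega>"
  and e_orth: "L2_inner \<Omega> (e i) (e j) = (if i = j then 1 else 0)"
  and L2_sums_self: "v \<in> L2 \<Omega> \<Longrightarrow> L2_sums \<Omega> e (\<lambda>j. L2_inner \<Omega> v (e j)) v"
  using basis by (auto simp: orthonormal_basis_def)

definition psum :: "(nat \<Rightarrow> real) \<Rightarrow> nat \<Rightarrow> real ^ 'n \<Rightarrow> real" where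
  "psum c n x = (\<Sum>j<n. c j * e j x)"

lemma psum_L2 [simp]: "psum c n \<in> L2 \<Omega>"
  unfolding psum_def[abs_def] by (intro L2_sum L2_cmult e_L2)

lemma inner_psum: "v \<in> L2 \<Omega> \<Longrightarrow> L2_inner \<Omega> (psum c n) v = (\<Sum>j<n. c j * L2_inner \<Omega> (e j) v)"
  unfolding psum_def[abs_def] by (subst L2_inner_sum) (auto intro: L2_cmult simp: L2_inner_cmult)

lemma inner_psum_e: "L2_inner \<Omega> (psum c n) (e j) = (if j < n then c j else 0)"
  by (simp add: inner_psum e_orth if_distrib sum.If_cases cong: if_cong)

lemma norm_psum: "(L2_norm \<Omega> (psum c n))\<^sup>2 = (\<Sum>j<n. (c j)\<^sup>2)"
  unfolding L2_norm_sq inner_psum[OF psum_L2]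
  by (rule sum.cong) (auto simp: L2_inner_commute[of \<Omega> "e _"] inner_psum_e power2_eq_square)

lemma norm_psum_diff:
  assumes "m \<le> n"
  shows "(L2_norm \<Omega> (\<lambda>x. psum c n x - psum c m x))\<^sup>2 = (\<Sum>j=m..<n. (c j)\<^sup>2)"
proof -
  have "psum c n x - psum c m x = psum (\<lambda>j. if j < m then 0 else c j) n x" for x
  proof -
    have "psum c n x = psum c m x + (\<Sum>j=m..<n. c j * e j x)"
      unfolding psum_def using sum.atLeastLessThan_concat[of 0 m n "\<lambda>j. c j * e j x"] assms
      by (simp add: atLeast0LessThan)
    moreover have "psum (\<lambda>j. if j < m then 0 else c j) n x = (\<Sum>j=m..<n. c j * e j x)"
      unfolding psum_def by (rule sum.mono_neutral_cong_right) auto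
    ultimately show ?thesis by simp
  qed
  moreover have "(\<Sum>j<n. (if j < m then 0 else c j)\<^sup>2) = (\<Sum>j=m..<n. (c j)\<^sup>2)"
    by (rule sum.mono_neutral_cong_right) auto
  ultimately show ?thesis by (simp add: norm_psum)
qed

lemma L2_sums_inner:
  assumes "L2_sums \<Omega> e c w"
  shows "L2_inner \<Omega> w (e j) = c j"
proof -
  have w: "w \<in> L2 \<Omega>" and lim: "(\<lambda>n. L2_norm \<Omega> (\<lambda>x. w x - psum c n x)) \<longlonglongrightarrow> 0"
    using assms by (auto simp: L2_sums_def psum_def)
  have "(\<lambda>n. L2_inner \<Omega> w (e j) - L2_inner \<Omega> (psum c n) (e j)) \<longlonglongrightarrow> 0"
  proof (rule Lim_null_comparison[OF always_eventually lim], rule allI)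
    fix n
    have "\<bar>L2_inner \<Omega> (\<lambda>x. w x - psum c n x) (e j)\<bar> \<le> L2_norm \<Omega> (\<lambda>x. w x - psum c n x) * L2_norm \<Omega> (e j)"
      by (intro L2_Cauchy_Schwarz L2_diff w) auto
    also have "L2_norm \<Omega> (e j) = 1"
      using L2_norm_sq[of \<Omega> "e j"] L2_norm_nonneg[of \<Omega> "e j"] by (simp add: e_orth power2_eq_1_iff)
    finally show "norm (L2_inner \<Omega> w (e j) - L2_inner \<Omega> (psum c n) (e j)) \<le> L2_norm \<Omega> (\<lambda>x. w x - psum c n x)"
      by (simp add: L2_inner_diff w)
  qed
  moreover have "eventually (\<lambda>n. L2_inner \<Omega> w (e j) - L2_inner \<Omega> (psum c n) (e j) = L2_inner \<Omega> w (e j) - c j) sequentially"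
    using eventually_gt_at_top[of j] by eventually_elim (simp add: inner_psum_e)
  ultimately have "(\<lambda>n. L2_inner \<Omega> w (e j) - c j) \<longlonglongrightarrow> 0"
    by (rule Lim_transform_eventually)
  then show ?thesis by (simp add: LIMSEQ_const_iff)
qed

text \<open>The basis property makes the expansion of a given function converge automatically.
  Statements about series in L2 thereby become statements about coefficients.\<close>

lemma L2_sums_iff: "L2_sums \<Omega> e c w \<longleftrightarrow> w \<in> L2 \<Omega> \<and> (\<forall>j. L2_inner \<Omega> w (e j) = c j)"
proof
  assume "w \<in> L2 \<Omega> \<and> (\<forall>j. L2_inner \<Omega> w (e j) = c j)"
  then show "L2_sums \<Omega> e c w" using L2_sums_self[of w] by (metis (no_types, lifting) ext)
qed (auto simp: L2_sums_inner, simp add: L2_sums_def)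

lemma parseval: 
  assumes v: "v \<in> L2 \<Omega>"
  shows "(\<lambda>j. (L2_inner \<Omega> v (e j))\<^sup>2) sums (L2_norm \<Omega> v)\<^sup>2"
proof -
  define c where "c j = L2_inner \<Omega> v (e j)" for j
  have lim: "(\<lambda>n. L2_norm \<Omega> (\<lambda>x. v x - psum c n x)) \<longlonglongrightarrow> 0"
    using L2_sums_self[OF v] by (simp add: L2_sums_def psum_def c_def)
  have "(L2_norm \<Omega> (\<lambda>x. v x - psum c n x))\<^sup>2 = (L2_norm \<Omega> v)\<^sup>2 - (\<Sum>j<n. (c j)\<^sup>2)" for n
  proof -
    have d: "(\<lambda>x. v x - psum c n x) \<in> L2 \<Omega>" by (intro L2_diff v) simp
    have 1: "L2_inner \<Omega> (psum c n) v = (\<Sum>j<n. (c j)\<^sup>2)"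
      unfolding inner_psum[OF v] by (simp add: c_def L2_inner_commute[of \<Omega> "e _"] power2_eq_square)
    have 2: "L2_inner \<Omega> (psum c n) (psum c n) = (\<Sum>j<n. (c j)\<^sup>2)"
      by (simp flip: L2_norm_sq add: norm_psum)
    show ?thesis
      unfolding L2_norm_sq L2_inner_diff[OF v psum_L2 d] L2_inner_commute[of \<Omega> v "\<lambda>x. v x - psum c n x"]
        L2_inner_commute[of \<Omega> "psum c n" "\<lambda>x. v x - psum c n x"] L2_inner_diff[OF v psum_L2 v] L2_inner_diff[OF v psum_L2 psum_L2]
      by (simp add: 1 2 L2_inner_commute[of \<Omega> v "psum c n"])
  qed
  then have "(\<lambda>n. (L2_norm \<Omega> v)\<^sup>2 - (\<Sum>j<n. (c j)\<^sup>2)) \<longlonglongrightarrow> 0"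
    using tendsto_power[OF lim, of 2] by simp
  then have "(\<lambda>n. (L2_norm \<Omega> v)\<^sup>2 - ((L2_norm \<Omega> v)\<^sup>2 - (\<Sum>j<n. (c j)\<^sup>2))) \<longlonglongrightarrow> (L2_norm \<Omega> v)\<^sup>2 - 0"
    by (intro tendsto_intros)
  then show ?thesis by (simp add: sums_def c_def)
qed

definition hat :: "(real ^ 'n \<Rightarrow> real) \<Rightarrow> ell2" where
  "hat v = ell2_of (\<lambda>j. L2_inner \<Omega> v (e j))"

lemma coord_hat: "v \<in> L2 \<Omega> \<Longrightarrow> coord (hat v) j = L2_inner \<Omega> v (e j)"
  unfolding hat_def by (rule coord_ell2_of) (use parseval in \<open>auto simp: sums_iff\<close>)

lemma norm_hat: "v \<in> L2 \<Omega> \<Longrightarrow> norm (hat v) = L2_norm \<Omega> v"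
proof -
  assume v: "v \<in> L2 \<Omega>"
  have "(norm (hat v))\<^sup>2 = (L2_norm \<Omega> v)\<^sup>2"
    unfolding norm_ell2_sq using parseval[OF v] by (simp add: coord_hat v sums_iff)
  then show ?thesis by (simp add: power2_eq_iff_nonneg)
qed

lemma hat_lincomb: "v \<in> L2 \<Omega> \<Longrightarrow> w \<in> L2 \<Omega> \<Longrightarrow> hat (\<lambda>x. a * v x + c * w x) = a *\<^sub>R hat v + c *\<^sub>R hat w"
  by (rule ell2_eqI) (simp add: coord_hat L2_lincomb L2_inner_lincomb)

lemma hat_add: "v \<in> L2 \<Omega> \<Longrightarrow> w \<in> L2 \<Omega> \<Longrightarrow> hat (\<lambda>x. v x + w x) = hat v + hat w"
  using hat_lincomb[of v w 1 1] by simp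

lemma hat_diff: "v \<in> L2 \<Omega> \<Longrightarrow> w \<in> L2 \<Omega> \<Longrightarrow> hat (\<lambda>x. v x - w x) = hat v - hat w"
  using hat_lincomb[of v w 1 "-1"] by simp

lemma hat_cmult: "v \<in> L2 \<Omega> \<Longrightarrow> hat (\<lambda>x. a * v x) = a *\<^sub>R hat v"
  using hat_lincomb[of v v a 0] by simp

lemma hat_zero [simp]: "hat (\<lambda>_. 0) = 0"
  using hat_cmult[of "\<lambda>_. 0" 0] by simp

lemma dist_hat: "v \<in> L2 \<Omega> \<Longrightarrow> w \<in> L2 \<Omega> \<Longrightarrow> dist (hat v) (hat w) = L2_norm \<Omega> (\<lambda>x. v x - w x)"
  by (simp add: dist_norm hat_diff norm_hat L2_diff flip: hat_diff)

lemma inner_hat: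
  assumes "v \<in> L2 \<Omega>" "w \<in> L2 \<Omega>"
  shows "inner (hat v) (hat w) = L2_inner \<Omega> v w"
proof -
  note vw = L2_add[OF assms]
  have "(norm (hat v + hat w))\<^sup>2 = L2_inner \<Omega> (\<lambda>x. v x + w x) (\<lambda>x. v x + w x)"
    by (simp add: hat_add[OF assms, symmetric] norm_hat vw L2_norm_sq)
  also have "\<dots> = L2_inner \<Omega> v v + 2 * L2_inner \<Omega> v w + L2_inner \<Omega> w w"
    unfolding L2_inner_add[OF assms vw] L2_inner_commute[of \<Omega> v "\<lambda>x. v x + w x"]
      L2_inner_commute[of \<Omega> w "\<lambda>x. v x + w x"] L2_inner_add[OF assms assms(1)] L2_inner_add[OF assms assms(2)]
    by (simp add: L2_inner_commute[of \<Omega> w v])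
  also have "\<dots> = (norm (hat v))\<^sup>2 + 2 * L2_inner \<Omega> v w + (norm (hat w))\<^sup>2"
    by (simp add: norm_hat assms L2_norm_sq)
  finally show ?thesis by (simp add: dot_norm)
qed

lemma hat_eq_iff:
  assumes "v \<in> L2 \<Omega>" "w \<in> L2 \<Omega>"
  shows "hat v = hat w \<longleftrightarrow> (AE x in lebesgue_on \<Omega>. v x = w x)"
proof -
  have "hat v = hat w \<longleftrightarrow> L2_norm \<Omega> (\<lambda>x. v x - w x) = 0"
    using dist_hat[OF assms] by (metis dist_eq_0_iff)
  then show ?thesis by (simp add: L2_norm_eq_0_iff L2_diff assms)
qed

text \<open>Riesz--Fischer. Along a subsequence with \<open>\<parallel>S\<^bsub>r(k+1)\<^esub> - S\<^bsub>r(k)\<^esub>\<parallel>\<^sup>2 \<le> 8\<^sup>-\<^sup>k\<close> the partial sums converge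
  almost everywhere, as \<open>\<bar>d\<bar> \<le> 2\<^sup>-\<^sup>k + 2\<^sup>k d\<^sup>2\<close>.\<close>

lemma riesz_fischer: "\<exists>w\<in>L2 \<Omega>. hat w = x"
proof -
  define c where "c = coord x"
  define M where "M = lebesgue_on \<Omega>"
  define tail where "tail n = (\<Sum>j. (c (j + n))\<^sup>2)" for n
  have sc: "summable (\<lambda>j. (c j)\<^sup>2)" by (simp add: c_def)
  have tail_le: "(\<Sum>j=m..<n. (c j)\<^sup>2) \<le> tail m" for m n
  proof -
    have "(\<Sum>j=m..<n. (c j)\<^sup>2) = (\<Sum>j<n - m. (c (j + m))\<^sup>2)"
    proof (cases "m \<le> n")
      case True
      then show ?thesis using sum.shift_bounds_nat_ivl[of "\<lambda>j. (c j)\<^sup>2" 0 m "n - m"] by (simp add: atLeast0LessThan)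
    qed simp
    also have "\<dots> \<le> tail m"
      unfolding tail_def by (rule sum_le_suminf) (auto intro: summable_ignore_initial_segment[OF sc])
    finally show ?thesis .
  qed
  have tail0: "tail \<longlonglongrightarrow> 0"
    unfolding tail_def[abs_def] by (rule suminf_exist_split2[OF sc])
  have "\<exists>N. \<forall>n\<ge>N. tail n < 1 / 8 ^ k" for k
    using tail0 by (metis order_tendstoD(2) eventually_sequentially zero_less_divide_1_iff zero_less_power zero_less_numeral)
  then obtain N where N: "\<And>k n. n \<ge> N k \<Longrightarrow> tail n < 1 / 8 ^ k" by metis
  \<comment> \<open>Adding k and all N i with i \<le> k makes r nondecreasing, at least k, and at
    least N k.\<close>
  define r where "r k = k + (\<Sum>i\<le>k. N i)" for k
  have rN: "r k \<ge> N k" for k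
    unfolding r_def using member_le_sum[of k "{..k}" N] by auto
  have r_Suc: "r k \<le> r (Suc k)" for k by (simp add: r_def)
  have r_ge: "r k \<ge> k" for k by (simp add: r_def)
  define d where "d k y = psum c (r (Suc k)) y - psum c (r k) y" for k y
  have dL2: "d k \<in> L2 \<Omega>" for k unfolding d_def[abs_def] by (intro L2_diff psum_L2)
  have dmeas [measurable]: "d k \<in> borel_measurable M" for k using L2_meas[OF dL2] by (simp add: M_def)
  have pmeas [measurable]: "psum c k \<in> borel_measurable M" for k using L2_meas[OF psum_L2] by (simp add: M_def)
  have nn_L2: "(\<integral>\<^sup>+y. ennreal ((f y)\<^sup>2) \<partial>M) = ennreal ((L2_norm \<Omega> f)\<^sup>2)" if "f \<in> L2 \<Omega>" for f
    using that unfolding M_def L2_norm_sq L2_inner_def power2_eq_square[symmetric]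
    by (intro nn_integral_eq_integral) (auto simp: L2_iff)
  have dk: "(\<integral>\<^sup>+y. ennreal ((d k y)\<^sup>2) \<partial>M) \<le> ennreal (1 / 8 ^ k)" for k
  proof -
    have "(L2_norm \<Omega> (d k))\<^sup>2 \<le> tail (r k)"
      unfolding d_def[abs_def] norm_psum_diff[OF r_Suc] by (rule tail_le)
    also have "\<dots> \<le> 1 / 8 ^ k" using N[OF rN] by (rule less_imp_le)
    finally show ?thesis unfolding nn_L2[OF dL2] by (rule ennreal_leI)
  qed
  have "(\<integral>\<^sup>+y. (\<Sum>k. ennreal (2 ^ k * (d k y)\<^sup>2)) \<partial>M) = (\<Sum>k. \<integral>\<^sup>+y. ennreal (2 ^ k * (d k y)\<^sup>2) \<partial>M)"
    by (rule nn_integral_suminf) measurable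
  also have "\<dots> \<le> (\<Sum>k. ennreal ((1 / 4) ^ k))"
  proof (rule suminf_le)
    fix k
    have "(\<integral>\<^sup>+y. ennreal (2 ^ k * (d k y)\<^sup>2) \<partial>M) = ennreal (2 ^ k) * (\<integral>\<^sup>+y. ennreal ((d k y)\<^sup>2) \<partial>M)"
      by (subst nn_integral_cmult[symmetric]) (auto simp: ennreal_mult)
    also have "\<dots> \<le> ennreal (2 ^ k) * ennreal (1 / 8 ^ k)" by (intro mult_left_mono dk) auto
    also have "\<dots> = ennreal ((1 / 4) ^ k)"
    proof -
      have "(2::real) ^ k * (1 / 8 ^ k) = (1 / 4) ^ k"
        by (simp add: power_divide field_simps flip: power_mult_distrib)
      then show ?thesis by (simp add: ennreal_mult[symmetric])
    qed
    finally show "(\<integral>\<^sup>+y. ennreal (2 ^ k * (d k y)\<^sup>2) \<partial>M) \<le> ennreal ((1 / 4) ^ k)" .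
  qed auto
  also have "\<dots> < top"
    by (subst suminf_ennreal2) (auto intro: summable_geometric)
  finally have "AE y in M. (\<Sum>k. ennreal (2 ^ k * (d k y)\<^sup>2)) \<noteq> \<infinity>"
    by (intro nn_integral_noteq_infinite) auto
  then have ae: "AE y in M. summable (\<lambda>k. d k y)"
  proof eventually_elim
    case (elim y)
    then have 1: "summable (\<lambda>k. 2 ^ k * (d k y)\<^sup>2)" by (intro summable_suminf_not_top) auto
    have 2: "summable (\<lambda>k. (1 / 2 :: real) ^ k)" by (rule summable_geometric) simp
    show ?case
    proof (rule summable_comparison_test'[OF summable_add[OF 2 1]])
      fix k :: nat
      define t where "t = (2::real) ^ k"
      have t: "t > 0" "(1 / 2) ^ k = 1 / t" by (simp_all add: t_def power_divide)
      have "0 \<le> (1 - t * \<bar>d k y\<bar>)\<^sup>2 + t * \<bar>d k y\<bar>" using t by simp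
      also have "\<dots> = 1 - t * \<bar>d k y\<bar> + (t * \<bar>d k y\<bar>)\<^sup>2" by (simp add: power2_eq_square algebra_simps)
      finally have "t * \<bar>d k y\<bar> \<le> 1 + (t * \<bar>d k y\<bar>)\<^sup>2" by simp
      then have "t * \<bar>d k y\<bar> \<le> t * (1 / t + t * (d k y)\<^sup>2)"
        using t by (simp add: power_mult_distrib power2_eq_square algebra_simps)
      then have "\<bar>d k y\<bar> \<le> 1 / t + t * (d k y)\<^sup>2" using t by (simp only: mult_le_cancel_left_pos)
      then show "norm (d k y) \<le> (1 / 2) ^ k + 2 ^ k * (d k y)\<^sup>2"
        using t by (simp add: t_def)
    qed
  qed
  define w where "w y = psum c (r 0) y + (\<Sum>k. d k y)" for y
  have w_meas [measurable]: "w \<in> borel_measurable M" unfolding w_def[abs_def] by measurable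
  have lim: "AE y in M. (\<lambda>k. psum c (r k) y) \<longlonglongrightarrow> w y"
    using ae
  proof eventually_elim
    case (elim y)
    have "psum c (r k) y = psum c (r 0) y + (\<Sum>i<k. d i y)" for k
      by (induction k) (auto simp: d_def)
    then have "(\<lambda>k. psum c (r k) y) = (\<lambda>k. psum c (r 0) y + (\<Sum>i<k. d i y))" by (rule ext)
    then show ?case
      unfolding w_def using tendsto_add[OF tendsto_const summable_LIMSEQ[OF elim], of "psum c (r 0) y"]
      by (simp only:)
  qed
  \<comment> \<open>Fatou's lemma along the subsequence bounds the squared distance of w to every
    partial sum by the tail. It serves twice: w lies in L2, and the full sequence of partial sums
    converges to w.\<close>
  have fatou: "(\<integral>\<^sup>+y. ennreal ((w y - psum c n y)\<^sup>2) \<partial>M) \<le> ennreal (tail n)" for n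
  proof -
    have "(\<integral>\<^sup>+y. ennreal ((w y - psum c n y)\<^sup>2) \<partial>M) =
        (\<integral>\<^sup>+y. liminf (\<lambda>k. ennreal ((psum c (r k) y - psum c n y)\<^sup>2)) \<partial>M)"
    proof (rule nn_integral_cong_AE)
      show "AE y in M. ennreal ((w y - psum c n y)\<^sup>2) = liminf (\<lambda>k. ennreal ((psum c (r k) y - psum c n y)\<^sup>2))"
        using lim
      proof eventually_elim
        case (elim y)
        then have "(\<lambda>k. ennreal ((psum c (r k) y - psum c n y)\<^sup>2)) \<longlonglongrightarrow> ennreal ((w y - psum c n y)\<^sup>2)"
          by (intro tendsto_intros)
        then show ?case by (intro lim_imp_Liminf[symmetric]) auto
      qed
    qed
    also have "\<dots> \<le> liminf (\<lambda>k. \<integral>\<^sup>+y. ennreal ((psum c (r k) y - psum c n y)\<^sup>2) \<partial>M)"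
      by (rule nn_integral_liminf) measurable
    also have "\<dots> \<le> ennreal (tail n)"
    proof (rule Liminf_le[OF _ ])
      show "eventually (\<lambda>k. (\<integral>\<^sup>+y. ennreal ((psum c (r k) y - psum c n y)\<^sup>2) \<partial>M) \<le> ennreal (tail n)) sequentially"
        using eventually_ge_at_top[of n]
      proof eventually_elim
        case (elim k)
        then have "n \<le> r k" using r_ge[of k] by linarith
        then show ?case
          by (subst nn_L2) (auto intro!: L2_diff ennreal_leI tail_le simp: norm_psum_diff)
      qed
    qed simp
    finally show ?thesis .
  qed
  have wn: "(\<lambda>y. w y - psum c n y) \<in> L2 \<Omega>" for n
    unfolding L2_iff M_def[symmetric]
  proof
    show "integrable M (\<lambda>y. (w y - psum c n y)\<^sup>2)"
    proof (rule integrableI_bounded)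
      show "(\<integral>\<^sup>+y. ennreal (norm ((w y - psum c n y)\<^sup>2)) \<partial>M) < \<infinity>"
        using fatou[of n] by (auto simp: le_less_trans[OF _ ennreal_less_top])
    qed simp
  qed simp
  have w: "w \<in> L2 \<Omega>" using L2_add[OF wn[of 0] psum_L2[of c 0]] by simp
  have "(\<lambda>n. L2_norm \<Omega> (\<lambda>y. w y - psum c n y)) \<longlonglongrightarrow> 0"
  proof (rule Lim_null_comparison[OF always_eventually])
    show "\<forall>n. norm (L2_norm \<Omega> (\<lambda>y. w y - psum c n y)) \<le> sqrt (tail n)"
    proof
      fix n
      have "0 \<le> tail n" unfolding tail_def by (intro suminf_nonneg) (auto intro: summable_ignore_initial_segment[OF sc])
      then have "(L2_norm \<Omega> (\<lambda>y. w y - psum c n y))\<^sup>2 \<le> tail n"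
        using fatou[of n] unfolding nn_L2[OF wn] by (simp add: ennreal_le_iff)
      then show "norm (L2_norm \<Omega> (\<lambda>y. w y - psum c n y)) \<le> sqrt (tail n)"
        by (simp add: real_le_rsqrt)
    qed
    show "(\<lambda>n. sqrt (tail n)) \<longlonglongrightarrow> 0" using tendsto_real_sqrt[OF tail0] by simp
  qed
  then have "L2_sums \<Omega> e c w" using w by (simp add: L2_sums_def psum_def)
  then have "hat w = x" by (intro ell2_eqI) (simp add: coord_hat w L2_sums_inner c_def)
  then show ?thesis using w by blast
qed

text \<open>Coefficients determine a function up to a null set, so a representative is chosen.
  Composing the other way round, \<open>syn (hat v)\<close> equals v almost everywhere only.\<close>

definition syn :: "ell2 \<Rightarrow> real ^ 'n \<Rightarrow> real" where
  "syn x = (SOME w. w \<in> L2 \<Omega> \<and> hat w = x)"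

lemma syn_L2 [simp]: "syn x \<in> L2 \<Omega>" and hat_syn [simp]: "hat (syn x) = x"
  using someI_ex[of "\<lambda>w. w \<in> L2 \<Omega> \<and> hat w = x"] riesz_fischer[of x] unfolding syn_def by auto

end

section \<open>Functions of time\<close>

text \<open>The notions of the problem use \<open>lebesgue_on\<close>, whereas the convolution
  calculus works with Borel functions on the whole line and \<open>lborel\<close>, where translation
  and Fubini are at hand. These two rules connect both worlds.\<close>

lemma
  fixes f :: "real \<Rightarrow> 'b::{banach, second_countable_topology}"
  assumes S: "S \<in> sets borel" and f: "(\<lambda>x. indicator S x *\<^sub>R f x) \<in> borel_measurable borel"
  shows integrable_lebesgue_on_borel: "integrable (lebesgue_on S) f \<longleftrightarrow> integrable lborel (\<lambda>x. indicator S x *\<^sub>R f x)"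
    and integral_lebesgue_on_borel: "(LINT x|lebesgue_on S. f x) = (LINT x|lborel. indicator S x *\<^sub>R f x)"
proof -
  have S': "S \<inter> space lebesgue \<in> sets lebesgue" using S by auto
  show "integrable (lebesgue_on S) f \<longleftrightarrow> integrable lborel (\<lambda>x. indicator S x *\<^sub>R f x)"
    using f by (subst integrable_restrict_space[OF S']) (simp add: integrable_completion)
  show "(LINT x|lebesgue_on S. f x) = (LINT x|lborel. indicator S x *\<^sub>R f x)"
    using f by (subst integral_restrict_space[OF S']) (simp add: integral_completion)
qed

lemma AE_lebesgue_on_iff:
  assumes "S \<in> sets borel"
  shows "(AE x in lebesgue_on S. P x) \<longleftrightarrow> (AE x in lborel. x \<in> S \<longrightarrow> P x)"
  using assms by (subst AE_restrict_space_iff) (auto simp: AE_completion_iff)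

context L2_basis
begin

text \<open>The simple functions sample u at the midpoints of n + 1 cells of equal length. Midpoints
  stay inside the open interval, so u may be singular at both ends.\<close>

lemma Bochner_Lp_continuous:
  assumes T: "T > 0" and u: "\<And>t. t \<in> {0<..<T} \<Longrightarrow> u t \<in> L2 \<Omega>"
    and c: "continuous_on {0<..<T} (\<lambda>t. hat (u t))"
    and i: "integrable (lebesgue_on {0<..<T}) (\<lambda>t. norm (hat (u t)))"
  shows "u \<in> Bochner_Lp T 1 \<Omega> 2"
proof -
  define N where "N n = real (Suc n)" for n
  have N: "N n > 0" for n by (simp add: N_def)
  define g where "g n t = T * (of_int \<lfloor>t * N n / T\<rfloor> + 1/2) / N n" for n t
  have fl: "\<exists>k\<le>n. \<lfloor>t * N n / T\<rfloor> = int k" if t: "t \<in> {0<..<T}" for n t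
  proof -
    have "0 \<le> t * N n / T" using t N[of n] by (auto intro!: mult_nonneg_nonneg divide_nonneg_nonneg)
    then have 1: "0 \<le> \<lfloor>t * N n / T\<rfloor>" by simp
    have "t * N n / T < N n"
      using t T N[of n] by (simp add: divide_less_eq)
    then have "\<lfloor>t * N n / T\<rfloor> < int (Suc n)" unfolding floor_less_iff by (simp add: N_def) 
    then show ?thesis using 1 by (intro exI[of _ "nat \<lfloor>t * N n / T\<rfloor>"]) auto
  qed
  have g_in: "g n t \<in> {0<..<T}" if t: "t \<in> {0<..<T}" for n t
  proof -
    obtain k where k: "\<lfloor>t * N n / T\<rfloor> = int k" "k \<le> n" using fl[OF t, of n] by auto
    have "(real k + 1/2) / N n < 1" using k by (simp add: N_def)
    then have "T * ((real k + 1/2) / N n) < T * 1" using T by (intro mult_strict_left_mono)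
    then show ?thesis using T N[of n] unfolding g_def k(1) by simp
  qed
  have g_near: "\<bar>g n t - t\<bar> \<le> T / N n" for n t
  proof -
    define a where "a = t * N n / T"
    have "of_int \<lfloor>a\<rfloor> \<le> a" "a < of_int \<lfloor>a\<rfloor> + 1" by linarith+
    then have "\<bar>of_int \<lfloor>a\<rfloor> + 1/2 - a\<bar> \<le> 1" unfolding abs_le_iff by linarith
    moreover have "g n t - t = (T / N n) * (of_int \<lfloor>a\<rfloor> + 1/2 - a)"
      using T N[of n] by (simp add: g_def a_def field_simps)
    ultimately have "\<bar>g n t - t\<bar> \<le> (T / N n) * 1"
      using T N[of n] by (simp only: abs_mult) (intro mult_mono, auto)
    then show ?thesis by simp
  qed
  have g_lim: "(\<lambda>n. g n t) \<longlonglongrightarrow> t" for t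
  proof (rule LIM_zero_cancel, rule Lim_null_comparison[OF always_eventually])
    show "\<forall>n. norm (g n t - t) \<le> T * inverse (real (Suc n))" using g_near by (simp add: divide_inverse N_def)
    show "(\<lambda>n. T * inverse (real (Suc n))) \<longlonglongrightarrow> 0"
      by (rule tendsto_mult_right_zero[OF LIMSEQ_inverse_real_of_nat])
  qed
  define s where "s n t = u (g n t)" for n t
  have "Lp_simple T \<Omega> 2 (s n)" for n
    unfolding Lp_simple_def
  proof (intro conjI allI)
    define p where "p k = T * (real k + 1/2) / N n" for k
    have sp: "s n t = u (p k)" if "\<lfloor>t * N n / T\<rfloor> = int k" for t k
      by (simp add: s_def g_def p_def that)
    have "s n ` {0<..<T} \<subseteq> (\<lambda>k. u (p k)) ` {..n}"
    proof
      fix z assume "z \<in> s n ` {0<..<T}"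
      then obtain t where t: "t \<in> {0<..<T}" "z = s n t" by auto
      obtain k where "k \<le> n" "\<lfloor>t * N n / T\<rfloor> = int k" using fl[OF t(1), of n] by auto
      then show "z \<in> (\<lambda>k. u (p k)) ` {..n}" using t(2) sp by auto
    qed
    then show "finite (s n ` {0<..<T})" by (rule finite_subset) simp
    show "s n ` {0<..<T} \<subseteq> L2 \<Omega>" using u g_in by (auto simp: s_def)
    fix v
    have "{t \<in> {0<..<T}. s n t = v} =
        (\<Union>k\<in>{k\<in>{..n}. u (p k) = v}. {0<..<T} \<inter> {t. \<lfloor>t * N n / T\<rfloor> = int k})"
      (is "?A = ?B")
    proof
      show "?A \<subseteq> ?B"
      proof
        fix t assume t: "t \<in> ?A"
        then obtain k where "k \<le> n" "\<lfloor>t * N n / T\<rfloor> = int k" using fl[of t n] by auto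
        with t sp[of t k] show "t \<in> ?B" by auto
      qed
      show "?B \<subseteq> ?A" using sp by auto
    qed
    also have "\<dots> \<in> sets lborel"
    proof (intro sets.finite_UN sets.Int)
      show "{t. \<lfloor>t * N n / T\<rfloor> = int k} \<in> sets lborel" for k
        by measurable
    qed auto
    finally show "{t \<in> {0<..<T}. s n t = v} \<in> sets lebesgue" by simp
  qed
  moreover have "(\<lambda>n. L2_norm \<Omega> (\<lambda>x. s n t x - u t x)) \<longlonglongrightarrow> 0" if t: "t \<in> {0<..<T}" for t
  proof -
    have "(\<lambda>n. hat (u (g n t))) \<longlonglongrightarrow> hat (u t)"
      by (rule continuous_on_tendsto_compose[OF c g_lim t]) (use g_in[OF t] in auto)
    then have "(\<lambda>n. dist (hat (u (g n t))) (hat (u t))) \<longlonglongrightarrow> 0" by (rule tendsto_dist_iff[THEN iffD1])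
    then show ?thesis by (simp add: s_def dist_hat[OF u[OF g_in[OF t]] u[OF t]])
  qed
  moreover have "integrable (lebesgue_on {0<..<T}) (\<lambda>t. L2_norm \<Omega> (u t) powr 1)"
    using i by (rule Bochner_Integration.integrable_cong[THEN iffD1, rotated -1]) (auto simp: norm_hat u)
  ultimately show ?thesis
    using u by (auto simp: Bochner_Lp_def AE_lebesgue_on_iff intro!: exI[of _ s])
qed

text \<open>An element of the Bochner space is only Lebesgue measurable and only defined up to null
  sets. Its coefficients are almost everywhere limits of simple functions, hence Lebesgue
  measurable, and are replaced by Borel representatives that are assembled into one Borel function
  on the line.\<close>

lemma Bochner_Lp_ell2:
  assumes h: "h \<in> Bochner_Lp T 1 \<Omega> 2"
  obtains H where "H \<in> borel_measurable borel" "integrable lborel H" "\<And>t. t \<notin> {0<..<T} \<Longrightarrow> H t = 0"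
    "AE t in lebesgue_on {0<..<T}. h t \<in> L2 \<Omega> \<and> hat (h t) = H t"
proof -
  let ?M = "lebesgue_on {0<..<T}"
  obtain s where L2: "AE t in ?M. h t \<in> L2 \<Omega>" and s: "\<And>n. Lp_simple T \<Omega> 2 (s n)"
    and lim: "AE t in ?M. (\<lambda>n. L2_norm \<Omega> (\<lambda>x. s n t x - h t x)) \<longlonglongrightarrow> 0"
    and int: "integrable ?M (\<lambda>t. L2_norm \<Omega> (h t) powr 1)"
    using h by (auto simp: Bochner_Lp_def)
  have S: "{0<..<T} \<in> sets lebesgue" by auto
  have sL2: "s n t \<in> L2 \<Omega>" if "t \<in> {0<..<T}" for n t
    using s[of n] that by (auto simp: Lp_simple_def)
  have c_meas: "(\<lambda>t. L2_inner \<Omega> (h t) (e j)) \<in> borel_measurable ?M" for j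
  proof -
    have sm: "(\<lambda>t. L2_inner \<Omega> (s n t) (e j)) \<in> borel_measurable ?M" for n
    proof -
      have "simple_function ?M (s n)"
        unfolding simple_function_def
      proof (intro conjI ballI)
        show "finite (s n ` space ?M)" using s[of n] by (auto simp: Lp_simple_def)
        fix v
        have "s n -` {v} \<inter> space ?M = {t \<in> {0<..<T}. s n t = v}" by auto
        then show "s n -` {v} \<inter> space ?M \<in> sets ?M"
          using s[of n] by (auto simp: Lp_simple_def sets_restrict_space_iff)
      qed
      then have "simple_function ?M ((\<lambda>v. L2_inner \<Omega> v (e j)) \<circ> s n)" by (rule simple_function_compose)
      then show ?thesis by (auto simp: o_def dest: borel_measurable_simple_function)
    qed
    have "(\<lambda>t. lim (\<lambda>n. L2_inner \<Omega> (s n t) (e j))) \<in> borel_measurable ?M"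
      by (rule borel_measurable_lim_metric) (rule sm)
    moreover have "AE t in ?M. lim (\<lambda>n. L2_inner \<Omega> (s n t) (e j)) = L2_inner \<Omega> (h t) (e j)"
      using L2 lim AE_space
    proof eventually_elim
      case (elim t)
      then have t: "t \<in> {0<..<T}" by simp
      have "(\<lambda>n. dist (hat (s n t)) (hat (h t))) \<longlonglongrightarrow> 0"
        using elim by (simp add: dist_hat sL2[OF t])
      then have "(\<lambda>n. coord (hat (s n t)) j) \<longlonglongrightarrow> coord (hat (h t)) j"
        by (intro tendsto_coord) (rule tendsto_dist_iff[THEN iffD2])
      then show ?case using elim by (intro limI) (simp add: coord_hat sL2[OF t])
    qed
    ultimately show ?thesis by (rule borel_measurable_AE_lebesgue_on[OF S])
  qed
  have "\<exists>b\<in>borel_measurable lborel. AE t in lborel. (if t \<in> {0<..<T} then L2_inner \<Omega> (h t) (e j) else 0) = b t" for j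
    by (rule completion_ex_borel_measurable_real) (rule borel_measurable_if[OF S, THEN iffD2, OF c_meas])
  then have "\<forall>j. \<exists>b. b \<in> borel_measurable lborel \<and>
      (AE t in lborel. (if t \<in> {0<..<T} then L2_inner \<Omega> (h t) (e j) else 0) = b t)" by blast
  from choice[OF this] obtain b where bm: "\<And>j. b j \<in> borel_measurable lborel"
    and b: "\<And>j. AE t in lborel. (if t \<in> {0<..<T} then L2_inner \<Omega> (h t) (e j) else 0) = b j t" by blast
  \<comment> \<open>On a null set the representatives \<open>b j t\<close> need not be square
    summable in j; there \<open>ell2_of\<close> gives 0.\<close>
  define H where "H t = indicator {0<..<T} t *\<^sub>R ell2_of (\<lambda>j. b j t)" for t
  have H_meas: "H \<in> borel_measurable borel"
  proof (rule measurable_ell2)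
    fix j
    \<comment> \<open>The condition is phrased with a series in \<open>ennreal\<close>, which is
      measurable in t without any assumption of convergence.\<close>
    have eq: "coord (H t) j = (if (\<Sum>i. ennreal ((b i t)\<^sup>2)) \<noteq> top \<and> t \<in> {0<..<T} then b j t else 0)" for t
    proof -
      have *: "(\<Sum>i. ennreal ((b i t)\<^sup>2)) \<noteq> top \<longleftrightarrow> summable (\<lambda>i. (b i t)\<^sup>2)"
      proof
        assume "summable (\<lambda>i. (b i t)\<^sup>2)"
        then show "(\<Sum>i. ennreal ((b i t)\<^sup>2)) \<noteq> top" by (subst suminf_ennreal2) simp_all
      qed (rule summable_suminf_not_top, simp_all)
      show ?thesis
      proof (cases "summable (\<lambda>i. (b i t)\<^sup>2)")
        case True
        then show ?thesis unfolding * by (simp add: H_def coord_ell2_of indicator_def)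
      next
        case False
        then have "ell2_of (\<lambda>j. b j t) = 0" by (simp add: ell2_of_def zero_ell2_def)
        with False show ?thesis unfolding * by (simp add: H_def)
      qed
    qed
    have [measurable]: "b i \<in> borel_measurable borel" for i using bm[of i] by simp
    show "(\<lambda>t. coord (H t) j) \<in> borel_measurable borel"
      unfolding eq by measurable
  qed
  have "AE t in lborel. \<forall>j. (if t \<in> {0<..<T} then L2_inner \<Omega> (h t) (e j) else 0) = b j t"
    using b by (simp add: AE_all_countable)
  then have HAE: "AE t in ?M. h t \<in> L2 \<Omega> \<and> hat (h t) = H t"
    using L2 unfolding AE_lebesgue_on_iff[OF borel_open[OF open_greaterThanLessThan]]
    by eventually_elim (auto simp: H_def hat_def)
  have "integrable ?M H"
  proof (rule Bochner_Integration.integrable_bound[OF int])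
    show "H \<in> borel_measurable ?M" using H_meas by (simp add: measurable_restrict_space1 measurable_completion)
    show "AE t in ?M. norm (H t) \<le> norm (L2_norm \<Omega> (h t) powr 1)"
      using HAE by eventually_elim (auto simp flip: norm_hat)
  qed
  moreover have iH: "indicator {0<..<T} t *\<^sub>R H t = H t" for t by (simp add: H_def indicator_def)
  ultimately have "integrable lborel H"
    by (subst (asm) integrable_lebesgue_on_borel) (auto simp: H_meas)
  then show thesis by (rule that[OF H_meas _ _ HAE]) (simp add: H_def)
qed

end

section \<open>Convolution of kernels with an integrable singularity\<close>

text \<open>A multiple of the Riemann-Liouville kernel, cut off at 0. Thanks to the cut-off, a
  convolution over the line is the integral over (0,t).\<close>

definition pk :: "real \<Rightarrow> real \<Rightarrow> real" where
  "pk a s = (if s > 0 then s powr (a - 1) else 0)"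

lemma pk_nonneg [simp]: "pk a s \<ge> 0"
  by (simp add: pk_def)

lemma measurable_pk [measurable]: "pk a \<in> borel_measurable borel"
  unfolding pk_def[abs_def] by measurable

text \<open>The substitution \<tau> = t s separates the power of t from Euler's integral for the
  Beta function.\<close>

lemma nn_integral_pk_conv:
  assumes a: "a > 0" and b: "b > 0"
  shows "(\<integral>\<^sup>+\<tau>. ennreal (pk a (t - \<tau>) * pk b \<tau>) \<partial>lborel) = ennreal (Beta a b * pk (a + b) t)"
proof (cases "t > 0")
  case False
  then have "pk a (t - \<tau>) * pk b \<tau> = 0" for \<tau> by (auto simp: pk_def)
  moreover have "pk (a + b) t = 0" using False by (simp add: pk_def)
  ultimately show ?thesis by (simp only:) simp
next
  case t: True
  have eq: "pk a (t - t * s) * pk b (t * s) =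
      t powr (a + b - 2) * (indicator {0<..<1} s * (s powr (b - 1) * (1 - s) powr (a - 1)))" for s
  proof (cases "s \<in> {0<..<1}")
    case True
    have "pk a (t - t * s) = t powr (a - 1) * (1 - s) powr (a - 1)"
      using True t powr_mult[of t "1 - s" "a - 1"] by (simp add: pk_def right_diff_distrib)
    moreover have "pk b (t * s) = t powr (b - 1) * s powr (b - 1)"
      using True t powr_mult[of t s "b - 1"] by (simp add: pk_def)
    moreover have "t powr (a + b - 2) = t powr (a - 1) * t powr (b - 1)"
      by (simp flip: powr_add)
    ultimately show ?thesis using True by simp
  next
    case False
    then have "s \<le> 0 \<or> 1 \<le> s" by auto
    then have "pk a (t - t * s) * pk b (t * s) = 0"
    proof
      assume "s \<le> 0"
      then have "t * s \<le> 0" using t by (simp add: mult_le_0_iff)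
      then show ?thesis by (simp add: pk_def)
    next
      assume "1 \<le> s"
      then have "t - t * s \<le> 0" using t by (simp add: mult_le_cancel_left1)
      then show ?thesis by (simp add: pk_def)
    qed
    then show ?thesis using False by simp
  qed
  have "((\<lambda>s. s powr (b - 1) * (1 - s) powr (a - 1)) has_integral Beta b a) {0<..<1}"
    using has_integral_Beta_real[OF b a] by (simp add: has_integral_Icc_iff_Ioo)
  then have "((\<lambda>s. if s \<in> {0<..<1} then s powr (b - 1) * (1 - s) powr (a - 1) else 0) has_integral Beta b a) UNIV"
    by (simp only: has_integral_restrict_UNIV)
  also have "(\<lambda>s. if s \<in> {0<..<1} then s powr (b - 1) * (1 - s) powr (a - 1) else 0) =
      (\<lambda>s. indicator {0<..<1} s * (s powr (b - 1) * (1 - s) powr (a - 1)))"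
    by (auto simp: indicator_def)
  finally have beta: "(\<integral>\<^sup>+s. ennreal (indicator {0<..<1} s * (s powr (b - 1) * (1 - s) powr (a - 1))) \<partial>lborel) = ennreal (Beta b a)"
    by (intro nn_integral_has_integral_lborel) auto
  have "(\<integral>\<^sup>+\<tau>. ennreal (pk a (t - \<tau>) * pk b \<tau>) \<partial>lborel) =
      ennreal \<bar>t\<bar> * (\<integral>\<^sup>+s. ennreal (pk a (t - (0 + t * s)) * pk b (0 + t * s)) \<partial>lborel)"
    using t by (intro nn_integral_real_affine) auto
  also have "(\<integral>\<^sup>+s. ennreal (pk a (t - (0 + t * s)) * pk b (0 + t * s)) \<partial>lborel) =
      (\<integral>\<^sup>+s. ennreal (t powr (a + b - 2)) * ennreal (indicator {0<..<1} s * (s powr (b - 1) * (1 - s) powr (a - 1))) \<partial>lborel)"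
    unfolding add_0 eq by (intro nn_integral_cong ennreal_mult) (auto simp: indicator_def)
  also have "\<dots> = ennreal (t powr (a + b - 2)) * ennreal (Beta b a)"
    by (subst nn_integral_cmult) (auto simp: beta)
  also have "ennreal \<bar>t\<bar> * (ennreal (t powr (a + b - 2)) * ennreal (Beta b a)) =
      ennreal (t * (t powr (a + b - 2) * Beta b a))"
    using t a b by (subst ennreal_mult'[symmetric], simp)+ simp
  also have "t * (t powr (a + b - 2) * Beta b a) = Beta a b * pk (a + b) t"
    using t by (simp add: pk_def Beta_commute powr_mult_base)
  finally show ?thesis .
qed

text \<open>The class in which all scalar convolutions take place. It is closed under
  \<open>cv\<close>, with exponents adding up, and its bounds give the absolute convergence needed
  for Fubini. The bound also forces the function to vanish for s \<le> 0.\<close>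

definition kbd :: "real \<Rightarrow> (real \<Rightarrow> real) \<Rightarrow> bool" where
  "kbd a A \<longleftrightarrow> A \<in> borel_measurable borel \<and> (\<exists>C. \<forall>s. \<bar>A s\<bar> \<le> C * pk a s)"

lemma kbdI: "A \<in> borel_measurable borel \<Longrightarrow> (\<And>s. \<bar>A s\<bar> \<le> C * pk a s) \<Longrightarrow> kbd a A"
  by (auto simp: kbd_def)

lemma kbdE:
  assumes "kbd a A"
  obtains C where "A \<in> borel_measurable borel" "C \<ge> 0" "\<And>s. \<bar>A s\<bar> \<le> C * pk a s"
proof -
  obtain C where C: "A \<in> borel_measurable borel" "\<And>s. \<bar>A s\<bar> \<le> C * pk a s"
    using assms by (auto simp: kbd_def)
  have "\<bar>A s\<bar> \<le> \<bar>C\<bar> * pk a s" for s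
    using C(2)[of s] mult_right_mono[of C "\<bar>C\<bar>" "pk a s"] by (auto intro: order_trans)
  then show ?thesis using C(1) by (intro that[of "\<bar>C\<bar>"]) auto
qed

lemma kbd_pk: "kbd a (pk a)"
  by (rule kbdI[of _ 1]) auto

definition cv :: "(real \<Rightarrow> real) \<Rightarrow> (real \<Rightarrow> real) \<Rightarrow> real \<Rightarrow> real" where
  "cv A B t = (\<integral>\<tau>. A (t - \<tau>) * B \<tau> \<partial>lborel)"

lemma cv_pk:
  assumes "a > 0" "b > 0"
  shows "integrable lborel (\<lambda>\<tau>. pk a (t - \<tau>) * pk b \<tau>)" "cv (pk a) (pk b) t = Beta a b * pk (a + b) t"
proof -
  have "has_bochner_integral lborel (\<lambda>\<tau>. pk a (t - \<tau>) * pk b \<tau>) (Beta a b * pk (a + b) t)"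
    by (rule has_bochner_integral_nn_integral)
       (use nn_integral_pk_conv[OF assms] assms in \<open>auto simp: Beta_def Gamma_real_pos intro!: mult_nonneg_nonneg divide_nonneg_nonneg\<close>)
  then show "integrable lborel (\<lambda>\<tau>. pk a (t - \<tau>) * pk b \<tau>)" "cv (pk a) (pk b) t = Beta a b * pk (a + b) t"
    by (auto simp: cv_def has_bochner_integral_iff)
qed

lemma cv_integrable:
  assumes A: "kbd a A" and B: "kbd b B" and ab: "a > 0" "b > 0"
  shows "integrable lborel (\<lambda>\<tau>. A (t - \<tau>) * B \<tau>)"
proof -
  obtain C where C: "A \<in> borel_measurable borel" "C \<ge> 0" "\<And>s. \<bar>A s\<bar> \<le> C * pk a s" using kbdE[OF A] by blast
  obtain D where D: "B \<in> borel_measurable borel" "D \<ge> 0" "\<And>s. \<bar>B s\<bar> \<le> D * pk b s" using kbdE[OF B] by blast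
  note [measurable] = C(1) D(1)
  show ?thesis
  proof (rule Bochner_Integration.integrable_bound)
    show "integrable lborel (\<lambda>\<tau>. (C * D) * (pk a (t - \<tau>) * pk b \<tau>))"
      by (intro integrable_mult_right cv_pk ab)
    show "AE \<tau> in lborel. norm (A (t - \<tau>) * B \<tau>) \<le> norm (C * D * (pk a (t - \<tau>) * pk b \<tau>))"
    proof (rule AE_I2)
      fix \<tau>
      have "\<bar>A (t - \<tau>)\<bar> * \<bar>B \<tau>\<bar> \<le> (C * pk a (t - \<tau>)) * (D * pk b \<tau>)"
        by (intro mult_mono C D) (auto intro!: mult_nonneg_nonneg C D)
      then show "norm (A (t - \<tau>) * B \<tau>) \<le> norm (C * D * (pk a (t - \<tau>) * pk b \<tau>))"
        using C D by (simp add: abs_mult mult_ac)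
    qed
  qed measurable
qed

lemma kbd_cv:
  assumes A: "kbd a A" and B: "kbd b B" and ab: "a > 0" "b > 0"
  shows "kbd (a + b) (cv A B)"
proof -
  obtain C where C: "A \<in> borel_measurable borel" "C \<ge> 0" "\<And>s. \<bar>A s\<bar> \<le> C * pk a s" using kbdE[OF A] by blast
  obtain D where D: "B \<in> borel_measurable borel" "D \<ge> 0" "\<And>s. \<bar>B s\<bar> \<le> D * pk b s" using kbdE[OF B] by blast
  note [measurable] = C(1) D(1)
  show ?thesis
  proof (rule kbdI[of _ "C * D * Beta a b"])
    show "cv A B \<in> borel_measurable borel" unfolding cv_def[abs_def] by measurable
    fix t
    have "\<bar>cv A B t\<bar> \<le> (\<integral>\<tau>. \<bar>A (t - \<tau>) * B \<tau>\<bar> \<partial>lborel)"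
      unfolding cv_def by (rule integral_abs_bound)
    also have "\<dots> \<le> (\<integral>\<tau>. (C * D) * (pk a (t - \<tau>) * pk b \<tau>) \<partial>lborel)"
    proof (rule integral_mono)
      fix \<tau>
      have "\<bar>A (t - \<tau>)\<bar> * \<bar>B \<tau>\<bar> \<le> (C * pk a (t - \<tau>)) * (D * pk b \<tau>)"
        by (intro mult_mono C D) (auto intro!: mult_nonneg_nonneg C D)
      then show "\<bar>A (t - \<tau>) * B \<tau>\<bar> \<le> C * D * (pk a (t - \<tau>) * pk b \<tau>)"
        by (simp add: abs_mult mult_ac)
    qed (use cv_integrable[OF A B ab] in \<open>auto intro!: integrable_mult_right cv_pk ab\<close>)
    also have "\<dots> = C * D * Beta a b * pk (a + b) t"
      using cv_pk(2)[OF ab, of t] by (simp add: cv_def)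
    finally show "\<bar>cv A B t\<bar> \<le> C * D * Beta a b * pk (a + b) t" .
  qed
qed

lemma cv_commute: "cv A B = cv B A"
proof
  fix t
  have "cv A B t = \<bar>-1\<bar> *\<^sub>R (\<integral>\<tau>. A (t - (t + (-1) * \<tau>)) * B (t + (-1) * \<tau>) \<partial>lborel)"
    unfolding cv_def by (rule lborel_integral_real_affine) simp
  then show "cv A B t = cv B A t" by (simp add: cv_def mult.commute)
qed

text \<open>Fubini's theorem after a shift of the inner variable. Absolute integrability on the
  product comes from the same bounds: the convolution of |B| and |C| is again in the class
  \<open>kbd\<close>.\<close>

lemma cv_assoc:
  assumes A: "kbd a A" and B: "kbd b B" and C: "kbd c C" and abc: "a > 0" "b > 0" "c > 0"
  shows "cv A (cv B C) = cv (cv A B) C"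
proof
  fix t
  have m [measurable]: "A \<in> borel_measurable borel" "B \<in> borel_measurable borel" "C \<in> borel_measurable borel"
    using A B C by (auto simp: kbd_def)
  have absk: "kbd d (\<lambda>s. \<bar>X s\<bar>)" if "kbd d X" for d X
    using that by (auto simp: kbd_def)
  have int: "integrable (lborel \<Otimes>\<^sub>M lborel) (\<lambda>(\<tau>, \<sigma>). A (t - \<tau>) * (B (\<tau> - \<sigma>) * C \<sigma>))"
  proof (rule lborel_pair.Fubini_integrable)
    show "(\<lambda>(\<tau>, \<sigma>). A (t - \<tau>) * (B (\<tau> - \<sigma>) * C \<sigma>)) \<in> borel_measurable (lborel \<Otimes>\<^sub>M lborel)" by measurable
    have "integrable lborel (\<lambda>\<tau>. \<bar>A (t - \<tau>)\<bar> * cv (\<lambda>s. \<bar>B s\<bar>) (\<lambda>s. \<bar>C s\<bar>) \<tau>)"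
      by (rule cv_integrable[OF absk[OF A] kbd_cv[OF absk[OF B] absk[OF C]]]) (use abc in auto)
    then show "integrable lborel (\<lambda>\<tau>. \<integral>\<sigma>. norm (case (\<tau>, \<sigma>) of (\<tau>, \<sigma>) \<Rightarrow> A (t - \<tau>) * (B (\<tau> - \<sigma>) * C \<sigma>)) \<partial>lborel)"
      by (simp add: cv_def abs_mult)
    show "AE \<tau> in lborel. integrable lborel (\<lambda>\<sigma>. case (\<tau>, \<sigma>) of (\<tau>, \<sigma>) \<Rightarrow> A (t - \<tau>) * (B (\<tau> - \<sigma>) * C \<sigma>))"
      by (auto intro!: integrable_mult_right cv_integrable[OF B C] abc)
  qed
  have "cv A (cv B C) t = (\<integral>\<tau>. (\<integral>\<sigma>. A (t - \<tau>) * (B (\<tau> - \<sigma>) * C \<sigma>) \<partial>lborel) \<partial>lborel)"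
    by (simp add: cv_def)
  also have "\<dots> = (\<integral>\<sigma>. (\<integral>\<tau>. A (t - \<tau>) * (B (\<tau> - \<sigma>) * C \<sigma>) \<partial>lborel) \<partial>lborel)"
    using lborel_pair.Fubini_integral[OF int] by simp
  also have "\<dots> = (\<integral>\<sigma>. cv A B (t - \<sigma>) * C \<sigma> \<partial>lborel)"
  proof (rule Bochner_Integration.integral_cong)
    fix \<sigma>
    have "(\<integral>\<tau>. A (t - \<tau>) * (B (\<tau> - \<sigma>) * C \<sigma>) \<partial>lborel) = (\<integral>\<tau>. A (t - \<tau>) * B (\<tau> - \<sigma>) \<partial>lborel) * C \<sigma>"
      by (simp flip: mult.assoc)
    also have "(\<integral>\<tau>. A (t - \<tau>) * B (\<tau> - \<sigma>) \<partial>lborel) = \<bar>1\<bar> *\<^sub>R (\<integral>\<tau>. A (t - (\<sigma> + 1 * \<tau>)) * B (\<sigma> + 1 * \<tau> - \<sigma>) \<partial>lborel)"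
      by (rule lborel_integral_real_affine) simp
    also have "\<dots> = cv A B (t - \<sigma>)" by (simp add: cv_def algebra_simps)
    finally show "(\<integral>\<tau>. A (t - \<tau>) * (B (\<tau> - \<sigma>) * C \<sigma>) \<partial>lborel) = cv A B (t - \<sigma>) * C \<sigma>" .
  qed simp
  finally show "cv A (cv B C) t = cv (cv A B) C t" by (simp add: cv_def)
qed

lemma cv_cmult: "cv A (\<lambda>s. c * B s) t = c * cv A B t"
  by (simp add: cv_def mult.left_commute)

lemma cv_cmult_left: "cv (\<lambda>s. c * A s) B t = c * cv A B t"
  by (simp add: cv_def mult.assoc)

lemma cv_add:
  assumes "kbd a A" "kbd b B" "kbd c C" "a > 0" "b > 0" "c > 0"
  shows "cv A (\<lambda>s. B s + C s) t = cv A B t + cv A C t"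
  using cv_integrable[OF assms(1,2)] cv_integrable[OF assms(1,3)] assms(4-)
  by (simp add: cv_def distrib_left)

section \<open>Mittag-Leffler functions\<close>

text \<open>Only the part of the Gamma integral over [R, R+1] is kept. Since R is free, the Gamma
  function outgrows every exponential, which gives convergence of the Mittag-Leffler series
  everywhere.\<close>

lemma Gamma_ge_powr:
  assumes x: "x \<ge> 1" and R: "R > (0::real)"
  shows "Gamma x \<ge> R powr (x - 1) / exp (R + 1)"
proof -
  have G: "((\<lambda>t. t powr (x - 1) / exp t) has_integral Gamma x) {0..}"
    using x by (intro Gamma_integral_real) auto
  have "((\<lambda>t. R powr (x - 1) / exp (R + 1)) has_integral R powr (x - 1) / exp (R + 1)) {R..R+1}"
    using has_integral_const_real[of "R powr (x - 1) / exp (R + 1)" R "R + 1"] by simp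
  then have C: "((\<lambda>t. if t \<in> {R..R+1} then R powr (x - 1) / exp (R + 1) else 0) has_integral R powr (x - 1) / exp (R + 1)) {0..}"
    using R by (subst has_integral_restrict) auto
  show ?thesis
  proof (rule has_integral_le[OF C G])
    fix t assume "t \<in> {0::real..}"
    show "(if t \<in> {R..R+1} then R powr (x - 1) / exp (R + 1) else 0) \<le> t powr (x - 1) / exp t"
      using x R by (auto intro!: frac_le powr_mono2)
  qed
qed

lemma summable_mittag_leffler:
  assumes \<alpha>: "\<alpha> > 0" and \<sigma>: "\<sigma> > 0"
  shows "summable (\<lambda>n. \<bar>z\<bar> ^ n * rGamma (\<alpha> * real n + \<sigma>))"
proof -
  \<comment> \<open>R^\<alpha> is 2 (|z| + 1), so that the n-th term is at most a constant times
    2^(-n). The index N below ensures that the argument of the Gamma function is at least 1.\<close>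
  define R where "R = (2 * (\<bar>z\<bar> + 1)) powr (1 / \<alpha>)"
  have R: "R > 0" "R powr \<alpha> = 2 * (\<bar>z\<bar> + 1)" using \<alpha> by (simp_all add: R_def powr_powr)
  define N where "N = nat \<lceil>1 / \<alpha>\<rceil>"
  show ?thesis
  proof (rule summable_comparison_test'[of "\<lambda>n. exp (R + 1) * R powr (1 - \<sigma>) * (1 / 2) ^ n" N])
    show "summable (\<lambda>n. exp (R + 1) * R powr (1 - \<sigma>) * (1 / 2) ^ n)"
      by (intro summable_mult summable_geometric) simp
    fix n assume "n \<ge> N"
    then have "1 / \<alpha> \<le> real n" by (simp add: N_def)
    then have ge: "\<alpha> * real n + \<sigma> \<ge> 1" using \<alpha> \<sigma> by (simp add: field_simps)
    have G: "Gamma (\<alpha> * real n + \<sigma>) \<ge> R powr (\<alpha> * real n + \<sigma> - 1) / exp (R + 1)"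
      by (rule Gamma_ge_powr[OF ge R(1)])
    have "rGamma (\<alpha> * real n + \<sigma>) \<le> exp (R + 1) / R powr (\<alpha> * real n + \<sigma> - 1)"
      unfolding rGamma_inverse_Gamma using le_imp_inverse_le[OF G] R by simp
    then have "\<bar>z\<bar> ^ n * rGamma (\<alpha> * real n + \<sigma>) \<le> \<bar>z\<bar> ^ n * (exp (R + 1) / R powr (\<alpha> * real n + \<sigma> - 1))"
      by (intro mult_left_mono) auto
    also have "R powr (\<alpha> * real n + \<sigma> - 1) = (2 * (\<bar>z\<bar> + 1)) ^ n / R powr (1 - \<sigma>)"
    proof -
      have "R powr (\<alpha> * real n) = (2 * (\<bar>z\<bar> + 1)) ^ n"
        using R by (simp add: powr_realpow flip: powr_powr)
      moreover have "R powr (\<alpha> * real n + \<sigma> - 1) = R powr (\<alpha> * real n - (1 - \<sigma>))" by (simp add: algebra_simps)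
      ultimately show ?thesis by (simp add: powr_diff)
    qed
    also have "\<bar>z\<bar> ^ n * (exp (R + 1) / ((2 * (\<bar>z\<bar> + 1)) ^ n / R powr (1 - \<sigma>))) =
        exp (R + 1) * R powr (1 - \<sigma>) * ((\<bar>z\<bar> / (\<bar>z\<bar> + 1)) ^ n * (1 / 2) ^ n)"
      unfolding power_mult_distrib power_divide by (simp add: mult_ac)
    also have "\<dots> \<le> exp (R + 1) * R powr (1 - \<sigma>) * (1 * (1 / 2) ^ n)"
      by (intro mult_left_mono mult_right_mono power_le_one) auto
    finally have "\<bar>z\<bar> ^ n * rGamma (\<alpha> * real n + \<sigma>) \<le> exp (R + 1) * R powr (1 - \<sigma>) * (1 / 2) ^ n" by simp
    moreover have "rGamma (\<alpha> * real n + \<sigma>) \<ge> 0"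
      unfolding rGamma_inverse_Gamma using ge by (intro inverse_nonnegative_iff_nonnegative[THEN iffD2] less_imp_le Gamma_real_pos) auto
    ultimately show "norm (\<bar>z\<bar> ^ n * rGamma (\<alpha> * real n + \<sigma>)) \<le> exp (R + 1) * R powr (1 - \<sigma>) * (1 / 2) ^ n"
      by (simp add: abs_mult)
  qed
qed

lemma summable_mittag_leffler':
  assumes "\<alpha> > 0" "\<sigma> > 0"
  shows "summable (\<lambda>n. z ^ n * rGamma (\<alpha> * real n + \<sigma>))"
proof (rule summable_rabs_cancel)
  have "rGamma (\<alpha> * real n + \<sigma>) \<ge> 0" for n
    unfolding rGamma_inverse_Gamma using assms
    by (intro inverse_nonnegative_iff_nonnegative[THEN iffD2] less_imp_le Gamma_real_pos) (auto intro: add_nonneg_pos)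
  then show "summable (\<lambda>n. \<bar>z ^ n * rGamma (\<alpha> * real n + \<sigma>)\<bar>)"
    using summable_mittag_leffler[OF assms, of z] by (simp add: abs_mult power_abs)
qed

lemma continuous_on_mittag_leffler:
  assumes "\<alpha> > 0" "\<sigma> > 0"
  shows "continuous_on S (mittag_leffler \<alpha> \<sigma>)"
proof (rule continuous_at_imp_continuous_on, rule ballI)
  fix z
  have "isCont (\<lambda>z. \<Sum>n. rGamma (\<alpha> * real n + \<sigma>) * z ^ n) z"
    by (rule isCont_powser_converges_everywhere)
       (use summable_mittag_leffler'[OF assms] in \<open>simp add: mult.commute\<close>)
  then show "isCont (mittag_leffler \<alpha> \<sigma>) z"
    unfolding mittag_leffler_def[abs_def] by (simp add: mult.commute)
qed

lemma mittag_leffler_0: "mittag_leffler \<alpha> 1 0 = 1"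
proof -
  have "(\<Sum>n. (0::real) ^ n * rGamma (\<alpha> * real n + 1)) = (\<Sum>n\<in>{0}. 0 ^ n * rGamma (\<alpha> * real n + 1))"
    by (rule suminf_finite) (auto simp: power_0_left)
  then show ?thesis by (simp add: mittag_leffler_def)
qed

lemma mittag_leffler_shift:
  assumes "\<alpha> > 0"
  shows "mittag_leffler \<alpha> 1 z = 1 + z * mittag_leffler \<alpha> (\<alpha> + 1) z"
proof -
  have "mittag_leffler \<alpha> 1 z = (\<Sum>n. z ^ Suc n * rGamma (\<alpha> * real (Suc n) + 1)) + z ^ 0 * rGamma (\<alpha> * real 0 + 1)"
    unfolding mittag_leffler_def
    using suminf_split_head[OF summable_mittag_leffler'[OF assms, of 1 z]] by simp
  also have "(\<Sum>n. z ^ Suc n * rGamma (\<alpha> * real (Suc n) + 1)) = (\<Sum>n. z * (z ^ n * rGamma (\<alpha> * real n + (\<alpha> + 1))))"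
    by (simp add: algebra_simps)
  also have "\<dots> = z * mittag_leffler \<alpha> (\<alpha> + 1) z"
    unfolding mittag_leffler_def using assms by (intro suminf_mult summable_mittag_leffler') auto
  finally show ?thesis by simp
qed

text \<open>\<open>ml_K\<close> is the kernel of \<open>\<G>\<^sub>1\<close> for the eigenvalue power \<open>\<mu>\<close>, cut off at \<open>0\<close>; \<open>ml_E\<close> is the solution of
  \<open>\<partial>\<^sub>t\<^sup>\<alpha> y + \<mu> y = 0\<close> with \<open>y(0) = 1\<close>.\<close>

definition ml_K :: "real \<Rightarrow> real \<Rightarrow> real \<Rightarrow> real" where
  "ml_K \<alpha> \<mu> s = pk \<alpha> s * mittag_leffler \<alpha> \<alpha> (- (\<mu> * s powr \<alpha>))"

definition ml_E :: "real \<Rightarrow> real \<Rightarrow> real \<Rightarrow> real" where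
  "ml_E \<alpha> \<mu> t = mittag_leffler \<alpha> 1 (- (\<mu> * t powr \<alpha>))"

lemma measurable_mittag_leffler [measurable]:
  assumes "\<alpha> > 0" "\<sigma> > 0"
  shows "mittag_leffler \<alpha> \<sigma> \<in> borel_measurable borel"
  by (rule borel_measurable_continuous_onI) (rule continuous_on_mittag_leffler[OF assms])

lemma measurable_ml_E: "\<alpha> > 0 \<Longrightarrow> ml_E \<alpha> \<mu> \<in> borel_measurable borel"
  using measurable_compose[OF _ measurable_mittag_leffler[of \<alpha> 1], of "\<lambda>s. - (\<mu> * s powr \<alpha>)" borel]
  unfolding ml_E_def[abs_def] by auto

lemma continuous_on_ml_K: "\<alpha> > 0 \<Longrightarrow> continuous_on {0<..} (ml_K \<alpha> \<mu>)"
proof -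
  assume "\<alpha> > 0"
  then have "continuous_on {0<..} (\<lambda>s. s powr (\<alpha> - 1) * mittag_leffler \<alpha> \<alpha> (- (\<mu> * s powr \<alpha>)))"
    by (intro continuous_intros continuous_on_compose2[OF continuous_on_mittag_leffler[of _ _ UNIV]]) auto
  then show ?thesis by (rule continuous_on_eq) (simp add: ml_K_def pk_def)
qed

lemma continuous_on_ml_E: "\<alpha> > 0 \<Longrightarrow> continuous_on {0..} (ml_E \<alpha> \<mu>)"
  unfolding ml_E_def
  by (intro continuous_intros continuous_on_compose2[OF continuous_on_mittag_leffler[of _ _ UNIV]] continuous_on_powr') auto

lemma ml_E_0: "\<alpha> > 0 \<Longrightarrow> ml_E \<alpha> \<mu> 0 = 1"
  by (simp add: ml_E_def mittag_leffler_0)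

text \<open>Termwise integration: the n-th term of the kernel is a multiple of
  \<open>pk (\<alpha> * real n + \<alpha>)\<close>, and the Beta value produced by the convolution
  cancels 1/Gamma(\<alpha>n + \<alpha>). For b = 1-\<alpha> the result is Gamma(1-\<alpha>) times
  \<open>ml_E\<close>; for b = 1, multiplied by \<mu>, it is 1 - \<open>ml_E\<close>.\<close>

lemma cv_pk_ml_K:
  assumes \<alpha>: "\<alpha> > 0" and b: "b > 0" and \<mu>: "\<mu> \<ge> 0" and t: "t > 0"
  shows "cv (pk b) (ml_K \<alpha> \<mu>) t = Gamma b * t powr (\<alpha> + b - 1) * mittag_leffler \<alpha> (\<alpha> + b) (- (\<mu> * t powr \<alpha>))"
proof -
  define f where "f n \<tau> = (- \<mu>) ^ n * rGamma (\<alpha> * real n + \<alpha>) * (pk b (t - \<tau>) * pk (\<alpha> * real n + \<alpha>) \<tau>)" for n \<tau>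
  have pos: "\<alpha> * real n + \<alpha> > 0" for n using \<alpha> by (simp add: add_nonneg_pos)
  have rG: "rGamma x \<ge> 0" if "x > 0" for x :: real
    using that by (simp add: rGamma_inverse_Gamma less_imp_le Gamma_real_pos)
  have beta: "rGamma (\<alpha> * real n + \<alpha>) * Beta b (\<alpha> * real n + \<alpha>) = Gamma b * rGamma (\<alpha> * real n + (\<alpha> + b))" for n
  proof -
    have "b + (\<alpha> * real n + \<alpha>) = \<alpha> * real n + (\<alpha> + b)" by simp
    moreover have "Gamma (\<alpha> * real n + \<alpha>) \<noteq> 0" using Gamma_real_pos[OF pos[of n]] by simp
    ultimately show ?thesis by (simp only: Beta_def rGamma_inverse_Gamma) (simp add: divide_inverse)
  qed
  have pw: "pk (b + (\<alpha> * real n + \<alpha>)) t = t powr (\<alpha> + b - 1) * (t powr \<alpha>) ^ n" for n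
  proof -
    have "pk (b + (\<alpha> * real n + \<alpha>)) t = t powr ((\<alpha> + b - 1) + \<alpha> * real n)"
      using t by (simp add: pk_def algebra_simps)
    also have "\<dots> = t powr (\<alpha> + b - 1) * (t powr \<alpha>) ^ n"
      using t by (simp add: powr_add powr_realpow flip: powr_powr)
    finally show ?thesis .
  qed
  have fint: "integrable lborel (f n)" for n
    unfolding f_def[abs_def] by (intro integrable_mult_right cv_pk b pos)
  have f_int: "(\<integral>\<tau>. f n \<tau> \<partial>lborel) =
      Gamma b * t powr (\<alpha> + b - 1) * ((- (\<mu> * t powr \<alpha>)) ^ n * rGamma (\<alpha> * real n + (\<alpha> + b)))" for n
  proof -
    have "(\<integral>\<tau>. f n \<tau> \<partial>lborel) = (- \<mu>) ^ n * (rGamma (\<alpha> * real n + \<alpha>) * Beta b (\<alpha> * real n + \<alpha>)) * pk (b + (\<alpha> * real n + \<alpha>)) t"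
      using cv_pk(2)[OF b pos[of n], of t] unfolding f_def cv_def by simp
    also have "(- \<mu>) ^ n * (t powr \<alpha>) ^ n = (- (\<mu> * t powr \<alpha>)) ^ n" by (simp flip: power_mult_distrib)
    then have "(- \<mu>) ^ n * (rGamma (\<alpha> * real n + \<alpha>) * Beta b (\<alpha> * real n + \<alpha>)) * pk (b + (\<alpha> * real n + \<alpha>)) t =
      Gamma b * t powr (\<alpha> + b - 1) * ((- (\<mu> * t powr \<alpha>)) ^ n * rGamma (\<alpha> * real n + (\<alpha> + b)))"
      unfolding beta pw by (simp add: mult_ac)
    finally show ?thesis .
  qed
  have f_norm: "(\<integral>\<tau>. norm (f n \<tau>) \<partial>lborel) =
      Gamma b * t powr (\<alpha> + b - 1) * (\<bar>\<mu> * t powr \<alpha>\<bar> ^ n * rGamma (\<alpha> * real n + (\<alpha> + b)))" for n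
  proof -
    have "norm (f n \<tau>) = \<mu> ^ n * rGamma (\<alpha> * real n + \<alpha>) * (pk b (t - \<tau>) * pk (\<alpha> * real n + \<alpha>) \<tau>)" for \<tau>
      using \<mu> rG[OF pos[of n]] by (simp add: f_def abs_mult power_abs)
    then have "(\<integral>\<tau>. norm (f n \<tau>) \<partial>lborel) = \<mu> ^ n * (rGamma (\<alpha> * real n + \<alpha>) * Beta b (\<alpha> * real n + \<alpha>)) * pk (b + (\<alpha> * real n + \<alpha>)) t"
      using cv_pk(2)[OF b pos[of n], of t] unfolding cv_def by simp
    then show ?thesis unfolding beta pw using \<mu> by (simp add: power_mult_distrib mult_ac)
  qed
  have pw2: "pk b (t - \<tau>) * pk (\<alpha> * real n + \<alpha>) \<tau> = pk b (t - \<tau>) * pk \<alpha> \<tau> * (\<tau> powr \<alpha>) ^ n" for n \<tau>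
  proof (cases "\<tau> > 0")
    case True
    have "pk (\<alpha> * real n + \<alpha>) \<tau> = \<tau> powr ((\<alpha> - 1) + \<alpha> * real n)" using True by (simp add: pk_def algebra_simps)
    also have "\<dots> = pk \<alpha> \<tau> * (\<tau> powr \<alpha>) ^ n"
      using True by (simp add: pk_def powr_add powr_realpow flip: powr_powr)
    finally show ?thesis by simp
  qed (simp add: pk_def)
  have f_eq: "f n \<tau> = pk b (t - \<tau>) * pk \<alpha> \<tau> * ((- (\<mu> * \<tau> powr \<alpha>)) ^ n * rGamma (\<alpha> * real n + \<alpha>))" for n \<tau>
  proof -
    have "(- \<mu>) ^ n * (\<tau> powr \<alpha>) ^ n = (- (\<mu> * \<tau> powr \<alpha>)) ^ n" by (simp flip: power_mult_distrib)
    then show ?thesis unfolding f_def pw2 by (simp add: mult_ac)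
  qed
  have sums: "(\<lambda>n. f n \<tau>) sums (pk b (t - \<tau>) * ml_K \<alpha> \<mu> \<tau>)" for \<tau>
    unfolding f_eq ml_K_def mittag_leffler_def mult.assoc[symmetric]
    unfolding mult.assoc[of "pk b (t - \<tau>) * pk \<alpha> \<tau>"]
    by (intro sums_mult summable_sums summable_mittag_leffler' \<alpha>)
  have abs: "summable (\<lambda>n. norm (f n \<tau>))" for \<tau>
  proof -
    have "norm (f n \<tau>) = pk b (t - \<tau>) * pk \<alpha> \<tau> * (\<bar>\<mu> * \<tau> powr \<alpha>\<bar> ^ n * rGamma (\<alpha> * real n + \<alpha>))" for n
      using rG[OF pos[of n]] by (simp add: f_eq abs_mult power_abs)
    then show ?thesis by (auto intro!: summable_mult summable_mittag_leffler \<alpha>)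
  qed
  have "(\<lambda>n. \<integral>\<tau>. f n \<tau> \<partial>lborel) sums (\<integral>\<tau>. (\<Sum>n. f n \<tau>) \<partial>lborel)"
  proof (rule sums_integral[OF fint])
    show "AE \<tau> in lborel. summable (\<lambda>n. norm (f n \<tau>))" using abs by simp
    show "summable (\<lambda>n. \<integral>\<tau>. norm (f n \<tau>) \<partial>lborel)"
      unfolding f_norm using \<alpha> b by (intro summable_mult summable_mittag_leffler) auto
  qed
  moreover have "(\<Sum>n. f n \<tau>) = pk b (t - \<tau>) * ml_K \<alpha> \<mu> \<tau>" for \<tau> using sums by (simp add: sums_iff)
  ultimately have 1: "(\<lambda>n. \<integral>\<tau>. f n \<tau> \<partial>lborel) sums cv (pk b) (ml_K \<alpha> \<mu>) t" by (simp add: cv_def)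
  have "(\<lambda>n. \<integral>\<tau>. f n \<tau> \<partial>lborel) sums (Gamma b * t powr (\<alpha> + b - 1) * mittag_leffler \<alpha> (\<alpha> + b) (- (\<mu> * t powr \<alpha>)))"
    unfolding f_int mittag_leffler_def using \<alpha> b by (intro sums_mult summable_sums summable_mittag_leffler') auto
  with 1 show ?thesis by (rule sums_unique2)
qed

lemma frac_integral_cv:
  assumes [measurable]: "f \<in> borel_measurable borel" and f0: "\<And>s. s \<le> 0 \<Longrightarrow> f s = 0"
    and fg: "\<And>s. s \<in> {0<..<t} \<Longrightarrow> g s = f s"
  shows "frac_integral \<sigma> g t = 1 / Gamma \<sigma> * cv (pk \<sigma>) f t"
    "integrable lborel (\<lambda>\<tau>. pk \<sigma> (t - \<tau>) * f \<tau>) \<Longrightarrow>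
      integrable (lebesgue_on {0<..<t}) (\<lambda>\<tau>. (t - \<tau>) powr (\<sigma> - 1) * g \<tau>)"
proof -
  have eq: "indicator {0<..<t} \<tau> *\<^sub>R ((t - \<tau>) powr (\<sigma> - 1) * g \<tau>) = pk \<sigma> (t - \<tau>) * f \<tau>" for \<tau>
    using f0[of \<tau>] fg[of \<tau>] by (cases "\<tau> \<in> {0<..<t}") (auto simp: pk_def)
  show "frac_integral \<sigma> g t = 1 / Gamma \<sigma> * cv (pk \<sigma>) f t"
    unfolding frac_integral_def cv_def by (subst integral_lebesgue_on_borel) (unfold eq, auto)
  show "integrable lborel (\<lambda>\<tau>. pk \<sigma> (t - \<tau>) * f \<tau>) \<Longrightarrow>
      integrable (lebesgue_on {0<..<t}) (\<lambda>\<tau>. (t - \<tau>) powr (\<sigma> - 1) * g \<tau>)"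
    by (subst integrable_lebesgue_on_borel) (unfold eq, auto)
qed

text \<open>The scalar fractional equation \<open>\<partial>\<^sub>t\<^sup>\<alpha> y + \<mu> y = f\<close>, integrated once in time.\<close>

lemma cv_fractional_ode:
  assumes \<alpha>: "0 < \<alpha>" "\<alpha> < 1" and \<mu>: "\<mu> \<ge> 0" and f: "kbd b f" "b > 0"
    and K: "kbd \<alpha> (ml_K \<alpha> \<mu>)" and E: "kbd 1 (\<lambda>s. indicator {0<..} s * ml_E \<alpha> \<mu> s)" and t: "t > 0"
  shows "1 / Gamma (1 - \<alpha>) * cv (pk (1 - \<alpha>)) (\<lambda>s. c * (indicator {0<..} s * (ml_E \<alpha> \<mu> s - 1)) + cv (ml_K \<alpha> \<mu>) f s) t =
    cv (pk 1) f t - \<mu> * cv (pk 1) (\<lambda>s. c * (indicator {0<..} s * ml_E \<alpha> \<mu> s) + cv (ml_K \<alpha> \<mu>) f s) t"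
proof -
  define E' where "E' s = indicator {0<..} s * ml_E \<alpha> \<mu> s" for s
  have E': "kbd 1 E'" using E by (simp add: E'_def[abs_def])
  have G: "Gamma (1 - \<alpha>) > 0" using \<alpha> by (intro Gamma_real_pos) auto
  have p1: "pk 1 s = indicator {0<..} s" for s by (simp add: pk_def indicator_def)
  \<comment> \<open>This identity and the next one are all that is used about Mittag-Leffler
    functions here; the rest is associativity of the convolution.\<close>
  have A1: "cv (pk (1 - \<alpha>)) (ml_K \<alpha> \<mu>) = (\<lambda>s. Gamma (1 - \<alpha>) * E' s)"
  proof
    fix s
    show "cv (pk (1 - \<alpha>)) (ml_K \<alpha> \<mu>) s = Gamma (1 - \<alpha>) * E' s"
    proof (cases "s > 0")
      case True
      then show ?thesis using cv_pk_ml_K[of \<alpha> "1 - \<alpha>" \<mu> s] \<alpha> \<mu> by (simp add: E'_def ml_E_def)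
    next
      case False
      then have "pk (1 - \<alpha>) (s - \<tau>) * ml_K \<alpha> \<mu> \<tau> = 0" for \<tau> by (auto simp: pk_def ml_K_def)
      then have "cv (pk (1 - \<alpha>)) (ml_K \<alpha> \<mu>) s = 0" by (simp only: cv_def) simp
      then show ?thesis using False by (simp add: E'_def)
    qed
  qed
  have A2: "\<mu> * cv (pk 1) (ml_K \<alpha> \<mu>) s = pk 1 s - E' s" for s
  proof (cases "s > 0")
    case True
    then show ?thesis using cv_pk_ml_K[of \<alpha> 1 \<mu> s] \<alpha> \<mu> mittag_leffler_shift[of \<alpha> "- (\<mu> * s powr \<alpha>)"]
      by (simp add: E'_def ml_E_def pk_def)
  next
    case False
    then have "pk 1 (s - \<tau>) * ml_K \<alpha> \<mu> \<tau> = 0" for \<tau> by (auto simp: pk_def ml_K_def)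
    then have "cv (pk 1) (ml_K \<alpha> \<mu>) s = 0" by (simp only: cv_def) simp
    then show ?thesis using False by (simp add: E'_def pk_def)
  qed
  have k1: "kbd (1 - \<alpha>) (pk (1 - \<alpha>))" "kbd 1 (pk 1)" by (rule kbd_pk)+
  have kK1: "kbd (1 + \<alpha>) (cv (pk 1) (ml_K \<alpha> \<mu>))" using kbd_cv[OF k1(2) K] \<alpha> by simp
  have kKf: "kbd (\<alpha> + b) (cv (ml_K \<alpha> \<mu>) f)" using kbd_cv[OF K f(1)] \<alpha> f(2) by simp
  \<comment> \<open>The homogeneous part is itself the convolution -c \<mu> (1 * K), so the same
    associativity handles it together with the forcing term.\<close>
  have cE: "c * (indicator {0<..} s * (ml_E \<alpha> \<mu> s - 1)) = - (c * \<mu>) * cv (pk 1) (ml_K \<alpha> \<mu>) s" for s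
  proof -
    have "- (c * \<mu>) * cv (pk 1) (ml_K \<alpha> \<mu>) s = - c * (\<mu> * cv (pk 1) (ml_K \<alpha> \<mu>) s)" by simp
    then show ?thesis unfolding A2 by (simp add: E'_def p1 right_diff_distrib)
  qed
  have scale: "kbd d (\<lambda>s. c * X s)" if X: "kbd d X" for c d X
  proof -
    obtain C where "X \<in> borel_measurable borel" "C \<ge> 0" "\<And>s. \<bar>X s\<bar> \<le> C * pk d s" using kbdE[OF X] by blast
    then show ?thesis
      by (intro kbdI[of _ "\<bar>c\<bar> * C"]) (auto simp: abs_mult mult.assoc intro!: mult_left_mono)
  qed
  have 1: "cv (pk (1 - \<alpha>)) (cv (pk 1) (ml_K \<alpha> \<mu>)) s = Gamma (1 - \<alpha>) * cv (pk 1) E' s" for s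
  proof -
    have "cv (pk (1 - \<alpha>)) (cv (pk 1) (ml_K \<alpha> \<mu>)) = cv (pk (1 - \<alpha>)) (cv (ml_K \<alpha> \<mu>) (pk 1))"
      by (simp add: cv_commute[of "pk 1"])
    also have "\<dots> = cv (cv (pk (1 - \<alpha>)) (ml_K \<alpha> \<mu>)) (pk 1)"
      by (rule cv_assoc[OF k1(1) K k1(2)]) (use \<alpha> in auto)
    finally show ?thesis unfolding A1 by (simp add: cv_cmult cv_commute[of _ "pk 1"])
  qed
  have 2: "cv (pk (1 - \<alpha>)) (cv (ml_K \<alpha> \<mu>) f) s = Gamma (1 - \<alpha>) * cv E' f s" for s
    using cv_assoc[OF k1(1) K f(1)] \<alpha> f(2) by (simp add: A1 cv_cmult_left)
  have 3: "\<mu> * cv (pk 1) (cv (ml_K \<alpha> \<mu>) f) s = cv (pk 1) f s - cv E' f s" for s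
  proof -
    have "\<mu> * cv (pk 1) (cv (ml_K \<alpha> \<mu>) f) s = \<mu> * cv (cv (pk 1) (ml_K \<alpha> \<mu>)) f s"
      using cv_assoc[OF k1(2) K f(1)] \<alpha> f(2) by simp
    also have "\<dots> = cv (\<lambda>s. \<mu> * cv (pk 1) (ml_K \<alpha> \<mu>) s) f s" by (rule cv_cmult_left[symmetric])
    also have "\<dots> = cv (\<lambda>s. pk 1 s - E' s) f s" by (simp only: A2)
    also have "\<dots> = cv (pk 1) f s - cv E' f s"
      using cv_integrable[OF k1(2) f(1)] cv_integrable[OF E' f(1)] f(2) by (simp add: cv_def left_diff_distrib)
    finally show ?thesis .
  qed
  have m1: "cv (pk (1 - \<alpha>)) (\<lambda>s. c * (indicator {0<..} s * (ml_E \<alpha> \<mu> s - 1)) + cv (ml_K \<alpha> \<mu>) f s) t =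
      - (c * \<mu>) * (Gamma (1 - \<alpha>) * cv (pk 1) E' t) + Gamma (1 - \<alpha>) * cv E' f t"
  proof -
    have "cv (pk (1 - \<alpha>)) (\<lambda>s. c * (indicator {0<..} s * (ml_E \<alpha> \<mu> s - 1)) + cv (ml_K \<alpha> \<mu>) f s) t =
        cv (pk (1 - \<alpha>)) (\<lambda>s. - (c * \<mu>) * cv (pk 1) (ml_K \<alpha> \<mu>) s) t + cv (pk (1 - \<alpha>)) (cv (ml_K \<alpha> \<mu>) f) t"
      unfolding cE by (rule cv_add[OF k1(1) scale[OF kK1] kKf]) (use \<alpha> f(2) in auto)
    then show ?thesis unfolding cv_cmult 1 2 .
  qed
  have m2: "cv (pk 1) (\<lambda>s. c * E' s + cv (ml_K \<alpha> \<mu>) f s) t = c * cv (pk 1) E' t + cv (pk 1) (cv (ml_K \<alpha> \<mu>) f) t"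
    using cv_add[OF k1(2) scale[OF E'] kKf] \<alpha> f(2) by (simp add: cv_cmult)
  have 3: "cv E' f t = cv (pk 1) f t - \<mu> * cv (pk 1) (cv (ml_K \<alpha> \<mu>) f) t" using 3[of t] by simp
  show ?thesis
    unfolding E'_def[symmetric] m1 m2 3 using G by (simp add: field_simps)
qed

section \<open>Weights\<close>

text \<open>Up to scaling, \<open>wt\<close> is the supremum of \<open>\<surd>m / (1 + m x)\<close> over \<open>m \<ge> 1\<close>, see \<open>wt_sup\<close>.\<close>

definition wt :: "real \<Rightarrow> real" where
  "wt x = (if x \<le> 0 then 0 else if x \<le> 1 then 1 / (2 * sqrt x) else 1 / (1 + x))"

lemma wt_nonneg [simp]: "wt x \<ge> 0"
  by (simp add: wt_def)

lemma measurable_wt [measurable]: "wt \<in> borel_measurable borel"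
  unfolding wt_def[abs_def] by measurable

lemma two_sqrt_le: "x \<ge> 0 \<Longrightarrow> 2 * sqrt x \<le> 1 + x"
  using sum_squares_bound[of "sqrt x" 1] by simp

lemma wt_ge: "x > 0 \<Longrightarrow> 1 / (1 + x) \<le> wt x"
  using two_sqrt_le[of x] by (auto simp: wt_def intro!: divide_left_mono)

lemma wt_le: "x > 0 \<Longrightarrow> wt x \<le> 1 / (2 * sqrt x)"
  using two_sqrt_le[of x] by (auto simp: wt_def intro!: divide_left_mono)

lemma wt_le_pk: "wt x \<le> 1 / 2 * pk (1 / 2) x"
  using wt_le[of x] by (cases "x > 0") (auto simp: pk_def powr_minus_divide powr_half_sqrt wt_def)

lemma wt_antimono:
  assumes "0 < x" "x \<le> y"
  shows "wt y \<le> wt x"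
proof (cases "y \<le> 1")
  case True
  then show ?thesis using assms by (auto simp: wt_def intro!: divide_left_mono)
next
  case False
  then have "wt y = 1 / (1 + y)" using assms by (simp add: wt_def)
  also have "\<dots> \<le> 1 / (1 + x)" using assms by (auto intro!: divide_left_mono)
  also have "\<dots> \<le> wt x" using assms by (intro wt_ge)
  finally show ?thesis .
qed

lemma continuous_on_wt: "continuous_on {0<..} wt"
proof -
  have "continuous_on {0<..} (\<lambda>x::real. if x \<le> 1 then 1 / (2 * sqrt x) else 1 / (1 + x))"
    by (rule continuous_on_cases_le) (auto intro!: continuous_intros)
  then show ?thesis by (rule continuous_on_eq) (auto simp: wt_def)
qed

text \<open>As a function of m', the left side increases up to m' = 1/x, where its value is 1/(2
  sqrt x), and decreases afterwards. If m x > 1 the peak lies below m, and the value at m' = m is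
  the largest one in the range.\<close>

lemma wt_sup:
  assumes "0 < m" "m \<le> m'" "x > 0"
  shows "sqrt m' / (1 + m' * x) \<le> sqrt m * wt (m * x)"
proof (cases "m * x \<le> 1")
  case True
  have "2 * (sqrt m' * sqrt x) \<le> 1 + m' * x"
    using two_sqrt_le[of "m' * x"] assms by (simp add: real_sqrt_mult)
  then have "sqrt m' / (1 + m' * x) \<le> 1 / (2 * sqrt x)"
    using assms by (simp add: field_simps add_pos_pos)
  also have "\<dots> = sqrt m * wt (m * x)"
    using True assms by (simp add: wt_def real_sqrt_mult not_le)
  finally show ?thesis .
next
  case False
  define a b where "a = sqrt m" "b = sqrt m'"
  have ab: "0 < a" "a \<le> b" "m = a * a" "m' = b * b" using assms by (auto simp: a_b_def)
  have "a * a * x \<le> a * b * x" using ab assms by (intro mult_right_mono mult_left_mono) auto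
  then have "1 \<le> a * b * x" using False unfolding ab(3) by linarith
  then have "(b - a) * 1 \<le> (b - a) * (a * b * x)" using ab by (intro mult_left_mono) auto
  then have "b * (1 + m * x) \<le> a * (1 + m' * x)" by (simp add: ab algebra_simps)
  moreover have "wt (m * x) = 1 / (1 + m * x)" using False assms by (simp add: wt_def not_le)
  moreover have "1 + m * x > 0" "1 + m' * x > 0" using assms by (auto intro: add_pos_pos)
  ultimately have "b / (1 + m' * x) \<le> a / (1 + m * x)" "wt (m * x) = 1 / (1 + m * x)"
    by (simp_all only: pos_divide_le_eq times_divide_eq_left pos_le_divide_eq)
  then show ?thesis by (simp add: a_b_def)
qed

section \<open>Convolutions of the weight with the resolvent and with itself\<close>

lemma nn_integral_cmult_real:
  assumes "f \<in> borel_measurable borel" "c \<ge> 0"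
  shows "(\<integral>\<^sup>+x. ennreal (c * f x) \<partial>lborel) = ennreal c * (\<integral>\<^sup>+x. ennreal (f x) \<partial>lborel)"
  unfolding ennreal_mult'[OF assms(2)] using assms by (intro nn_integral_cmult) auto

text \<open>The factor lost when \<open>wt\<close> is convolved with 1/(1+y), see
  \<open>wt_conv_resolvent\<close>. For \<xi> \<le> 1 it comes from the majorants 1/(2 sqrt) and 1.
  For \<xi> > 1 the part 1 + 1/(3\<xi>) belongs to the unit interval next to the singularity of
  \<open>wt\<close>, and 2 ln \<xi> to the rest.\<close>

definition Lam :: "real \<Rightarrow> real" where
  "Lam \<xi> = (if \<xi> \<le> 1 then 2 * \<xi> else 1 + 1 / (3 * \<xi>) + 2 * ln \<xi>)"

text \<open>For t = 1 the second factor confines y to x-1 < y < x. In this form the Beta integral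
  evaluates the contribution of a singularity at y = x.\<close>

lemma nn_integral_pk_shift:
  assumes "a > 0" "b > 0"
  shows "(\<integral>\<^sup>+y. ennreal (pk a (x - y) * pk b (t - x + y)) \<partial>lborel) = ennreal (Beta a b * pk (a + b) t)"
proof -
  have "(\<integral>\<^sup>+y. ennreal (pk a (x - y) * pk b (t - x + y)) \<partial>lborel) =
      ennreal \<bar>1\<bar> * (\<integral>\<^sup>+\<tau>. ennreal (pk a (x - (x - t + 1 * \<tau>)) * pk b (t - x + (x - t + 1 * \<tau>))) \<partial>lborel)"
    by (rule nn_integral_real_affine) auto
  also have "\<dots> = (\<integral>\<^sup>+\<tau>. ennreal (pk a (t - \<tau>) * pk b \<tau>) \<partial>lborel)" by simp
  finally show ?thesis using nn_integral_pk_conv[OF assms] by simp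
qed

lemma Beta_half_1: "Beta (1 / 2) 1 = (2 :: real)"
proof -
  have "Gamma (1 / 2 + 1 :: real) = 1 / 2 * Gamma (1 / 2)"
    by (rule Gamma_plus1) (auto elim!: nonpos_Ints_cases)
  moreover have "Gamma (3 / 2 :: real) \<noteq> 0" by (rule less_imp_neq[THEN not_sym], rule Gamma_real_pos) simp
  ultimately show ?thesis by (simp add: Beta_def divide_eq_eq)
qed

lemma Beta_3half_1: "Beta (3 / 2) 1 = (2 / 3 :: real)"
proof -
  have "Gamma (3 / 2 + 1 :: real) = 3 / 2 * Gamma (3 / 2)"
    by (rule Gamma_plus1) (auto elim!: nonpos_Ints_cases)
  moreover have "Gamma (5 / 2 :: real) \<noteq> 0" by (rule less_imp_neq[THEN not_sym], rule Gamma_real_pos) simp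
  ultimately show ?thesis by (simp add: Beta_def divide_eq_eq)
qed

lemma Beta_half_half: "Beta (1 / 2) (1 / 2) = (pi :: real)"
  by (simp add: Beta_def Gamma_one_half_real)

lemma nn_integral_partial_fraction:
  assumes "0 \<le> a" "a \<le> b" "b < 1 + x"
  shows "(\<integral>\<^sup>+y. ennreal (1 / ((1 + y) * (1 + x - y))) * indicator {a..b} y \<partial>lborel) =
    ennreal ((ln (1 + b) - ln (1 + x - b) - (ln (1 + a) - ln (1 + x - a))) / (2 + x))"
proof -
  define F where "F y = (ln (1 + y) - ln (1 + x - y)) / (2 + x)" for y
  have "(\<integral>\<^sup>+y. ennreal (1 / ((1 + y) * (1 + x - y))) * indicator {a..b} y \<partial>lborel) = ennreal (F b - F a)"
  proof (rule nn_integral_FTC_Icc)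
    fix y assume y: "y \<in> {a..b}"
    then have p: "1 + y > 0" "1 + x - y > 0" "2 + x > 0" using assms by auto
    then show "0 \<le> 1 / ((1 + y) * (1 + x - y))" by simp
    have "(F has_real_derivative (1 / (1 + y) - (- 1) / (1 + x - y)) / (2 + x)) (at y)"
      unfolding F_def using p by (auto intro!: derivative_eq_intros simp: divide_inverse)
    also have "1 / (1 + y) - (- 1) / (1 + x - y) = (2 + x) / ((1 + y) * (1 + x - y))"
      using p by (simp add: divide_simps)
    also have "\<dots> / (2 + x) = 1 / ((1 + y) * (1 + x - y))" using p by simp
    finally show "(F has_real_derivative 1 / ((1 + y) * (1 + x - y))) (at y)" .
  qed (use assms in auto)
  then show ?thesis by (simp add: F_def diff_divide_distrib)
qed

text \<open>For x > 1 the range of y is cut at x - 1. Below, both factors are resolvents and partial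
  fractions give logarithms; above, the singularity (x-y)^(-1/2) is integrated against a linear
  majorant of the resolvent.\<close>

lemma wt_conv_resolvent:
  assumes x: "x > 0"
  shows "(\<integral>\<^sup>+y. ennreal (wt (x - y) * (indicator {0<..} y / (1 + y))) \<partial>lborel) \<le> ennreal (Lam x * wt x)"
proof (cases "x \<le> 1")
  case True
  have "(\<integral>\<^sup>+y. ennreal (wt (x - y) * (indicator {0<..} y / (1 + y))) \<partial>lborel) \<le>
      (\<integral>\<^sup>+y. ennreal (1 / 2 * (pk (1 / 2) (x - y) * pk 1 y)) \<partial>lborel)"
  proof (rule nn_integral_mono)
    fix y
    have "indicator {0<..} y / (1 + y) \<le> pk 1 y" by (auto simp: pk_def indicator_def)
    then have "wt (x - y) * (indicator {0<..} y / (1 + y)) \<le> (1 / 2 * pk (1 / 2) (x - y)) * pk 1 y"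
      by (intro mult_mono wt_le_pk) (auto simp: indicator_def)
    then show "ennreal (wt (x - y) * (indicator {0<..} y / (1 + y))) \<le>
        ennreal (1 / 2 * (pk (1 / 2) (x - y) * pk 1 y))"
      by (intro ennreal_leI) simp
  qed
  also have "\<dots> = ennreal (1 / 2) * ennreal (2 * pk (3 / 2) x)"
    using nn_integral_pk_conv[of "1/2" 1 x] by (subst nn_integral_cmult_real) (auto simp: Beta_half_1)
  also have "\<dots> = ennreal (1 / 2 * (2 * pk (3 / 2) x))" by (rule ennreal_mult'[symmetric]) simp
  also have "1 / 2 * (2 * pk (3 / 2) x) = sqrt x"
    using x by (simp add: pk_def powr_half_sqrt)
  also have "sqrt x = Lam x * wt x"
    using x True by (simp add: Lam_def wt_def real_div_sqrt)
  finally show ?thesis .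
next
  case False
  \<comment> \<open>With z = x - y, the convex function 1/(1+x-z) lies below its chord on 0 < z < 1.
    Then \<open>f1\<close> and \<open>f2\<close> are the constant and the linear part of this chord,
    each multiplied by 1/(2 sqrt z), so \<open>c\<close> is half the slope.\<close>
  define c where "c = 1 / 2 * (1 / x - 1 / (1 + x))"
  have c: "c \<ge> 0" using x by (simp add: c_def field_simps)
  define f1 where "f1 y = 1 / (2 * (1 + x)) * (pk (1 / 2) (x - y) * pk 1 (1 - x + y))" for y
  define f2 where "f2 y = c * (pk (3 / 2) (x - y) * pk 1 (1 - x + y))" for y
  have "(\<integral>\<^sup>+y. ennreal (wt (x - y) * (indicator {0<..} y / (1 + y))) \<partial>lborel) \<le>
      (\<integral>\<^sup>+y. ennreal (f1 y) + ennreal (f2 y) + ennreal (1 / ((1 + y) * (1 + x - y))) * indicator {0..x - 1} y \<partial>lborel)"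
  proof (rule nn_integral_mono)
    fix y
    consider "y \<le> 0 \<or> y \<ge> x" | "0 < y" "y \<le> x - 1" | "0 < y" "x - 1 < y" "y < x" using False by linarith
    then show "ennreal (wt (x - y) * (indicator {0<..} y / (1 + y))) \<le>
        ennreal (f1 y) + ennreal (f2 y) + ennreal (1 / ((1 + y) * (1 + x - y))) * indicator {0..x - 1} y"
    proof cases
      case 1
      then have "wt (x - y) * (indicator {0<..} y / (1 + y)) = 0" by (auto simp: wt_def)
      then show ?thesis by (simp only:) simp
    next
      case 2
      then have "wt (x - y) = 1 / (1 + x - y)" by (cases "x - y = 1") (auto simp: wt_def)
      then have "wt (x - y) * (indicator {0<..} y / (1 + y)) = 1 / ((1 + y) * (1 + x - y))" using 2 by simp
      then show ?thesis using 2 by simp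
    next
      case 3
      define z where "z = x - y"
      have z: "0 < z" "z < 1" using 3 by (auto simp: z_def)
      have "1 / (1 + x - z) \<le> (1 - z) / (1 + x) + z / x"
      proof -
        have "1 + x - z > 0" using x z by simp
        moreover have "((1 - z) / (1 + x) + z / x) * (1 + x - z) = 1 + z * (1 - z) / (x * (1 + x))"
          using x by (simp add: divide_simps) (simp add: algebra_simps)
        moreover have "z * (1 - z) / (x * (1 + x)) \<ge> 0" using x z by simp
        ultimately show ?thesis by (simp add: divide_le_eq)
      qed
      then have "1 / (2 * sqrt z) * (1 / (1 + x - z)) \<le> 1 / (2 * sqrt z) * ((1 - z) / (1 + x) + z / x)"
        using z by (intro mult_left_mono) auto
      also have "\<dots> = f1 y + f2 y"
      proof -
        have "pk (1/2) z = 1 / sqrt z" using z by (simp add: pk_def powr_minus_divide powr_half_sqrt)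
        moreover have "pk (3/2) z = z / sqrt z" using z by (simp add: pk_def powr_half_sqrt real_div_sqrt)
        moreover have "pk 1 (1 - z) = 1" using z by (simp add: pk_def)
        moreover have "1 - x + y = 1 - z" "x - y = z" by (auto simp: z_def)
        ultimately have "f1 y + f2 y = 1 / (2 * (1 + x)) * (1 / sqrt z) + c * (z / sqrt z)"
          unfolding f1_def f2_def by (simp only: mult_1_right)
        also have "\<dots> = 1 / (2 * sqrt z) * ((1 - z) / (1 + x) + z / x)"
          using z x by (simp add: c_def divide_simps) (simp add: algebra_simps)
        finally show ?thesis by simp
      qed
      also have "1 / (2 * sqrt z) = wt (x - y)" using z by (simp add: wt_def z_def)
      also have "1 / (1 + x - z) = indicator {0<..} y / (1 + y)" using 3 by (simp add: z_def)
      finally have "ennreal (wt (x - y) * (indicator {0<..} y / (1 + y))) \<le> ennreal (f1 y + f2 y)" by (rule ennreal_leI)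
      also have "\<dots> = ennreal (f1 y) + ennreal (f2 y)" using c x by (simp add: f1_def f2_def)
      finally show ?thesis by (rule order_trans) simp
    qed
  qed
  also have "\<dots> = (\<integral>\<^sup>+y. ennreal (f1 y) \<partial>lborel) + (\<integral>\<^sup>+y. ennreal (f2 y) \<partial>lborel) +
      (\<integral>\<^sup>+y. ennreal (1 / ((1 + y) * (1 + x - y))) * indicator {0..x - 1} y \<partial>lborel)"
    unfolding f1_def f2_def by (subst nn_integral_add; (subst nn_integral_add)?; measurable)
  also have "(\<integral>\<^sup>+y. ennreal (f1 y) \<partial>lborel) = ennreal (1 / (1 + x))"
  proof -
    have "(\<integral>\<^sup>+y. ennreal (f1 y) \<partial>lborel) = ennreal (1 / (2 * (1 + x))) * ennreal (Beta (1/2) 1 * pk (1/2 + 1) 1)"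
      unfolding f1_def using x nn_integral_pk_shift[of "1/2" 1 x 1]
      by (subst nn_integral_cmult_real) auto
    also have "\<dots> = ennreal (1 / (2 * (1 + x)) * (Beta (1/2) 1 * pk (1/2 + 1) 1))"
      using x by (intro ennreal_mult'[symmetric]) simp
    also have "1 / (2 * (1 + x)) * (Beta (1/2) 1 * pk (1/2 + 1) 1) = 1 / (1 + x)"
      using x by (simp add: Beta_half_1 pk_def field_simps)
    finally show ?thesis .
  qed
  also have "(\<integral>\<^sup>+y. ennreal (f2 y) \<partial>lborel) = ennreal (c * (2 / 3))"
  proof -
    have "(\<integral>\<^sup>+y. ennreal (f2 y) \<partial>lborel) = ennreal c * ennreal (Beta (3/2) 1 * pk (3/2 + 1) 1)"
      unfolding f2_def using c nn_integral_pk_shift[of "3/2" 1 x 1]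
      by (subst nn_integral_cmult_real) auto
    also have "\<dots> = ennreal (c * (Beta (3/2) 1 * pk (3/2 + 1) 1))"
      using c by (intro ennreal_mult'[symmetric])
    finally show ?thesis by (simp add: Beta_3half_1 pk_def)
  qed
  also have "(\<integral>\<^sup>+y. ennreal (1 / ((1 + y) * (1 + x - y))) * indicator {0..x - 1} y \<partial>lborel) =
      ennreal ((ln x - ln 2 + ln (1 + x)) / (2 + x))"
    using False by (subst nn_integral_partial_fraction) auto
  also have "ennreal (1 / (1 + x)) + ennreal (c * (2 / 3)) + ennreal ((ln x - ln 2 + ln (1 + x)) / (2 + x)) =
      ennreal (1 / (1 + x) + c * (2 / 3) + (ln x - ln 2 + ln (1 + x)) / (2 + x))"
  proof -
    have "ln x \<ge> 0" "ln 2 \<le> ln (1 + x)" using False by (auto simp: ln_le_cancel_iff)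
    then have "ln x - ln 2 + ln (1 + x) \<ge> 0" by linarith
    then have "(ln x - ln 2 + ln (1 + x)) / (2 + x) \<ge> 0" using x by (intro divide_nonneg_nonneg) auto
    then show ?thesis using c x by (subst ennreal_plus[symmetric], simp, simp)+ simp
  qed
  also have "\<dots> \<le> ennreal (Lam x * wt x)"
  proof (rule ennreal_leI)
    have l: "ln x \<ge> 0" "ln 2 \<le> ln (1 + x)" using False by (auto simp: ln_le_cancel_iff)
    have "ln (1 + x) \<le> ln (2 * x)" using False x by (subst ln_le_cancel_iff) auto
    then have "ln x - ln 2 + ln (1 + x) \<le> 2 * ln x" using x by (simp add: ln_mult)
    then have "(ln x - ln 2 + ln (1 + x)) / (2 + x) \<le> 2 * ln x / (1 + x)"
      using x l by (intro frac_le) auto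
    moreover have "1 / (1 + x) + c * (2 / 3) = (1 + 1 / (3 * x)) / (1 + x)"
      using x by (simp add: c_def divide_simps)
    moreover have "Lam x * wt x = (1 + 1 / (3 * x)) / (1 + x) + 2 * ln x / (1 + x)"
      using False by (simp add: Lam_def wt_def add_divide_distrib)
    ultimately show "1 / (1 + x) + c * (2 / 3) + (ln x - ln 2 + ln (1 + x)) / (2 + x) \<le> Lam x * wt x"
      by linarith
  qed
  finally show ?thesis .
qed

text \<open>Since \<open>wt\<close> is at most half of \<open>pk (1/2)\<close>, the value B(1/2,
  1/2) = \<pi> gives a bound that is uniform in x.\<close>

lemma wt_conv_wt_small: "(\<integral>\<^sup>+y. ennreal (wt y * wt (x - y)) \<partial>lborel) \<le> ennreal (pi / 4)"
proof -
  have "(\<integral>\<^sup>+y. ennreal (wt y * wt (x - y)) \<partial>lborel) \<le>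
      (\<integral>\<^sup>+y. ennreal (1 / 4 * (pk (1 / 2) (x - y) * pk (1 / 2) y)) \<partial>lborel)"
  proof (rule nn_integral_mono)
    fix y
    have "wt y * wt (x - y) \<le> (1 / 2 * pk (1 / 2) y) * (1 / 2 * pk (1 / 2) (x - y))"
      by (intro mult_mono wt_le_pk) auto
    then show "ennreal (wt y * wt (x - y)) \<le> ennreal (1 / 4 * (pk (1 / 2) (x - y) * pk (1 / 2) y))"
      by (intro ennreal_leI) (simp add: mult.commute)
  qed
  also have "\<dots> = ennreal (1 / 4) * ennreal (pi * pk 1 x)"
    using nn_integral_pk_conv[of "1/2" "1/2" x] by (subst nn_integral_cmult_real) (auto simp: Beta_half_half)
  also have "\<dots> = ennreal (1 / 4 * (pi * pk 1 x))" by (rule ennreal_mult'[symmetric]) simp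
  also have "\<dots> \<le> ennreal (pi / 4)"
    by (intro ennreal_leI) (simp add: pk_def)
  finally show ?thesis .
qed

text \<open>Each of the two unit intervals at the ends contributes 1/x: there the far factor is at
  most 1/x, and 1/(2 sqrt y) has integral 1. In between, both factors are resolvents and partial
  fractions apply.\<close>

lemma wt_conv_wt_large:
  assumes x: "x \<ge> 2"
  shows "(\<integral>\<^sup>+y. ennreal (wt y * wt (x - y)) \<partial>lborel) \<le> ennreal ((2 + 2 * ln (x / 2)) / x)"
proof -
  define g where "g y = 1 / (2 * x) * (pk (1 / 2) y * pk 1 (1 - y))" for y
  have g0: "g y \<ge> 0" for y using x by (simp add: g_def)
  have gm [measurable]: "g \<in> borel_measurable borel" unfolding g_def[abs_def] by measurable
  have half: "wt y * wt (x - y) \<le> g y" if y: "0 < y" "y < 1" for y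
  proof -
    have "wt (x - y) \<le> 1 / x"
    proof (cases "x - y = 1")
      case True then show ?thesis using x y by simp
    next
      case False
      then have "wt (x - y) = 1 / (1 + (x - y))" using x y by (simp add: wt_def)
      also have "\<dots> \<le> 1 / x" using x y by (intro divide_left_mono) auto
      finally show ?thesis .
    qed
    then have "wt y * wt (x - y) \<le> (1 / 2 * pk (1 / 2) y) * (1 / x)" by (intro mult_mono wt_le_pk) auto
    also have "\<dots> = g y" using y by (simp add: g_def pk_def)
    finally show ?thesis .
  qed
  have "(\<integral>\<^sup>+y. ennreal (wt y * wt (x - y)) \<partial>lborel) \<le>
      (\<integral>\<^sup>+y. ennreal (g y) + ennreal (g (x - y)) + ennreal (1 / ((1 + y) * (1 + x - y))) * indicator {1..x - 1} y \<partial>lborel)"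
  proof (rule nn_integral_mono)
    fix y
    consider "y \<le> 0 \<or> y \<ge> x" | "0 < y" "y < 1" | "0 < x - y" "x - y < 1" | "1 \<le> y" "y \<le> x - 1" by linarith
    then show "ennreal (wt y * wt (x - y)) \<le>
        ennreal (g y) + ennreal (g (x - y)) + ennreal (1 / ((1 + y) * (1 + x - y))) * indicator {1..x - 1} y"
    proof cases
      case 1
      then have "wt y * wt (x - y) = 0" by (auto simp: wt_def)
      then show ?thesis by (simp only:) simp
    next
      case 2
      then have "ennreal (wt y * wt (x - y)) \<le> ennreal (g y)" by (intro ennreal_leI half)
      then show ?thesis by (rule order_trans) (simp add: add.assoc)
    next
      case 3
      then have "ennreal (wt y * wt (x - y)) \<le> ennreal (g (x - y))"
        using half[of "x - y"] by (intro ennreal_leI) (simp add: mult.commute)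
      then show ?thesis by (rule order_trans) (simp add: add.assoc add.left_commute)
    next
      case 4
      have "wt y = 1 / (1 + y)" using 4 by (cases "y = 1") (auto simp: wt_def)
      moreover have "wt (x - y) = 1 / (1 + x - y)" using 4 by (cases "x - y = 1") (auto simp: wt_def)
      ultimately show ?thesis using 4 by simp
    qed
  qed
  also have "\<dots> = (\<integral>\<^sup>+y. ennreal (g y) \<partial>lborel) + (\<integral>\<^sup>+y. ennreal (g (x - y)) \<partial>lborel) +
      (\<integral>\<^sup>+y. ennreal (1 / ((1 + y) * (1 + x - y))) * indicator {1..x - 1} y \<partial>lborel)"
    by (subst nn_integral_add; (subst nn_integral_add)?; measurable)
  also have "(\<integral>\<^sup>+y. ennreal (g (x - y)) \<partial>lborel) = (\<integral>\<^sup>+y. ennreal (g y) \<partial>lborel)"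
    using nn_integral_real_affine[of "\<lambda>y. ennreal (g y)" "-1" x] by simp
  also have "(\<integral>\<^sup>+y. ennreal (g y) \<partial>lborel) = ennreal (1 / x)"
  proof -
    have "(\<integral>\<^sup>+y. ennreal (g y) \<partial>lborel) = ennreal (1 / (2 * x)) * ennreal (Beta 1 (1/2) * pk (1 + 1/2) 1)"
      unfolding g_def using x nn_integral_pk_conv[of 1 "1/2" 1]
      by (subst nn_integral_cmult_real) (auto simp: mult.commute)
    also have "\<dots> = ennreal (1 / (2 * x) * (Beta 1 (1/2) * pk (1 + 1/2) 1))"
      using x by (intro ennreal_mult'[symmetric]) simp
    finally show ?thesis using x by (simp add: Beta_commute[of 1] Beta_half_1 pk_def)
  qed
  also have "(\<integral>\<^sup>+y. ennreal (1 / ((1 + y) * (1 + x - y))) * indicator {1..x - 1} y \<partial>lborel) =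
      ennreal (2 * ln (x / 2) / (2 + x))"
    using x by (subst nn_integral_partial_fraction) (auto simp: ln_div)
  also have "ennreal (1 / x) + ennreal (1 / x) + ennreal (2 * ln (x / 2) / (2 + x)) =
      ennreal (2 / x + 2 * ln (x / 2) / (2 + x))"
    using x by (simp flip: ennreal_plus)
  also have "\<dots> \<le> ennreal ((2 + 2 * ln (x / 2)) / x)"
  proof (rule ennreal_leI)
    have "2 * ln (x / 2) / (2 + x) \<le> 2 * ln (x / 2) / x" using x by (intro divide_left_mono) auto
    then show "2 / x + 2 * ln (x / 2) / (2 + x) \<le> (2 + 2 * ln (x / 2)) / x" by (simp add: add_divide_distrib)
  qed
  finally show ?thesis .
qed

subsection \<open>The choice of the weight\<close>

text \<open>The tangent of the logarithm at e, evaluated at w = Z^q, reads ln w \<le> w/e.\<close>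

lemma powr_div_ge_ln:
  fixes Z q :: real
  assumes "Z \<ge> 1" "0 < q"
  shows "exp 1 * ln Z \<le> Z powr q / q"
proof -
  define w where "w = Z powr q"
  have "w > 0" using assms by (simp add: w_def)
  then have "ln (w / exp 1) \<le> w / exp 1 - 1" by (intro ln_le_minus_one) auto
  then have "ln w \<le> w / exp 1" using \<open>w > 0\<close> by (simp add: ln_div)
  moreover have "ln w = q * ln Z" using assms by (simp add: w_def ln_powr)
  ultimately show ?thesis using assms by (simp add: w_def[symmetric] field_simps)
qed

text \<open>Equality holds at q = 1/2. For smaller q the claim is 2q \<le> Z^(q-1/2), which follows
  from exp u \<ge> 1 + u, because ln Z \<le> 2 bounds (1/2 - q) ln Z by 1 - 2q.\<close>

lemma powr_div_ge_sqrt: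
  fixes Z q :: real
  assumes "Z \<ge> 1" "ln Z \<le> 2" "0 < q" "q \<le> 1 / 2"
  shows "2 * sqrt Z \<le> Z powr q / q"
proof -
  have "(1/2 - q) * ln Z \<le> (1/2 - q) * 2" using assms by (intro mult_left_mono) auto
  then have "2 * q \<le> 1 + (q - 1/2) * ln Z" by (simp add: algebra_simps)
  also have "\<dots> \<le> exp ((q - 1/2) * ln Z)" by (rule exp_ge_add_one_self)
  also have "\<dots> = Z powr (q - 1/2)" using assms by (simp add: powr_def)
  also have "\<dots> = Z powr q / sqrt Z" using assms by (simp add: powr_diff powr_half_sqrt)
  finally show ?thesis using assms by (simp add: field_simps)
qed

text \<open>In exponential form, p^p q^q e^p \<le> 1. For ln Z \<le> 2 this gives the first
  alternative of \<open>weight_cases\<close>. If p \<le> 1/3, already p (ln p + 1) \<le> 0 because e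
  < 3.\<close>

lemma entropy_bound:
  fixes p q :: real
  assumes "0 < p" "p \<le> 1/2" "q = 1 - p"
  shows "p * ln p + q * ln q + p \<le> 0"
proof (cases "p \<le> 1/3")
  case True
  have "exp 1 \<le> (3::real)" using e_less_272 by simp
  then have "(1::real) \<le> ln 3" by (metis exp_le_cancel_iff exp_ln zero_less_numeral)
  moreover have "ln p \<le> ln (1/3)" using True assms by (subst ln_le_cancel_iff) auto
  ultimately have "ln p \<le> -1" by (simp add: ln_div)
  then have "p * (ln p + 1) \<le> 0" using assms by (intro mult_nonneg_nonpos) auto
  moreover have "q * ln q \<le> 0" using assms by (intro mult_nonneg_nonpos) auto
  ultimately show ?thesis by (simp add: algebra_simps)
next
  case False
  \<comment> \<open>The tangent of the logarithm at 1/2, which is accurate enough here since p and q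
    both lie between 1/3 and 2/3.\<close>
  have t: "ln x \<le> 2 * x - 1 - ln 2" if "x > 0" for x :: real
    using ln_le_minus_one[of "2 * x"] that by (simp add: ln_mult)
  have "p * ln p \<le> p * (2 * p - 1 - ln 2)" "q * ln q \<le> q * (2 * q - 1 - ln 2)"
    using assms t[of p] t[of q] by (auto intro!: mult_left_mono)
  then have "p * ln p + q * ln q + p \<le> 4 * p\<^sup>2 - 3 * p + 1 - ln 2"
    unfolding assms(3) by (simp add: algebra_simps power2_eq_square)
  also have "\<dots> \<le> 4 * p\<^sup>2 - 3 * p + 1 / 3" using ln2_ge_two_thirds by simp
  also have "\<dots> = 4 * ((p - 1/3) * (p - 1/2)) + (p - 1) / 3"
    by (simp add: field_simps power2_eq_square)
  also have "(p - 1/3) * (p - 1/2) \<le> 0"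
    using False assms by (intro mult_nonneg_nonpos) auto
  finally show ?thesis using assms by simp
qed

lemma exp_1_ge: "(8/3 :: real) \<le> exp 1"
proof -
  have "(1 + 1/4 + (1/4)\<^sup>2 / 2 :: real) \<le> exp (1/4)" by (rule exp_lower_Taylor_quadratic) simp
  then have "(41/32 :: real) ^ 4 \<le> exp (1/4) ^ 4" by (intro power_mono) (auto simp: power2_eq_square)
  also have "exp (1/4 :: real) ^ 4 = exp 1" by (simp flip: exp_of_nat_mult)
  finally show ?thesis by (simp add: power4_eq_xxxx)
qed

lemma Lam_le_sqrt:
  assumes x: "x > 0"
  shows "Lam x \<le> 2 * sqrt x"
proof -
  define w where "w = sqrt x"
  have w: "w > 0" "x = w\<^sup>2" using x by (auto simp: w_def)
  consider "x \<le> 1" | "1 < x" "x \<le> 3/2" | "3/2 \<le> x" by linarith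
  then show ?thesis
  proof cases
    case 1
    then have "w \<le> 1" using w_def by simp
    then have "w * w \<le> w * 1" using w by (intro mult_left_mono) auto
    then show ?thesis using 1 w by (simp add: Lam_def w_def[symmetric] power2_eq_square)
  next
    case 2
    have w1: "1 < w" using 2(1) by (simp add: w_def)
    have "w \<le> 5/4"
    proof (rule power2_le_imp_le)
      show "w\<^sup>2 \<le> (5/4)\<^sup>2" using 2(2) w by (simp add: power2_eq_square)
    qed simp
    \<comment> \<open>Convexity: on [1, 5/4] the square of w lies below its chord 9/4 w -
      5/4.\<close>
    then have "(w - 1) * (w - 5/4) \<le> 0" using w1 by (intro mult_nonneg_nonpos) auto
    moreover have "(w - 1) * (w - 5/4) = w * w - 9/4 * w + 5/4" by (simp add: field_simps)
    ultimately have "w * w \<le> 9/4 * w - 5/4" by linarith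
    moreover have "9/4 * w - 5/4 \<le> w + 1/3" using \<open>w \<le> 5/4\<close> by simp
    ultimately have "x \<le> w + 1/3" using w(2) unfolding power2_eq_square by linarith
    moreover have "ln x \<le> x - 1" using x by (rule ln_le_minus_one)
    moreover have "1 / (3 * x) \<le> 1/3" using 2 by (simp add: field_simps)
    ultimately have "1 + 1 / (3 * x) + 2 * ln x \<le> 2 * w" by linarith
    then show ?thesis using 2 by (simp add: Lam_def w_def)
  next
    case 3
    have "ln x = 2 * ln w" using w by (simp add: ln_realpow)
    \<comment> \<open>The tangent of the logarithm at 2. With ln 2 \<le> 25/36 and 1/(3x) \<le> 2/9
      the constants cancel exactly, as 1 + 2/9 = 4 (1 - 25/36); this explains the threshold x =
      3/2.\<close>
    moreover have "ln w \<le> w / 2 - 1 + ln 2" using ln_le_minus_one[of "w / 2"] w by (simp add: ln_div)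
    moreover have "1 / (3 * x) \<le> 2/9" using 3 by (simp add: field_simps)
    ultimately have "1 + 1 / (3 * x) + 2 * ln x \<le> 2 * w" using ln2_le_25_over_36 by linarith
    then show ?thesis using 3 by (simp add: Lam_def w_def)
  qed
qed

text \<open>For x > 1 the nonlogarithmic part of \<open>Lam\<close> is at most 4/3, which is at most
  2/3 ln Z since ln Z \<ge> 2. Added to 2 ln Z this makes 8/3 ln Z, and 8/3 \<le> e.\<close>

lemma Lam_le_ln:
  assumes "0 < x" "x \<le> Z" "2 \<le> ln Z"
  shows "Lam x \<le> exp 1 * ln Z"
proof -
  have "8/3 * ln Z \<le> exp 1 * ln Z"
    using assms(3) by (intro mult_right_mono exp_1_ge) linarith
  moreover have "Lam x \<le> 8/3 * ln Z"
  proof (cases "x \<le> 1")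
    case False
    have "ln x \<le> ln Z" using assms by (subst ln_le_cancel_iff) auto
    moreover have "1 / (3 * x) \<le> 1/3" using False by (simp add: field_simps)
    moreover have "Lam x = 1 + 1 / (3 * x) + 2 * ln x" using False by (simp add: Lam_def)
    ultimately show ?thesis using assms(3) by linarith
  qed (use assms in \<open>simp add: Lam_def\<close>)
  ultimately show ?thesis by linarith
qed

text \<open>The two regimes used for \<open>\<kappa> = 0\<close>: in the first the power weight \<open>t\<^bsup>-\<alpha>q\<^esup>\<close> is good enough, in the second
  the weight \<open>wt\<close> has to be used.\<close>

lemma weight_cases:
  fixes Z p q :: real
  assumes Z: "Z > 0" and pq: "0 < p" "0 < q" "p + q = 1"
  shows "(p powr p * q powr q)\<^sup>2 * Z powr p \<le> 1 \<or>
    ((\<forall>x. 0 < x \<longrightarrow> x \<le> Z \<longrightarrow> Lam x \<le> Z powr q / q) \<and>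
     (\<exists>P\<ge>0. (\<integral>\<^sup>+y. ennreal (wt y * wt (Z - y)) \<partial>lborel) \<le> ennreal P \<and> Z * P \<le> Z powr q / q))"
proof -
  have pq1: "p \<le> 1" "q \<le> 1" using pq by auto
  \<comment> \<open>The value ln Z = 2 separates the two lower bounds for Z^q/q: the square root is
    used below it, the logarithm above it. For ln Z \<le> 2 one of p and q is at most 1/2, and p
    \<le> 1/2 leads to the power weight.\<close>
  consider "Z \<le> 1" | "Z \<ge> 1" "ln Z \<le> 2" "p \<le> 1/2" | "Z \<ge> 1" "ln Z \<le> 2" "q \<le> 1/2" | "Z \<ge> 1" "2 \<le> ln Z"
    using pq by linarith
  then show ?thesis
  proof cases
    case 1
    have "p powr p \<le> 1" "q powr q \<le> 1" using pq by (auto intro!: powr_le1)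
    then have "(p powr p * q powr q)\<^sup>2 * Z powr p \<le> 1\<^sup>2 * 1"
      using 1 Z pq by (intro mult_mono power_mono mult_le_one powr_le1) auto
    then show ?thesis by simp
  next
    case 2
    define a where "a = p * ln p + q * ln q"
    have "p * ln Z \<le> p * 2" using 2 pq by (intro mult_left_mono) auto
    moreover have "a + p \<le> 0" unfolding a_def by (rule entropy_bound) (use 2 pq in auto)
    ultimately have "2 * a + p * ln Z \<le> 0" by simp
    then have "2 * (p * ln p + q * ln q) + p * ln Z \<le> 0" by (simp only: a_def)
    moreover have "(p powr p * q powr q)\<^sup>2 * Z powr p = exp (2 * (p * ln p + q * ln q) + p * ln Z)"
      using pq Z by (simp add: powr_def exp_add exp_double distrib_left power_mult_distrib)
    ultimately show ?thesis by simp
  next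
    case 3
    note ge = powr_div_ge_sqrt[OF 3(1,2) pq(2) 3(3)]
    have "Lam x \<le> Z powr q / q" if "0 < x" "x \<le> Z" for x
    proof -
      have "Lam x \<le> 2 * sqrt x" by (rule Lam_le_sqrt[OF that(1)])
      also have "\<dots> \<le> 2 * sqrt Z" using that by simp
      finally show ?thesis using ge by linarith
    qed
    moreover have "\<exists>P\<ge>0. (\<integral>\<^sup>+y. ennreal (wt y * wt (Z - y)) \<partial>lborel) \<le> ennreal P \<and> Z * P \<le> Z powr q / q"
    proof (cases "Z \<le> 4")
      case True
      then have "sqrt Z \<le> sqrt 4" by (subst real_sqrt_le_iff)
      then have "sqrt Z * sqrt Z \<le> 2 * sqrt Z" using Z by (intro mult_right_mono) auto
      then have "Z \<le> 2 * sqrt Z" using Z by simp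
      moreover have "Z * (pi / 4) \<le> Z * 1" using Z pi_less_4 by (intro mult_left_mono) auto
      ultimately have "Z * (pi / 4) \<le> Z powr q / q" using ge by linarith
      then show ?thesis using wt_conv_wt_small[of Z] by (intro exI[of _ "pi/4"] conjI) auto
    next
      case False
      have "ln (sqrt Z) \<le> sqrt Z / 2 - 1 + ln 2" using ln_le_minus_one[of "sqrt Z / 2"] Z by (simp add: ln_div)
      then have "ln Z \<le> sqrt Z - 2 + 2 * ln 2" using Z by (simp add: ln_sqrt)
      then have "2 + 2 * ln (Z / 2) \<le> 2 * sqrt Z" using Z ln2_le_25_over_36 by (simp add: ln_div)
      then have "2 + 2 * ln (Z / 2) \<le> Z powr q / q" using ge by linarith
      then show ?thesis using wt_conv_wt_large[of Z] False by (intro exI[of _ "(2 + 2 * ln (Z / 2)) / Z"]) auto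
    qed
    ultimately show ?thesis by blast
  next
    case 4
    note ge = powr_div_ge_ln[OF 4(1) pq(2)]
    have Z2: "Z \<ge> 2"
    proof (rule ccontr)
      assume "\<not> Z \<ge> 2"
      then have "ln Z \<le> ln 2" using Z by (subst ln_le_cancel_iff) auto
      then show False using 4(2) ln2_le_25_over_36 by linarith
    qed
    have "Lam x \<le> Z powr q / q" if "0 < x" "x \<le> Z" for x
      using Lam_le_ln[OF that 4(2)] ge by linarith
    moreover have "\<exists>P\<ge>0. (\<integral>\<^sup>+y. ennreal (wt y * wt (Z - y)) \<partial>lborel) \<le> ennreal P \<and> Z * P \<le> Z powr q / q"
    proof -
      have "8/3 * ln Z \<le> exp 1 * ln Z"
        using 4(2) by (intro mult_right_mono exp_1_ge) linarith
      moreover have "2 + 2 * ln (Z / 2) \<le> 8/3 * ln Z" using 4 Z ln2_ge_two_thirds by (simp add: ln_div)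
      ultimately have "2 + 2 * ln (Z / 2) \<le> Z powr q / q" using ge by linarith
      then show ?thesis using wt_conv_wt_large[OF Z2] Z2 by (intro exI[of _ "(2 + 2 * ln (Z / 2)) / Z"]) auto
    qed
    ultimately show ?thesis by blast
  qed
qed

subsection \<open>Convolution with the weight in the time variable\<close>

text \<open>The derivative of s -> \<mu> s^\<alpha> may be unbounded at 0. The substitution is
  therefore carried out on the intervals [1/(n+1), n+1], which exhaust the half-line.\<close>

lemma nn_integral_subst_powr:
  assumes \<alpha>: "\<alpha> > 0" and \<mu>: "\<mu> > 0" and h [measurable]: "h \<in> borel_measurable borel"
  shows "(\<integral>\<^sup>+s. ennreal (h (\<mu> * s powr \<alpha>) * (\<alpha> * \<mu> * pk \<alpha> s)) \<partial>lborel) =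
    (\<integral>\<^sup>+y. ennreal (h y * indicator {0<..} y) \<partial>lborel)"
proof -
  define g where "g s = \<mu> * s powr \<alpha>" for s
  define A where "A n = {1 / real (Suc n)..real (Suc n)}" for n
  define B where "B n = {g (1 / real (Suc n))..g (real (Suc n))}" for n
  have step: "(\<integral>\<^sup>+y. ennreal (h y) * indicator (B n) y \<partial>lborel) =
      (\<integral>\<^sup>+s. ennreal (h (g s) * (\<alpha> * \<mu> * pk \<alpha> s)) * indicator (A n) s \<partial>lborel)" for n
  proof -
    have "(\<integral>\<^sup>+y. ennreal (h y * indicator (B n) y) \<partial>lborel) =
        (\<integral>\<^sup>+s. ennreal (h (g s) * (\<alpha> * \<mu> * s powr (\<alpha> - 1)) * indicator (A n) s) \<partial>lborel)"
      unfolding A_def B_def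
    proof (rule nn_integral_substitution)
      show "set_borel_measurable borel {g (1 / real (Suc n))..g (real (Suc n))} h"
        unfolding set_borel_measurable_def by measurable
      fix x assume x: "x \<in> {1 / real (Suc n)..real (Suc n)}"
      then have "x > 0" by (auto intro: less_le_trans[rotated])
      then show "(g has_real_derivative \<alpha> * \<mu> * x powr (\<alpha> - 1)) (at x)"
        unfolding g_def by (auto intro!: derivative_eq_intros)
      show "0 \<le> \<alpha> * \<mu> * x powr (\<alpha> - 1)" using \<alpha> \<mu> by simp
    next
      have "(1::real) / real (Suc n) > 0" by simp
      then show "continuous_on {1 / real (Suc n)..real (Suc n)} (\<lambda>x. \<alpha> * \<mu> * x powr (\<alpha> - 1))"
        by (intro continuous_intros) auto
      show "1 / real (Suc n) \<le> real (Suc n)" by (simp add: field_simps)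
    qed
    also have "\<dots> = (\<integral>\<^sup>+s. ennreal (h (g s) * (\<alpha> * \<mu> * pk \<alpha> s)) * indicator (A n) s \<partial>lborel)"
    proof (rule nn_integral_cong)
      fix s
      have "s > 0" if "s \<in> A n"
        using that unfolding A_def by (auto intro: less_le_trans[rotated])
      then show "ennreal (h (g s) * (\<alpha> * \<mu> * s powr (\<alpha> - 1)) * indicator (A n) s) =
          ennreal (h (g s) * (\<alpha> * \<mu> * pk \<alpha> s)) * indicator (A n) s"
        by (auto simp: indicator_def pk_def)
    qed
    finally have "(\<integral>\<^sup>+y. ennreal (h y * indicator (B n) y) \<partial>lborel) =
      (\<integral>\<^sup>+s. ennreal (h (g s) * (\<alpha> * \<mu> * pk \<alpha> s)) * indicator (A n) s \<partial>lborel)" .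
    moreover have "ennreal (h y * indicator (B n) y) = ennreal (h y) * indicator (B n) y" for y
      by (simp add: indicator_def)
    ultimately show ?thesis by (simp only:)
  qed
  have mono_recip: "1 / real (Suc n) \<le> 1 / real (Suc m)" if "m \<le> n" for m n
    using that by (intro divide_left_mono) auto
  have incA: "incseq A"
    unfolding incseq_def A_def atLeastatMost_subset_iff using mono_recip by auto
  have g_mono: "g x \<le> g y" if "0 \<le> x" "x \<le> y" for x y
    unfolding g_def using that \<alpha> \<mu> by (intro mult_left_mono powr_mono2) auto
  have incB: "incseq B"
    unfolding incseq_def B_def atLeastatMost_subset_iff
  proof (intro allI impI disjI2 conjI)
    fix m n :: nat assume "m \<le> n"
    then show "g (1 / real (Suc n)) \<le> g (1 / real (Suc m))" by (intro g_mono mono_recip) auto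
    show "g (real (Suc m)) \<le> g (real (Suc n))" using \<open>m \<le> n\<close> by (intro g_mono) auto
  qed
  have UA: "(\<Union>n. A n) = {0<..}"
  proof (intro equalityI subsetI)
    fix s :: real assume "s \<in> {0<..}"
    then have "s > 0" by simp
    obtain n where n: "max s (1 / s) \<le> real n" using real_arch_simple by blast
    then have "s \<le> real (Suc n)" "1 / s \<le> real (Suc n)" by auto
    then have "s \<in> A n" using \<open>s > 0\<close> by (simp add: A_def field_simps del: of_nat_Suc)
    then show "s \<in> (\<Union>n. A n)" by blast
  qed (auto simp: A_def intro: less_le_trans[rotated])
  have UB: "(\<Union>n. B n) = {0<..}"
  proof (intro equalityI subsetI)
    fix y :: real assume "y \<in> {0<..}"
    then have y: "y > 0" by simp
    define s where "s = (y / \<mu>) powr (1 / \<alpha>)"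
    have s: "s > 0" "g s = y" using y \<alpha> \<mu> by (auto simp: s_def g_def powr_powr)
    then have "s \<in> (\<Union>n. A n)" by (simp add: UA)
    then obtain n where n: "1 / real (Suc n) \<le> s" "s \<le> real (Suc n)" by (auto simp: A_def)
    have "y \<in> B n" unfolding B_def s(2)[symmetric] using n s(1) by (auto intro!: g_mono simp del: of_nat_Suc)
    then show "y \<in> (\<Union>n. B n)" by blast
  next
    fix y assume "y \<in> (\<Union>n. B n)"
    then obtain n where "g (1 / real (Suc n)) \<le> y" by (auto simp: B_def)
    moreover have "g (1 / real (Suc n)) > 0" using \<mu> by (simp add: g_def)
    ultimately show "y \<in> {0<..}" by simp
  qed
  have sup: "(SUP n. \<integral>\<^sup>+x. F x * indicator (C n) x \<partial>lborel) = (\<integral>\<^sup>+x. F x * indicator (\<Union>n. C n) x \<partial>lborel)"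
    if [measurable]: "F \<in> borel_measurable borel" "\<And>n. C n \<in> sets borel" and "incseq C" for F :: "real \<Rightarrow> ennreal" and C
  proof -
    have "(SUP n. emeasure (density lborel F) (C n)) = emeasure (density lborel F) (\<Union>n. C n)"
      using that by (intro SUP_emeasure_incseq) auto
    then show ?thesis using that by (simp add: emeasure_density)
  qed
  have mA: "A n \<in> sets borel" "B n \<in> sets borel" for n by (auto simp: A_def B_def)
  have gm [measurable]: "g \<in> borel_measurable borel" unfolding g_def[abs_def] by measurable
  have "(\<integral>\<^sup>+s. ennreal (h (g s) * (\<alpha> * \<mu> * pk \<alpha> s)) \<partial>lborel) =
      (\<integral>\<^sup>+s. ennreal (h (g s) * (\<alpha> * \<mu> * pk \<alpha> s)) * indicator (\<Union>n. A n) s \<partial>lborel)"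
    unfolding UA by (rule nn_integral_cong) (auto simp: indicator_def pk_def)
  also have "\<dots> = (\<integral>\<^sup>+y. ennreal (h y) * indicator (\<Union>n. B n) y \<partial>lborel)"
    using sup[of "\<lambda>s. ennreal (h (g s) * (\<alpha> * \<mu> * pk \<alpha> s))" A] sup[of "\<lambda>y. ennreal (h y)" B] incA incB mA step
    by simp
  also have "\<dots> = (\<integral>\<^sup>+y. ennreal (h y * indicator {0<..} y) \<partial>lborel)"
    unfolding UB by (rule nn_integral_cong) (auto simp: indicator_def)
  finally show ?thesis by (simp add: g_def)
qed

lemma powr_subadd:
  fixes a b \<alpha> :: real
  assumes "0 < a" "0 < b" "0 < \<alpha>" "\<alpha> \<le> 1"
  shows "(a + b) powr \<alpha> \<le> a powr \<alpha> + b powr \<alpha>"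
proof -
  have "(a + b) powr \<alpha> = (a + b) * (a + b) powr (\<alpha> - 1)" using assms by (simp add: powr_mult_base)
  also have "\<dots> = a * (a + b) powr (\<alpha> - 1) + b * (a + b) powr (\<alpha> - 1)" by (simp add: distrib_right)
  also have "\<dots> \<le> a * a powr (\<alpha> - 1) + b * b powr (\<alpha> - 1)"
    using assms by (intro add_mono mult_left_mono powr_mono2') auto
  also have "\<dots> = a powr \<alpha> + b powr \<alpha>" using assms by (simp add: powr_mult_base)
  finally show ?thesis .
qed

definition rho2 :: "real \<Rightarrow> real \<Rightarrow> real \<Rightarrow> real" where
  "rho2 \<alpha> \<mu> \<tau> = (if \<tau> > 0 then wt (\<mu> * \<tau> powr \<alpha>) else 0)"

lemma rho2_nonneg [simp]: "rho2 \<alpha> \<mu> \<tau> \<ge> 0"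
  by (simp add: rho2_def)

lemma measurable_rho2 [measurable]: "rho2 \<alpha> \<mu> \<in> borel_measurable borel"
  unfolding rho2_def[abs_def] by measurable

text \<open>Subadditivity of the power gives \<mu> (t-s)^\<alpha> \<ge> \<mu> t^\<alpha> - \<mu>
  s^\<alpha>, and \<open>wt\<close> decreases. A convolution in time is thus dominated by one in the
  variable y = \<mu> s^\<alpha>, for which dy = \<alpha> \<mu> s^(\<alpha>-1) ds.\<close>

lemma rho2_shift:
  assumes "0 < \<alpha>" "\<alpha> \<le> 1" "0 < \<mu>" "0 < s"
  shows "rho2 \<alpha> \<mu> (t - s) \<le> wt (\<mu> * t powr \<alpha> - \<mu> * s powr \<alpha>)"
proof (cases "s < t")
  case True
  have "t powr \<alpha> \<le> (t - s) powr \<alpha> + s powr \<alpha>"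
    using powr_subadd[of "t - s" s \<alpha>] True assms by simp
  then have "\<mu> * t powr \<alpha> \<le> \<mu> * ((t - s) powr \<alpha> + s powr \<alpha>)" using assms by (intro mult_left_mono) auto
  then have "\<mu> * t powr \<alpha> - \<mu> * s powr \<alpha> \<le> \<mu> * (t - s) powr \<alpha>" by (simp add: algebra_simps)
  moreover have "s powr \<alpha> < t powr \<alpha>" using True assms by (intro powr_less_mono2) auto
  then have "\<mu> * t powr \<alpha> - \<mu> * s powr \<alpha> > 0" using assms by simp
  ultimately show ?thesis using True by (simp add: rho2_def wt_antimono)
qed (simp add: rho2_def)

lemma nn_integral_reflect:
  fixes f :: "real \<Rightarrow> ennreal"
  assumes "f \<in> borel_measurable borel"
  shows "(\<integral>\<^sup>+\<tau>. f (t - \<tau>) \<partial>lborel) = (\<integral>\<^sup>+s. f s \<partial>lborel)"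
  using nn_integral_real_affine[OF assms, of "-1" t] by simp

lemma rho2_resolvent:
  assumes \<alpha>: "0 < \<alpha>" "\<alpha> \<le> 1" and \<mu>: "0 < \<mu>" and t: "0 < t"
  shows "(\<integral>\<^sup>+\<tau>. ennreal (pk \<alpha> (t - \<tau>) / (1 + \<mu> * (t - \<tau>) powr \<alpha>) * rho2 \<alpha> \<mu> \<tau>) \<partial>lborel) \<le>
    ennreal (Lam (\<mu> * t powr \<alpha>) / (\<alpha> * \<mu>) * rho2 \<alpha> \<mu> t)"
proof -
  define x where "x = \<mu> * t powr \<alpha>"
  have x: "x > 0" using \<mu> t by (simp add: x_def)
  define h where "h y = wt (x - y) * (indicator {0<..} y / (1 + y)) / (\<alpha> * \<mu>)" for y
  have hm [measurable]: "h \<in> borel_measurable borel" unfolding h_def[abs_def] by measurable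
  have "(\<integral>\<^sup>+\<tau>. ennreal (pk \<alpha> (t - \<tau>) / (1 + \<mu> * (t - \<tau>) powr \<alpha>) * rho2 \<alpha> \<mu> \<tau>) \<partial>lborel) =
      (\<integral>\<^sup>+s. ennreal (pk \<alpha> s / (1 + \<mu> * s powr \<alpha>) * rho2 \<alpha> \<mu> (t - s)) \<partial>lborel)"
    using nn_integral_reflect[of "\<lambda>s. ennreal (pk \<alpha> s / (1 + \<mu> * s powr \<alpha>) * rho2 \<alpha> \<mu> (t - s))" t] by simp
  also have "\<dots> \<le> (\<integral>\<^sup>+s. ennreal (h (\<mu> * s powr \<alpha>) * (\<alpha> * \<mu> * pk \<alpha> s)) \<partial>lborel)"
  proof (rule nn_integral_mono)
    fix s
    show "ennreal (pk \<alpha> s / (1 + \<mu> * s powr \<alpha>) * rho2 \<alpha> \<mu> (t - s)) \<le> ennreal (h (\<mu> * s powr \<alpha>) * (\<alpha> * \<mu> * pk \<alpha> s))"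
    proof (cases "s > 0")
      case True
      have "pk \<alpha> s / (1 + \<mu> * s powr \<alpha>) * rho2 \<alpha> \<mu> (t - s) \<le> pk \<alpha> s / (1 + \<mu> * s powr \<alpha>) * wt (x - \<mu> * s powr \<alpha>)"
        unfolding x_def using True \<alpha> \<mu> by (intro mult_left_mono rho2_shift) (auto simp: add_nonneg_nonneg)
      also have "\<dots> = h (\<mu> * s powr \<alpha>) * (\<alpha> * \<mu> * pk \<alpha> s)"
        using True \<alpha> \<mu> by (simp add: h_def)
      finally show ?thesis by (rule ennreal_leI)
    qed (simp add: pk_def)
  qed
  also have "\<dots> = (\<integral>\<^sup>+y. ennreal (h y * indicator {0<..} y) \<partial>lborel)"
    by (rule nn_integral_subst_powr[OF \<alpha>(1) \<mu> hm])
  also have "\<dots> = (\<integral>\<^sup>+y. ennreal (1 / (\<alpha> * \<mu>) * (wt (x - y) * (indicator {0<..} y / (1 + y)))) \<partial>lborel)"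
    by (intro nn_integral_cong) (auto simp: h_def indicator_def mult_ac)
  also have "\<dots> = ennreal (1 / (\<alpha> * \<mu>)) * (\<integral>\<^sup>+y. ennreal (wt (x - y) * (indicator {0<..} y / (1 + y))) \<partial>lborel)"
    using \<alpha> \<mu> by (intro nn_integral_cmult_real) auto
  also have "\<dots> \<le> ennreal (1 / (\<alpha> * \<mu>)) * ennreal (Lam x * wt x)"
    by (intro mult_left_mono wt_conv_resolvent[OF x]) auto
  also have "\<dots> = ennreal (Lam (\<mu> * t powr \<alpha>) / (\<alpha> * \<mu>) * rho2 \<alpha> \<mu> t)"
    using \<alpha> \<mu> t by (subst ennreal_mult'[symmetric]) (auto simp: rho2_def x_def)
  finally show ?thesis .
qed

lemma rho2_conv:
  assumes \<alpha>: "0 < \<alpha>" "\<alpha> \<le> 1" and \<mu>: "0 < \<mu>"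
  shows "(\<integral>\<^sup>+\<tau>. ennreal (\<alpha> * \<mu> * pk \<alpha> (T - \<tau>) * rho2 \<alpha> \<mu> (T - \<tau>) * rho2 \<alpha> \<mu> \<tau>) \<partial>lborel) \<le>
    (\<integral>\<^sup>+y. ennreal (wt y * wt (\<mu> * T powr \<alpha> - y)) \<partial>lborel)"
proof -
  define x where "x = \<mu> * T powr \<alpha>"
  define h where "h y = wt y * wt (x - y)" for y
  have hm [measurable]: "h \<in> borel_measurable borel" unfolding h_def[abs_def] by measurable
  have "(\<integral>\<^sup>+\<tau>. ennreal (\<alpha> * \<mu> * pk \<alpha> (T - \<tau>) * rho2 \<alpha> \<mu> (T - \<tau>) * rho2 \<alpha> \<mu> \<tau>) \<partial>lborel) =
      (\<integral>\<^sup>+s. ennreal (\<alpha> * \<mu> * pk \<alpha> s * rho2 \<alpha> \<mu> s * rho2 \<alpha> \<mu> (T - s)) \<partial>lborel)"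
    using nn_integral_reflect[of "\<lambda>s. ennreal (\<alpha> * \<mu> * pk \<alpha> s * rho2 \<alpha> \<mu> s * rho2 \<alpha> \<mu> (T - s))" T] by simp
  also have "\<dots> \<le> (\<integral>\<^sup>+s. ennreal (h (\<mu> * s powr \<alpha>) * (\<alpha> * \<mu> * pk \<alpha> s)) \<partial>lborel)"
  proof (rule nn_integral_mono)
    fix s
    show "ennreal (\<alpha> * \<mu> * pk \<alpha> s * rho2 \<alpha> \<mu> s * rho2 \<alpha> \<mu> (T - s)) \<le> ennreal (h (\<mu> * s powr \<alpha>) * (\<alpha> * \<mu> * pk \<alpha> s))"
    proof (cases "s > 0")
      case True
      have "\<alpha> * \<mu> * pk \<alpha> s * rho2 \<alpha> \<mu> s * rho2 \<alpha> \<mu> (T - s) \<le> \<alpha> * \<mu> * pk \<alpha> s * rho2 \<alpha> \<mu> s * wt (x - \<mu> * s powr \<alpha>)"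
        unfolding x_def using True \<alpha> \<mu> by (intro mult_left_mono rho2_shift) auto
      also have "\<dots> = h (\<mu> * s powr \<alpha>) * (\<alpha> * \<mu> * pk \<alpha> s)"
        using True by (simp add: h_def rho2_def)
      finally show ?thesis by (rule ennreal_leI)
    qed (simp add: pk_def)
  qed
  also have "\<dots> = (\<integral>\<^sup>+y. ennreal (h y * indicator {0<..} y) \<partial>lborel)"
    by (rule nn_integral_subst_powr[OF \<alpha>(1) \<mu> hm])
  also have "\<dots> \<le> (\<integral>\<^sup>+y. ennreal (h y) \<partial>lborel)"
    by (rule nn_integral_mono) (auto simp: indicator_def h_def)
  finally show ?thesis by (simp add: h_def x_def)
qed

text \<open>The weighted inequality between arithmetic and geometric means for 1/p and v/q. The
  constant is the exact maximum, attained at v = q/p.\<close>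

lemma powr_over_1_plus_le:
  assumes "0 < p" "0 < q" "p + q = 1" "v > (0::real)"
  shows "v powr q / (1 + v) \<le> p powr p * q powr q"
proof -
  have "(1 / p) powr p * (v / q) powr q \<le> p * (1 / p) + q * (v / q)"
    using assms by (intro Youngs_inequality_0) auto
  then have "v powr q / (p powr p * q powr q) \<le> 1 + v"
    using assms by (simp add: powr_divide)
  then show ?thesis using assms by (simp add: divide_le_eq add_pos_pos mult.commute)
qed

section \<open>Convolution with a family of diagonal operators\<close>

text \<open>The bound holds for every \<tau> and not just almost everywhere, and the support lies in
  (0,T); integrals over the line then need no restriction. The exponent convention is that of
  \<open>pk\<close>.\<close>

definition adm :: "real \<Rightarrow> real \<Rightarrow> real \<Rightarrow> (real \<Rightarrow> ell2) \<Rightarrow> bool" where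
  "adm T c C h \<longleftrightarrow> h \<in> borel_measurable borel \<and> (\<forall>\<tau>. \<tau> \<notin> {0<..<T} \<longrightarrow> h \<tau> = 0) \<and> (\<forall>\<tau>. norm (h \<tau>) \<le> C * pk c \<tau>)"

definition VC :: "(nat \<Rightarrow> real \<Rightarrow> real) \<Rightarrow> (real \<Rightarrow> ell2) \<Rightarrow> real \<Rightarrow> ell2" where
  "VC m h t = (\<integral>\<tau>. diag (\<lambda>j. m j (t - \<tau>)) (h \<tau>) \<partial>lborel)"

lemma admI:
  assumes "continuous_on {0<..<T} f" "\<And>\<tau>. \<tau> \<in> {0<..<T} \<Longrightarrow> norm (f \<tau>) \<le> C * \<tau> powr (c - 1)" "C \<ge> 0"
  shows "adm T c C (\<lambda>\<tau>. indicator {0<..<T} \<tau> *\<^sub>R f \<tau>)"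
  unfolding adm_def
proof (intro conjI allI)
  show "(\<lambda>\<tau>. indicator {0<..<T} \<tau> *\<^sub>R f \<tau>) \<in> borel_measurable borel"
    by (rule borel_measurable_continuous_on_indicator) (use assms in auto)
  show "norm (indicator {0<..<T} \<tau> *\<^sub>R f \<tau>) \<le> C * pk c \<tau>" for \<tau>
    using assms(2)[of \<tau>] assms(3) by (auto simp: indicator_def pk_def)
qed (auto simp: indicator_def)

lemma adm_diff:
  assumes "adm T c C h" "adm T c D k"
  shows "adm T c (C + D) (\<lambda>\<tau>. h \<tau> - k \<tau>)"
  using assms unfolding adm_def distrib_right
  by (auto intro!: borel_measurable_diff intro: order_trans[OF norm_triangle_ineq4 add_mono])

lemma adm_nonneg:
  assumes "adm T c C h"
  shows "C \<ge> 0"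
proof -
  have "norm (h 1) \<le> C * pk c 1" using assms by (simp add: adm_def)
  then show ?thesis by (simp add: pk_def) (metis norm_ge_zero order_trans)
qed

lemma adm_integrable:
  assumes h: "adm T c C h" and c: "c > 0"
  shows "integrable lborel h"
proof (rule Bochner_Integration.integrable_bound)
  show "integrable lborel (\<lambda>\<tau>. C * (pk 1 (T - \<tau>) * pk c \<tau>))"
    using cv_pk(1)[of 1 c T] c by simp
  show "h \<in> borel_measurable lborel" using h by (simp add: adm_def)
  show "AE \<tau> in lborel. norm (h \<tau>) \<le> norm (C * (pk 1 (T - \<tau>) * pk c \<tau>))"
  proof (rule AE_I2)
    fix \<tau>
    show "norm (h \<tau>) \<le> norm (C * (pk 1 (T - \<tau>) * pk c \<tau>))"
    proof (cases "\<tau> \<in> {0<..<T}")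
      case True
      have "norm (h \<tau>) \<le> C * pk c \<tau>" using h by (simp add: adm_def)
      then show ?thesis using True adm_nonneg[OF h] by (simp add: pk_def)
    qed (use h in \<open>simp add: adm_def\<close>)
  qed
qed

lemma pk_le_pk:
  assumes "a \<le> b" "t \<le> T" "T > 0"
  shows "pk b t \<le> T powr (b - a) * pk a t"
proof (cases "t > 0")
  case True
  have "t powr (b - 1) = t powr (b - a) * t powr (a - 1)" by (simp flip: powr_add)
  also have "\<dots> \<le> T powr (b - a) * t powr (a - 1)"
    using True assms by (intro mult_right_mono powr_mono2) auto
  finally show ?thesis using True by (simp add: pk_def)
qed (simp add: pk_def)

text \<open>One scalar kernel for each eigenvalue. The common bound M s^(a-1) controls the operator
  norm of the diagonal operator with entries m j s, and makes all kernels vanish for s \<le>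
  0.\<close>

locale multiplier =
  fixes a M :: real and m :: "nat \<Rightarrow> real \<Rightarrow> real"
  assumes a: "a > 0" and M: "M \<ge> 0"
    and m_cont: "\<And>j. continuous_on {0<..} (m j)"
    and m_bd: "\<And>j s. \<bar>m j s\<bar> \<le> M * pk a s"
begin

lemma m_0: "s \<le> 0 \<Longrightarrow> m j s = 0"
  using m_bd[of j s] by (simp add: pk_def)

lemma m_meas [measurable]: "m j \<in> borel_measurable borel"
proof -
  have "(\<lambda>s. indicator {0<..} s *\<^sub>R m j s) \<in> borel_measurable borel"
    by (rule borel_measurable_continuous_on_indicator) (use m_cont in auto)
  also have "(\<lambda>s. indicator {0<..} s *\<^sub>R m j s) = m j"
    using m_0 by (auto simp: indicator_def fun_eq_iff not_less)
  finally show ?thesis .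
qed

lemma kbd_m: "kbd a (m j)"
  by (rule kbdI[of _ M]) (auto intro: m_bd)

lemma coord_m: "coord (diag (\<lambda>j. m j s) x) j = m j s * coord x j"
  by (rule coord_diag[of _ "M * pk a s"]) (rule m_bd)

lemma norm_m: "norm (diag (\<lambda>j. m j s) x) \<le> M * pk a s * norm x"
  by (rule norm_diag_le) (rule m_bd)

lemma integrand_meas:
  assumes "h \<in> borel_measurable borel"
  shows "(\<lambda>\<tau>. diag (\<lambda>j. m j (t - \<tau>)) (h \<tau>)) \<in> borel_measurable borel"
  by (rule measurable_ell2) (use assms in \<open>simp add: coord_m\<close>)

lemma VC_integrable:
  assumes h: "adm T c C h" and c: "c > 0"
  shows "integrable lborel (\<lambda>\<tau>. diag (\<lambda>j. m j (t - \<tau>)) (h \<tau>))"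
proof (rule Bochner_Integration.integrable_bound)
  show "integrable lborel (\<lambda>\<tau>. (M * C) * (pk a (t - \<tau>) * pk c \<tau>))"
    by (intro integrable_mult_right cv_pk a c)
  show "(\<lambda>\<tau>. diag (\<lambda>j. m j (t - \<tau>)) (h \<tau>)) \<in> borel_measurable lborel"
    using integrand_meas[of h] h by (simp add: adm_def)
  show "AE \<tau> in lborel. norm (diag (\<lambda>j. m j (t - \<tau>)) (h \<tau>)) \<le> norm ((M * C) * (pk a (t - \<tau>) * pk c \<tau>))"
  proof (rule AE_I2)
    fix \<tau>
    have "norm (diag (\<lambda>j. m j (t - \<tau>)) (h \<tau>)) \<le> M * pk a (t - \<tau>) * norm (h \<tau>)" by (rule norm_m)
    also have "\<dots> \<le> M * pk a (t - \<tau>) * (C * pk c \<tau>)"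
      using h M by (intro mult_left_mono mult_nonneg_nonneg) (auto simp: adm_def)
    finally show "norm (diag (\<lambda>j. m j (t - \<tau>)) (h \<tau>)) \<le> norm ((M * C) * (pk a (t - \<tau>) * pk c \<tau>))"
      by (simp add: mult_ac)
  qed
qed

lemma VC_norm:
  assumes h: "adm T c C h" and c: "c > 0"
  shows "norm (VC m h t) \<le> M * C * Beta a c * pk (a + c) t"
proof -
  have "norm (VC m h t) \<le> (\<integral>\<tau>. norm (diag (\<lambda>j. m j (t - \<tau>)) (h \<tau>)) \<partial>lborel)"
    unfolding VC_def by (rule integral_norm_bound)
  also have "\<dots> \<le> (\<integral>\<tau>. (M * C) * (pk a (t - \<tau>) * pk c \<tau>) \<partial>lborel)"
  proof (rule integral_mono)
    show "integrable lborel (\<lambda>\<tau>. norm (diag (\<lambda>j. m j (t - \<tau>)) (h \<tau>)))"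
      by (intro integrable_norm VC_integrable[OF h c])
    show "integrable lborel (\<lambda>\<tau>. (M * C) * (pk a (t - \<tau>) * pk c \<tau>))"
      by (intro integrable_mult_right cv_pk a c)
    fix \<tau>
    have "norm (diag (\<lambda>j. m j (t - \<tau>)) (h \<tau>)) \<le> M * pk a (t - \<tau>) * norm (h \<tau>)" by (rule norm_m)
    also have "\<dots> \<le> M * pk a (t - \<tau>) * (C * pk c \<tau>)"
      using h M by (intro mult_left_mono mult_nonneg_nonneg) (auto simp: adm_def)
    finally show "norm (diag (\<lambda>j. m j (t - \<tau>)) (h \<tau>)) \<le> (M * C) * (pk a (t - \<tau>) * pk c \<tau>)"
      by (simp add: mult_ac)
  qed
  also have "\<dots> = M * C * Beta a c * pk (a + c) t"
    using cv_pk(2)[OF a c, of t] by (simp add: cv_def)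
  finally show ?thesis .
qed

lemma VC_coord:
  assumes h: "adm T c C h" and c: "c > 0"
  shows "coord (VC m h t) j = (\<integral>\<tau>. m j (t - \<tau>) * coord (h \<tau>) j \<partial>lborel)"
  unfolding VC_def
  using integral_bounded_linear[OF bounded_linear_coord VC_integrable[OF assms, of t], of j] by (simp add: coord_m)

lemma VC_diff:
  assumes "adm T c C h" "adm T c D k" and c: "c > 0"
  shows "VC m (\<lambda>\<tau>. h \<tau> - k \<tau>) t = VC m h t - VC m k t"
proof -
  have "diag (\<lambda>j. m j s) (x - y) = diag (\<lambda>j. m j s) x - diag (\<lambda>j. m j s) y" for s x y
    by (rule ell2_eqI) (simp add: coord_m right_diff_distrib)
  then show ?thesis
    using VC_integrable[OF assms(1) c] VC_integrable[OF assms(2) c] by (simp add: VC_def)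
qed

text \<open>After \<tau> = t \<sigma> the singularities sit at \<sigma> = 0 and \<sigma> = 1 for all
  t, so one multiple of (1-\<sigma>)^(a-1) \<sigma>^(c-1) dominates the integrands along a
  convergent sequence of times. Pointwise convergence is \<open>diag_tendsto\<close>. The endpoint t
  = T is included although h is continuous on the open interval only.\<close>

lemma VC_cont:
  assumes h: "adm T c C h" and c: "c > 0" and hc: "continuous_on {0<..<T} h" and T: "T > 0"
  shows "continuous_on {0<..T} (VC m h)"
proof -
  have eq: "VC m h t = t *\<^sub>R (\<integral>\<sigma>. diag (\<lambda>j. m j (t - t * \<sigma>)) (h (t * \<sigma>)) \<partial>lborel)" if "t > 0" for t
    unfolding VC_def
    using lborel_integral_real_affine[of t "\<lambda>\<tau>. diag (\<lambda>j. m j (t - \<tau>)) (h \<tau>)" 0] that by simp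
  have pk_scale: "pk b (t * s) = t powr (b - 1) * pk b s" if "t > 0" for b s t
    using that powr_mult[of t s "b - 1"] by (auto simp: pk_def zero_less_mult_iff)
  show ?thesis
    unfolding continuous_on_sequentially
  proof (intro allI ballI impI)
    fix t :: "nat \<Rightarrow> real" and t0
    assume t0: "t0 \<in> {0<..T}" and "(\<forall>n. t n \<in> {0<..T}) \<and> t \<longlonglongrightarrow> t0"
    then have t: "\<And>n. t n \<in> {0<..T}" "t \<longlonglongrightarrow> t0" by auto
    have "(\<lambda>n. t n powr (a - 1) * t n powr (c - 1)) \<longlonglongrightarrow> t0 powr (a - 1) * t0 powr (c - 1)"
      using t0 t by (intro tendsto_intros) auto
    then have "Bseq (\<lambda>n. t n powr (a - 1) * t n powr (c - 1))" by (rule convergent_imp_Bseq[OF convergentI])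
    then obtain B where B: "\<And>n. norm (t n powr (a - 1) * t n powr (c - 1)) \<le> B" by (rule BseqE) blast
    have "(\<lambda>n. \<integral>\<sigma>. diag (\<lambda>j. m j (t n - t n * \<sigma>)) (h (t n * \<sigma>)) \<partial>lborel) \<longlonglongrightarrow>
        (\<integral>\<sigma>. diag (\<lambda>j. m j (t0 - t0 * \<sigma>)) (h (t0 * \<sigma>)) \<partial>lborel)"
    proof (rule integral_dominated_convergence[where w = "\<lambda>\<sigma>. (M * \<bar>C\<bar> * B) * (pk a (1 - \<sigma>) * pk c \<sigma>)"])
      have hm: "h \<in> borel_measurable borel" using h by (simp add: adm_def)
      show "(\<lambda>\<sigma>. diag (\<lambda>j. m j (s - s * \<sigma>)) (h (s * \<sigma>))) \<in> borel_measurable lborel" for s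
        using measurable_compose[OF _ integrand_meas[OF hm, of s], of "\<lambda>\<sigma>. s * \<sigma>" lborel] by simp
      then show "(\<lambda>\<sigma>. diag (\<lambda>j. m j (t n - t n * \<sigma>)) (h (t n * \<sigma>))) \<in> borel_measurable lborel" for n .
      show "integrable lborel (\<lambda>\<sigma>. (M * \<bar>C\<bar> * B) * (pk a (1 - \<sigma>) * pk c \<sigma>))"
        by (intro integrable_mult_right cv_pk a c)
      show "AE \<sigma> in lborel. norm (diag (\<lambda>j. m j (t n - t n * \<sigma>)) (h (t n * \<sigma>))) \<le> (M * \<bar>C\<bar> * B) * (pk a (1 - \<sigma>) * pk c \<sigma>)" for n
      proof (rule AE_I2)
        fix \<sigma>
        have tn: "t n > 0" using t(1)[of n] by simp
        have "norm (h (t n * \<sigma>)) \<le> \<bar>C\<bar> * pk c (t n * \<sigma>)"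
          using h unfolding adm_def by (meson abs_ge_self mult_right_mono order_trans pk_nonneg)
        then have "norm (diag (\<lambda>j. m j (t n - t n * \<sigma>)) (h (t n * \<sigma>))) \<le> M * pk a (t n - t n * \<sigma>) * (\<bar>C\<bar> * pk c (t n * \<sigma>))"
          using M by (intro order_trans[OF norm_m] mult_left_mono) auto
        also have "pk a (t n - t n * \<sigma>) = t n powr (a - 1) * pk a (1 - \<sigma>)"
          using pk_scale[OF tn, of a "1 - \<sigma>"] by (simp add: right_diff_distrib)
        also have "M * (t n powr (a - 1) * pk a (1 - \<sigma>)) * (\<bar>C\<bar> * pk c (t n * \<sigma>)) =
            (t n powr (a - 1) * t n powr (c - 1)) * (M * \<bar>C\<bar> * (pk a (1 - \<sigma>) * pk c \<sigma>))"
          unfolding pk_scale[OF tn] by (simp add: mult_ac)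
        also have "\<dots> \<le> B * (M * \<bar>C\<bar> * (pk a (1 - \<sigma>) * pk c \<sigma>))"
          using B[of n] M by (intro mult_right_mono) auto
        finally show "norm (diag (\<lambda>j. m j (t n - t n * \<sigma>)) (h (t n * \<sigma>))) \<le> (M * \<bar>C\<bar> * B) * (pk a (1 - \<sigma>) * pk c \<sigma>)"
          by (simp add: mult_ac)
      qed
      show "AE \<sigma> in lborel. (\<lambda>n. diag (\<lambda>j. m j (t n - t n * \<sigma>)) (h (t n * \<sigma>))) \<longlonglongrightarrow> diag (\<lambda>j. m j (t0 - t0 * \<sigma>)) (h (t0 * \<sigma>))"
      proof (rule AE_I2)
        fix \<sigma>
        show "(\<lambda>n. diag (\<lambda>j. m j (t n - t n * \<sigma>)) (h (t n * \<sigma>))) \<longlonglongrightarrow> diag (\<lambda>j. m j (t0 - t0 * \<sigma>)) (h (t0 * \<sigma>))"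
        proof (cases "\<sigma> \<in> {0<..<1}")
          case True
          have in1: "s * \<sigma> \<in> {0<..<T}" "s - s * \<sigma> > 0" if "s \<in> {0<..T}" for s
          proof -
            have "s * \<sigma> < s" using that True by simp
            moreover have "s * \<sigma> > 0" using that True by simp
            ultimately show "s * \<sigma> \<in> {0<..<T}" "s - s * \<sigma> > 0" using that by auto
          qed
          have hl: "(\<lambda>n. h (t n * \<sigma>)) \<longlonglongrightarrow> h (t0 * \<sigma>)"
            by (rule continuous_on_tendsto_compose[OF hc]) (use in1 t t0 in \<open>auto intro!: tendsto_intros\<close>)
          have sl: "(\<lambda>n. t n - t n * \<sigma>) \<longlonglongrightarrow> t0 - t0 * \<sigma>" by (intro tendsto_intros t)
          have "(\<lambda>n. pk a (t n - t n * \<sigma>)) \<longlonglongrightarrow> pk a (t0 - t0 * \<sigma>)"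
          proof -
            have "(\<lambda>n. (t n - t n * \<sigma>) powr (a - 1)) \<longlonglongrightarrow> (t0 - t0 * \<sigma>) powr (a - 1)"
              using in1[OF t0] by (intro tendsto_powr sl tendsto_const) auto
            moreover have "pk a (s - s * \<sigma>) = (s - s * \<sigma>) powr (a - 1)" if "s \<in> {0<..T}" for s
              using in1[OF that] by (simp add: pk_def)
            ultimately show ?thesis using t(1) t0 by simp
          qed
          then have "Bseq (\<lambda>n. pk a (t n - t n * \<sigma>))" by (rule convergent_imp_Bseq[OF convergentI])
          then obtain D where D: "\<And>n. norm (pk a (t n - t n * \<sigma>)) \<le> D" by (rule BseqE) blast
          show ?thesis
          proof (rule diag_tendsto[where C = "M * max D (pk a (t0 - t0 * \<sigma>))"])
            show "(\<lambda>n. m j (t n - t n * \<sigma>)) \<longlonglongrightarrow> m j (t0 - t0 * \<sigma>)" for j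
              by (rule continuous_on_tendsto_compose[OF m_cont sl]) (use in1 t t0 in auto)
            show "\<forall>\<^sub>F n in sequentially. \<forall>j. \<bar>m j (t n - t n * \<sigma>)\<bar> \<le> M * max D (pk a (t0 - t0 * \<sigma>))"
            proof (intro always_eventually allI)
              fix n j
              have "\<bar>m j (t n - t n * \<sigma>)\<bar> \<le> M * pk a (t n - t n * \<sigma>)" by (rule m_bd)
              also have "\<dots> \<le> M * max D (pk a (t0 - t0 * \<sigma>))" using D[of n] M by (intro mult_left_mono) auto
              finally show "\<bar>m j (t n - t n * \<sigma>)\<bar> \<le> M * max D (pk a (t0 - t0 * \<sigma>))" .
            qed
            fix j
            have "\<bar>m j (t0 - t0 * \<sigma>)\<bar> \<le> M * pk a (t0 - t0 * \<sigma>)" by (rule m_bd)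
            also have "\<dots> \<le> M * max D (pk a (t0 - t0 * \<sigma>))" using M by (intro mult_left_mono) auto
            finally show "\<bar>m j (t0 - t0 * \<sigma>)\<bar> \<le> M * max D (pk a (t0 - t0 * \<sigma>))" .
          qed (rule hl)
        next
          case False
          have "diag (\<lambda>j. m j (s - s * \<sigma>)) (h (s * \<sigma>)) = 0" if "s > 0" for s
          proof (cases "\<sigma> \<le> 0")
            case True
            then have "s * \<sigma> \<le> 0" using that by (simp add: mult_le_0_iff)
            then have "h (s * \<sigma>) = 0" using h by (auto simp: adm_def)
            then show ?thesis by (intro ell2_eqI) (simp add: coord_m)
          next
            case s: False
            then have "\<sigma> \<ge> 1" using False by auto
            then have "s - s * \<sigma> \<le> 0" using that by simp
            then show ?thesis by (intro ell2_eqI) (subst coord_m, simp add: m_0)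
          qed
          then show ?thesis using t(1) t0 by simp
        qed
      qed
    qed
    then have "(\<lambda>n. t n *\<^sub>R (\<integral>\<sigma>. diag (\<lambda>j. m j (t n - t n * \<sigma>)) (h (t n * \<sigma>)) \<partial>lborel)) \<longlonglongrightarrow>
        t0 *\<^sub>R (\<integral>\<sigma>. diag (\<lambda>j. m j (t0 - t0 * \<sigma>)) (h (t0 * \<sigma>)) \<partial>lborel)"
      by (intro tendsto_intros t)
    then show "(VC m h \<circ> t) \<longlonglongrightarrow> VC m h t0"
      using t(1) t0 by (simp add: o_def eq)
  qed
qed

end

section \<open>A nonlocal evolution problem in the sequence space\<close>

text \<open>Inserting the inequality into itself raises the kernel exponent by \<alpha> each time.
  Once the exponent is at least 1, the kernel is bounded on (0,T) and integrability of y alone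
  controls the remaining term. Values in \<open>ennreal\<close> spare any prior knowledge that the
  convolutions are finite.\<close>

lemma singular_gronwall:
  fixes y :: "real \<Rightarrow> ennreal"
  assumes \<alpha>: "\<alpha> > 0" and c: "0 < c" "c \<le> 1" and T: "T > 0"
    and y [measurable]: "y \<in> borel_measurable borel" and y0: "\<And>t. t \<notin> {0<..<T} \<Longrightarrow> y t = 0"
    and fin: "(\<integral>\<^sup>+t. y t \<partial>lborel) < top" and A: "A \<ge> 0" and B: "B \<ge> 0"
    and le: "AE t in lborel. y t \<le> ennreal (A * pk c t) + ennreal B * (\<integral>\<^sup>+\<tau>. ennreal (pk \<alpha> (t - \<tau>)) * y \<tau> \<partial>lborel)"
  shows "\<exists>C\<ge>0. AE t in lborel. y t \<le> ennreal (C * pk c t)"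
proof -
  define I where "I a t = (\<integral>\<^sup>+\<tau>. ennreal (pk a (t - \<tau>)) * y \<tau> \<partial>lborel)" for a t
  have Im [measurable]: "I a \<in> borel_measurable borel" for a
    unfolding I_def[abs_def] by measurable
  have step: "\<exists>A'\<ge>0. \<exists>B'\<ge>0. AE t in lborel. y t \<le> ennreal (A' * pk c t) + ennreal B' * I (real (Suc n) * \<alpha>) t" for n
  proof (induction n)
    case 0
    then show ?case using le A B by (intro exI[of _ A] exI[of _ B] conjI) (simp_all add: I_def)
  next
    case (Suc n)
    then obtain A' B' where A': "A' \<ge> 0" and B': "B' \<ge> 0"
      and IH: "AE t in lborel. y t \<le> ennreal (A' * pk c t) + ennreal B' * I (real (Suc n) * \<alpha>) t" by blast
    define a where "a = real (Suc n) * \<alpha>"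
    have a: "a > 0" using \<alpha> by (simp add: a_def)
    have beta0: "Beta x z \<ge> 0" if "x > 0" "z > 0" for x z :: real
      using that by (simp add: Beta_def Gamma_real_pos less_imp_le)
    have conv: "I \<alpha> t \<le> ennreal (A' * Beta \<alpha> c * pk (\<alpha> + c) t) + ennreal (B' * Beta \<alpha> a) * I (\<alpha> + a) t" for t
    proof -
      have "I \<alpha> t \<le> (\<integral>\<^sup>+\<tau>. ennreal (pk \<alpha> (t - \<tau>)) * (ennreal (A' * pk c \<tau>) + ennreal B' * I a \<tau>) \<partial>lborel)"
        unfolding I_def[of \<alpha>] using IH by (intro nn_integral_mono_AE) (auto simp: a_def elim!: eventually_mono intro: mult_left_mono)
      also have "\<dots> = (\<integral>\<^sup>+\<tau>. ennreal A' * ennreal (pk \<alpha> (t - \<tau>) * pk c \<tau>) + ennreal B' * (ennreal (pk \<alpha> (t - \<tau>)) * I a \<tau>) \<partial>lborel)"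
        using A' B' by (intro nn_integral_cong) (simp add: distrib_left ennreal_mult mult_ac)
      also have "\<dots> = ennreal A' * (\<integral>\<^sup>+\<tau>. ennreal (pk \<alpha> (t - \<tau>) * pk c \<tau>) \<partial>lborel) + ennreal B' * (\<integral>\<^sup>+\<tau>. ennreal (pk \<alpha> (t - \<tau>)) * I a \<tau> \<partial>lborel)"
        by (subst nn_integral_add) (auto simp: nn_integral_cmult)
      also have "(\<integral>\<^sup>+\<tau>. ennreal (pk \<alpha> (t - \<tau>) * pk c \<tau>) \<partial>lborel) = ennreal (Beta \<alpha> c * pk (\<alpha> + c) t)"
        by (rule nn_integral_pk_conv[OF \<alpha> c(1)])
      also have "(\<integral>\<^sup>+\<tau>. ennreal (pk \<alpha> (t - \<tau>)) * I a \<tau> \<partial>lborel) = ennreal (Beta \<alpha> a) * I (\<alpha> + a) t"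
      proof -
        have "(\<integral>\<^sup>+\<tau>. ennreal (pk \<alpha> (t - \<tau>)) * I a \<tau> \<partial>lborel) =
            (\<integral>\<^sup>+\<tau>. \<integral>\<^sup>+\<sigma>. ennreal (pk \<alpha> (t - \<tau>)) * (ennreal (pk a (\<tau> - \<sigma>)) * y \<sigma>) \<partial>lborel \<partial>lborel)"
          unfolding I_def by (subst nn_integral_cmult) auto
        also have "\<dots> = (\<integral>\<^sup>+\<sigma>. \<integral>\<^sup>+\<tau>. ennreal (pk \<alpha> (t - \<tau>)) * (ennreal (pk a (\<tau> - \<sigma>)) * y \<sigma>) \<partial>lborel \<partial>lborel)"
          by (rule lborel_pair.Fubini') measurable
        also have "\<dots> = (\<integral>\<^sup>+\<sigma>. ennreal (Beta \<alpha> a) * (ennreal (pk (\<alpha> + a) (t - \<sigma>)) * y \<sigma>) \<partial>lborel)"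
        proof (rule nn_integral_cong)
          fix \<sigma>
          have "(\<integral>\<^sup>+\<tau>. ennreal (pk \<alpha> (t - \<tau>)) * (ennreal (pk a (\<tau> - \<sigma>)) * y \<sigma>) \<partial>lborel) =
              (\<integral>\<^sup>+\<tau>. ennreal (pk \<alpha> (t - \<tau>) * pk a (\<tau> - \<sigma>)) \<partial>lborel) * y \<sigma>"
            by (subst nn_integral_multc[symmetric]) (auto simp: ennreal_mult mult.assoc)
          also have "(\<integral>\<^sup>+\<tau>. ennreal (pk \<alpha> (t - \<tau>) * pk a (\<tau> - \<sigma>)) \<partial>lborel) = ennreal (Beta \<alpha> a * pk (\<alpha> + a) (t - \<sigma>))"
            using nn_integral_pk_shift[OF \<alpha> a, of t "t - \<sigma>"] by (simp add: add.commute)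
          also have "\<dots> * y \<sigma> = ennreal (Beta \<alpha> a) * (ennreal (pk (\<alpha> + a) (t - \<sigma>)) * y \<sigma>)"
            using beta0[OF \<alpha> a] by (simp add: ennreal_mult mult.assoc)
          finally show "(\<integral>\<^sup>+\<tau>. ennreal (pk \<alpha> (t - \<tau>)) * (ennreal (pk a (\<tau> - \<sigma>)) * y \<sigma>) \<partial>lborel) =
            ennreal (Beta \<alpha> a) * (ennreal (pk (\<alpha> + a) (t - \<sigma>)) * y \<sigma>)" .
        qed
        also have "\<dots> = ennreal (Beta \<alpha> a) * I (\<alpha> + a) t"
          unfolding I_def by (rule nn_integral_cmult) measurable
        finally show ?thesis .
      qed
      finally show ?thesis
        using A' B' beta0[OF \<alpha> c(1)] beta0[OF \<alpha> a] by (simp add: ennreal_mult mult.assoc)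
    qed
    have A0: "A + B * (A' * Beta \<alpha> c * T powr \<alpha>) \<ge> 0" "B * (B' * Beta \<alpha> a) \<ge> 0"
      using A B A' B' beta0[OF \<alpha> c(1)] beta0[OF \<alpha> a] by auto
    have "AE t in lborel. y t \<le> ennreal ((A + B * (A' * Beta \<alpha> c * T powr \<alpha>)) * pk c t) + ennreal (B * (B' * Beta \<alpha> a)) * I (\<alpha> + a) t"
      using le
    proof eventually_elim
      case (elim t)
      show ?case
      proof (cases "t \<in> {0<..<T}")
        case True
        have "y t \<le> ennreal (A * pk c t) + ennreal B * I \<alpha> t" using elim by (simp add: I_def)
        also have "\<dots> \<le> ennreal (A * pk c t) + ennreal B * (ennreal (A' * Beta \<alpha> c * pk (\<alpha> + c) t) + ennreal (B' * Beta \<alpha> a) * I (\<alpha> + a) t)"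
          by (intro add_left_mono mult_left_mono conv) auto
        also have "\<dots> \<le> ennreal (A * pk c t) + ennreal B * (ennreal (A' * Beta \<alpha> c * T powr \<alpha> * pk c t) + ennreal (B' * Beta \<alpha> a) * I (\<alpha> + a) t)"
        proof (intro add_left_mono mult_left_mono add_right_mono ennreal_leI)
          have "pk (\<alpha> + c) t \<le> T powr (\<alpha> + c - c) * pk c t" using True \<alpha> T by (intro pk_le_pk) auto
          then have "A' * Beta \<alpha> c * pk (\<alpha> + c) t \<le> A' * Beta \<alpha> c * (T powr \<alpha> * pk c t)"
            using A' beta0[OF \<alpha> c(1)] by (intro mult_left_mono) auto
          then show "A' * Beta \<alpha> c * pk (\<alpha> + c) t \<le> A' * Beta \<alpha> c * T powr \<alpha> * pk c t" by (simp add: mult.assoc)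
        qed auto
        also have "\<dots> = ennreal ((A + B * (A' * Beta \<alpha> c * T powr \<alpha>)) * pk c t) + ennreal (B * (B' * Beta \<alpha> a)) * I (\<alpha> + a) t"
          using A B A' B' beta0[OF \<alpha> c(1)] beta0[OF \<alpha> a]
          by (simp add: distrib_left distrib_right ennreal_mult ennreal_plus mult.assoc add.assoc)
        finally show ?thesis .
      qed (simp add: y0)
    qed
    moreover have "\<alpha> + a = real (Suc (Suc n)) * \<alpha>" by (simp add: a_def algebra_simps)
    ultimately show ?case using A0 by metis
  qed
  obtain n :: nat where n: "1 / \<alpha> \<le> real n" using real_arch_simple by blast
  define a where "a = real (Suc n) * \<alpha>"
  have a: "a \<ge> 1" using n \<alpha> by (simp add: a_def field_simps)
  obtain A' B' where A': "A' \<ge> 0" and B': "B' \<ge> 0"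
    and y_le: "AE t in lborel. y t \<le> ennreal (A' * pk c t) + ennreal B' * I a t"
    using step[of n] unfolding a_def by blast
  define Y where "Y = enn2real (\<integral>\<^sup>+t. y t \<partial>lborel)"
  have Y: "(\<integral>\<^sup>+t. y t \<partial>lborel) = ennreal Y" "Y \<ge> 0" using fin by (simp_all add: Y_def)
  define C where "C = A' + B' * (T powr (a - 1) * Y) * T powr (1 - c)"
  have "AE t in lborel. y t \<le> ennreal (C * pk c t)"
    using y_le
  proof eventually_elim
    case (elim t)
    show ?case
    proof (cases "t \<in> {0<..<T}")
      case True
      have "I a t \<le> (\<integral>\<^sup>+\<tau>. ennreal (T powr (a - 1)) * y \<tau> \<partial>lborel)"
        unfolding I_def
      proof (rule nn_integral_mono)
        fix \<tau>
        show "ennreal (pk a (t - \<tau>)) * y \<tau> \<le> ennreal (T powr (a - 1)) * y \<tau>"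
        proof (cases "\<tau> \<in> {0<..<T}")
          case \<tau>: True
          then have "pk a (t - \<tau>) \<le> T powr (a - 1)"
            using True a by (auto simp: pk_def intro!: powr_mono2)
          then show ?thesis by (intro mult_right_mono ennreal_leI) auto
        qed (simp add: y0)
      qed
      also have "\<dots> = ennreal (T powr (a - 1) * Y)"
        using Y by (simp add: nn_integral_cmult ennreal_mult)
      finally have "y t \<le> ennreal (A' * pk c t) + ennreal B' * ennreal (T powr (a - 1) * Y)"
        by (intro order_trans[OF elim] add_left_mono mult_left_mono) auto
      also have "\<dots> = ennreal (A' * pk c t + B' * (T powr (a - 1) * Y))"
        using A' B' Y by (simp add: ennreal_mult ennreal_plus)
      also have "\<dots> \<le> ennreal (C * pk c t)"
      proof (rule ennreal_leI)
        have "1 \<le> T powr (1 - c) * pk c t" using pk_le_pk[of c 1 t T] True c T by (simp add: pk_def)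
        then have "B' * (T powr (a - 1) * Y) * 1 \<le> B' * (T powr (a - 1) * Y) * (T powr (1 - c) * pk c t)"
          using B' Y by (intro mult_left_mono) auto
        then show "A' * pk c t + B' * (T powr (a - 1) * Y) \<le> C * pk c t"
          by (simp add: C_def distrib_right mult.assoc)
      qed
      finally show ?thesis .
    qed (simp add: y0)
  qed
  moreover have "C \<ge> 0" using A' B' Y by (simp add: C_def)
  ultimately show ?thesis by blast
qed

text \<open>\<open>G\<close> is \<open>\<G>\<^sub>1 + \<G>\<^sub>3\<close>, with kernel \<open>K\<close> for \<open>\<G>\<^sub>1\<close> and factors \<open>ee j t\<close> for \<open>\<G>\<^sub>2\<close>. The assumption \<open>schur\<close>
  is the Schur test for the weight \<open>\<rho>\<close>; it makes \<open>v \<mapsto> G (f v)\<close> a contraction in the weighted sup norm.\<close>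

locale evolution = multiplier \<alpha> M K for \<alpha> M K +
  fixes T :: real and ee :: "nat \<Rightarrow> real \<Rightarrow> real" and \<delta> :: real and \<rho> :: "real \<Rightarrow> real"
    and N1 :: "real \<Rightarrow> real" and N3 :: "real \<Rightarrow> real \<Rightarrow> real" and A c0 C0 g :: real
  assumes \<alpha>1: "\<alpha> < 1" and T: "T > 0" and \<delta>: "0 < \<delta>" "\<delta> < 1" and Mpos: "M > 0"
    and e_cont: "\<And>j. continuous_on {0<..} (ee j)"
    and e_bd: "\<And>j t. t \<in> {0<..T} \<Longrightarrow> \<bar>ee j t\<bar> \<le> M * t powr (- \<alpha>)"
    and eK_bd: "\<And>j t s. t \<in> {0<..T} \<Longrightarrow> \<bar>ee j t * K j s\<bar> \<le> M * t powr (- (\<alpha> * \<delta>)) * pk (\<alpha> * \<delta>) s"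
    and N1_meas [measurable]: "N1 \<in> borel_measurable borel" and N1: "\<And>j s. \<bar>K j s\<bar> \<le> N1 s"
    and N3_meas [measurable]: "\<And>t. N3 t \<in> borel_measurable borel"
    and N3: "\<And>j t s. t \<in> {0<..T} \<Longrightarrow> \<bar>ee j t * K j s\<bar> \<le> N3 t s"
    and rho_meas [measurable]: "\<rho> \<in> borel_measurable borel" and rho_cont: "continuous_on {0<..} \<rho>"
    and rho0: "\<And>t. \<rho> t \<ge> 0" and c0: "c0 > 0"
    and rho_ge: "\<And>t. t \<in> {0<..T} \<Longrightarrow> c0 * t powr (- (\<alpha> * \<delta>)) \<le> \<rho> t"
    and rho_le: "\<And>t. t \<in> {0<..T} \<Longrightarrow> \<rho> t \<le> C0 * t powr (- (\<alpha> * \<delta>))"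
    and schur: "\<And>t. t \<in> {0<..T} \<Longrightarrow>
      (\<integral>\<^sup>+\<tau>. ennreal (N1 (t - \<tau>) * \<rho> \<tau>) \<partial>lborel) + (\<integral>\<^sup>+\<tau>. ennreal (N3 t (T - \<tau>) * \<rho> \<tau>) \<partial>lborel) \<le> ennreal (A * \<rho> t)"
    and A: "A \<ge> 0" and g: "g \<ge> 0" and gA: "g * A < 1"
begin

definition G :: "(real \<Rightarrow> ell2) \<Rightarrow> real \<Rightarrow> ell2" where
  "G h t = VC K h t - diag (\<lambda>j. ee j t) (VC K h T)"

lemma \<alpha>0: "\<alpha> > 0" by (rule a)

lemma rho_pos: "t \<in> {0<..T} \<Longrightarrow> \<rho> t > 0"
  using rho_ge[of t] c0 by (auto intro: less_le_trans[rotated])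

lemma C0: "C0 \<ge> 0"
proof -
  have "c0 * T powr (- (\<alpha> * \<delta>)) \<le> C0 * T powr (- (\<alpha> * \<delta>))"
    using order_trans[OF rho_ge[of T] rho_le[of T]] T by simp
  moreover have "T powr (- (\<alpha> * \<delta>)) > 0" using T by simp
  ultimately have "c0 \<le> C0" by (rule mult_right_le_imp_le)
  then show ?thesis using c0 by simp
qed

lemma multiplier_eK:
  assumes "t \<in> {0<..T}"
  shows "multiplier (\<alpha> * \<delta>) (M * t powr (- (\<alpha> * \<delta>))) (\<lambda>j s. ee j t * K j s)"
  by standard (use assms \<alpha>0 \<delta> M eK_bd m_cont in \<open>auto intro!: continuous_intros\<close>)

lemma coord_e: "t \<in> {0<..T} \<Longrightarrow> coord (diag (\<lambda>j. ee j t) x) j = ee j t * coord x j"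
  by (rule coord_diag[of _ "M * t powr (- \<alpha>)"]) (rule e_bd)

lemma norm_e: "t \<in> {0<..T} \<Longrightarrow> norm (diag (\<lambda>j. ee j t) x) \<le> M * t powr (- \<alpha>) * norm x"
  by (rule norm_diag_le) (rule e_bd)

text \<open>The factors \<open>ee j t\<close> alone are only known to be of order t^(-\<alpha>).
  Moved under the integral they combine with K, and for the product the better bound
  \<open>eK_bd\<close> and the majorant \<open>N3\<close> are available.\<close>

lemma e_VC:
  assumes h: "adm T c C h" and c: "c > 0" and t: "t \<in> {0<..T}"
  shows "diag (\<lambda>j. ee j t) (VC K h T) = VC (\<lambda>j s. ee j t * K j s) h T"
proof -
  interpret E: multiplier "\<alpha> * \<delta>" "M * t powr (- (\<alpha> * \<delta>))" "\<lambda>j s. ee j t * K j s"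
    by (rule multiplier_eK[OF t])
  show ?thesis
    by (rule ell2_eqI) (simp add: coord_e[OF t] VC_coord[OF h c] E.VC_coord[OF h c] mult.assoc)
qed

text \<open>The exponent \<alpha> + c - 1 is nonnegative, so one application of \<open>G\<close>
  leads into the weighted space even from data as singular as t^(-\<alpha>). This starts the
  iterations in \<open>existence\<close> and in \<open>uniqueness\<close>; the bound is linear in C,
  which later makes the solution estimate linear in the datum.\<close>

lemma G_norm_pow:
  assumes c: "c > 0" "1 - \<alpha> \<le> c"
  shows "\<exists>D\<ge>0. \<forall>C h. adm T c C h \<longrightarrow> (\<forall>t\<in>{0<..T}. norm (G h t) \<le> D * C * \<rho> t)"
proof -
  define b where "b = \<alpha> * \<delta>"
  have b: "b > 0" using \<alpha>0 \<delta> by (simp add: b_def)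
  define D where "D = (M * Beta \<alpha> c * T powr (\<alpha> + c - 1 + b) + M * Beta b c * T powr (b + c - 1)) / c0"
  have beta0: "Beta x z \<ge> 0" if "x > 0" "z > 0" for x z :: real
    using that by (simp add: Beta_def Gamma_real_pos less_imp_le)
  have "norm (G h t) \<le> D * C * \<rho> t" if h: "adm T c C h" and t: "t \<in> {0<..T}" for C h t
  proof -
    note C = adm_nonneg[OF h]
    interpret E: multiplier b "M * t powr (- b)" "\<lambda>j s. ee j t * K j s"
      unfolding b_def by (rule multiplier_eK[OF t])
    have "norm (VC K h t) \<le> M * C * Beta \<alpha> c * pk (\<alpha> + c) t" by (rule VC_norm[OF h c(1)])
    also have "pk (\<alpha> + c) t = t powr (\<alpha> + c - 1 + b) * t powr (- b)"
      using t by (simp add: pk_def flip: powr_add)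
    also have "\<dots> \<le> T powr (\<alpha> + c - 1 + b) * t powr (- b)"
      using t c b by (intro mult_right_mono powr_mono2) auto
    finally have 1: "norm (VC K h t) \<le> M * C * Beta \<alpha> c * (T powr (\<alpha> + c - 1 + b) * t powr (- b))"
      using M C beta0[OF \<alpha>0 c(1)] by (simp add: mult_left_mono)
    have 2: "norm (VC (\<lambda>j s. ee j t * K j s) h T) \<le> M * t powr (- b) * C * Beta b c * T powr (b + c - 1)"
      using E.VC_norm[OF h c(1), of T] T by (simp add: pk_def)
    have "norm (G h t) \<le> norm (VC K h t) + norm (VC (\<lambda>j s. ee j t * K j s) h T)"
      unfolding G_def e_VC[OF h c(1) t] by (rule norm_triangle_ineq4)
    also have "\<dots> \<le> D * C * (c0 * t powr (- b))"
    proof -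
      have "D * C * (c0 * t powr (- b)) = M * C * Beta \<alpha> c * (T powr (\<alpha> + c - 1 + b) * t powr (- b)) +
          M * t powr (- b) * C * Beta b c * T powr (b + c - 1)"
        using c0 by (simp add: D_def) (simp add: algebra_simps)
      then show ?thesis using 1 2 by linarith
    qed
    also have "\<dots> \<le> D * C * \<rho> t"
      using rho_ge[OF t] C M beta0[OF \<alpha>0 c(1)] beta0[OF b c(1)] c0
      by (intro mult_left_mono) (auto simp: b_def D_def)
    finally show ?thesis .
  qed
  moreover have "D \<ge> 0" using M beta0[OF \<alpha>0 c(1)] beta0[OF b c(1)] c0 by (simp add: D_def)
  ultimately show ?thesis by blast
qed

text \<open>The contraction step: the two Schur integrals bound the two summands of
  \<open>G\<close>. Admissibility of h supplies integrability, while its constants c and C do not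
  appear in the estimate. The pointwise bound is required almost everywhere only, as
  \<open>uniqueness\<close> provides no more.\<close>

lemma G_norm_rho:
  assumes h: "adm T c C h" and c: "c > 0" and t: "t \<in> {0<..T}" and S: "S \<ge> 0"
    and le: "AE \<tau> in lborel. \<tau> \<in> {0<..<T} \<longrightarrow> norm (h \<tau>) \<le> S * \<rho> \<tau>"
  shows "norm (G h t) \<le> S * A * \<rho> t"
proof -
  interpret E: multiplier "\<alpha> * \<delta>" "M * t powr (- (\<alpha> * \<delta>))" "\<lambda>j s. ee j t * K j s"
    by (rule multiplier_eK[OF t])
  have bound: "ennreal (norm (VC m h s)) \<le> ennreal S * (\<integral>\<^sup>+\<tau>. ennreal (N (s - \<tau>) * \<rho> \<tau>) \<partial>lborel)"
    if "multiplier a' M' m" and [measurable]: "N \<in> borel_measurable borel" and N: "\<And>j s. \<bar>m j s\<bar> \<le> N s"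
    for a' M' m N s
  proof -
    interpret m: multiplier a' M' m by fact
    have N0: "N s \<ge> 0" for s using N[of 0 s] by linarith
    have "ennreal (norm (VC m h s)) \<le> (\<integral>\<^sup>+\<tau>. norm (diag (\<lambda>j. m j (s - \<tau>)) (h \<tau>)) \<partial>lborel)"
      unfolding VC_def by (rule integral_norm_bound_ennreal[OF m.VC_integrable[OF h c]])
    also have "\<dots> \<le> (\<integral>\<^sup>+\<tau>. ennreal (S * (N (s - \<tau>) * \<rho> \<tau>)) \<partial>lborel)"
      using le
    proof (intro nn_integral_mono_AE, eventually_elim)
      case (elim \<tau>)
      have "norm (diag (\<lambda>j. m j (s - \<tau>)) (h \<tau>)) \<le> N (s - \<tau>) * norm (h \<tau>)" by (rule norm_diag_le) (rule N)
      also have "norm (h \<tau>) \<le> S * \<rho> \<tau>"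
        using elim h S rho0[of \<tau>] by (cases "\<tau> \<in> {0<..<T}") (auto simp: adm_def)
      then have "N (s - \<tau>) * norm (h \<tau>) \<le> N (s - \<tau>) * (S * \<rho> \<tau>)" using N0 by (intro mult_left_mono)
      finally show ?case by (intro ennreal_leI) (simp add: mult_ac)
    qed
    also have "\<dots> = ennreal S * (\<integral>\<^sup>+\<tau>. ennreal (N (s - \<tau>) * \<rho> \<tau>) \<partial>lborel)"
      using S by (intro nn_integral_cmult_real) auto
    finally show ?thesis .
  qed
  have "ennreal (norm (G h t)) \<le> ennreal (norm (VC K h t) + norm (VC (\<lambda>j s. ee j t * K j s) h T))"
    unfolding G_def e_VC[OF h c t] by (intro ennreal_leI norm_triangle_ineq4)
  also have "\<dots> = ennreal (norm (VC K h t)) + ennreal (norm (VC (\<lambda>j s. ee j t * K j s) h T))" by simp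
  also have "\<dots> \<le> ennreal S * (\<integral>\<^sup>+\<tau>. ennreal (N1 (t - \<tau>) * \<rho> \<tau>) \<partial>lborel) +
      ennreal S * (\<integral>\<^sup>+\<tau>. ennreal (N3 t (T - \<tau>) * \<rho> \<tau>) \<partial>lborel)"
    by (intro add_mono bound[OF multiplier_axioms] bound[OF E.multiplier_axioms] N1 N3 t) measurable
  also have "\<dots> = ennreal S * ((\<integral>\<^sup>+\<tau>. ennreal (N1 (t - \<tau>) * \<rho> \<tau>) \<partial>lborel) + (\<integral>\<^sup>+\<tau>. ennreal (N3 t (T - \<tau>) * \<rho> \<tau>) \<partial>lborel))"
    by (simp add: distrib_left)
  also have "\<dots> \<le> ennreal S * ennreal (A * \<rho> t)" by (intro mult_left_mono schur t) auto
  also have "\<dots> = ennreal (S * A * \<rho> t)" using S by (simp add: ennreal_mult'[symmetric] mult.assoc)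
  finally show ?thesis using S A rho0[of t] by (subst (asm) ennreal_le_iff) auto
qed

lemma e_cont_diag: "continuous_on {0<..T} (\<lambda>t. diag (\<lambda>j. ee j t) x)"
  unfolding continuous_on_def
proof
  fix t0 assume t0: "t0 \<in> {0<..T}"
  define C where "C = M * (t0 / 2) powr (- \<alpha>)"
  have C: "\<bar>ee j t\<bar> \<le> C" if "t \<in> {0<..T}" "t > t0 / 2" for j t
  proof -
    have "\<bar>ee j t\<bar> \<le> M * t powr (- \<alpha>)" by (rule e_bd[OF that(1)])
    also have "\<dots> \<le> C" unfolding C_def using that t0 M \<alpha>0 by (intro mult_left_mono powr_mono2') auto
    finally show ?thesis .
  qed
  show "((\<lambda>t. diag (\<lambda>j. ee j t) x) \<longlongrightarrow> diag (\<lambda>j. ee j t0) x) (at t0 within {0<..T})"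
  proof (rule diag_tendsto[where C = C])
    show "((\<lambda>t. ee j t) \<longlongrightarrow> ee j t0) (at t0 within {0<..T})" for j
    proof -
      have "continuous_on {0<..T} (ee j)" by (rule continuous_on_subset[OF e_cont]) auto
      then show ?thesis using t0 by (auto simp: continuous_on_def)
    qed
    have "\<forall>\<^sub>F t in at t0 within {0<..T}. t > t0 / 2"
      by (rule order_tendstoD(1)[OF tendsto_ident_at]) (use t0 in auto)
    moreover have "\<forall>\<^sub>F t in at t0 within {0<..T}. t \<in> {0<..T}" by (simp add: eventually_at_filter)
    ultimately show "\<forall>\<^sub>F t in at t0 within {0<..T}. \<forall>j. \<bar>ee j t\<bar> \<le> C"
      by eventually_elim (use C in auto)
    show "\<bar>ee j t0\<bar> \<le> C" for j using C[OF t0] t0 by auto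
  qed (rule tendsto_const)
qed

lemma G_cont:
  assumes "adm T c C h" "c > 0" "continuous_on {0<..<T} h"
  shows "continuous_on {0<..T} (G h)"
  unfolding G_def by (intro continuous_intros VC_cont[OF assms T] e_cont_diag)

lemma G_diff:
  assumes h: "adm T c C h" "adm T c D k" and c: "c > 0" and t: "t \<in> {0<..T}"
  shows "G (\<lambda>\<tau>. h \<tau> - k \<tau>) t = G h t - G k t"
  unfolding G_def VC_diff[OF h c]
  by (rule ell2_eqI) (simp add: coord_e[OF t] algebra_simps)

text \<open>The iteration runs for v = u - \<psi>, because \<psi> itself may be more singular than
  \<rho> when b exceeds \<delta>. The contraction only concerns differences, in which \<psi>
  cancels. The constant D is chosen before \<psi> and C, so that the norm of u is bounded linearly
  in C.\<close>

theorem existence: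
  fixes f :: "real \<Rightarrow> ell2 \<Rightarrow> ell2" and b :: real
  assumes f_cont: "continuous_on ({0<..<T} \<times> UNIV) (\<lambda>(t, x). f t x)"
    and f0: "\<And>t. t \<in> {0<..<T} \<Longrightarrow> f t 0 = 0"
    and lip: "\<And>t x y. t \<in> {0<..<T} \<Longrightarrow> norm (f t x - f t y) \<le> g * norm (x - y)"
    and b: "0 \<le> b" "b < 1"
  shows "\<exists>D\<ge>0. \<forall>\<psi> C. continuous_on {0<..T} \<psi> \<longrightarrow> C \<ge> 0 \<longrightarrow> (\<forall>t\<in>{0<..T}. norm (\<psi> t) \<le> C * t powr (- (\<alpha> * b))) \<longrightarrow>
    (\<exists>u. continuous_on {0<..T} u \<and>
      (\<forall>t\<in>{0<..T}. u t = \<psi> t + G (\<lambda>\<tau>. indicator {0<..<T} \<tau> *\<^sub>R f \<tau> (u \<tau>)) t) \<and>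
      (\<forall>t\<in>{0<..T}. norm (u t) \<le> D * C * t powr (- (\<alpha> * max b \<delta>))))"
proof -
  define cb where "cb = 1 - \<alpha> * b"
  define c where "c = 1 - \<alpha> * max b \<delta>"
  have small: "\<alpha> * x < 1" "\<alpha> * x \<le> \<alpha>" if "0 \<le> x" "x < 1" for x
  proof -
    have "\<alpha> * x \<le> \<alpha> * 1" using that \<alpha>0 by (intro mult_left_mono) auto
    then show "\<alpha> * x < 1" "\<alpha> * x \<le> \<alpha>" using \<alpha>1 by auto
  qed
  have cb: "cb > 0" "1 - \<alpha> \<le> cb" using small[of b] b by (auto simp: cb_def)
  have c: "c > 0" using small[of "max b \<delta>"] b \<delta> by (auto simp: c_def)
  obtain D1 where D1: "D1 \<ge> 0" "\<And>C h t. adm T cb C h \<Longrightarrow> t \<in> {0<..T} \<Longrightarrow> norm (G h t) \<le> D1 * C * \<rho> t"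
    using G_norm_pow[OF cb] by blast
  define \<theta> where "\<theta> = g * A"
  have \<theta>: "0 \<le> \<theta>" "\<theta> < 1" using g A gA by (auto simp: \<theta>_def)
  have le_c: "t powr (- (\<alpha> * x)) \<le> T powr (\<alpha> * (max b \<delta> - x)) * t powr (- (\<alpha> * max b \<delta>))"
    if t: "t \<in> {0<..T}" and x: "x \<le> max b \<delta>" for t x
  proof -
    have "t powr (- (\<alpha> * x)) = t powr (\<alpha> * (max b \<delta> - x)) * t powr (- (\<alpha> * max b \<delta>))"
      by (simp add: right_diff_distrib flip: powr_add)
    also have "\<dots> \<le> T powr (\<alpha> * (max b \<delta> - x)) * t powr (- (\<alpha> * max b \<delta>))"
      using t x \<alpha>0 by (intro mult_right_mono powr_mono2) auto
    finally show ?thesis .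
  qed
  define E1 E2 where "E1 = T powr (\<alpha> * (max b \<delta> - b))" "E2 = C0 * T powr (\<alpha> * (max b \<delta> - \<delta>))"
  have E: "E1 \<ge> 0" "E2 \<ge> 0" using C0 by (auto simp: E1_E2_def)
  have rho_c: "\<rho> t \<le> E2 * t powr (- (\<alpha> * max b \<delta>))" if t: "t \<in> {0<..T}" for t
    using order_trans[OF rho_le[OF t] mult_left_mono[OF le_c[OF t, of \<delta>] C0]] by (simp add: E1_E2_def mult.assoc)
  \<comment> \<open>E1 and E2 convert t^(-\<alpha>b) and \<rho> into the common power t^(-\<alpha>
    max(b,\<delta>)). The factor g D1 bounds the first iterate, and 1/(1-\<theta>) sums the
    geometric series of increments.\<close>
  define D where "D = E1 + g * D1 / (1 - \<theta>) * E2"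
  have f_norm: "norm (f t x) \<le> g * norm x" if "t \<in> {0<..<T}" for t x
    using lip[OF that, of x 0] f0[OF that] by simp
  have f_cont': "continuous_on {0<..<T} (\<lambda>t. f t (w t))" if "continuous_on {0<..T} w" for w
  proof -
    have "continuous_on {0<..<T} ((\<lambda>(t, x). f t x) \<circ> (\<lambda>t. (t, w t)))"
      by (intro continuous_on_compose continuous_on_subset[OF f_cont] continuous_intros
            continuous_on_subset[OF that]) auto
    then show ?thesis by (simp add: o_def)
  qed
  have main: "\<exists>u. continuous_on {0<..T} u \<and>
      (\<forall>t\<in>{0<..T}. u t = \<psi> t + G (\<lambda>\<tau>. indicator {0<..<T} \<tau> *\<^sub>R f \<tau> (u \<tau>)) t) \<and>
      (\<forall>t\<in>{0<..T}. norm (u t) \<le> D * C * t powr (- (\<alpha> * max b \<delta>)))"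
    if \<psi>: "continuous_on {0<..T} \<psi>" and C: "C \<ge> 0" and \<psi>_le: "\<forall>t\<in>{0<..T}. norm (\<psi> t) \<le> C * t powr (- (\<alpha> * b))"
    for \<psi> C
  proof -
    define N where "N v \<tau> = indicator {0<..<T} \<tau> *\<^sub>R f \<tau> (\<psi> \<tau> + v \<tau>)" for v \<tau>
    have N_adm: "adm T c (g * (C * E1 + S * E2)) (N v)" and N_cont: "continuous_on {0<..<T} (N v)"
      if v: "continuous_on {0<..T} v" "\<And>t. t \<in> {0<..T} \<Longrightarrow> norm (v t) \<le> S * \<rho> t" "S \<ge> 0" for v S
    proof -
      have fc: "continuous_on {0<..<T} (\<lambda>\<tau>. f \<tau> (\<psi> \<tau> + v \<tau>))"
        by (intro f_cont' continuous_intros \<psi> v)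
      show "adm T c (g * (C * E1 + S * E2)) (N v)"
        unfolding N_def
      proof (rule admI[OF fc])
        show "g * (C * E1 + S * E2) \<ge> 0" using g C E v by simp
        fix \<tau> assume \<tau>: "\<tau> \<in> {0<..<T}"
        then have \<tau>': "\<tau> \<in> {0<..T}" by simp
        have "norm (f \<tau> (\<psi> \<tau> + v \<tau>)) \<le> g * norm (\<psi> \<tau> + v \<tau>)" by (rule f_norm[OF \<tau>])
        also have "norm (\<psi> \<tau> + v \<tau>) \<le> C * \<tau> powr (- (\<alpha> * b)) + S * \<rho> \<tau>"
          using \<psi>_le \<tau>' v(2)[OF \<tau>'] by (intro norm_triangle_le add_mono) auto
        also have "\<dots> \<le> C * (E1 * \<tau> powr (- (\<alpha> * max b \<delta>))) + S * (E2 * \<tau> powr (- (\<alpha> * max b \<delta>)))"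
          using le_c[OF \<tau>', of b] rho_c[OF \<tau>'] C v(3) by (intro add_mono mult_left_mono) (auto simp: E1_E2_def)
        also have "\<dots> = (C * E1 + S * E2) * \<tau> powr (c - 1)" by (simp add: c_def algebra_simps)
        finally show "norm (f \<tau> (\<psi> \<tau> + v \<tau>)) \<le> g * (C * E1 + S * E2) * \<tau> powr (c - 1)"
          using g by (simp add: mult_left_mono mult.assoc)
      qed
      show "continuous_on {0<..<T} (N v)"
        by (rule continuous_on_eq[OF fc]) (simp add: N_def)
    qed
    have N_lip: "norm (G (N v) t - G (N w) t) \<le> \<theta> * R * \<rho> t"
      if v: "continuous_on {0<..T} v" "\<And>t. t \<in> {0<..T} \<Longrightarrow> norm (v t) \<le> S * \<rho> t" "S \<ge> 0"
        and w: "continuous_on {0<..T} w" "\<And>t. t \<in> {0<..T} \<Longrightarrow> norm (w t) \<le> S' * \<rho> t" "S' \<ge> 0"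
        and vw: "\<And>t. t \<in> {0<..T} \<Longrightarrow> norm (v t - w t) \<le> R * \<rho> t" and R: "R \<ge> 0" and t: "t \<in> {0<..T}"
      for v w S S' R t
    proof -
      note av = N_adm[OF v] and aw = N_adm[OF w]
      have "norm (G (\<lambda>\<tau>. N v \<tau> - N w \<tau>) t) \<le> (g * R) * A * \<rho> t"
      proof (rule G_norm_rho[OF adm_diff[OF av aw] c t])
        show "AE \<tau> in lborel. \<tau> \<in> {0<..<T} \<longrightarrow> norm (N v \<tau> - N w \<tau>) \<le> g * R * \<rho> \<tau>"
        proof (intro AE_I2 impI)
          fix \<tau> assume \<tau>: "\<tau> \<in> {0<..<T}"
          have "norm (N v \<tau> - N w \<tau>) \<le> g * norm (v \<tau> - w \<tau>)"
            using lip[OF \<tau>, of "\<psi> \<tau> + v \<tau>" "\<psi> \<tau> + w \<tau>"] \<tau> by (simp add: N_def)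
          also have "\<dots> \<le> g * (R * \<rho> \<tau>)" using vw[of \<tau>] \<tau> g by (intro mult_left_mono) auto
          finally show "norm (N v \<tau> - N w \<tau>) \<le> g * R * \<rho> \<tau>" by (simp add: mult.assoc)
        qed
      qed (use g R in auto)
      moreover have "G (\<lambda>\<tau>. N v \<tau> - N w \<tau>) t = G (N v) t - G (N w) t" by (rule G_diff[OF av aw c t])
      ultimately show ?thesis by (simp only: \<theta>_def mult_ac)
    qed
    define v where "v n = ((\<lambda>w. G (N w)) ^^ n) (\<lambda>_. 0)" for n
    have v0: "v 0 = (\<lambda>_. 0)" and vS: "v (Suc n) = G (N (v n))" for n by (simp_all add: v_def)
    define R where "R = g * D1 * C"
    have R: "R \<ge> 0" using g D1 C by (simp add: R_def)
    have first: "norm (G (N (\<lambda>_. 0)) t) \<le> R * \<rho> t" if "t \<in> {0<..T}" for t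
    proof -
      have "adm T cb (g * C) (N (\<lambda>_. 0))"
        unfolding N_def add_0_right
      proof (rule admI[OF f_cont'[OF \<psi>]])
        fix \<tau> assume \<tau>: "\<tau> \<in> {0<..<T}"
        have "norm (f \<tau> (\<psi> \<tau>)) \<le> g * norm (\<psi> \<tau>)" by (rule f_norm[OF \<tau>])
        also have "\<dots> \<le> g * (C * \<tau> powr (- (\<alpha> * b)))" using \<psi>_le \<tau> g by (intro mult_left_mono) auto
        finally show "norm (f \<tau> (\<psi> \<tau>)) \<le> g * C * \<tau> powr (cb - 1)" by (simp add: cb_def mult.assoc)
      qed (use g C in auto)
      from D1(2)[OF this that] show ?thesis by (simp add: R_def mult_ac)
    qed
    have v_props: "continuous_on {0<..T} (v n) \<and> (\<exists>S\<ge>0. \<forall>t\<in>{0<..T}. norm (v n t) \<le> S * \<rho> t) \<and>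
        (\<forall>t\<in>{0<..T}. norm (v (Suc n) t - v n t) \<le> \<theta> ^ n * R * \<rho> t)" for n
    proof (induction n)
      case 0
      then show ?case using first by (auto simp: v0 vS intro!: exI[of _ 0])
    next
      case (Suc n)
      then obtain S where S: "S \<ge> 0" "\<And>t. t \<in> {0<..T} \<Longrightarrow> norm (v n t) \<le> S * \<rho> t"
        and d: "\<And>t. t \<in> {0<..T} \<Longrightarrow> norm (v (Suc n) t - v n t) \<le> \<theta> ^ n * R * \<rho> t"
        and cn: "continuous_on {0<..T} (v n)" by blast
      have cS: "continuous_on {0<..T} (v (Suc n))"
        unfolding vS by (rule G_cont[OF N_adm[OF cn S(2,1)] c N_cont[OF cn S(2,1)]])
      have S': "norm (v (Suc n) t) \<le> (\<theta> ^ n * R + S) * \<rho> t" if "t \<in> {0<..T}" for t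
        using d[OF that] S(2)[OF that] norm_triangle_ineq[of "v (Suc n) t - v n t" "v n t"]
        by (simp add: distrib_right)
      have S'0: "\<theta> ^ n * R + S \<ge> 0" using \<theta> R S by simp
      have "norm (v (Suc (Suc n)) t - v (Suc n) t) \<le> \<theta> ^ Suc n * R * \<rho> t" if "t \<in> {0<..T}" for t
        using N_lip[OF cS S' S'0 cn S(2,1) d _ that] \<theta> R unfolding vS[of "Suc n"] vS[of n] by (simp add: mult.assoc vS)
      then show ?case using cS S' S'0 by blast
    qed
    \<comment> \<open>Division by \<rho> turns the weighted norm into the sup norm, and the
      telescoping series of the iterates converges uniformly on (0,T].\<close>
    define W where "W t = (\<Sum>n. (v (Suc n) t - v n t) /\<^sub>R \<rho> t)" for t
    define vi where "vi t = \<rho> t *\<^sub>R W t" for t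
    have terms: "norm ((v (Suc n) t - v n t) /\<^sub>R \<rho> t) \<le> \<theta> ^ n * R" if t: "t \<in> {0<..T}" for n t
    proof -
      have "norm (v (Suc n) t - v n t) \<le> \<theta> ^ n * R * \<rho> t" using v_props[of n] t by blast
      moreover have "norm ((v (Suc n) t - v n t) /\<^sub>R \<rho> t) = norm (v (Suc n) t - v n t) / \<rho> t"
        using rho0[of t] by (simp add: divide_inverse mult.commute)
      ultimately show ?thesis using rho_pos[OF t] by (simp add: pos_divide_le_eq)
    qed
    have summ: "summable (\<lambda>n. \<theta> ^ n * R)" using \<theta> by (intro summable_mult2 summable_geometric) simp
    have unif: "uniform_limit {0<..T} (\<lambda>n t. \<Sum>i<n. (v (Suc i) t - v i t) /\<^sub>R \<rho> t) W sequentially"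
      unfolding W_def by (rule Weierstrass_m_test[OF terms summ])
    have part: "(\<Sum>i<n. (v (Suc i) t - v i t) /\<^sub>R \<rho> t) = v n t /\<^sub>R \<rho> t" for n t
      by (induction n) (simp_all add: v0 scaleR_diff_right)
    have rho_c': "continuous_on {0<..T} \<rho>" by (rule continuous_on_subset[OF rho_cont]) auto
    have "continuous_on {0<..T} W"
    proof (rule uniform_limit_theorem[OF _ unif])
      show "\<forall>\<^sub>F n in sequentially. continuous_on {0<..T} (\<lambda>t. \<Sum>i<n. (v (Suc i) t - v i t) /\<^sub>R \<rho> t)"
        unfolding part using v_props rho_c' rho_pos
        by (intro always_eventually allI continuous_intros) (auto simp: less_imp_neq[THEN not_sym])
    qed simp
    then have vi_cont: "continuous_on {0<..T} vi"
      unfolding vi_def by (intro continuous_intros rho_c')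
    have vi_le: "norm (vi t) \<le> (R / (1 - \<theta>)) * \<rho> t" if t: "t \<in> {0<..T}" for t
    proof -
      have "norm (W t) \<le> (\<Sum>n. \<theta> ^ n * R)" unfolding W_def by (rule norm_suminf_le[OF terms[OF t] summ])
      also have "\<dots> = R / (1 - \<theta>)"
        using \<theta> suminf_mult2[OF summable_geometric[of \<theta>], of R] by (simp add: suminf_geometric)
      finally have "\<rho> t * norm (W t) \<le> \<rho> t * (R / (1 - \<theta>))" using rho0[of t] by (rule mult_left_mono)
      then show ?thesis using rho0[of t] unfolding vi_def by (simp add: mult.commute)
    qed
    have conv: "\<exists>N. \<forall>n\<ge>N. \<forall>t\<in>{0<..T}. norm (v n t - vi t) \<le> \<epsilon> * \<rho> t" if \<epsilon>: "\<epsilon> > 0" for \<epsilon>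
    proof -
      obtain N where N: "\<And>n t. n \<ge> N \<Longrightarrow> t \<in> {0<..T} \<Longrightarrow> dist (v n t /\<^sub>R \<rho> t) (W t) < \<epsilon>"
        using uniform_limitD[OF unif \<epsilon>] unfolding part eventually_sequentially by blast
      have "norm (v n t - vi t) \<le> \<epsilon> * \<rho> t" if "n \<ge> N" and t: "t \<in> {0<..T}" for n t
      proof -
        have "v n t - vi t = \<rho> t *\<^sub>R (v n t /\<^sub>R \<rho> t - W t)"
          using rho_pos[OF t] by (simp add: vi_def scaleR_diff_right)
        then have "norm (v n t - vi t) = \<rho> t * dist (v n t /\<^sub>R \<rho> t) (W t)"
          using rho0[of t] by (simp add: dist_norm)
        also have "\<dots> \<le> \<rho> t * \<epsilon>" using N[OF that] rho0[of t] by (intro mult_left_mono) auto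
        finally show ?thesis by (simp add: mult.commute)
      qed
      then show ?thesis by blast
    qed
    have R': "R / (1 - \<theta>) \<ge> 0" using R \<theta> by simp
    have fix1: "vi t = G (N vi) t" if t: "t \<in> {0<..T}" for t
    proof -
      have "norm (vi t - G (N vi) t) \<le> 0"
      proof (rule field_le_epsilon)
        fix \<epsilon>' :: real assume \<epsilon>': "\<epsilon>' > 0"
        define \<epsilon> where "\<epsilon> = \<epsilon>' / (2 * \<rho> t)"
        have \<epsilon>: "\<epsilon> > 0" using \<epsilon>' rho_pos[OF t] by (simp add: \<epsilon>_def)
        obtain n where n: "\<And>m t. m \<ge> n \<Longrightarrow> t \<in> {0<..T} \<Longrightarrow> norm (v m t - vi t) \<le> \<epsilon> * \<rho> t"
          using conv[OF \<epsilon>] by blast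
        obtain S where S: "S \<ge> 0" "\<And>t. t \<in> {0<..T} \<Longrightarrow> norm (v n t) \<le> S * \<rho> t" using v_props[of n] by blast
        have cn: "continuous_on {0<..T} (v n)" using v_props[of n] by blast
        have "norm (G (N (v n)) t - G (N vi) t) \<le> \<theta> * \<epsilon> * \<rho> t"
          by (rule N_lip[OF cn S(2,1) vi_cont vi_le R' _ _ t]) (use n \<epsilon> in auto)
        also have "\<dots> \<le> 1 * \<epsilon> * \<rho> t" using \<theta> \<epsilon> rho0[of t] by (intro mult_right_mono) auto
        finally have 1: "norm (v (Suc n) t - G (N vi) t) \<le> \<epsilon> * \<rho> t" by (simp add: vS)
        have 2: "norm (v (Suc n) t - vi t) \<le> \<epsilon> * \<rho> t" using n[of "Suc n" t] t by simp
        have "norm (vi t - G (N vi) t) \<le> norm (v (Suc n) t - G (N vi) t) + norm (v (Suc n) t - vi t)"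
          using norm_triangle_ineq4[of "v (Suc n) t - G (N vi) t" "v (Suc n) t - vi t"] by simp
        also have "\<dots> \<le> 2 * (\<epsilon> * \<rho> t)" using 1 2 by simp
        also have "\<dots> = \<epsilon>'" using rho_pos[OF t] by (simp add: \<epsilon>_def)
        finally show "norm (vi t - G (N vi) t) \<le> 0 + \<epsilon>'" by simp
      qed
      then show ?thesis by simp
    qed
    define u where "u t = \<psi> t + vi t" for t
    have Nu: "N vi = (\<lambda>\<tau>. indicator {0<..<T} \<tau> *\<^sub>R f \<tau> (u \<tau>))" by (simp add: N_def u_def fun_eq_iff)
    show ?thesis
    proof (intro exI[of _ u] conjI ballI)
      show "continuous_on {0<..T} u" unfolding u_def by (intro continuous_intros \<psi> vi_cont)
      fix t assume t: "t \<in> {0<..T}"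
      show "u t = \<psi> t + G (\<lambda>\<tau>. indicator {0<..<T} \<tau> *\<^sub>R f \<tau> (u \<tau>)) t"
        using fix1[OF t] unfolding Nu by (simp add: u_def)
      have "norm (u t) \<le> norm (\<psi> t) + norm (vi t)" unfolding u_def by (rule norm_triangle_ineq)
      also have "\<dots> \<le> C * t powr (- (\<alpha> * b)) + (R / (1 - \<theta>)) * \<rho> t"
        using \<psi>_le t vi_le[OF t] by (intro add_mono) auto
      also have "\<dots> \<le> C * (E1 * t powr (- (\<alpha> * max b \<delta>))) + (R / (1 - \<theta>)) * (E2 * t powr (- (\<alpha> * max b \<delta>)))"
        using le_c[OF t, of b] rho_c[OF t] C R' by (intro add_mono mult_left_mono) (auto simp: E1_E2_def)
      also have "\<dots> = D * C * t powr (- (\<alpha> * max b \<delta>))" by (simp add: D_def R_def algebra_simps)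
      finally show "norm (u t) \<le> D * C * t powr (- (\<alpha> * max b \<delta>))" .
    qed
  qed
  moreover have "D \<ge> 0" using E g D1 \<theta> by (simp add: D_def)
  ultimately show ?thesis by blast
qed

text \<open>Here d is the difference of two solutions, h the difference of their forcing terms F(u)
  - k u, and \<xi> the convolution of h at time T. As h is merely integrable, convolutions with h
  are given by their coordinates, and become admissible Bochner integrals after the Gronwall step.
  Iterating the contraction then produces the factors (g A)^n.\<close>

theorem uniqueness:
  fixes d h :: "real \<Rightarrow> ell2" and \<xi> :: ell2
  assumes h [measurable]: "h \<in> borel_measurable borel" and h_int: "integrable lborel h"
    and h0: "\<And>t. t \<notin> {0<..<T} \<Longrightarrow> h t = 0"
    and \<xi>: "\<And>j. coord \<xi> j = (\<integral>\<tau>. K j (T - \<tau>) * coord (h \<tau>) j \<partial>lborel)"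
    and d: "AE t in lborel. t \<in> {0<..<T} \<longrightarrow> (\<forall>j. coord (d t) j =
      (\<integral>\<tau>. K j (t - \<tau>) * coord (h \<tau>) j \<partial>lborel) - ee j t * coord \<xi> j)"
    and le: "AE t in lborel. t \<in> {0<..<T} \<longrightarrow> norm (h t) \<le> g * norm (d t)"
  shows "AE t in lborel. t \<in> {0<..<T} \<longrightarrow> d t = 0"
proof -
  define y where "y t = ennreal (norm (h t))" for t
  have [measurable]: "y \<in> borel_measurable borel" unfolding y_def by measurable
  have first: "AE t in lborel. y t \<le> ennreal (g * M * norm \<xi> * pk (1 - \<alpha>) t) +
      ennreal (g * M) * (\<integral>\<^sup>+\<tau>. ennreal (pk \<alpha> (t - \<tau>)) * y \<tau> \<partial>lborel)"
    using d le
  proof eventually_elim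
    case (elim t)
    show ?case
    proof (cases "t \<in> {0<..<T}")
      case True
      define I where "I = (\<integral>\<^sup>+\<tau>. ennreal (pk \<alpha> (t - \<tau>)) * y \<tau> \<partial>lborel)"
      show ?thesis
      \<comment> \<open>If g = 0 then h vanishes, and if I is infinite the right-hand side is
        infinite. In the remaining case the convolution at time t exists as a Bochner integral in
        \<open>ell2\<close>.\<close>
      proof (cases "g = 0 \<or> I = top")
        case True
        then show ?thesis
        proof
          assume "g = 0"
          then have "y t = 0" using elim \<open>t \<in> {0<..<T}\<close> by (simp add: y_def)
          then show ?thesis by simp
        next
          assume "I = top"
          show ?thesis
          proof (cases "g = 0")
            case True
            then have "y t = 0" using elim \<open>t \<in> {0<..<T}\<close> by (simp add: y_def)
            then show ?thesis by simp
          next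
            case False
            then have "ennreal (g * M) \<noteq> 0" using g Mpos by (simp add: ennreal_eq_0_iff not_le)
            then show ?thesis unfolding I_def[symmetric] \<open>I = top\<close> by (simp add: ennreal_mult_top)
          qed
        qed
      next
        case False
        have t: "t \<in> {0<..T}" using True by simp
        have nb: "(\<integral>\<^sup>+\<tau>. norm (diag (\<lambda>j. K j (t - \<tau>)) (h \<tau>)) \<partial>lborel) \<le> ennreal M * I"
        proof -
          have "(\<integral>\<^sup>+\<tau>. norm (diag (\<lambda>j. K j (t - \<tau>)) (h \<tau>)) \<partial>lborel) \<le> (\<integral>\<^sup>+\<tau>. ennreal M * (ennreal (pk \<alpha> (t - \<tau>)) * y \<tau>) \<partial>lborel)"
          proof (rule nn_integral_mono)
            fix \<tau>
            show "ennreal (norm (diag (\<lambda>j. K j (t - \<tau>)) (h \<tau>))) \<le> ennreal M * (ennreal (pk \<alpha> (t - \<tau>)) * y \<tau>)"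
              unfolding y_def using ennreal_leI[OF norm_m[of "t - \<tau>" "h \<tau>"]] M by (simp add: ennreal_mult mult.assoc)
          qed
          also have "\<dots> = ennreal M * I" unfolding I_def by (rule nn_integral_cmult) measurable
          finally show ?thesis .
        qed
        also have "ennreal M * I < top" using False by (simp add: ennreal_mult_less_top less_top)
        finally have fin: "(\<integral>\<^sup>+\<tau>. norm (diag (\<lambda>j. K j (t - \<tau>)) (h \<tau>)) \<partial>lborel) < top" .
        have int: "integrable lborel (\<lambda>\<tau>. diag (\<lambda>j. K j (t - \<tau>)) (h \<tau>))"
          using integrand_meas[OF h, of t] fin by (intro integrableI_bounded) auto
        have "d t = VC K h t - diag (\<lambda>j. ee j t) \<xi>"
        proof (rule ell2_eqI)
          fix j
          have "coord (VC K h t) j = (\<integral>\<tau>. K j (t - \<tau>) * coord (h \<tau>) j \<partial>lborel)"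
            unfolding VC_def using integral_bounded_linear[OF bounded_linear_coord int, of j] by (simp add: coord_m)
          then show "coord (d t) j = coord (VC K h t - diag (\<lambda>j. ee j t) \<xi>) j"
            using elim True by (simp add: coord_e[OF t])
        qed
        then have "norm (d t) \<le> norm (VC K h t) + M * t powr (- \<alpha>) * norm \<xi>"
          using norm_triangle_ineq4[of "VC K h t" "diag (\<lambda>j. ee j t) \<xi>"] norm_e[OF t, of \<xi>] by simp
        then have "norm (h t) \<le> g * (norm (VC K h t) + M * t powr (- \<alpha>) * norm \<xi>)"
          using elim True g by (meson mult_left_mono order_trans)
        then have "y t \<le> ennreal (g * (norm (VC K h t) + M * t powr (- \<alpha>) * norm \<xi>))"
          unfolding y_def by (rule ennreal_leI)
        also have "g * (norm (VC K h t) + M * t powr (- \<alpha>) * norm \<xi>) =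
            g * M * norm \<xi> * pk (1 - \<alpha>) t + g * norm (VC K h t)"
          using t by (simp add: pk_def algebra_simps)
        also have "ennreal \<dots> = ennreal (g * M * norm \<xi> * pk (1 - \<alpha>) t) + ennreal (g * norm (VC K h t))"
          using g M by (intro ennreal_plus) auto
        also have "ennreal (g * norm (VC K h t)) = ennreal g * ennreal (norm (VC K h t))"
          using g by (rule ennreal_mult')
        also have "ennreal (g * M * norm \<xi> * pk (1 - \<alpha>) t) + ennreal g * ennreal (norm (VC K h t)) \<le>
            ennreal (g * M * norm \<xi> * pk (1 - \<alpha>) t) + ennreal g * (ennreal M * I)"
          unfolding VC_def
          by (intro add_left_mono mult_left_mono order_trans[OF integral_norm_bound_ennreal[OF int] nb]) simp
        also have "ennreal g * (ennreal M * I) = ennreal (g * M) * I"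
          unfolding ennreal_mult'[OF g] by (rule mult.assoc[symmetric])
        finally show ?thesis unfolding I_def[symmetric] .
      qed
    qed (simp add: y_def h0)
  qed
  have "\<exists>C\<ge>0. AE t in lborel. y t \<le> ennreal (C * pk (1 - \<alpha>) t)"
  proof (rule singular_gronwall[OF \<alpha>0 _ _ T _ _ _ _ _ first])
    show "(\<integral>\<^sup>+t. y t \<partial>lborel) < top"
      using h_int unfolding y_def integrable_iff_bounded by simp
  qed (use \<alpha>0 \<alpha>1 g M h0 in \<open>auto simp: y_def\<close>)
  then obtain C where C: "C \<ge> 0" "AE t in lborel. norm (h t) \<le> C * pk (1 - \<alpha>) t"
    by (auto simp: y_def ennreal_le_iff)
  \<comment> \<open>Admissibility is a bound at every time, so h is replaced by 0 on the null set
    where the bound fails.\<close>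
  define k where "k t = (if norm (h t) \<le> C * pk (1 - \<alpha>) t then h t else 0)" for t
  have k_adm: "adm T (1 - \<alpha>) C k"
    unfolding adm_def k_def using C h0 by auto
  have kh: "AE t in lborel. k t = h t" using C(2) by eventually_elim (simp add: k_def)
  have c: "1 - \<alpha> > 0" using \<alpha>1 by simp
  have k_meas: "k \<in> borel_measurable borel" using k_adm by (simp add: adm_def)
  have int_eq: "(\<integral>\<tau>. K j (t - \<tau>) * coord (h \<tau>) j \<partial>lborel) = coord (VC K k t) j" for t j
    unfolding VC_coord[OF k_adm c] using kh k_meas
    by (intro integral_cong_AE) auto
  have \<xi>_eq: "\<xi> = VC K k T" by (rule ell2_eqI) (simp add: \<xi> int_eq)
  have dG: "AE t in lborel. t \<in> {0<..<T} \<longrightarrow> d t = G k t"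
    using d by eventually_elim (auto intro!: ell2_eqI simp: G_def int_eq coord_e \<xi>_eq)
  obtain D where D: "D \<ge> 0" "\<And>t. t \<in> {0<..T} \<Longrightarrow> norm (G k t) \<le> D * C * \<rho> t"
    using G_norm_pow[OF c] k_adm by blast
  define S where "S = D * C"
  have S: "S \<ge> 0" using D C by (simp add: S_def)
  have iter: "AE t in lborel. t \<in> {0<..<T} \<longrightarrow> norm (d t) \<le> (g * A) ^ n * S * \<rho> t" for n
  proof (induction n)
    case 0
    show ?case using dG by eventually_elim (auto simp: S_def D)
  next
    case (Suc n)
    have "AE t in lborel. t \<in> {0<..<T} \<longrightarrow> norm (k t) \<le> g * ((g * A) ^ n * S) * \<rho> t"
      using Suc le kh
    proof eventually_elim
      case (elim t)
      show ?case
      proof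
        assume t: "t \<in> {0<..<T}"
        have "norm (k t) \<le> g * norm (d t)" using elim t by simp
        also have "\<dots> \<le> g * ((g * A) ^ n * S * \<rho> t)" using elim t g by (intro mult_left_mono) auto
        finally show "norm (k t) \<le> g * ((g * A) ^ n * S) * \<rho> t" by (simp add: mult.assoc)
      qed
    qed
    then have "norm (G k t) \<le> g * ((g * A) ^ n * S) * A * \<rho> t" if "t \<in> {0<..T}" for t
      using g A S by (intro G_norm_rho[OF k_adm c that]) auto
    then have Gk: "norm (G k t) \<le> (g * A) ^ Suc n * S * \<rho> t" if "t \<in> {0<..<T}" for t
      using that by (simp add: mult_ac)
    show ?case using dG by eventually_elim (use Gk in auto)
  qed
  then have "AE t in lborel. \<forall>n. t \<in> {0<..<T} \<longrightarrow> norm (d t) \<le> (g * A) ^ n * S * \<rho> t"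
    unfolding AE_all_countable by blast
  then show ?thesis
  proof eventually_elim
    case (elim t)
    show ?case
    proof
      assume t: "t \<in> {0<..<T}"
      have "(\<lambda>n. (g * A) ^ n * S * \<rho> t) \<longlonglongrightarrow> 0"
        using g A gA by (intro tendsto_mult_left_zero LIMSEQ_power_zero) auto
      then have "norm (d t) \<le> 0"
        by (rule LIMSEQ_le_const) (use elim t in auto)
      then show "d t = 0" by simp
    qed
  qed
qed

end

lemma one_plus_le_powr:
  assumes "v > (0::real)" "0 \<le> \<theta>" "\<theta> \<le> 1"
  shows "1 / (1 + v) \<le> v powr (- \<theta>)"
proof -
  have "v powr \<theta> \<le> 1 + v"
  proof (cases "v \<le> 1")
    case True
    then have "v powr \<theta> \<le> 1" using assms by (intro powr_le1) auto
    then show ?thesis using assms by linarith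
  next
    case False
    then have "v powr \<theta> \<le> v powr 1" using assms by (intro powr_mono) auto
    then show ?thesis using assms by simp
  qed
  then show ?thesis using assms by (simp add: powr_minus_divide frac_le)
qed

text \<open>B(a, .) decreases and B(a, 1) = 1/a. With a = \<alpha>q this lets the Beta factor of
  \<open>A\<Theta>\<close> dominate 1/(\<alpha>q), as required for the second weight.\<close>

lemma Beta_reflect_ge:
  assumes "0 < a" "a < (1::real)"
  shows "1 / a \<le> Beta a (1 - a)"
proof -
  have "Beta a 1 \<le> Beta a (1 - a)" using assms by (intro Beta_real_mono) auto
  moreover have "Beta a 1 = 1 / a"
  proof -
    have "Gamma (a + 1) = a * Gamma a" using assms by (intro Gamma_plus1) (auto elim!: nonpos_Ints_cases)
    moreover have "Gamma a \<noteq> 0" by (rule less_imp_neq[THEN not_sym], rule Gamma_real_pos[OF assms(1)])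
    ultimately show ?thesis by (simp add: Beta_def)
  qed
  ultimately show ?thesis by simp
qed

section \<open>Estimates for the solution operators\<close>

locale solution_operators =
  fixes \<alpha> T \<kappa> M2 C p q :: real and mu \<Psi> :: "nat \<Rightarrow> real"
  assumes \<alpha>: "0 < \<alpha>" "\<alpha> < 1" and T: "T > 0" and M2: "M2 > 0" and C: "C > 0"
    and mu0: "mu 0 > 0" and mu_ge: "\<And>j. mu 0 \<le> mu j"
    and ml1: "\<And>z. z \<ge> 0 \<Longrightarrow> \<bar>mittag_leffler \<alpha> 1 (- z)\<bar> \<le> M2 / (1 + z)"
    and mla: "\<And>z. z \<ge> 0 \<Longrightarrow> \<bar>mittag_leffler \<alpha> \<alpha> (- z)\<bar> \<le> M2 / (1 + z)"
    and \<Psi>: "\<And>j. \<bar>\<Psi> j\<bar> \<le> (if \<kappa> = 0 then C * mu j * T powr \<alpha> else C)"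
    and pq: "0 < p" "p < 1" "0 < q" "q < 1" "p + q = 1"
begin

definition K :: "nat \<Rightarrow> real \<Rightarrow> real" where "K j s = ml_K \<alpha> (mu j) s"

definition ee :: "nat \<Rightarrow> real \<Rightarrow> real" where "ee j t = \<Psi> j * ml_E \<alpha> (mu j) t"

lemma mu_pos: "mu j > 0"
  using mu0 mu_ge[of j] by linarith

lemma K_bound: "\<bar>K j s\<bar> \<le> M2 * pk \<alpha> s / (1 + mu j * s powr \<alpha>)"
proof -
  have "\<bar>mittag_leffler \<alpha> \<alpha> (- (mu j * s powr \<alpha>))\<bar> \<le> M2 / (1 + mu j * s powr \<alpha>)"
    by (rule mla) (use mu_pos[of j] in simp)
  then have "pk \<alpha> s * \<bar>mittag_leffler \<alpha> \<alpha> (- (mu j * s powr \<alpha>))\<bar> \<le> pk \<alpha> s * (M2 / (1 + mu j * s powr \<alpha>))"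
    by (rule mult_left_mono) simp
  then show ?thesis by (simp add: K_def ml_K_def abs_mult mult.commute)
qed

lemma E_bound: "\<bar>ml_E \<alpha> (mu j) t\<bar> \<le> M2 / (1 + mu j * t powr \<alpha>)"
  unfolding ml_E_def by (rule ml1) (use mu_pos[of j] in simp)

text \<open>\<open>\<theta>\<close> is the amount of regularity that is traded for integrability in time.\<close>

lemma K_bound_powr:
  assumes "0 \<le> \<theta>" "\<theta> \<le> 1"
  shows "\<bar>K j s\<bar> \<le> M2 * mu j powr (- \<theta>) * pk (\<alpha> * (1 - \<theta>)) s"
proof (cases "s > 0")
  case True
  have x: "mu j * s powr \<alpha> > 0" using True mu_pos[of j] by simp
  have "\<bar>K j s\<bar> \<le> M2 * pk \<alpha> s * (1 / (1 + mu j * s powr \<alpha>))" using K_bound[of j s] by simp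
  also have "\<dots> \<le> M2 * pk \<alpha> s * (mu j * s powr \<alpha>) powr (- \<theta>)"
    using M2 by (intro mult_left_mono one_plus_le_powr[OF x assms]) auto
  also have "(mu j * s powr \<alpha>) powr (- \<theta>) = mu j powr (- \<theta>) * s powr (- (\<alpha> * \<theta>))"
    using mu_pos[of j] by (simp add: powr_mult powr_powr)
  also have "M2 * pk \<alpha> s * (mu j powr (- \<theta>) * s powr (- (\<alpha> * \<theta>))) = M2 * mu j powr (- \<theta>) * pk (\<alpha> * (1 - \<theta>)) s"
  proof -
    have "pk (\<alpha> * (1 - \<theta>)) s = pk \<alpha> s * s powr (- (\<alpha> * \<theta>))"
      using True by (simp add: pk_def algebra_simps flip: powr_add)
    then show ?thesis by simp
  qed
  finally show ?thesis .
qed (simp add: K_def ml_K_def pk_def)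

lemma K_bound_powr0:
  assumes "0 \<le> \<theta>" "\<theta> \<le> 1"
  shows "\<bar>K j s\<bar> \<le> M2 * mu 0 powr (- \<theta>) * pk (\<alpha> * (1 - \<theta>)) s"
proof -
  have "mu j powr (- \<theta>) \<le> mu 0 powr (- \<theta>)" using assms mu0 mu_ge by (intro powr_mono2') auto
  then have "M2 * mu j powr (- \<theta>) * pk (\<alpha> * (1 - \<theta>)) s \<le> M2 * mu 0 powr (- \<theta>) * pk (\<alpha> * (1 - \<theta>)) s"
    using M2 by (intro mult_right_mono mult_left_mono) auto
  with K_bound_powr[OF assms, of j s] show ?thesis by linarith
qed

lemma K_cont: "continuous_on {0<..} (K j)"
  unfolding K_def using \<alpha> by (rule_tac continuous_on_ml_K) auto

lemma ee_cont: "continuous_on {0<..} (ee j)"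
  unfolding ee_def using \<alpha>
  by (intro continuous_intros continuous_on_subset[OF continuous_on_ml_E]) auto

lemma multiplier_K: "multiplier \<alpha> M K" if "M \<ge> M2" for M
proof
  show "\<bar>K j s\<bar> \<le> M * pk \<alpha> s" for j s
  proof -
    have "\<bar>K j s\<bar> \<le> M2 * pk \<alpha> s" using K_bound_powr[of 0 j s] mu_pos[of j] by simp
    also have "\<dots> \<le> M * pk \<alpha> s" using that by (intro mult_right_mono) auto
    finally show ?thesis .
  qed
qed (use \<alpha> M2 that K_cont in auto)

text \<open>The kernel of \<open>\<G>\<^sub>1\<close> followed by L^(\<beta>p). Absorbing the power
  p costs integrability in time: the exponent drops from \<alpha> to \<alpha>q.\<close>

definition Kp :: "nat \<Rightarrow> real \<Rightarrow> real" where "Kp j s = mu j powr p * K j s"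

lemma multiplier_Kp: "multiplier (\<alpha> * q) M2 Kp"
  unfolding Kp_def[abs_def]
proof
  show "\<bar>mu j powr p * K j s\<bar> \<le> M2 * pk (\<alpha> * q) s" for j s
  proof -
    have "mu j powr p * \<bar>K j s\<bar> \<le> mu j powr p * (M2 * mu j powr (- p) * pk (\<alpha> * (1 - p)) s)"
      using pq by (intro mult_left_mono K_bound_powr) auto
    also have "\<dots> = M2 * (mu j powr p * mu j powr (- p)) * pk (\<alpha> * (1 - p)) s" by simp
    also have "mu j powr p * mu j powr (- p) = 1" using mu_pos[of j] by (simp flip: powr_add)
    also have "1 - p = q" using pq by simp
    finally show ?thesis by (simp add: abs_mult)
  qed
qed (use \<alpha> M2 pq K_cont in \<open>auto intro!: continuous_intros\<close>)

text \<open>One shape for both cases. If \<kappa> = 0, the factor \<Psi>_j costs a full power of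
  \<mu>_j, of which the decay of the Mittag-Leffler function returns \<theta>. Otherwise \<Psi>_j is
  bounded, and the factors \<mu>_j^(1-\<theta>) and t^(-\<alpha>\<theta>) are inserted at the price
  of \<mu>_0^(\<theta>-1) and T^(\<alpha>\<theta>).\<close>

lemma ee_bound_powr:
  assumes t: "t \<in> {0<..T}" and \<theta>: "0 \<le> \<theta>" "\<theta> \<le> 1"
  shows "\<bar>ee j t\<bar> \<le> C * M2 * (T powr \<alpha> + mu 0 powr (\<theta> - 1) * T powr (\<alpha> * \<theta>)) * t powr (- (\<alpha> * \<theta>)) * mu j powr (1 - \<theta>)"
proof -
  define x where "x = mu j * t powr \<alpha>"
  have x: "x > 0" using t mu_pos[of j] by (simp add: x_def)
  have E1: "\<bar>ml_E \<alpha> (mu j) t\<bar> \<le> M2 * (1 / (1 + x))" using E_bound[of j t] by (simp add: x_def)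
  show ?thesis
  proof (cases "\<kappa> = 0")
    case True
    have "\<bar>ee j t\<bar> \<le> (C * mu j * T powr \<alpha>) * (M2 * (1 / (1 + x)))"
      unfolding ee_def abs_mult using \<Psi>[of j] True E1 C mu_pos[of j] by (intro mult_mono) auto
    also have "\<dots> \<le> (C * mu j * T powr \<alpha>) * (M2 * x powr (- \<theta>))"
      using C M2 mu_pos[of j] by (intro mult_left_mono one_plus_le_powr x \<theta>) auto
    also have "x powr (- \<theta>) = mu j powr (- \<theta>) * t powr (- (\<alpha> * \<theta>))"
      using mu_pos[of j] t by (simp add: x_def powr_mult powr_powr)
    also have "(C * mu j * T powr \<alpha>) * (M2 * (mu j powr (- \<theta>) * t powr (- (\<alpha> * \<theta>)))) =
        C * M2 * T powr \<alpha> * t powr (- (\<alpha> * \<theta>)) * (mu j * mu j powr (- \<theta>))" by simp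
    also have "mu j * mu j powr (- \<theta>) = mu j powr (1 - \<theta>)"
      using mu_pos[of j] by (simp add: powr_mult_base)
    also have "C * M2 * T powr \<alpha> * t powr (- (\<alpha> * \<theta>)) * mu j powr (1 - \<theta>) \<le>
        C * M2 * (T powr \<alpha> + mu 0 powr (\<theta> - 1) * T powr (\<alpha> * \<theta>)) * t powr (- (\<alpha> * \<theta>)) * mu j powr (1 - \<theta>)"
      using C M2 by (intro mult_right_mono mult_left_mono) auto
    finally show ?thesis .
  next
    case False
    have "\<bar>ee j t\<bar> \<le> C * (M2 * (1 / (1 + x)))"
      unfolding ee_def abs_mult using \<Psi>[of j] False E1 C by (intro mult_mono) auto
    also have "\<dots> \<le> C * (M2 * 1)" using C M2 x by (intro mult_left_mono) auto
    also have "\<dots> \<le> C * (M2 * ((mu 0 powr (\<theta> - 1) * mu j powr (1 - \<theta>)) * (T powr (\<alpha> * \<theta>) * t powr (- (\<alpha> * \<theta>)))))"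
    proof -
      have "1 = mu 0 powr (\<theta> - 1) * mu 0 powr (1 - \<theta>)" using mu0 by (simp flip: powr_add)
      also have "\<dots> \<le> mu 0 powr (\<theta> - 1) * mu j powr (1 - \<theta>)"
        using mu0 mu_ge \<theta> by (intro mult_left_mono powr_mono2) auto
      finally have 1: "1 \<le> mu 0 powr (\<theta> - 1) * mu j powr (1 - \<theta>)" .
      have "1 = t powr (\<alpha> * \<theta>) * t powr (- (\<alpha> * \<theta>))" using t by (simp flip: powr_add)
      also have "\<dots> \<le> T powr (\<alpha> * \<theta>) * t powr (- (\<alpha> * \<theta>))"
        using t \<alpha> \<theta> by (intro mult_right_mono powr_mono2) auto
      finally have 2: "1 \<le> T powr (\<alpha> * \<theta>) * t powr (- (\<alpha> * \<theta>))" .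
      have "1 * 1 \<le> (mu 0 powr (\<theta> - 1) * mu j powr (1 - \<theta>)) * (T powr (\<alpha> * \<theta>) * t powr (- (\<alpha> * \<theta>)))"
        using 1 2 by (intro mult_mono) auto
      then show ?thesis using C M2 by (intro mult_left_mono) auto
    qed
    also have "\<dots> = C * M2 * (mu 0 powr (\<theta> - 1) * T powr (\<alpha> * \<theta>)) * t powr (- (\<alpha> * \<theta>)) * mu j powr (1 - \<theta>)" by simp
    also have "\<dots> \<le> C * M2 * (T powr \<alpha> + mu 0 powr (\<theta> - 1) * T powr (\<alpha> * \<theta>)) * t powr (- (\<alpha> * \<theta>)) * mu j powr (1 - \<theta>)"
      using C M2 by (intro mult_right_mono mult_left_mono) auto
    finally show ?thesis .
  qed
qed

definition M\<theta> :: "real \<Rightarrow> real" where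
  "M\<theta> \<theta> = C * M2 * (T powr \<alpha> + mu 0 powr (\<theta> - 1) * T powr (\<alpha> * \<theta>))"

lemma M\<theta>_nonneg: "M\<theta> \<theta> \<ge> 0"
  using C M2 by (simp add: M\<theta>_def)

text \<open>The kernel K gains exactly the power of \<mu>_j that \<open>ee\<close> costs, so the
  bound is uniform in j. The free parameter \<theta> becomes the exponent \<delta> of the locale
  \<open>evolution\<close>: it is q for the power weight and 1/2 for the other one.\<close>

lemma eeK_bound_powr:
  assumes t: "t \<in> {0<..T}" and \<theta>: "0 \<le> \<theta>" "\<theta> \<le> 1"
  shows "\<bar>ee j t * K j s\<bar> \<le> (M\<theta> \<theta> * M2) * t powr (- (\<alpha> * \<theta>)) * pk (\<alpha> * \<theta>) s"
proof -
  have "\<bar>ee j t * K j s\<bar> \<le> (M\<theta> \<theta> * t powr (- (\<alpha> * \<theta>)) * mu j powr (1 - \<theta>)) *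
      (M2 * mu j powr (- (1 - \<theta>)) * pk (\<alpha> * (1 - (1 - \<theta>))) s)"
    unfolding abs_mult using ee_bound_powr[OF t \<theta>, of j] K_bound_powr[of "1 - \<theta>" j s] \<theta> M\<theta>_nonneg[of \<theta>]
    by (intro mult_mono) (auto simp: M\<theta>_def)
  also have "\<dots> = (M\<theta> \<theta> * M2) * t powr (- (\<alpha> * \<theta>)) * pk (\<alpha> * \<theta>) s * (mu j powr (1 - \<theta>) * mu j powr (- (1 - \<theta>)))"
    by simp
  also have "mu j powr (1 - \<theta>) * mu j powr (- (1 - \<theta>)) = 1" using mu_pos[of j] by (simp flip: powr_add)
  finally show ?thesis by simp
qed

text \<open>The coefficient of \<Upsilon> + ||k|| in \<Theta>(T), written with \<mu>_0^(-p) in place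
  of \<lambda>_1^(-\<beta>p).\<close>

definition A\<Theta> :: real where
  "A\<Theta> = M2 * mu 0 powr (- p) * T powr (\<alpha> * q) * (1 + C * M2) * Beta (\<alpha> * q) (1 - \<alpha> * q)"

lemma \<alpha>q: "0 < \<alpha> * q" "\<alpha> * q < 1"
proof -
  show "0 < \<alpha> * q" using \<alpha> pq by simp
  have "\<alpha> * q < 1 * 1" using \<alpha> pq by (intro mult_strict_mono) auto
  then show "\<alpha> * q < 1" by simp
qed

lemma beta_nonneg: "Beta (\<alpha> * q) (1 - \<alpha> * q) \<ge> 0"
  using \<alpha>q by (simp add: Beta_def Gamma_real_pos less_imp_le)

lemma A\<Theta>_nonneg: "A\<Theta> \<ge> 0"
  using M2 C beta_nonneg by (simp add: A\<Theta>_def)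

section \<open>The Schur test for the two weights\<close>

definition Mall :: "real \<Rightarrow> real" where
  "Mall \<theta> = M2 + M\<theta> 1 + M\<theta> \<theta> * M2"

lemma evolution_basics:
  assumes \<theta>: "0 < \<theta>" "\<theta> < 1"
  shows "M2 \<le> Mall \<theta>" "Mall \<theta> > 0"
    "t \<in> {0<..T} \<Longrightarrow> \<bar>ee j t\<bar> \<le> Mall \<theta> * t powr (- \<alpha>)"
    "t \<in> {0<..T} \<Longrightarrow> \<bar>ee j t * K j s\<bar> \<le> Mall \<theta> * t powr (- (\<alpha> * \<theta>)) * pk (\<alpha> * \<theta>) s"
proof -
  have m: "M\<theta> 1 \<ge> 0" "M\<theta> \<theta> * M2 \<ge> 0" using M\<theta>_nonneg M2 by auto
  show 1: "M2 \<le> Mall \<theta>" "Mall \<theta> > 0" using m M2 by (auto simp: Mall_def)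
  assume t: "t \<in> {0<..T}"
  have "\<bar>ee j t\<bar> \<le> M\<theta> 1 * t powr (- \<alpha>)"
    using ee_bound_powr[OF t, of 1 j] mu_pos[of j] by (simp add: M\<theta>_def)
  also have "\<dots> \<le> Mall \<theta> * t powr (- \<alpha>)" using m M2 by (intro mult_right_mono) (auto simp: Mall_def)
  finally show "\<bar>ee j t\<bar> \<le> Mall \<theta> * t powr (- \<alpha>)" .
  have "\<bar>ee j t * K j s\<bar> \<le> (M\<theta> \<theta> * M2) * t powr (- (\<alpha> * \<theta>)) * pk (\<alpha> * \<theta>) s"
    by (rule eeK_bound_powr[OF t]) (use \<theta> in auto)
  also have "\<dots> \<le> Mall \<theta> * t powr (- (\<alpha> * \<theta>)) * pk (\<alpha> * \<theta>) s"
    using m M2 by (intro mult_right_mono) (auto simp: Mall_def)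
  finally show "\<bar>ee j t * K j s\<bar> \<le> Mall \<theta> * t powr (- (\<alpha> * \<theta>)) * pk (\<alpha> * \<theta>) s" .
qed

text \<open>Both Schur integrals are Beta integrals of \<open>pk (\<alpha> * q)\<close> against
  t^(-\<alpha>q), hence independent of the time at which the convolution is taken. The first one is
  constant in t and becomes a multiple of the weight through 1 \<le> T^(\<alpha>q) t^(-\<alpha>q);
  the second carries the weight as a factor. The limit on D is the share of \<open>A\<Theta>\<close>
  left for the second.\<close>

lemma evolution_power_weight:
  assumes g: "g \<ge> 0" "g * A\<Theta> < 1"
    and D: "D \<ge> 0" "D \<le> C * M2\<^sup>2 * mu 0 powr (- p) * T powr (\<alpha> * q)"
    and eK: "\<And>j t s. t \<in> {0<..T} \<Longrightarrow> \<bar>ee j t * K j s\<bar> \<le> D * t powr (- (\<alpha> * q)) * pk (\<alpha> * q) s"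
  shows "evolution \<alpha> (Mall q) K T ee q (pk (1 - \<alpha> * q)) (\<lambda>s. M2 * mu 0 powr (- p) * pk (\<alpha> * q) s)
    (\<lambda>t s. D * t powr (- (\<alpha> * q)) * pk (\<alpha> * q) s) A\<Theta> 1 1 g"
proof -
  note eb = evolution_basics[OF pq(3,4)]
  interpret multiplier \<alpha> "Mall q" K by (rule multiplier_K[OF eb(1)])
  show ?thesis
  proof unfold_locales
    show "\<bar>K j s\<bar> \<le> M2 * mu 0 powr (- p) * pk (\<alpha> * q) s" for j s
    proof -
      have q: "q = 1 - p" using pq by simp
      show ?thesis unfolding q using pq by (intro K_bound_powr0) auto
    qed
    show "continuous_on {0<..} (pk (1 - \<alpha> * q))"
    proof -
      have "continuous_on {0<..} (\<lambda>t. t powr (1 - \<alpha> * q - 1))" by (intro continuous_intros) auto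
      then show ?thesis by (rule continuous_on_eq) (simp add: pk_def)
    qed
    show "1 * t powr (- (\<alpha> * q)) \<le> pk (1 - \<alpha> * q) t" "pk (1 - \<alpha> * q) t \<le> 1 * t powr (- (\<alpha> * q))" if "t \<in> {0<..T}" for t
      using that by (auto simp: pk_def)
    fix t assume t: "t \<in> {0<..T}"
    define B where "B = Beta (\<alpha> * q) (1 - \<alpha> * q)"
    have B: "B \<ge> 0" using beta_nonneg by (simp add: B_def)
    have conv: "(\<integral>\<^sup>+\<tau>. ennreal (c * pk (\<alpha> * q) (s - \<tau>) * pk (1 - \<alpha> * q) \<tau>) \<partial>lborel) = ennreal (c * B)"
      if "c \<ge> 0" "s > 0" for c s
    proof -
      have "(\<integral>\<^sup>+\<tau>. ennreal (c * (pk (\<alpha> * q) (s - \<tau>) * pk (1 - \<alpha> * q) \<tau>)) \<partial>lborel) = ennreal c * ennreal (B * pk 1 s)"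
        using nn_integral_pk_conv[of "\<alpha> * q" "1 - \<alpha> * q" s] \<alpha>q that by (subst nn_integral_cmult_real) (auto simp: B_def)
      also have "\<dots> = ennreal (c * (B * pk 1 s))" using that(1) by (rule ennreal_mult'[symmetric])
      finally show ?thesis using that by (simp add: pk_def mult.assoc)
    qed
    have "(\<integral>\<^sup>+\<tau>. ennreal (M2 * mu 0 powr (- p) * pk (\<alpha> * q) (t - \<tau>) * pk (1 - \<alpha> * q) \<tau>) \<partial>lborel) +
        (\<integral>\<^sup>+\<tau>. ennreal (D * t powr (- (\<alpha> * q)) * pk (\<alpha> * q) (T - \<tau>) * pk (1 - \<alpha> * q) \<tau>) \<partial>lborel) =
        ennreal (M2 * mu 0 powr (- p) * B) + ennreal (D * t powr (- (\<alpha> * q)) * B)"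
      using t T M2 D by (subst (1 2) conv) auto
    also have "\<dots> = ennreal (M2 * mu 0 powr (- p) * B + D * t powr (- (\<alpha> * q)) * B)"
      using M2 D B by (intro ennreal_plus[symmetric]) auto
    also have "\<dots> \<le> ennreal (A\<Theta> * pk (1 - \<alpha> * q) t)"
    proof (rule ennreal_leI)
      have "1 = t powr (\<alpha> * q) * t powr (- (\<alpha> * q))" using t by (simp flip: powr_add)
      also have "\<dots> \<le> T powr (\<alpha> * q) * t powr (- (\<alpha> * q))"
        using t \<alpha>q by (intro mult_right_mono powr_mono2) auto
      finally have "M2 * mu 0 powr (- p) * B * 1 \<le> M2 * mu 0 powr (- p) * B * (T powr (\<alpha> * q) * t powr (- (\<alpha> * q)))"
        using M2 B by (intro mult_left_mono) auto
      moreover have "D * t powr (- (\<alpha> * q)) * B \<le> (C * M2\<^sup>2 * mu 0 powr (- p) * T powr (\<alpha> * q)) * t powr (- (\<alpha> * q)) * B"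
        using D B by (intro mult_right_mono) auto
      moreover have "A\<Theta> * pk (1 - \<alpha> * q) t = M2 * mu 0 powr (- p) * B * (T powr (\<alpha> * q) * t powr (- (\<alpha> * q))) +
          (C * M2\<^sup>2 * mu 0 powr (- p) * T powr (\<alpha> * q)) * t powr (- (\<alpha> * q)) * B"
        using t by (simp add: A\<Theta>_def B_def pk_def power2_eq_square algebra_simps)
      ultimately show "M2 * mu 0 powr (- p) * B + D * t powr (- (\<alpha> * q)) * B \<le> A\<Theta> * pk (1 - \<alpha> * q) t" by simp
    qed
    finally show "(\<integral>\<^sup>+\<tau>. ennreal (M2 * mu 0 powr (- p) * pk (\<alpha> * q) (t - \<tau>) * pk (1 - \<alpha> * q) \<tau>) \<partial>lborel) +
        (\<integral>\<^sup>+\<tau>. ennreal (D * t powr (- (\<alpha> * q)) * pk (\<alpha> * q) (T - \<tau>) * pk (1 - \<alpha> * q) \<tau>) \<partial>lborel) \<le>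
      ennreal (A\<Theta> * pk (1 - \<alpha> * q) t)" .
  qed (use \<alpha> T pq eb ee_cont eK A\<Theta>_nonneg g in auto)
qed

text \<open>The majorant of the product of \<open>ee\<close> and K is a function of t times a
  function of s, so the second Schur integral is a constant times \<rho>(t). The premises on
  \<open>Lam\<close> and P are the second alternative of \<open>weight_cases\<close>. The exponent
  is 1/2 because \<open>wt\<close> behaves like 1/(2 sqrt x) near 0.\<close>

lemma evolution_wt_weight:
  assumes g: "g \<ge> 0" "g * A\<Theta> < 1" and \<kappa>: "\<kappa> = 0"
    and L: "\<And>x. 0 < x \<Longrightarrow> x \<le> mu 0 * T powr \<alpha> \<Longrightarrow> Lam x \<le> (mu 0 * T powr \<alpha>) powr q / q"
    and P: "P \<ge> 0" "(\<integral>\<^sup>+y. ennreal (wt y * wt (mu 0 * T powr \<alpha> - y)) \<partial>lborel) \<le> ennreal P"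
      "(mu 0 * T powr \<alpha>) * P \<le> (mu 0 * T powr \<alpha>) powr q / q"
  shows "evolution \<alpha> (Mall (1/2)) K T ee (1/2) (rho2 \<alpha> (mu 0)) (\<lambda>s. M2 * (pk \<alpha> s / (1 + mu 0 * s powr \<alpha>)))
    (\<lambda>t s. C * M2\<^sup>2 * T powr \<alpha> * rho2 \<alpha> (mu 0) t / \<alpha> * (\<alpha> * mu 0 * pk \<alpha> s * rho2 \<alpha> (mu 0) s)) A\<Theta>
    (1 / (2 * (1 + mu 0 * T powr \<alpha>) * sqrt (mu 0))) (1 / (2 * sqrt (mu 0))) g"
proof -
  have half: "0 < (1/2::real)" "1/2 < (1::real)" by auto
  note eb = evolution_basics[OF half]
  interpret multiplier \<alpha> "Mall (1/2)" K by (rule multiplier_K[OF eb(1)])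
  define m Z where "m = mu 0" "Z = mu 0 * T powr \<alpha>"
  have m: "m > 0" "Z = m * T powr \<alpha>" "Z > 0" using mu0 T by (auto simp: m_Z_def)
  show ?thesis
    unfolding m_Z_def(1)[symmetric]
  proof unfold_locales
    show "\<bar>K j s\<bar> \<le> M2 * (pk \<alpha> s / (1 + m * s powr \<alpha>))" for j s
    proof -
      have "1 + m * s powr \<alpha> > 0" using m by (simp add: add_pos_nonneg)
      moreover have "m * s powr \<alpha> \<le> mu j * s powr \<alpha>" using mu_ge by (intro mult_right_mono) (auto simp: m_Z_def)
      ultimately have "M2 * pk \<alpha> s / (1 + mu j * s powr \<alpha>) \<le> M2 * pk \<alpha> s / (1 + m * s powr \<alpha>)"
        using M2 by (intro divide_left_mono mult_pos_pos) auto
      then show ?thesis using K_bound[of j s] by simp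
    qed
    show "\<bar>ee j t * K j s\<bar> \<le> C * M2\<^sup>2 * T powr \<alpha> * rho2 \<alpha> m t / \<alpha> * (\<alpha> * m * pk \<alpha> s * rho2 \<alpha> m s)"
      if t: "t \<in> {0<..T}" for j t s
    proof (cases "s > 0")
      case True
      define n where "n = mu j"
      have n: "n > 0" "m \<le> n" using mu_pos mu_ge by (auto simp: n_def m_Z_def)
      have "\<bar>ee j t\<bar> \<le> (C * n * T powr \<alpha>) * (M2 / (1 + n * t powr \<alpha>))"
        unfolding ee_def abs_mult using \<Psi>[of j] \<kappa> E_bound[of j t] C n by (intro mult_mono) (auto simp: n_def)
      moreover have "\<bar>K j s\<bar> \<le> M2 * pk \<alpha> s / (1 + n * s powr \<alpha>)" using K_bound[of j s] by (simp add: n_def)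
      ultimately have "\<bar>ee j t * K j s\<bar> \<le> ((C * n * T powr \<alpha>) * (M2 / (1 + n * t powr \<alpha>))) * (M2 * pk \<alpha> s / (1 + n * s powr \<alpha>))"
        unfolding abs_mult using C M2 n by (intro mult_mono) auto
      \<comment> \<open>The factor n = \<mu>_j from the bound on \<Psi>_j is divided evenly, which
        brings both resolvent factors into the form treated by \<open>wt_sup\<close>.\<close>
      also have "\<dots> = C * M2\<^sup>2 * T powr \<alpha> * pk \<alpha> s * ((sqrt n / (1 + n * t powr \<alpha>)) * (sqrt n / (1 + n * s powr \<alpha>)))"
        using n by (simp add: power2_eq_square)
      also have "\<dots> \<le> C * M2\<^sup>2 * T powr \<alpha> * pk \<alpha> s * ((sqrt m * wt (m * t powr \<alpha>)) * (sqrt m * wt (m * s powr \<alpha>)))"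
        using C n m t True by (intro mult_left_mono mult_mono wt_sup) (auto intro!: divide_nonneg_nonneg)
      also have "\<dots> = C * M2\<^sup>2 * T powr \<alpha> * rho2 \<alpha> m t / \<alpha> * (\<alpha> * m * pk \<alpha> s * rho2 \<alpha> m s)"
        using m t True \<alpha> by (simp add: rho2_def)
      finally show ?thesis .
    qed (simp add: K_def ml_K_def pk_def)
    show "continuous_on {0<..} (rho2 \<alpha> m)"
    proof -
      have "continuous_on {0<..} (\<lambda>t. wt (m * t powr \<alpha>))"
        by (rule continuous_on_compose2[OF continuous_on_wt]) (use m in \<open>auto intro!: continuous_intros\<close>)
      then show ?thesis by (rule continuous_on_eq) (simp add: rho2_def)
    qed
    fix t assume t: "t \<in> {0<..T}"
    define x where "x = m * t powr \<alpha>"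
    have x: "x > 0" using m t by (simp add: x_def)
    have xZ: "x \<le> Z" unfolding x_def m(2) using t m \<alpha> by (intro mult_left_mono powr_mono2) auto
    have sx: "sqrt x = sqrt m * t powr (\<alpha> * (1/2))"
      using t m by (simp add: x_def real_sqrt_mult powr_powr flip: powr_half_sqrt)
    have rx: "rho2 \<alpha> m t = wt x" using t by (simp add: rho2_def x_def)
    have inv: "1 / sqrt x = t powr (- (\<alpha> * (1/2))) / sqrt m"
      unfolding sx using t by (simp add: powr_minus_divide)
    show "rho2 \<alpha> m t \<le> 1 / (2 * sqrt m) * t powr (- (\<alpha> * (1/2)))"
      using wt_le[OF x] inv by (simp add: rx)
    have "1 / (2 * (1 + Z)) * (1 / sqrt x) \<le> wt x"
    proof (cases "x \<le> 1")
      case True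
      have "1 / (2 * (1 + Z)) \<le> 1 / 2" using m by simp
      then have "1 / (2 * (1 + Z)) * (1 / sqrt x) \<le> 1 / 2 * (1 / sqrt x)" using x by (intro mult_right_mono) auto
      also have "\<dots> = wt x" using True x by (simp add: wt_def)
      finally show ?thesis .
    next
      case False
      have "1 / (2 * (1 + Z)) * (1 / sqrt x) \<le> 1 / (1 + x) * 1"
        using False x xZ by (intro mult_mono frac_le) auto
      also have "\<dots> = wt x" using False x by (simp add: wt_def)
      finally show ?thesis .
    qed
    then show "1 / (2 * (1 + m * T powr \<alpha>) * sqrt m) * t powr (- (\<alpha> * (1/2))) \<le> rho2 \<alpha> m t"
      unfolding rx inv m(2)[symmetric] by simp
    define B where "B = Beta (\<alpha> * q) (1 - \<alpha> * q)"
    \<comment> \<open>The estimates so far aim at Z^q/q, whereas \<open>A\<Theta>\<close> contains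
      the Beta factor B. The resulting inequality 1/q \<le> \<alpha> B converts one into the other,
      and its \<alpha> cancels the 1/\<alpha> produced by the substitution in time.\<close>
    have "1 / (\<alpha> * q) \<le> B" unfolding B_def by (rule Beta_reflect_ge[OF \<alpha>q])
    then have "\<alpha> * (1 / (\<alpha> * q)) \<le> \<alpha> * B" using \<alpha> by (intro mult_left_mono) auto
    then have B: "1 / q \<le> \<alpha> * B" using \<alpha> by simp
    then have ZB: "Z powr q / q \<le> Z powr q * (\<alpha> * B)"
      using mult_left_mono[OF B, of "Z powr q"] by simp
    have B0: "B \<ge> 0" using beta_nonneg by (simp add: B_def)
    have Zq: "Z powr q = m * (m powr (- p) * T powr (\<alpha> * q))"
    proof -
      have "Z powr q = m powr q * T powr (\<alpha> * q)" using m by (simp add: powr_mult powr_powr)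
      also have "m powr q = m * m powr (- p)"
      proof -
        have q: "q = 1 - p" using pq by simp
        show ?thesis unfolding q using m by (simp add: powr_mult_base)
      qed
      finally show ?thesis by simp
    qed
    have i1: "(\<integral>\<^sup>+\<tau>. ennreal (M2 * (pk \<alpha> (t - \<tau>) / (1 + m * (t - \<tau>) powr \<alpha>)) * rho2 \<alpha> m \<tau>) \<partial>lborel) \<le>
        ennreal (M2 * m powr (- p) * T powr (\<alpha> * q) * B * rho2 \<alpha> m t)"
    proof -
      have "(\<integral>\<^sup>+\<tau>. ennreal (M2 * (pk \<alpha> (t - \<tau>) / (1 + m * (t - \<tau>) powr \<alpha>)) * rho2 \<alpha> m \<tau>) \<partial>lborel) =
          (\<integral>\<^sup>+\<tau>. ennreal (M2 * (pk \<alpha> (t - \<tau>) / (1 + m * (t - \<tau>) powr \<alpha>) * rho2 \<alpha> m \<tau>)) \<partial>lborel)"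
        by (simp add: mult.assoc)
      also have "\<dots> = ennreal M2 * (\<integral>\<^sup>+\<tau>. ennreal (pk \<alpha> (t - \<tau>) / (1 + m * (t - \<tau>) powr \<alpha>) * rho2 \<alpha> m \<tau>) \<partial>lborel)"
        using M2 by (intro nn_integral_cmult_real) auto
      also have "\<dots> \<le> ennreal M2 * ennreal (Lam x / (\<alpha> * m) * rho2 \<alpha> m t)"
        unfolding x_def using \<alpha> m t by (intro mult_left_mono rho2_resolvent) auto
      also have "\<dots> = ennreal (M2 * (Lam x / (\<alpha> * m) * rho2 \<alpha> m t))"
        using M2 by (intro ennreal_mult'[symmetric]) auto
      also have "\<dots> \<le> ennreal (M2 * m powr (- p) * T powr (\<alpha> * q) * B * rho2 \<alpha> m t)"
      proof (rule ennreal_leI)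
        have "Lam x \<le> Z powr q / q" using L[OF x] xZ by (simp only: m_Z_def)
        with ZB have "Lam x \<le> m * (m powr (- p) * T powr (\<alpha> * q)) * (\<alpha> * B)"
          unfolding Zq by linarith
        then have "Lam x / (\<alpha> * m) \<le> m powr (- p) * T powr (\<alpha> * q) * B"
          using \<alpha> m by (simp add: divide_le_eq mult_ac)
        then have "M2 * (Lam x / (\<alpha> * m) * rho2 \<alpha> m t) \<le> M2 * (m powr (- p) * T powr (\<alpha> * q) * B * rho2 \<alpha> m t)"
          using M2 by (intro mult_left_mono mult_right_mono) auto
        then show "M2 * (Lam x / (\<alpha> * m) * rho2 \<alpha> m t) \<le> M2 * m powr (- p) * T powr (\<alpha> * q) * B * rho2 \<alpha> m t"
          by (simp add: mult.assoc)
      qed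
      finally show ?thesis .
    qed
    have i2: "(\<integral>\<^sup>+\<tau>. ennreal (C * M2\<^sup>2 * T powr \<alpha> * rho2 \<alpha> m t / \<alpha> * (\<alpha> * m * pk \<alpha> (T - \<tau>) * rho2 \<alpha> m (T - \<tau>)) * rho2 \<alpha> m \<tau>) \<partial>lborel) \<le>
        ennreal (C * M2\<^sup>2 * m powr (- p) * T powr (\<alpha> * q) * B * rho2 \<alpha> m t)"
    proof -
      define c where "c = C * M2\<^sup>2 * T powr \<alpha> * rho2 \<alpha> m t / \<alpha>"
      have c: "c \<ge> 0" using C \<alpha> by (simp add: c_def)
      have "(\<integral>\<^sup>+\<tau>. ennreal (c * (\<alpha> * m * pk \<alpha> (T - \<tau>) * rho2 \<alpha> m (T - \<tau>)) * rho2 \<alpha> m \<tau>) \<partial>lborel) =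
          (\<integral>\<^sup>+\<tau>. ennreal (c * (\<alpha> * m * pk \<alpha> (T - \<tau>) * rho2 \<alpha> m (T - \<tau>) * rho2 \<alpha> m \<tau>)) \<partial>lborel)"
        by (simp add: mult.assoc)
      also have "\<dots> = ennreal c * (\<integral>\<^sup>+\<tau>. ennreal (\<alpha> * m * pk \<alpha> (T - \<tau>) * rho2 \<alpha> m (T - \<tau>) * rho2 \<alpha> m \<tau>) \<partial>lborel)"
        using c by (intro nn_integral_cmult_real) auto
      also have "\<dots> \<le> ennreal c * ennreal P"
        using \<alpha> m P(2) by (intro mult_left_mono order_trans[OF rho2_conv]) (auto simp: m_Z_def)
      also have "\<dots> = ennreal (c * P)" using c by (intro ennreal_mult'[symmetric])
      also have "\<dots> \<le> ennreal (C * M2\<^sup>2 * m powr (- p) * T powr (\<alpha> * q) * B * rho2 \<alpha> m t)"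
      proof (rule ennreal_leI)
        have "Z * P \<le> Z powr q / q" using P(3) by (simp only: m_Z_def)
        also note ZB
        finally have "m * (T powr \<alpha> * P) \<le> m * (m powr (- p) * T powr (\<alpha> * q) * (\<alpha> * B))"
          unfolding Zq by (simp only: m(2) mult.assoc)
        then have "T powr \<alpha> * P \<le> m powr (- p) * T powr (\<alpha> * q) * (\<alpha> * B)" using m by simp
        then have "(C * M2\<^sup>2 * rho2 \<alpha> m t / \<alpha>) * (T powr \<alpha> * P) \<le> (C * M2\<^sup>2 * rho2 \<alpha> m t / \<alpha>) * (m powr (- p) * T powr (\<alpha> * q) * (\<alpha> * B))"
          using C \<alpha> by (intro mult_left_mono) auto
        then show "c * P \<le> C * M2\<^sup>2 * m powr (- p) * T powr (\<alpha> * q) * B * rho2 \<alpha> m t"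
          using \<alpha> by (simp add: c_def mult_ac)
      qed
      finally show ?thesis by (simp only: c_def)
    qed
    have "(\<integral>\<^sup>+\<tau>. ennreal (M2 * (pk \<alpha> (t - \<tau>) / (1 + m * (t - \<tau>) powr \<alpha>)) * rho2 \<alpha> m \<tau>) \<partial>lborel) +
        (\<integral>\<^sup>+\<tau>. ennreal (C * M2\<^sup>2 * T powr \<alpha> * rho2 \<alpha> m t / \<alpha> * (\<alpha> * m * pk \<alpha> (T - \<tau>) * rho2 \<alpha> m (T - \<tau>)) * rho2 \<alpha> m \<tau>) \<partial>lborel) \<le>
        ennreal (M2 * m powr (- p) * T powr (\<alpha> * q) * B * rho2 \<alpha> m t) + ennreal (C * M2\<^sup>2 * m powr (- p) * T powr (\<alpha> * q) * B * rho2 \<alpha> m t)"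
      by (rule add_mono[OF i1 i2])
    also have "\<dots> = ennreal (M2 * m powr (- p) * T powr (\<alpha> * q) * B * rho2 \<alpha> m t + C * M2\<^sup>2 * m powr (- p) * T powr (\<alpha> * q) * B * rho2 \<alpha> m t)"
      using M2 C B0 by (intro ennreal_plus[symmetric]) auto
    also have "M2 * m powr (- p) * T powr (\<alpha> * q) * B * rho2 \<alpha> m t + C * M2\<^sup>2 * m powr (- p) * T powr (\<alpha> * q) * B * rho2 \<alpha> m t =
        A\<Theta> * rho2 \<alpha> m t"
      by (simp add: A\<Theta>_def B_def m_Z_def power2_eq_square algebra_simps)
    finally show "(\<integral>\<^sup>+\<tau>. ennreal (M2 * (pk \<alpha> (t - \<tau>) / (1 + m * (t - \<tau>) powr \<alpha>)) * rho2 \<alpha> m \<tau>) \<partial>lborel) +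
        (\<integral>\<^sup>+\<tau>. ennreal (C * M2\<^sup>2 * T powr \<alpha> * rho2 \<alpha> m t / \<alpha> * (\<alpha> * m * pk \<alpha> (T - \<tau>) * rho2 \<alpha> m (T - \<tau>)) * rho2 \<alpha> m \<tau>) \<partial>lborel)
      \<le> ennreal (A\<Theta> * rho2 \<alpha> m t)" .
  qed (use \<alpha> T eb ee_cont A\<Theta>_nonneg g m in \<open>auto intro!: mult_pos_pos add_pos_pos\<close>)
qed

lemma evolution_exists:
  assumes g: "g \<ge> 0" "g * A\<Theta> < 1"
  obtains M \<delta> \<rho> N1 N3 c0 C0 where "evolution \<alpha> M K T ee \<delta> \<rho> N1 N3 A\<Theta> c0 C0 g"
proof (cases "\<kappa> = 0")
  case False
  have "\<bar>ee j t * K j s\<bar> \<le> (C * M2\<^sup>2 * mu 0 powr (- p) * T powr (\<alpha> * q)) * t powr (- (\<alpha> * q)) * pk (\<alpha> * q) s"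
    if t: "t \<in> {0<..T}" for j t s
  proof -
    have "\<bar>ml_E \<alpha> (mu j) t\<bar> \<le> M2 / (1 + mu j * t powr \<alpha>)" by (rule E_bound)
    also have "\<dots> \<le> M2 / 1" using mu_pos[of j] M2 by (intro divide_left_mono) (auto intro: add_pos_nonneg)
    finally have "\<bar>ee j t\<bar> \<le> C * M2"
      unfolding ee_def abs_mult using \<Psi>[of j] False C by (intro mult_mono) auto
    moreover have "\<bar>K j s\<bar> \<le> M2 * mu 0 powr (- p) * pk (\<alpha> * (1 - p)) s"
      using pq by (intro K_bound_powr0) auto
    moreover have q: "1 - p = q" using pq by simp
    ultimately have "\<bar>ee j t * K j s\<bar> \<le> (C * M2) * (M2 * mu 0 powr (- p) * pk (\<alpha> * q) s)"
      unfolding abs_mult q using C M2 by (intro mult_mono) auto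
    also have "\<dots> = (C * M2\<^sup>2 * mu 0 powr (- p) * pk (\<alpha> * q) s) * 1" by (simp add: power2_eq_square)
    also have "\<dots> \<le> (C * M2\<^sup>2 * mu 0 powr (- p) * pk (\<alpha> * q) s) * (T powr (\<alpha> * q) * t powr (- (\<alpha> * q)))"
    proof (rule mult_left_mono)
      have "1 = t powr (\<alpha> * q) * t powr (- (\<alpha> * q))" using t by (simp flip: powr_add)
      also have "\<dots> \<le> T powr (\<alpha> * q) * t powr (- (\<alpha> * q))"
        using t \<alpha>q by (intro mult_right_mono powr_mono2) auto
      finally show "1 \<le> T powr (\<alpha> * q) * t powr (- (\<alpha> * q))" .
    qed (use C in auto)
    finally show ?thesis by (simp add: mult_ac)
  qed
  from evolution_power_weight[OF g _ order_refl this] show ?thesis using C M2 by (intro that) auto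
next
  case True
  define Z where "Z = mu 0 * T powr \<alpha>"
  have Z: "Z > 0" using mu0 T by (simp add: Z_def)
  consider "(p powr p * q powr q)\<^sup>2 * Z powr p \<le> 1" |
    "\<forall>x. 0 < x \<longrightarrow> x \<le> Z \<longrightarrow> Lam x \<le> Z powr q / q"
    "\<exists>P\<ge>0. (\<integral>\<^sup>+y. ennreal (wt y * wt (Z - y)) \<partial>lborel) \<le> ennreal P \<and> Z * P \<le> Z powr q / q"
    using weight_cases[OF Z pq(1,3,5)] by blast
  then show ?thesis
  proof cases
    case 1
    define c where "c = p powr p * q powr q"
    \<comment> \<open>Each resolvent factor is replaced by its best power, with exponent q for x and
      p for y. The exponents add up to 1, so the factor \<mu>_j cancels. The cost is c^2 T^\<alpha>
      in place of \<mu>_0^(-p) T^(\<alpha>q), which is permitted because c^2 Z^p \<le> 1.\<close>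
    define D where "D = C * M2\<^sup>2 * T powr \<alpha> * c\<^sup>2"
    have c: "c \<ge> 0" by (simp add: c_def)
    have eK: "\<bar>ee j t * K j s\<bar> \<le> D * t powr (- (\<alpha> * q)) * pk (\<alpha> * q) s" if t: "t \<in> {0<..T}" for j t s
    proof (cases "s > 0")
      case s: True
      define n x y where "n = mu j" "x = n * t powr \<alpha>" "y = n * s powr \<alpha>"
      have n: "n > 0" "x > 0" "y > 0" using mu_pos t s by (auto simp: n_x_y_def)
      have "\<bar>ee j t\<bar> \<le> (C * n * T powr \<alpha>) * (M2 / (1 + x))"
        unfolding ee_def abs_mult using \<Psi>[of j] True E_bound[of j t] C n by (intro mult_mono) (auto simp: n_x_y_def)
      moreover have "\<bar>K j s\<bar> \<le> M2 * pk \<alpha> s / (1 + y)" using K_bound[of j s] by (simp add: n_x_y_def)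
      ultimately have "\<bar>ee j t * K j s\<bar> \<le> ((C * n * T powr \<alpha>) * (M2 / (1 + x))) * (M2 * pk \<alpha> s / (1 + y))"
        unfolding abs_mult using C M2 n by (intro mult_mono) auto
      also have "\<dots> = C * M2\<^sup>2 * T powr \<alpha> * n * pk \<alpha> s * ((1 / (1 + x)) * (1 / (1 + y)))"
        by (simp add: power2_eq_square)
      also have "\<dots> \<le> C * M2\<^sup>2 * T powr \<alpha> * n * pk \<alpha> s * ((c * x powr (- q)) * (c * y powr (- p)))"
      proof (intro mult_left_mono mult_mono)
        have "x powr q / (1 + x) \<le> c" unfolding c_def using pq n by (intro powr_over_1_plus_le) auto
        then show "1 / (1 + x) \<le> c * x powr (- q)" using n by (simp add: powr_minus_divide field_simps)
        have "y powr p / (1 + y) \<le> q powr q * p powr p" using pq n by (intro powr_over_1_plus_le) auto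
        then show "1 / (1 + y) \<le> c * y powr (- p)" using n by (simp add: powr_minus_divide field_simps c_def)
      qed (use C n c in auto)
      also have "x powr (- q) = n powr (- q) * t powr (- (\<alpha> * q))" using n by (simp add: n_x_y_def powr_mult powr_powr)
      also have "y powr (- p) = n powr (- p) * s powr (- (\<alpha> * p))" using n by (simp add: n_x_y_def powr_mult powr_powr)
      also have "C * M2\<^sup>2 * T powr \<alpha> * n * pk \<alpha> s * ((c * (n powr (- q) * t powr (- (\<alpha> * q)))) * (c * (n powr (- p) * s powr (- (\<alpha> * p))))) =
          D * t powr (- (\<alpha> * q)) * (pk \<alpha> s * s powr (- (\<alpha> * p))) * (n * (n powr (- q) * n powr (- p)))"
        by (simp add: D_def power2_eq_square)
      also have "n * (n powr (- q) * n powr (- p)) = 1"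
      proof -
        have "n powr (- q) * n powr (- p) = n powr (- q + - p)" by (rule powr_add[symmetric])
        also have "- q + - p = - 1" using pq by linarith
        finally show ?thesis using n by (simp add: powr_minus_divide)
      qed
      also have "pk \<alpha> s * s powr (- (\<alpha> * p)) = pk (\<alpha> * q) s"
      proof -
        have "\<alpha> * q = \<alpha> - \<alpha> * p" using pq by (metis add_diff_cancel_left' mult.right_neutral right_diff_distrib)
        then have "\<alpha> - 1 + - (\<alpha> * p) = \<alpha> * q - 1" by linarith
        then have "s powr (\<alpha> - 1) * s powr (- (\<alpha> * p)) = s powr (\<alpha> * q - 1)"
          by (simp only: powr_add[symmetric])
        then show ?thesis using s by (simp add: pk_def)
      qed
      finally show ?thesis by simp
    qed (simp add: K_def ml_K_def pk_def)
    have "D \<le> C * M2\<^sup>2 * mu 0 powr (- p) * T powr (\<alpha> * q)"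
    proof -
      have "T powr \<alpha> = T powr (\<alpha> * q) * T powr (\<alpha> * p)"
        using pq by (simp flip: powr_add distrib_left) (simp add: add.commute)
      moreover have "Z powr p = mu 0 powr p * T powr (\<alpha> * p)"
        using mu0 by (simp add: Z_def powr_mult powr_powr)
      ultimately have "D = C * M2\<^sup>2 * mu 0 powr (- p) * T powr (\<alpha> * q) * (c\<^sup>2 * Z powr p)"
        using mu0 by (simp add: D_def powr_minus field_simps)
      also have "\<dots> \<le> C * M2\<^sup>2 * mu 0 powr (- p) * T powr (\<alpha> * q) * 1"
        using 1 C by (intro mult_left_mono) (auto simp: c_def)
      finally show ?thesis by simp
    qed
    from evolution_power_weight[OF g _ this eK] show ?thesis using C by (intro that) (auto simp: D_def)
  next
    case 2
    then obtain P where P: "P \<ge> 0" "(\<integral>\<^sup>+y. ennreal (wt y * wt (Z - y)) \<partial>lborel) \<le> ennreal P" "Z * P \<le> Z powr q / q" by blast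
    from evolution_wt_weight[OF g True _ P[unfolded Z_def]] 2(1) show ?thesis
      by (intro that) (auto simp: Z_def)
  qed
qed

end

section \<open>The Caputo derivative in the sequence space\<close>

lemma diag_const: "diag (\<lambda>j. r) x = r *\<^sub>R x"
  by (rule ell2_eqI) (simp add: coord_diag[of _ "\<bar>r\<bar>"])

lemma multiplier_pk:
  assumes "a > 0" "k \<ge> 0"
  shows "multiplier a k (\<lambda>j s. k * pk a s)"
proof
  have "continuous_on {0<..} (\<lambda>s. k * s powr (a - 1))" by (intro continuous_intros) auto
  then show "continuous_on {0<..} (\<lambda>s. k * pk a s)" by (rule continuous_on_eq) (simp add: pk_def)
qed (use assms in \<open>auto simp: abs_mult\<close>)

text \<open>A fundamental theorem for integrands that are continuous on (0,T] and integrable but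
  possibly unbounded near 0; at t = T the limit is one-sided.\<close>

lemma primitive_derivative:
  fixes W :: "real \<Rightarrow> 'b::{banach, second_countable_topology}"
  assumes W: "continuous_on {0<..T} W" and int: "integrable lborel (\<lambda>\<tau>. indicator {0<..<T} \<tau> *\<^sub>R W \<tau>)"
    and t: "t \<in> {0<..T}"
  defines "I s \<equiv> \<integral>\<tau>. indicator {0<..<s} \<tau> *\<^sub>R W \<tau> \<partial>lborel"
  shows "((\<lambda>s. (I s - I t) /\<^sub>R (s - t)) \<longlongrightarrow> W t) (at t within {0<..T})"
proof (rule tendstoI)
  fix r :: real assume r: "r > 0"
  have int_s: "integrable lborel (\<lambda>\<tau>. indicator {0<..<s} \<tau> *\<^sub>R W \<tau>)" if "s \<in> {0<..T}" for s
  proof -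
    have "integrable lborel (\<lambda>\<tau>. indicator {0<..<s} \<tau> *\<^sub>R (indicator {0<..<T} \<tau> *\<^sub>R W \<tau>))"
      by (rule integrable_mult_indicator[OF _ int]) auto
    also have "(\<lambda>\<tau>. indicator {0<..<s} \<tau> *\<^sub>R (indicator {0<..<T} \<tau> *\<^sub>R W \<tau>)) = (\<lambda>\<tau>. indicator {0<..<s} \<tau> *\<^sub>R W \<tau>)"
      using that by (auto simp: fun_eq_iff indicator_def)
    finally show ?thesis .
  qed
  have int_1: "integrable lborel (\<lambda>\<tau>. indicator {0<..<s} \<tau> :: real)"
    and int_1': "(\<integral>\<tau>. indicator {0<..<s} \<tau> \<partial>lborel) = (s::real)" if "s > 0" for s :: real
    using that by (auto simp: integrable_indicator_iff)
  obtain d where d: "d > 0" "\<And>x. x \<in> {0<..T} \<Longrightarrow> dist x t < d \<Longrightarrow> dist (W x) (W t) < r / 2"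
    using W t r unfolding continuous_on_iff by (metis half_gt_zero)
  show "\<forall>\<^sub>F s in at t within {0<..T}. dist ((I s - I t) /\<^sub>R (s - t)) (W t) < r"
    unfolding eventually_at
  proof (intro exI[of _ d] conjI ballI impI d(1))
    fix s assume s: "s \<in> {0<..T}" "s \<noteq> t \<and> dist s t < d"
    \<comment> \<open>The signed indicator of the interval between s and t, which treats s < t and s
      > t together.\<close>
    define D :: "real \<Rightarrow> real" where "D \<tau> = indicator {0<..<s} \<tau> - indicator {0<..<t} \<tau>" for \<tau>
    have D: "integrable lborel D" "(\<integral>\<tau>. D \<tau> \<partial>lborel) = s - t"
      using int_1[of s] int_1[of t] int_1'[of s] int_1'[of t] s t by (auto simp: D_def[abs_def])
    have DW: "integrable lborel (\<lambda>\<tau>. D \<tau> *\<^sub>R W \<tau>)" "(\<integral>\<tau>. D \<tau> *\<^sub>R W \<tau> \<partial>lborel) = I s - I t"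
      using int_s[OF s(1)] int_s[OF t] by (auto simp: D_def[abs_def] I_def scaleR_diff_left)
    have "I s - I t - (s - t) *\<^sub>R W t = (\<integral>\<tau>. D \<tau> *\<^sub>R W \<tau> - D \<tau> *\<^sub>R W t \<partial>lborel)"
      using D DW by simp
    also have "norm \<dots> \<le> (\<integral>\<tau>. r / 2 * sgn (s - t) * D \<tau> \<partial>lborel)"
    proof (rule Bochner_Integration.integral_norm_bound_integral)
      show "integrable lborel (\<lambda>\<tau>. D \<tau> *\<^sub>R W \<tau> - D \<tau> *\<^sub>R W t)" using D DW by simp
      show "integrable lborel (\<lambda>\<tau>. r / 2 * sgn (s - t) * D \<tau>)" using D by simp
      fix \<tau>
      show "norm (D \<tau> *\<^sub>R W \<tau> - D \<tau> *\<^sub>R W t) \<le> r / 2 * sgn (s - t) * D \<tau>"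
      proof (cases "D \<tau> = 0")
        case False
        then have \<tau>: "\<tau> \<in> {0<..T}" "dist \<tau> t < d" and DD: "\<bar>D \<tau>\<bar> = sgn (s - t) * D \<tau>"
        proof -
          have "(\<tau> \<in> {0<..<s}) \<noteq> (\<tau> \<in> {0<..<t})"
            using False by (cases "\<tau> \<in> {0<..<s}"; cases "\<tau> \<in> {0<..<t}"; simp add: D_def)
          then have "0 < \<tau>" "min s t \<le> \<tau>" "\<tau> < max s t" by (auto simp: min_def max_def)
          then show "\<tau> \<in> {0<..T}" "dist \<tau> t < d" "\<bar>D \<tau>\<bar> = sgn (s - t) * D \<tau>"
            using s t by (auto simp: D_def dist_real_def indicator_def)
        qed
        have "norm (D \<tau> *\<^sub>R W \<tau> - D \<tau> *\<^sub>R W t) = \<bar>D \<tau>\<bar> * dist (W \<tau>) (W t)"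
          by (simp add: dist_norm flip: scaleR_diff_right)
        also have "\<dots> \<le> \<bar>D \<tau>\<bar> * (r / 2)" using d(2)[OF \<tau>] by (intro mult_left_mono) auto
        also have "\<dots> = r / 2 * sgn (s - t) * D \<tau>" by (simp add: DD)
        finally show ?thesis .
      qed simp
    qed
    also have "\<dots> = r / 2 * \<bar>s - t\<bar>" using D by (simp add: abs_sgn mult.commute)
    finally have le: "norm (I s - I t - (s - t) *\<^sub>R W t) \<le> r / 2 * \<bar>s - t\<bar>" .
    have "dist ((I s - I t) /\<^sub>R (s - t)) (W t) = norm ((I s - I t - (s - t) *\<^sub>R W t) /\<^sub>R (s - t))"
      using s by (simp add: dist_norm scaleR_diff_right)
    also have "\<dots> = norm (I s - I t - (s - t) *\<^sub>R W t) / \<bar>s - t\<bar>" by (simp add: divide_inverse mult.commute)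
    also have "\<dots> \<le> r / 2" using le s by (simp add: divide_le_eq)
    finally show "dist ((I s - I t) /\<^sub>R (s - t)) (W t) < r" using r by simp
  qed
qed

context solution_operators
begin

lemma mu_neg_powr: "\<theta> \<ge> 0 \<Longrightarrow> \<bar>mu j powr (- \<theta>)\<bar> \<le> mu 0 powr (- \<theta>)"
  using powr_mono2'[of "- \<theta>" "mu 0" "mu j"] mu0 mu_ge[of j] by auto

lemma diag_ee_cont: "continuous_on {0<..T} (\<lambda>t. diag (\<lambda>j. ee j t) x)"
proof -
  obtain M \<delta> \<rho> N1 N3 c0 C0 where "evolution \<alpha> M K T ee \<delta> \<rho> N1 N3 A\<Theta> c0 C0 0"
    by (rule evolution_exists[of 0]) auto
  then show ?thesis by (rule evolution.e_cont_diag)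
qed

text \<open>For \<kappa> = 0 the factors \<Psi>_j may grow like \<mu>_j, but \<Psi>_j/\<mu>_j is
  bounded in both cases. This is what gives the initial value a meaning in D(L^(-\<beta>q)).\<close>

definition B\<Psi> :: real where "B\<Psi> = C * T powr \<alpha> + C / mu 0"

lemma B\<Psi>: "\<bar>\<Psi> j / mu j\<bar> \<le> B\<Psi>" "B\<Psi> \<ge> 0"
proof -
  show "B\<Psi> \<ge> 0" using C mu0 by (simp add: B\<Psi>_def)
  show "\<bar>\<Psi> j / mu j\<bar> \<le> B\<Psi>"
  proof (cases "\<kappa> = 0")
    case True
    then have "\<bar>\<Psi> j / mu j\<bar> \<le> C * T powr \<alpha>" using \<Psi>[of j] mu_pos[of j] by (simp add: divide_le_eq mult_ac)
    also have "\<dots> \<le> B\<Psi>" using C mu0 by (simp add: B\<Psi>_def)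
    finally show ?thesis .
  next
    case False
    then have "\<bar>\<Psi> j / mu j\<bar> \<le> C / mu 0" using \<Psi>[of j] mu_ge[of j] mu0 C by (simp add: frac_le)
    also have "\<dots> \<le> B\<Psi>" using C by (simp add: B\<Psi>_def)
    finally show ?thesis .
  qed
qed

lemma E_le: "\<bar>ml_E \<alpha> (mu j) t\<bar> \<le> M2"
proof -
  have "M2 / (1 + mu j * t powr \<alpha>) \<le> M2 / 1"
    using mu_pos[of j] M2 by (intro divide_left_mono) (auto intro: add_pos_nonneg)
  then show ?thesis using E_bound[of j t] by simp
qed

lemma kbd_K: "kbd \<alpha> (ml_K \<alpha> (mu j))"
  using multiplier.kbd_m[OF multiplier_K[OF order_refl], of j] by (simp add: K_def[abs_def])

lemma kbd_E: "kbd 1 (\<lambda>s. indicator {0<..} s * ml_E \<alpha> (mu j) s)"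
proof (rule kbdI)
  show "(\<lambda>s. indicator {0<..} s * ml_E \<alpha> (mu j) s) \<in> borel_measurable borel"
    using measurable_ml_E[OF \<alpha>(1), of "mu j"] by measurable
  show "\<bar>indicator {0<..} s * ml_E \<alpha> (mu j) s\<bar> \<le> M2 * pk 1 s" for s
    using E_le[of j s] by (auto simp: pk_def indicator_def)
qed

text \<open>The factor with which a bound Cf t^(c-1) on the forcing term enters the estimate of the
  derivative. The three summands belong to the forcing term itself, to the nonlocal term taken at T,
  and to the convolution at time t.\<close>

definition Df :: "real \<Rightarrow> real" where
  "Df c = mu 0 powr (- q) * T powr (c - (1 - \<alpha>)) + M\<theta> 1 * (M2 * Beta (\<alpha> * q) c * pk (\<alpha> * q + c) T) +
     M2 * Beta (\<alpha> * q) c * T powr (\<alpha> * q + c - (1 - \<alpha>))"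

lemma Df_nonneg: "c > 0 \<Longrightarrow> Df c \<ge> 0"
  using M2 \<alpha>q M\<theta>_nonneg[of 1] Gamma_real_pos[of c] Gamma_real_pos[of "\<alpha> * q"] Gamma_real_pos[of "\<alpha> * q + c"]
  by (simp add: Df_def Beta_def)

text \<open>Multiplication of coordinates by \<mu>_j^(-q) carries D(L^(-\<beta>q)) to
  \<open>ell2\<close>. Under it L^\<beta> u becomes \<mu>_j^p u_j, and the Caputo derivative becomes
  W, the image of f minus this sequence. The condition 1-\<alpha> < c makes the convolution term
  vanish at t = 0, so that the limit U0 exists.\<close>

lemma caputo_regularity:
  fixes f u :: "real \<Rightarrow> ell2" and \<Phi> :: ell2
  defines "h \<equiv> \<lambda>\<tau>. indicator {0<..<T} \<tau> *\<^sub>R f \<tau>"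
  assumes c: "1 - \<alpha> < c" and Cf: "Cf \<ge> 0" and f: "continuous_on {0<..T} f"
    and f_bd: "\<And>\<tau>. \<tau> \<in> {0<..T} \<Longrightarrow> norm (f \<tau>) \<le> Cf * \<tau> powr (c - 1)"
    and u: "\<And>t j. t \<in> {0<..T} \<Longrightarrow> coord (u t) j =
      ee j t * (mu j powr (- p) * coord \<Phi> j) + coord (VC K h t) j - ee j t * coord (VC K h T) j"
  obtains U0 W J where "((\<lambda>t. diag (\<lambda>j. mu j powr (- q)) (u t)) \<longlongrightarrow> U0) (at_right 0)"
    and "continuous_on {0<..T} W"
    and "\<And>t. t \<in> {0<..T} \<Longrightarrow> norm (W t) \<le> (M\<theta> 1 * norm \<Phi> + Df c * Cf) * t powr (- \<alpha>)"
    and "(\<lambda>\<tau>. indicator {0<..<T} \<tau> *\<^sub>R (diag (\<lambda>j. mu j powr (- q)) (u \<tau>) - U0)) \<in> borel_measurable borel"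
    and "\<And>t z. t \<in> {0<..T} \<Longrightarrow> integrable lborel
      (\<lambda>\<tau>. pk (1 - \<alpha>) (t - \<tau>) * inner (indicator {0<..<T} \<tau> *\<^sub>R (diag (\<lambda>j. mu j powr (- q)) (u \<tau>) - U0)) z)"
    and "\<And>t z. t \<in> {0<..T} \<Longrightarrow> inner (J t) z = 1 / Gamma (1 - \<alpha>) *
      cv (pk (1 - \<alpha>)) (\<lambda>\<tau>. inner (indicator {0<..<T} \<tau> *\<^sub>R (diag (\<lambda>j. mu j powr (- q)) (u \<tau>) - U0)) z) t"
    and "\<And>t. t \<in> {0<..T} \<Longrightarrow> ((\<lambda>s. (J s - J t) /\<^sub>R (s - t)) \<longlongrightarrow> W t) (at t within {0<..T})"
proof -
  have c0: "c > 0" using c \<alpha> by linarith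
  have \<alpha>1: "1 - \<alpha> > 0" using \<alpha> by simp
  have G: "Gamma (1 - \<alpha>) > 0" by (rule Gamma_real_pos[OF \<alpha>1])
  interpret mK: multiplier \<alpha> M2 K by (rule multiplier_K) simp
  interpret mKp: multiplier "\<alpha> * q" M2 Kp by (rule multiplier_Kp)
  interpret m1: multiplier 1 1 "\<lambda>j s. 1 * pk 1 s" by (rule multiplier_pk) auto
  interpret mG: multiplier "1 - \<alpha>" "1 / Gamma (1 - \<alpha>)" "\<lambda>j s. 1 / Gamma (1 - \<alpha>) * pk (1 - \<alpha>) s"
    using \<alpha>1 G by (intro multiplier_pk) auto
  have f': "continuous_on {0<..<T} f" by (rule continuous_on_subset[OF f]) auto
  have h: "adm T c Cf h" unfolding h_def using f' f_bd Cf by (intro admI) auto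
  have hc: "continuous_on {0<..<T} h"
    using f' by (rule continuous_on_eq) (simp add: h_def)
  note bq = mu_neg_powr[of q]
  have bq: "\<bar>mu j powr (- q)\<bar> \<le> mu 0 powr (- q)" for j using bq[of j] pq by simp
  note coord_q = coord_diag[OF bq] and norm_q = norm_diag_le[OF bq]
  \<comment> \<open>X collects everything that \<open>ee j t\<close> multiplies after applying
    L^(\<beta>p), so V represents L^(\<beta>p) u. The initial value of u has the coordinates
    \<Psi>_j \<mu>_j^(-p) X_j; multiplied by \<mu>_j^(-q) they are \<Psi>_j/\<mu>_j X_j, which is
    \<open>U0\<close>.\<close>
  define X where "X = \<Phi> - VC Kp h T"
  define U0 where "U0 = diag (\<lambda>j. \<Psi> j / mu j) X"
  define V where "V t = diag (\<lambda>j. ee j t) X + VC Kp h t" for t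
  define W where "W t = diag (\<lambda>j. mu j powr (- q)) (f t) - V t" for t
  have coordU0: "coord U0 j = \<Psi> j / mu j * coord X j" for j
    unfolding U0_def by (rule coord_diag[OF B\<Psi>(1)])
  have ee1: "\<bar>ee j t\<bar> \<le> M\<theta> 1 * t powr (- \<alpha>)" if "t \<in> {0<..T}" for j t
    using ee_bound_powr[OF that, of 1 j] mu_pos[of j] by (simp add: M\<theta>_def)
  have coord_Kp: "coord (VC Kp h t) j = mu j powr p * coord (VC K h t) j" for t j
    unfolding mKp.VC_coord[OF h c0] mK.VC_coord[OF h c0] by (simp add: Kp_def mult.assoc)
  have pq1: "mu j powr (- q) = mu j powr p / mu j" for j
  proof -
    have "p - 1 = - q" using pq by linarith
    then have "mu j powr (- q) = mu j powr (p - 1)" by simp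
    then show ?thesis using mu_pos[of j] by (simp add: powr_diff)
  qed
  have mup: "mu j powr p * mu j powr (- p) = 1" for j using mu_pos[of j] by (simp flip: powr_add)
  have coordV: "coord (V t) j = mu j powr p * coord (u t) j" if t: "t \<in> {0<..T}" for t j
  proof -
    have "coord (V t) j = ee j t * (coord \<Phi> j - mu j powr p * coord (VC K h T) j) + mu j powr p * coord (VC K h t) j"
      by (simp add: V_def coord_diag[OF ee1[OF t]] X_def coord_Kp)
    also have "\<dots> = ee j t * ((mu j powr p * mu j powr (- p)) * coord \<Phi> j - mu j powr p * coord (VC K h T) j) + mu j powr p * coord (VC K h t) j"
      by (simp add: mup)
    also have "\<dots> = mu j powr p * coord (u t) j"
      unfolding u[OF t] by (simp add: algebra_simps)
    finally show ?thesis .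
  qed
  have u_q: "diag (\<lambda>j. mu j powr (- q)) (u t) = diag (\<lambda>j. \<Psi> j / mu j * ml_E \<alpha> (mu j) t) X + diag (\<lambda>j. mu j powr (- q)) (VC K h t)"
    if t: "t \<in> {0<..T}" for t
  proof (rule ell2_eqI)
    fix j
    have b: "\<bar>\<Psi> j / mu j * ml_E \<alpha> (mu j) t\<bar> \<le> B\<Psi> * M2" for j
      unfolding abs_mult by (intro mult_mono B\<Psi> E_le) auto
    have "coord (diag (\<lambda>j. mu j powr (- q)) (u t)) j = coord (V t) j / mu j"
      by (simp only: coord_q) (simp add: coordV[OF t] pq1)
    also have "\<dots> = ee j t / mu j * coord X j + mu j powr (- q) * coord (VC K h t) j"
      by (simp add: V_def coord_diag[OF ee1[OF t]] coord_Kp pq1 add_divide_distrib)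
    finally show "coord (diag (\<lambda>j. mu j powr (- q)) (u t)) j =
        coord (diag (\<lambda>j. \<Psi> j / mu j * ml_E \<alpha> (mu j) t) X + diag (\<lambda>j. mu j powr (- q)) (VC K h t)) j"
      by (simp only: coord_add coord_diag[OF b] coord_q) (simp add: ee_def)
  qed
  have lim0: "((\<lambda>t. diag (\<lambda>j. mu j powr (- q)) (u t)) \<longlongrightarrow> U0) (at_right 0)"
  proof -
    have ev: "\<forall>\<^sub>F t in at_right 0. t \<in> {0<..T}"
      using T unfolding eventually_at_right_field by (intro exI[of _ T]) auto
    have "((\<lambda>t. diag (\<lambda>j. \<Psi> j / mu j * ml_E \<alpha> (mu j) t) X) \<longlongrightarrow> U0) (at_right 0)"
      unfolding U0_def
    proof (rule diag_tendsto)
      fix j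
      have "(ml_E \<alpha> (mu j) \<longlongrightarrow> ml_E \<alpha> (mu j) 0) (at 0 within {0..})"
        using continuous_on_ml_E[OF \<alpha>(1), of "mu j"] by (auto simp: continuous_on_def)
      then have "(ml_E \<alpha> (mu j) \<longlongrightarrow> 1) (at_right 0)"
        unfolding ml_E_0[OF \<alpha>(1)] by (rule tendsto_within_subset) auto
      then have "((\<lambda>t. \<Psi> j / mu j * ml_E \<alpha> (mu j) t) \<longlongrightarrow> \<Psi> j / mu j * 1) (at_right 0)"
        by (intro tendsto_intros)
      then show "((\<lambda>t. \<Psi> j / mu j * ml_E \<alpha> (mu j) t) \<longlongrightarrow> \<Psi> j / mu j) (at_right 0)" by simp
      show "\<bar>\<Psi> j / mu j\<bar> \<le> B\<Psi> * (M2 + 1)"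
        using mult_mono[OF B\<Psi>(1)[of j], of 1 "M2 + 1"] B\<Psi>(2) M2 by simp
    next
      show "\<forall>\<^sub>F t in at_right 0. \<forall>j. \<bar>\<Psi> j / mu j * ml_E \<alpha> (mu j) t\<bar> \<le> B\<Psi> * (M2 + 1)"
      proof (intro always_eventually allI)
        fix t j
        have "\<bar>ml_E \<alpha> (mu j) t\<bar> \<le> M2 + 1" using E_le[of j t] by simp
        then show "\<bar>\<Psi> j / mu j * ml_E \<alpha> (mu j) t\<bar> \<le> B\<Psi> * (M2 + 1)"
          unfolding abs_mult by (intro mult_mono B\<Psi>) auto
      qed
    qed simp
    moreover have "((\<lambda>t. diag (\<lambda>j. mu j powr (- q)) (VC K h t)) \<longlongrightarrow> 0) (at_right 0)"
    proof (rule Lim_null_comparison)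
      show "\<forall>\<^sub>F t in at_right 0. norm (diag (\<lambda>j. mu j powr (- q)) (VC K h t)) \<le>
          mu 0 powr (- q) * (M2 * Cf * Beta \<alpha> c * t powr (\<alpha> + c - 1))"
        using ev
      proof eventually_elim
        case (elim t)
        then show ?case using order_trans[OF norm_q mult_left_mono[OF mK.VC_norm[OF h c0, of t]]] by (simp add: pk_def)
      qed
      have "((\<lambda>t. t powr (\<alpha> + c - 1)) \<longlongrightarrow> 0 powr (\<alpha> + c - 1)) (at_right 0)"
        using c by (intro tendsto_powr' tendsto_intros) (auto simp: eventually_at_filter)
      then have "((\<lambda>t. t powr (\<alpha> + c - 1)) \<longlongrightarrow> 0) (at_right 0)" by simp
      then show "((\<lambda>t. mu 0 powr (- q) * (M2 * Cf * Beta \<alpha> c * t powr (\<alpha> + c - 1))) \<longlongrightarrow> 0) (at_right 0)"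
        by (intro tendsto_mult_right_zero)
    qed
    ultimately have "((\<lambda>t. diag (\<lambda>j. \<Psi> j / mu j * ml_E \<alpha> (mu j) t) X + diag (\<lambda>j. mu j powr (- q)) (VC K h t)) \<longlongrightarrow> U0 + 0) (at_right 0)"
      by (rule tendsto_add)
    then have "((\<lambda>t. diag (\<lambda>j. \<Psi> j / mu j * ml_E \<alpha> (mu j) t) X + diag (\<lambda>j. mu j powr (- q)) (VC K h t)) \<longlongrightarrow> U0) (at_right 0)"
      by simp
    then show ?thesis
      by (rule Lim_transform_eventually) (use ev in eventually_elim, simp add: u_q)
  qed
  have Vc: "continuous_on {0<..T} V"
    unfolding V_def by (intro continuous_intros diag_ee_cont mKp.VC_cont[OF h c0 hc T])
  have Wc: "continuous_on {0<..T} W"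
    unfolding W_def by (intro continuous_intros Vc bounded_linear.continuous_on[OF bounded_linear_diag[OF bq]] f)
  define CW where "CW = M\<theta> 1 * norm \<Phi> + Df c * Cf"
  have CW: "CW \<ge> 0" unfolding CW_def using M\<theta>_nonneg[of 1] Df_nonneg[OF c0] Cf by simp
  have Wn: "norm (W t) \<le> CW * t powr (- \<alpha>)" if t: "t \<in> {0<..T}" for t
  proof -
    have b0: "Beta (\<alpha> * q) c \<ge> 0"
      using \<alpha>q Gamma_real_pos[of c] Gamma_real_pos[of "\<alpha> * q"] Gamma_real_pos[of "\<alpha> * q + c"] c0 by (simp add: Beta_def)
    have "norm (diag (\<lambda>j. mu j powr (- q)) (f t)) \<le> mu 0 powr (- q) * (Cf * pk c t)"
      by (rule order_trans[OF norm_q mult_left_mono]) (use f_bd[OF t] t in \<open>auto simp: pk_def\<close>)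
    also have "\<dots> \<le> mu 0 powr (- q) * (Cf * (T powr (c - (1 - \<alpha>)) * pk (1 - \<alpha>) t))"
      using c Cf t T by (intro mult_left_mono pk_le_pk) auto
    finally have 1: "norm (diag (\<lambda>j. mu j powr (- q)) (f t)) \<le> mu 0 powr (- q) * T powr (c - (1 - \<alpha>)) * Cf * t powr (- \<alpha>)"
      using t by (simp add: pk_def mult_ac)
    have "norm (VC Kp h t) \<le> M2 * Cf * Beta (\<alpha> * q) c * pk (\<alpha> * q + c) t" by (rule mKp.VC_norm[OF h c0])
    also have "\<dots> \<le> M2 * Cf * Beta (\<alpha> * q) c * (T powr (\<alpha> * q + c - (1 - \<alpha>)) * pk (1 - \<alpha>) t)"
      using c Cf t T M2 b0 \<alpha>q by (intro mult_left_mono pk_le_pk) auto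
    finally have 2: "norm (VC Kp h t) \<le> M2 * Beta (\<alpha> * q) c * T powr (\<alpha> * q + c - (1 - \<alpha>)) * Cf * t powr (- \<alpha>)"
      using t by (simp add: pk_def mult_ac)
    have "norm X \<le> norm \<Phi> + norm (VC Kp h T)" unfolding X_def by (rule norm_triangle_ineq4)
    also have "\<dots> \<le> norm \<Phi> + M2 * Cf * Beta (\<alpha> * q) c * pk (\<alpha> * q + c) T"
      using mKp.VC_norm[OF h c0, of T] by simp
    finally have nX: "norm X \<le> norm \<Phi> + M2 * Cf * Beta (\<alpha> * q) c * pk (\<alpha> * q + c) T" .
    have "norm (diag (\<lambda>j. ee j t) X) \<le> (M\<theta> 1 * t powr (- \<alpha>)) * norm X"
      by (rule norm_diag_le[OF ee1[OF t]])
    also have "\<dots> \<le> (M\<theta> 1 * t powr (- \<alpha>)) * (norm \<Phi> + M2 * Cf * Beta (\<alpha> * q) c * pk (\<alpha> * q + c) T)"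
      using nX M\<theta>_nonneg[of 1] by (intro mult_left_mono) auto
    finally have 3: "norm (diag (\<lambda>j. ee j t) X) \<le>
      M\<theta> 1 * norm \<Phi> * t powr (- \<alpha>) + M\<theta> 1 * (M2 * Beta (\<alpha> * q) c * pk (\<alpha> * q + c) T) * Cf * t powr (- \<alpha>)"
      by (simp add: algebra_simps)
    have "norm (W t) \<le> norm (diag (\<lambda>j. mu j powr (- q)) (f t)) + (norm (diag (\<lambda>j. ee j t) X) + norm (VC Kp h t))"
      unfolding W_def V_def by (intro order_trans[OF norm_triangle_ineq4] add_mono norm_triangle_ineq) auto
    also have "\<dots> \<le> CW * t powr (- \<alpha>)"
      using 1 2 3 by (simp add: CW_def Df_def algebra_simps)
    finally show ?thesis .
  qed
  define hW where "hW = (\<lambda>\<tau>. indicator {0<..<T} \<tau> *\<^sub>R W \<tau>)"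
  have hW: "adm T (1 - \<alpha>) CW hW"
    unfolding hW_def using Wn CW by (intro admI continuous_on_subset[OF Wc]) auto
  define Y where "Y t = diag (\<lambda>j. mu j powr (- q)) (u t) - U0" for t
  define Z where "Z = (\<lambda>\<tau>. indicator {0<..<T} \<tau> *\<^sub>R Y \<tau>)"
  have coordY: "coord (Y t) j = \<Psi> j / mu j * coord X j * (ml_E \<alpha> (mu j) t - 1) + mu j powr (- q) * coord (VC K h t) j"
    if t: "t \<in> {0<..T}" for t j
  proof -
    have b: "\<bar>\<Psi> j / mu j * ml_E \<alpha> (mu j) t\<bar> \<le> B\<Psi> * M2" for j
      unfolding abs_mult by (intro mult_mono B\<Psi> E_le) auto
    show ?thesis unfolding Y_def u_q[OF t] coord_diff coord_add coord_diag[OF b] coord_q coordU0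
      by (simp add: right_diff_distrib diff_divide_distrib mult_ac)
  qed
  have Yc: "continuous_on {0<..T} Y"
  proof -
    have "continuous_on {0<..T} (\<lambda>t. diag (\<lambda>j. 1 / mu j) (V t) - U0)"
    proof (intro continuous_intros bounded_linear.continuous_on[OF bounded_linear_diag] Vc)
      show "\<bar>1 / mu j\<bar> \<le> 1 / mu 0" for j using mu_ge[of j] mu0 by (simp add: frac_le)
    qed
    then show ?thesis
    proof (rule continuous_on_eq)
      fix t assume t: "t \<in> {0<..T}"
      have b: "\<bar>1 / mu j\<bar> \<le> 1 / mu 0" for j using mu_ge[of j] mu0 by (simp add: frac_le)
      show "diag (\<lambda>j. 1 / mu j) (V t) - U0 = Y t"
        unfolding Y_def by (rule ell2_eqI) (simp only: coord_diff coord_diag[OF b] coord_q, simp add: coordV[OF t] pq1)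
    qed
  qed
  obtain CY where CY: "CY \<ge> 0" "\<And>t. t \<in> {0<..T} \<Longrightarrow> norm (Y t) \<le> CY"
  proof
    define CY where "CY = B\<Psi> * M2 * norm X + mu 0 powr (- q) * (M2 * Cf * Beta \<alpha> c * T powr (\<alpha> + c - 1)) + norm U0"
    have b0: "Beta \<alpha> c \<ge> 0"
      using \<alpha> Gamma_real_pos[of c] Gamma_real_pos[of "\<alpha>"] Gamma_real_pos[of "\<alpha> + c"] c0 by (simp add: Beta_def)
    show "CY \<ge> 0" using B\<Psi> M2 Cf b0 by (simp add: CY_def)
    fix t assume t: "t \<in> {0<..T}"
    have b: "\<bar>\<Psi> j / mu j * ml_E \<alpha> (mu j) t\<bar> \<le> B\<Psi> * M2" for j
      unfolding abs_mult by (intro mult_mono B\<Psi> E_le) auto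
    have "norm (VC K h t) \<le> M2 * Cf * Beta \<alpha> c * T powr (\<alpha> + c - 1)"
    proof -
      have "pk (\<alpha> + c) t \<le> T powr (\<alpha> + c - 1) * pk 1 t" using c t T by (intro pk_le_pk) auto
      then have "M2 * Cf * Beta \<alpha> c * pk (\<alpha> + c) t \<le> M2 * Cf * Beta \<alpha> c * (T powr (\<alpha> + c - 1) * 1)"
        using t M2 Cf b0 by (intro mult_left_mono) (auto simp: pk_def)
      with mK.VC_norm[OF h c0, of t] show ?thesis by simp
    qed
    then have "norm (diag (\<lambda>j. mu j powr (- q)) (VC K h t)) \<le> mu 0 powr (- q) * (M2 * Cf * Beta \<alpha> c * T powr (\<alpha> + c - 1))"
      by (intro order_trans[OF norm_q mult_left_mono]) auto
    moreover have "norm (diag (\<lambda>j. \<Psi> j / mu j * ml_E \<alpha> (mu j) t) X) \<le> B\<Psi> * M2 * norm X" by (rule norm_diag_le[OF b])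
    ultimately show "norm (Y t) \<le> CY"
      unfolding Y_def u_q[OF t] CY_def
      by (intro order_trans[OF norm_triangle_ineq4] add_mono order_trans[OF norm_triangle_ineq]) auto
  qed
  have Z: "adm T 1 CY Z"
    unfolding Z_def using CY by (intro admI continuous_on_subset[OF Yc]) auto
  define J where "J t = VC (\<lambda>j s. 1 / Gamma (1 - \<alpha>) * pk (1 - \<alpha>) s) Z t" for t
  have J_eq: "J t = (\<integral>\<tau>. indicator {0<..<t} \<tau> *\<^sub>R W \<tau> \<partial>lborel)" if t: "t \<in> {0<..T}" for t
  proof -
    \<comment> \<open>In each coordinate this is \<open>cv_fractional_ode\<close> with coefficient
      \<open>cj\<close> and forcing term \<open>fj\<close>. The cut-offs at T do no harm, as the
      kernels only see arguments below t \<le> T.\<close>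
    have "J t = VC (\<lambda>j s. 1 * pk 1 s) hW t"
    proof (rule ell2_eqI)
      fix j
      define fj where "fj s = mu j powr (- q) * coord (h s) j" for s
      define cj where "cj = \<Psi> j / mu j * coord X j"
      have h0: "h s = 0" if "s \<notin> {0<..<T}" for s using that by (simp add: h_def)
      have fj: "kbd c fj"
      proof (rule kbdI)
        have "h \<in> borel_measurable borel" using h by (simp add: adm_def)
        then show "fj \<in> borel_measurable borel" unfolding fj_def[abs_def] by measurable
        show "\<bar>fj s\<bar> \<le> mu 0 powr (- q) * Cf * pk c s" for s
        proof -
          have "\<bar>coord (h s) j\<bar> \<le> Cf * pk c s" using abs_coord_le[of "h s" j] h by (meson adm_def order_trans)
          then have "\<bar>fj s\<bar> \<le> mu 0 powr (- q) * (Cf * pk c s)"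
            unfolding fj_def abs_mult using bq by (intro mult_mono) auto
          then show ?thesis by simp
        qed
      qed
      have cvK: "cv (ml_K \<alpha> (mu j)) fj s = mu j powr (- q) * coord (VC K h s) j" for s
        unfolding cv_def fj_def mK.VC_coord[OF h c0] by (simp add: K_def mult.left_commute)
      have "coord (J t) j = 1 / Gamma (1 - \<alpha>) * (\<integral>\<tau>. pk (1 - \<alpha>) (t - \<tau>) * coord (Z \<tau>) j \<partial>lborel)"
        unfolding J_def mG.VC_coord[OF Z zero_less_one] by (simp add: mult.assoc)
      also have "(\<integral>\<tau>. pk (1 - \<alpha>) (t - \<tau>) * coord (Z \<tau>) j \<partial>lborel) =
          cv (pk (1 - \<alpha>)) (\<lambda>s. cj * (indicator {0<..} s * (ml_E \<alpha> (mu j) s - 1)) + cv (ml_K \<alpha> (mu j)) fj s) t"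
        unfolding cv_def[of "pk (1 - \<alpha>)"]
      proof (rule Bochner_Integration.integral_cong[OF refl])
        fix \<tau>
        consider "\<tau> \<le> 0" | "t \<le> \<tau>" | "0 < \<tau>" "\<tau> < t" by linarith
        then show "pk (1 - \<alpha>) (t - \<tau>) * coord (Z \<tau>) j = pk (1 - \<alpha>) (t - \<tau>) *
          (cj * (indicator {0<..} \<tau> * (ml_E \<alpha> (mu j) \<tau> - 1)) + cv (ml_K \<alpha> (mu j)) fj \<tau>)"
        proof cases
          case 1
          have "norm (VC K h \<tau>) \<le> 0" using mK.VC_norm[OF h c0, of \<tau>] 1 by (simp add: pk_def)
          then show ?thesis using 1 by (simp add: Z_def cvK)
        next
          case 3
          then show ?thesis using t coordY[of \<tau> j] by (simp add: Z_def cvK cj_def)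
        qed (simp add: pk_def)
      qed
      also have "1 / Gamma (1 - \<alpha>) * \<dots> = cv (pk 1) fj t -
          mu j * cv (pk 1) (\<lambda>s. cj * (indicator {0<..} s * ml_E \<alpha> (mu j) s) + cv (ml_K \<alpha> (mu j)) fj s) t"
        using t mu_pos[of j] by (intro cv_fractional_ode[OF \<alpha> _ fj c0 kbd_K kbd_E]) auto
      also have "\<dots> = cv (pk 1) (\<lambda>s. fj s - mu j * (cj * (indicator {0<..} s * ml_E \<alpha> (mu j) s) + cv (ml_K \<alpha> (mu j)) fj s)) t"
      proof -
        define v where "v s = cj * (indicator {0<..} s * ml_E \<alpha> (mu j) s) + cv (ml_K \<alpha> (mu j)) fj s" for s
        have i1: "integrable lborel (\<lambda>\<tau>. pk 1 (t - \<tau>) * fj \<tau>)"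
          using c0 by (intro cv_integrable[OF kbd_pk fj]) auto
        have i2: "integrable lborel (\<lambda>\<tau>. pk 1 (t - \<tau>) * (indicator {0<..} \<tau> * ml_E \<alpha> (mu j) \<tau>))"
          by (intro cv_integrable[OF kbd_pk kbd_E]) auto
        have i3: "integrable lborel (\<lambda>\<tau>. pk 1 (t - \<tau>) * cv (ml_K \<alpha> (mu j)) fj \<tau>)"
          using c0 \<alpha> by (intro cv_integrable[OF kbd_pk kbd_cv[OF kbd_K fj]]) auto
        have i4: "integrable lborel (\<lambda>\<tau>. pk 1 (t - \<tau>) * v \<tau>)"
        proof -
          have "(\<lambda>\<tau>. pk 1 (t - \<tau>) * v \<tau>) = (\<lambda>\<tau>. cj * (pk 1 (t - \<tau>) * (indicator {0<..} \<tau> * ml_E \<alpha> (mu j) \<tau>)) +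
              pk 1 (t - \<tau>) * cv (ml_K \<alpha> (mu j)) fj \<tau>)" by (simp add: v_def fun_eq_iff algebra_simps)
          then show ?thesis using i2 i3 by simp
        qed
        have "cv (pk 1) (\<lambda>s. fj s - mu j * v s) t = (\<integral>\<tau>. pk 1 (t - \<tau>) * fj \<tau> - mu j * (pk 1 (t - \<tau>) * v \<tau>) \<partial>lborel)"
          by (simp add: cv_def algebra_simps)
        also have "\<dots> = cv (pk 1) fj t - mu j * cv (pk 1) v t"
          using i1 i4 by (simp add: cv_def)
        finally show ?thesis by (simp add: v_def[abs_def])
      qed
      also have "\<dots> = (\<integral>\<tau>. 1 * pk 1 (t - \<tau>) * coord (hW \<tau>) j \<partial>lborel)"
        unfolding cv_def[of "pk 1"]
      proof (rule Bochner_Integration.integral_cong[OF refl])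
        fix \<tau>
        consider "\<tau> \<le> 0" | "t \<le> \<tau>" | "0 < \<tau>" "\<tau> < t" by linarith
        then show "pk 1 (t - \<tau>) * (fj \<tau> - mu j * (cj * (indicator {0<..} \<tau> * ml_E \<alpha> (mu j) \<tau>) + cv (ml_K \<alpha> (mu j)) fj \<tau>)) =
            1 * pk 1 (t - \<tau>) * coord (hW \<tau>) j"
        proof cases
          case 1
          have "norm (VC K h \<tau>) \<le> 0" using mK.VC_norm[OF h c0, of \<tau>] 1 by (simp add: pk_def)
          then show ?thesis using 1 by (simp add: hW_def cvK fj_def h_def)
        next
          case 3
          then have \<tau>: "\<tau> \<in> {0<..T}" "\<tau> \<in> {0<..<T}" using t by auto
          have m: "mu j \<noteq> 0" using mu_pos[of j] by simp
          have "coord (hW \<tau>) j = fj \<tau> - coord (V \<tau>) j"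
            using \<tau> by (simp add: hW_def W_def fj_def h_def coord_q)
          also have "coord (V \<tau>) j = mu j * (cj * ml_E \<alpha> (mu j) \<tau> + cv (ml_K \<alpha> (mu j)) fj \<tau>)"
            unfolding V_def coord_add coord_diag[OF ee1[OF \<tau>(1)]] coord_Kp cvK using m
            by (simp add: pq1 cj_def ee_def field_simps)
          finally show ?thesis using 3 by simp
        qed (simp add: pk_def)
      qed
      also have "\<dots> = coord (VC (\<lambda>j s. 1 * pk 1 s) hW t) j"
        by (rule m1.VC_coord[OF hW \<alpha>1, symmetric])
      finally show "coord (J t) j = coord (VC (\<lambda>j s. 1 * pk 1 s) hW t) j" .
    qed
    also have "\<dots> = (\<integral>\<tau>. indicator {0<..<t} \<tau> *\<^sub>R W \<tau> \<partial>lborel)"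
      unfolding VC_def diag_const
      by (rule Bochner_Integration.integral_cong) (use t in \<open>auto simp: hW_def pk_def indicator_def\<close>)
    finally show ?thesis .
  qed
  have hWint: "integrable lborel hW" by (rule adm_integrable[OF hW \<alpha>1])
  have der: "((\<lambda>s. (J s - J t) /\<^sub>R (s - t)) \<longlongrightarrow> W t) (at t within {0<..T})" if t: "t \<in> {0<..T}" for t
  proof -
    have "((\<lambda>s. ((\<integral>\<tau>. indicator {0<..<s} \<tau> *\<^sub>R W \<tau> \<partial>lborel) - (\<integral>\<tau>. indicator {0<..<t} \<tau> *\<^sub>R W \<tau> \<partial>lborel)) /\<^sub>R (s - t)) \<longlongrightarrow> W t)
        (at t within {0<..T})"
      by (rule primitive_derivative[OF Wc _ t]) (use hWint in \<open>simp add: hW_def\<close>)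
    then show ?thesis
      by (rule Lim_transform_eventually) (use t in \<open>auto simp: eventually_at_filter J_eq\<close>)
  qed
  have Zmeas: "Z \<in> borel_measurable borel" using Z by (simp add: adm_def)
  have Zint: "integrable lborel (\<lambda>\<tau>. (pk (1 - \<alpha>) (t - \<tau>) / Gamma (1 - \<alpha>)) *\<^sub>R Z \<tau>)" for t
    using mG.VC_integrable[OF Z zero_less_one, of t] by (simp add: diag_const)
  have Jt: "J t = (\<integral>\<tau>. (pk (1 - \<alpha>) (t - \<tau>) / Gamma (1 - \<alpha>)) *\<^sub>R Z \<tau> \<partial>lborel)" for t
    by (simp add: J_def VC_def diag_const)
  have int: "integrable lborel (\<lambda>\<tau>. pk (1 - \<alpha>) (t - \<tau>) * inner (Z \<tau>) z)" for t z
  proof -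
    have "integrable lborel (\<lambda>\<tau>. Gamma (1 - \<alpha>) * inner ((pk (1 - \<alpha>) (t - \<tau>) / Gamma (1 - \<alpha>)) *\<^sub>R Z \<tau>) z)"
      using Zint[of t] by (intro integrable_mult_right integrable_inner_left)
    moreover have "Gamma (1 - \<alpha>) \<noteq> 0" using G by linarith
    ultimately show ?thesis by simp
  qed
  have J_in: "inner (J t) z = 1 / Gamma (1 - \<alpha>) * cv (pk (1 - \<alpha>)) (\<lambda>\<tau>. inner (Z \<tau>) z) t" for t z
  proof -
    have "inner (J t) z = (\<integral>\<tau>. inner ((pk (1 - \<alpha>) (t - \<tau>) / Gamma (1 - \<alpha>)) *\<^sub>R Z \<tau>) z \<partial>lborel)"
      unfolding Jt using Zint[of t] by (intro integral_inner_left[symmetric]) auto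
    also have "\<dots> = (\<integral>\<tau>. 1 / Gamma (1 - \<alpha>) * (pk (1 - \<alpha>) (t - \<tau>) * inner (Z \<tau>) z) \<partial>lborel)" by simp
    finally show ?thesis unfolding cv_def by simp
  qed
  show thesis
    by (rule that[of U0 W J]) (use lim0 Wc Wn Zmeas int J_in der in \<open>simp_all add: CW_def Z_def Y_def\<close>)
qed

end

section \<open>The nonlocal problem\<close>

text \<open>Nothing is assumed about measurability of f, which is typically an inner product with an
  arbitrary representative; it follows from the agreement with g by completeness.\<close>

lemma lebesgue_on_interval_transport:
  fixes f g :: "real \<Rightarrow> real"
  assumes g: "g \<in> borel_measurable borel" and g0: "\<And>\<tau>. \<tau> \<notin> {0<..<t} \<Longrightarrow> g \<tau> = 0"
    and ae: "AE \<tau> in lborel. \<tau> \<in> {0<..<t} \<longrightarrow> f \<tau> = g \<tau>"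
  shows "integrable (lebesgue_on {0<..<t}) f \<longleftrightarrow> integrable lborel g"
    and "(LINT \<tau>|lebesgue_on {0<..<t}. f \<tau>) = (\<integral>\<tau>. g \<tau> \<partial>lborel)"
proof -
  let ?M = "lebesgue_on {0<..<t}"
  have S: "{0<..<t} \<in> sets lebesgue" "{0<..<t} \<in> sets borel" by auto
  have gm: "g \<in> borel_measurable ?M" using g by (intro measurable_restrict_space1 measurable_completion) simp
  have ae': "AE \<tau> in ?M. f \<tau> = g \<tau>" unfolding AE_lebesgue_on_iff[OF S(2)] by (rule ae)
  have ae'': "AE \<tau> in ?M. g \<tau> = f \<tau>" using ae' by eventually_elim simp
  have fm: "f \<in> borel_measurable ?M" by (rule borel_measurable_AE_lebesgue_on[OF S(1) gm ae''])
  have ind: "(\<lambda>\<tau>. indicator {0<..<t} \<tau> *\<^sub>R g \<tau>) = g"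
  proof
    show "indicator {0<..<t} \<tau> *\<^sub>R g \<tau> = g \<tau>" for \<tau> using g0[of \<tau>] by (cases "\<tau> \<in> {0<..<t}") auto
  qed
  have "integrable ?M f \<longleftrightarrow> integrable ?M g" by (rule integrable_cong_AE[OF fm gm ae'])
  then show "integrable ?M f \<longleftrightarrow> integrable lborel g"
    using integrable_lebesgue_on_borel[OF S(2), of g] g unfolding ind by simp
  have "(LINT \<tau>|?M. f \<tau>) = (LINT \<tau>|?M. g \<tau>)" by (rule integral_cong_AE[OF fm gm ae'])
  then show "(LINT \<tau>|?M. f \<tau>) = (\<integral>\<tau>. g \<tau> \<partial>lborel)"
    using integral_lebesgue_on_borel[OF S(2), of g] g unfolding ind by simp
qed

lemma AE_interval_ex:
  assumes "AE t in lborel. t \<in> {0<..<T} \<longrightarrow> P t" "T > (0::real)"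
  shows "\<exists>t\<in>{0<..<T}. P t"
proof (rule ccontr)
  assume "\<not> ?thesis"
  with assms(1) have "AE t in lborel. t \<notin> {0<..<T}" by (elim AE_mp) auto
  then have "emeasure lborel {0<..<T} = 0" by (subst (asm) AE_iff_null_sets[symmetric]) (auto simp: null_sets_def)
  then show False using assms(2) by simp
qed

locale nonlocal_problem = L2_basis \<Omega> e + solution_operators \<alpha> T \<kappa> M2 C p q "\<lambda>j. lam j powr \<beta>" "Psi lam \<alpha> \<beta> \<kappa> T"
  for \<Omega> :: "(real ^ 'n) set" and e and \<alpha> T \<kappa> M2 C p q and lam :: "nat \<Rightarrow> real" and \<beta> +
  fixes \<Upsilon> :: real and k :: "real \<Rightarrow> real" and F :: "real \<Rightarrow> (real ^ 'n \<Rightarrow> real) \<Rightarrow> real ^ 'n \<Rightarrow> real"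
  assumes \<Omega>: "open \<Omega>" and \<beta>: "\<beta> > 0" and lam: "\<And>j. 0 < lam 0 \<and> lam 0 \<le> lam j"
    and k: "continuous_on {0..T} k"
    and F_L2: "\<And>t v. t \<in> {0<..<T} \<Longrightarrow> v \<in> L2 \<Omega> \<Longrightarrow> F t v \<in> L2 \<Omega>"
    and F_0: "\<And>t. t \<in> {0<..<T} \<Longrightarrow> AE x in lebesgue_on \<Omega>. F t (\<lambda>_. 0) x = 0"
    and \<Upsilon>: "\<Upsilon> > 0"
    and F_lip: "\<And>t1 t2 v1 v2. t1 \<in> {0<..<T} \<Longrightarrow> t2 \<in> {0<..<T} \<Longrightarrow> v1 \<in> L2 \<Omega> \<Longrightarrow> v2 \<in> L2 \<Omega> \<Longrightarrow>
      L2_norm \<Omega> (\<lambda>x. F t1 v1 x - F t2 v2 x) \<le> \<Upsilon> * (\<bar>t1 - t2\<bar> + L2_norm \<Omega> (\<lambda>x. v1 x - v2 x))"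
    and gA: "(\<Upsilon> + C_norm T k) * A\<Theta> < 1"
begin

abbreviation g :: real where "g \<equiv> \<Upsilon> + C_norm T k"

lemma \<Omega>_sets: "\<Omega> \<in> sets lebesgue"
  using \<Omega> by (metis borel_open sets_completionI_sets sets_lborel)

lemma lam_pos: "lam j > 0"
  using lam[of j] by linarith

lemma k_le: "t \<in> {0..T} \<Longrightarrow> \<bar>k t\<bar> \<le> C_norm T k"
  unfolding C_norm_def
proof (rule cSUP_upper)
  have "compact ((\<lambda>t. \<bar>k t\<bar>) ` {0..T})"
    by (intro compact_continuous_image continuous_intros k) auto
  then show "bdd_above ((\<lambda>t. \<bar>k t\<bar>) ` {0..T})" by (intro bounded_imp_bdd_above compact_imp_bounded)
qed

lemma C_norm_nonneg: "C_norm T k \<ge> 0"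
  using k_le[of 0] T abs_ge_zero[of "k 0"] by (simp del: abs_ge_zero) 

lemma g_nonneg: "g \<ge> 0"
  using \<Upsilon> C_norm_nonneg by simp

lemma G1_kernel_eq: "s > 0 \<Longrightarrow> G1_kernel lam \<alpha> \<beta> j s = K j s"
  by (simp add: G1_kernel_def K_def ml_K_def pk_def)

section \<open>Mild solutions in coordinates\<close>

definition represents :: "(real \<Rightarrow> ell2) \<Rightarrow> (real \<Rightarrow> real ^ 'n \<Rightarrow> real) \<Rightarrow> bool" where
  "represents H h \<longleftrightarrow> H \<in> borel_measurable borel \<and> (\<forall>\<tau>. \<tau> \<notin> {0<..<T} \<longrightarrow> H \<tau> = 0) \<and>
     (AE \<tau> in lborel. \<tau> \<in> {0<..<T} \<longrightarrow> h \<tau> \<in> L2 \<Omega> \<and> hat (h \<tau>) = H \<tau>)"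

lemma G1_transport:
  assumes rep: "represents H h" and t: "t \<in> {0<..T}"
  shows "integrable (lebesgue_on {0<..<t}) (\<lambda>\<tau>. L2_inner \<Omega> (h \<tau>) (e j) * G1_kernel lam \<alpha> \<beta> j (t - \<tau>)) \<longleftrightarrow>
      integrable lborel (\<lambda>\<tau>. K j (t - \<tau>) * coord (H \<tau>) j)"
    and "(LINT \<tau>|lebesgue_on {0<..<t}. L2_inner \<Omega> (h \<tau>) (e j) * G1_kernel lam \<alpha> \<beta> j (t - \<tau>)) =
      (\<integral>\<tau>. K j (t - \<tau>) * coord (H \<tau>) j \<partial>lborel)"
proof -
  interpret multiplier \<alpha> M2 K by (rule multiplier_K) simp
  have H: "H \<in> borel_measurable borel" "\<And>\<tau>. \<tau> \<notin> {0<..<T} \<Longrightarrow> H \<tau> = 0"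
    and ae: "AE \<tau> in lborel. \<tau> \<in> {0<..<T} \<longrightarrow> h \<tau> \<in> L2 \<Omega> \<and> hat (h \<tau>) = H \<tau>"
    using rep by (auto simp: represents_def)
  have 1: "(\<lambda>\<tau>. K j (t - \<tau>) * coord (H \<tau>) j) \<in> borel_measurable borel" using H by measurable
  have 2: "K j (t - \<tau>) * coord (H \<tau>) j = 0" if "\<tau> \<notin> {0<..<t}" for \<tau>
    using that t H(2)[of \<tau>] m_0[of "t - \<tau>" j] by (cases "\<tau> \<le> 0") auto
  have 3: "AE \<tau> in lborel. \<tau> \<in> {0<..<t} \<longrightarrow> L2_inner \<Omega> (h \<tau>) (e j) * G1_kernel lam \<alpha> \<beta> j (t - \<tau>) = K j (t - \<tau>) * coord (H \<tau>) j"
    using ae by eventually_elim (use t in \<open>auto simp: G1_kernel_eq simp flip: coord_hat\<close>)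
  note * = lebesgue_on_interval_transport[OF 1 2 3]
  show "integrable (lebesgue_on {0<..<t}) (\<lambda>\<tau>. L2_inner \<Omega> (h \<tau>) (e j) * G1_kernel lam \<alpha> \<beta> j (t - \<tau>)) \<longleftrightarrow>
      integrable lborel (\<lambda>\<tau>. K j (t - \<tau>) * coord (H \<tau>) j)" by (rule *(1))
  show "(LINT \<tau>|lebesgue_on {0<..<t}. L2_inner \<Omega> (h \<tau>) (e j) * G1_kernel lam \<alpha> \<beta> j (t - \<tau>)) =
      (\<integral>\<tau>. K j (t - \<tau>) * coord (H \<tau>) j \<partial>lborel)" by (rule *(2))
qed

lemma has_G1_iff:
  assumes rep: "represents H h" and t: "t \<in> {0<..T}"
  shows "has_G1 \<Omega> lam e \<alpha> \<beta> t h w \<longleftrightarrow> w \<in> L2 \<Omega> \<and>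
    (\<forall>j. integrable lborel (\<lambda>\<tau>. K j (t - \<tau>) * coord (H \<tau>) j) \<and>
         coord (hat w) j = (\<integral>\<tau>. K j (t - \<tau>) * coord (H \<tau>) j \<partial>lborel))"
  unfolding has_G1_def L2_sums_iff G1_transport[OF assms] by (auto simp: coord_hat)

lemma has_G2_iff:
  assumes v: "v \<in> L2 \<Omega>"
  shows "has_G2 \<Omega> lam e \<alpha> \<beta> \<kappa> T t v w \<longleftrightarrow> w \<in> L2 \<Omega> \<and> (\<forall>j. coord (hat w) j = ee j t * coord (hat v) j)"
  unfolding has_G2_def L2_sums_iff using v by (auto simp: coord_hat ee_def ml_E_def mult_ac)

text \<open>The intermediate function in \<open>has_G3\<close> is replaced by its coefficient vector
  \<xi>. In the converse direction \<open>syn \<xi>\<close> recovers such a function.\<close>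

lemma has_G3_iff:
  assumes rep: "represents H h"
  shows "has_G3 \<Omega> lam e \<alpha> \<beta> \<kappa> T t h w \<longleftrightarrow> w \<in> L2 \<Omega> \<and>
    (\<exists>\<xi>. (\<forall>j. integrable lborel (\<lambda>\<tau>. K j (T - \<tau>) * coord (H \<tau>) j) \<and>
              coord \<xi> j = (\<integral>\<tau>. K j (T - \<tau>) * coord (H \<tau>) j \<partial>lborel)) \<and>
         (\<forall>j. coord (hat w) j = - (ee j t * coord \<xi> j)))" (is "?L \<longleftrightarrow> ?R")
proof
  have T': "T \<in> {0<..T}" using T by simp
  assume ?L
  then obtain v where v: "has_G1 \<Omega> lam e \<alpha> \<beta> T h v" "has_G2 \<Omega> lam e \<alpha> \<beta> \<kappa> T t v (\<lambda>x. - w x)"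
    by (auto simp: has_G3_def)
  then have v': "v \<in> L2 \<Omega>" by (simp add: has_G1_iff[OF assms T'])
  have w': "(\<lambda>x. - w x) \<in> L2 \<Omega>" and c: "\<And>j. coord (hat (\<lambda>x. - w x)) j = ee j t * coord (hat v) j"
    using v(2) by (auto simp: has_G2_iff[OF v'])
  have w: "w \<in> L2 \<Omega>" using L2_cmult[OF w', of "- 1"] by simp
  have "hat (\<lambda>x. - w x) = - hat w" using hat_cmult[OF w, of "- 1"] by simp
  then have "coord (hat w) j = - (ee j t * coord (hat v) j)" for j using c[of j] by simp
  then show ?R using w v(1) unfolding has_G1_iff[OF assms T'] by (intro conjI exI[of _ "hat v"]) auto
next
  have T': "T \<in> {0<..T}" using T by simp
  assume R: ?R
  then obtain \<xi> where w: "w \<in> L2 \<Omega>" and \<xi>: "\<And>j. integrable lborel (\<lambda>\<tau>. K j (T - \<tau>) * coord (H \<tau>) j) \<and>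
              coord \<xi> j = (\<integral>\<tau>. K j (T - \<tau>) * coord (H \<tau>) j \<partial>lborel)"
         "\<And>j. coord (hat w) j = - (ee j t * coord \<xi> j)" by blast
  have w': "(\<lambda>x. - w x) \<in> L2 \<Omega>" using L2_cmult[OF w, of "- 1"] by simp
  have h': "hat (\<lambda>x. - w x) = - hat w" using hat_cmult[OF w, of "- 1"] by simp
  have 1: "has_G1 \<Omega> lam e \<alpha> \<beta> T h (syn \<xi>)" unfolding has_G1_iff[OF assms T'] using \<xi>(1) by simp
  have 2: "has_G2 \<Omega> lam e \<alpha> \<beta> \<kappa> T t (syn \<xi>) (\<lambda>x. - w x)"
    unfolding has_G2_iff[OF syn_L2] using w' \<xi>(2) by (simp add: h')
  show ?L unfolding has_G3_def using 1 2 by blast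
qed

text \<open>The operator \<open>\<G>\<^sub>3\<close> depends on t through \<open>ee j t\<close>
  only; its inner value at T is the same vector at all times. Hence one time t0 at which the
  equation holds yields the vector \<xi>, and the equations at other times are rewritten with
  it.\<close>

lemma mild_hat:
  assumes v: "mild_solution \<Omega> lam e \<alpha> \<beta> \<kappa> T \<phi> k F v" and \<phi>: "\<phi> \<in> L2 \<Omega>"
  obtains H \<xi> where "H \<in> borel_measurable borel" "integrable lborel H" "\<forall>t. t \<notin> {0<..<T} \<longrightarrow> H t = 0"
    "\<forall>j. integrable lborel (\<lambda>\<tau>. K j (T - \<tau>) * coord (H \<tau>) j) \<and>
      coord \<xi> j = (\<integral>\<tau>. K j (T - \<tau>) * coord (H \<tau>) j \<partial>lborel)"
    "AE t in lborel. t \<in> {0<..<T} \<longrightarrow> v t \<in> L2 \<Omega> \<and> H t = hat (F t (v t)) - k t *\<^sub>R hat (v t) \<and>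
      (\<forall>j. integrable lborel (\<lambda>\<tau>. K j (t - \<tau>) * coord (H \<tau>) j) \<and>
           coord (hat (v t)) j = ee j t * coord (hat \<phi>) j + (\<integral>\<tau>. K j (t - \<tau>) * coord (H \<tau>) j \<partial>lborel) - ee j t * coord \<xi> j)"
proof -
  have I: "{0<..<T} \<in> sets borel" by simp
  obtain H1 where H1: "H1 \<in> borel_measurable borel" "integrable lborel H1" "\<And>t. t \<notin> {0<..<T} \<Longrightarrow> H1 t = 0"
    and ae1: "AE t in lborel. t \<in> {0<..<T} \<longrightarrow> F t (v t) \<in> L2 \<Omega> \<and> hat (F t (v t)) = H1 t"
    using v Bochner_Lp_ell2[of "\<lambda>t. F t (v t)" T] unfolding mild_solution_def AE_lebesgue_on_iff[OF I] by blast
  obtain H2 where H2: "H2 \<in> borel_measurable borel" "integrable lborel H2" "\<And>t. t \<notin> {0<..<T} \<Longrightarrow> H2 t = 0"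
    and ae2: "AE t in lborel. t \<in> {0<..<T} \<longrightarrow> (\<lambda>x. k t * v t x) \<in> L2 \<Omega> \<and> hat (\<lambda>x. k t * v t x) = H2 t"
    using v Bochner_Lp_ell2[of "\<lambda>t x. k t * v t x" T] unfolding mild_solution_def AE_lebesgue_on_iff[OF I] by blast
  have h1: "represents H1 (\<lambda>t. F t (v t))" using H1(1,3) ae1 by (simp add: represents_def)
  have h2: "represents H2 (\<lambda>t x. k t * v t x)" using H2(1,3) ae2 by (simp add: represents_def)
  define E where "E t a1 a2 a3 a4 a5 \<longleftrightarrow>
        has_G2 \<Omega> lam e \<alpha> \<beta> \<kappa> T t \<phi> a1 \<and>
        has_G1 \<Omega> lam e \<alpha> \<beta> t (\<lambda>\<tau>. F \<tau> (v \<tau>)) a2 \<and>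
        has_G3 \<Omega> lam e \<alpha> \<beta> \<kappa> T t (\<lambda>\<tau>. F \<tau> (v \<tau>)) a3 \<and>
        has_G3 \<Omega> lam e \<alpha> \<beta> \<kappa> T t (\<lambda>\<tau> x. k \<tau> * v \<tau> x) a4 \<and>
        has_G1 \<Omega> lam e \<alpha> \<beta> t (\<lambda>\<tau> x. k \<tau> * v \<tau> x) a5 \<and>
        (AE x in lebesgue_on \<Omega>. v t x = a1 x + a2 x + a3 x - a4 x - a5 x)" for t a1 a2 a3 a4 a5
  have ae: "AE t in lborel. t \<in> {0<..<T} \<longrightarrow> (\<exists>a1 a2 a3 a4 a5. E t a1 a2 a3 a4 a5)"
    using v unfolding mild_solution_def AE_lebesgue_on_iff[OF I] E_def by blast
  obtain t0 a1 a2 a3 a4 a5 where t0: "t0 \<in> {0<..<T}" "E t0 a1 a2 a3 a4 a5"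
    using AE_interval_ex[OF ae T] by blast
  obtain \<xi>1 where \<xi>1: "\<And>j. integrable lborel (\<lambda>\<tau>. K j (T - \<tau>) * coord (H1 \<tau>) j)"
      "\<And>j. coord \<xi>1 j = (\<integral>\<tau>. K j (T - \<tau>) * coord (H1 \<tau>) j \<partial>lborel)"
    using t0(2) unfolding E_def has_G3_iff[OF h1] by blast
  obtain \<xi>2 where \<xi>2: "\<And>j. integrable lborel (\<lambda>\<tau>. K j (T - \<tau>) * coord (H2 \<tau>) j)"
      "\<And>j. coord \<xi>2 j = (\<integral>\<tau>. K j (T - \<tau>) * coord (H2 \<tau>) j \<partial>lborel)"
    using t0(2) unfolding E_def has_G3_iff[OF h2] by blast
  define H where "H \<tau> = H1 \<tau> - H2 \<tau>" for \<tau>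
  define \<xi> where "\<xi> = \<xi>1 - \<xi>2"
  show thesis
  proof (rule that[of H \<xi>])
    show "H \<in> borel_measurable borel" "integrable lborel H" "\<forall>t. t \<notin> {0<..<T} \<longrightarrow> H t = 0"
      using H1 H2 by (auto simp: H_def[abs_def])
    show "\<forall>j. integrable lborel (\<lambda>\<tau>. K j (T - \<tau>) * coord (H \<tau>) j) \<and>
        coord \<xi> j = (\<integral>\<tau>. K j (T - \<tau>) * coord (H \<tau>) j \<partial>lborel)"
      using \<xi>1 \<xi>2 by (auto simp: H_def \<xi>_def right_diff_distrib)
    show "AE t in lborel. t \<in> {0<..<T} \<longrightarrow> v t \<in> L2 \<Omega> \<and> H t = hat (F t (v t)) - k t *\<^sub>R hat (v t) \<and>
      (\<forall>j. integrable lborel (\<lambda>\<tau>. K j (t - \<tau>) * coord (H \<tau>) j) \<and>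
           coord (hat (v t)) j = ee j t * coord (hat \<phi>) j + (\<integral>\<tau>. K j (t - \<tau>) * coord (H \<tau>) j \<partial>lborel) - ee j t * coord \<xi> j)"
      using ae ae1 ae2
    proof eventually_elim
      case (elim t)
      show ?case
      proof
        assume t: "t \<in> {0<..<T}"
        then have t': "t \<in> {0<..T}" by simp
        obtain a1 a2 a3 a4 a5 where a: "E t a1 a2 a3 a4 a5" using elim t by blast
        have L: "a1 \<in> L2 \<Omega>" "a2 \<in> L2 \<Omega>" "a3 \<in> L2 \<Omega>" "a4 \<in> L2 \<Omega>" "a5 \<in> L2 \<Omega>"
          using a unfolding E_def has_G1_iff[OF h1 t'] has_G1_iff[OF h2 t'] has_G3_iff[OF h1] has_G3_iff[OF h2] has_G2_iff[OF \<phi>]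
          by blast+
        have c1: "coord (hat a1) j = ee j t * coord (hat \<phi>) j" for j
          using a unfolding E_def has_G2_iff[OF \<phi>] by blast
        have c2: "integrable lborel (\<lambda>\<tau>. K j (t - \<tau>) * coord (H1 \<tau>) j)"
          "coord (hat a2) j = (\<integral>\<tau>. K j (t - \<tau>) * coord (H1 \<tau>) j \<partial>lborel)" for j
          using a unfolding E_def has_G1_iff[OF h1 t'] by blast+
        have c5: "integrable lborel (\<lambda>\<tau>. K j (t - \<tau>) * coord (H2 \<tau>) j)"
          "coord (hat a5) j = (\<integral>\<tau>. K j (t - \<tau>) * coord (H2 \<tau>) j \<partial>lborel)" for j
          using a unfolding E_def has_G1_iff[OF h2 t'] by blast+
        have c3: "coord (hat a3) j = - (ee j t * coord \<xi>1 j)" for j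
        proof -
          have "has_G3 \<Omega> lam e \<alpha> \<beta> \<kappa> T t (\<lambda>\<tau>. F \<tau> (v \<tau>)) a3" using a unfolding E_def by blast
          then obtain \<xi>' where "\<And>j. coord \<xi>' j = coord \<xi>1 j" "\<And>j. coord (hat a3) j = - (ee j t * coord \<xi>' j)"
            unfolding has_G3_iff[OF h1] \<xi>1(2) by blast
          then show ?thesis by simp
        qed
        have c4: "coord (hat a4) j = - (ee j t * coord \<xi>2 j)" for j
        proof -
          have "has_G3 \<Omega> lam e \<alpha> \<beta> \<kappa> T t (\<lambda>\<tau> x. k \<tau> * v \<tau> x) a4" using a unfolding E_def by blast
          then obtain \<xi>' where "\<And>j. coord \<xi>' j = coord \<xi>2 j" "\<And>j. coord (hat a4) j = - (ee j t * coord \<xi>' j)"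
            unfolding has_G3_iff[OF h2] \<xi>2(2) by blast
          then show ?thesis by simp
        qed
        define s where "s x = a1 x + a2 x + a3 x - a4 x - a5 x" for x
        have s: "s \<in> L2 \<Omega>" unfolding s_def by (intro L2_diff L2_add L)
        have hs: "hat s = hat a1 + hat a2 + hat a3 - hat a4 - hat a5"
          unfolding s_def by (simp add: hat_diff hat_add L2_diff L2_add L)
        have sv: "AE x in lebesgue_on \<Omega>. s x = v t x"
          using a unfolding E_def s_def by (auto elim: AE_mp)
        \<comment> \<open>The definition places v in a Bochner space with unspecified exponents;
          that v t is square integrable is read off from the equation.\<close>
        have vt: "v t \<in> L2 \<Omega>" by (rule L2_cong_AE[OF \<Omega>_sets s sv])
        have hv: "hat (v t) = hat s" using hat_eq_iff[OF s vt] sv by simp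
        have "H t = hat (F t (v t)) - k t *\<^sub>R hat (v t)"
          using elim t hat_cmult[OF vt, of "k t"] by (simp add: H_def)
        moreover have "integrable lborel (\<lambda>\<tau>. K j (t - \<tau>) * coord (H \<tau>) j) \<and>
           coord (hat (v t)) j = ee j t * coord (hat \<phi>) j + (\<integral>\<tau>. K j (t - \<tau>) * coord (H \<tau>) j \<partial>lborel) - ee j t * coord \<xi> j" for j
        proof -
          have "(\<integral>\<tau>. K j (t - \<tau>) * coord (H \<tau>) j \<partial>lborel) = coord (hat a2) j - coord (hat a5) j"
            using c2[of j] c5[of j] by (simp add: H_def right_diff_distrib)
          moreover have "integrable lborel (\<lambda>\<tau>. K j (t - \<tau>) * coord (H \<tau>) j)"
            using c2[of j] c5[of j] by (simp add: H_def right_diff_distrib)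
          moreover have "coord (hat (v t)) j = coord (hat a1) j + coord (hat a2) j + coord (hat a3) j - coord (hat a4) j - coord (hat a5) j"
            by (simp add: hv hs)
          ultimately show ?thesis unfolding c1 c3 c4 \<xi>_def by (simp add: algebra_simps)
        qed
        ultimately show "v t \<in> L2 \<Omega> \<and> H t = hat (F t (v t)) - k t *\<^sub>R hat (v t) \<and>
      (\<forall>j. integrable lborel (\<lambda>\<tau>. K j (t - \<tau>) * coord (H \<tau>) j) \<and>
           coord (hat (v t)) j = ee j t * coord (hat \<phi>) j + (\<integral>\<tau>. K j (t - \<tau>) * coord (H \<tau>) j \<partial>lborel) - ee j t * coord \<xi> j)"
          using vt by blast
      qed
    qed
  qed
qed

lemma norm_hat_F_diff:
  assumes "t \<in> {0<..<T}" "s \<in> {0<..<T}" "v \<in> L2 \<Omega>" "w \<in> L2 \<Omega>"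
  shows "norm (hat (F t v) - hat (F s w)) \<le> \<Upsilon> * (\<bar>t - s\<bar> + norm (hat v - hat w))"
  using F_lip[OF assms] assms dist_hat[of "F t v" "F s w"] dist_hat[of v w] by (simp add: dist_norm F_L2)

lemma mild_unique:
  assumes u: "mild_solution \<Omega> lam e \<alpha> \<beta> \<kappa> T \<phi> k F u" and v: "mild_solution \<Omega> lam e \<alpha> \<beta> \<kappa> T \<phi> k F v"
    and \<phi>: "\<phi> \<in> L2 \<Omega>"
  shows "AE t in lebesgue_on {0<..<T}. AE x in lebesgue_on \<Omega>. v t x = u t x"
proof -
  obtain M \<delta> \<rho> N1 N3 c0 C0 where "evolution \<alpha> M K T ee \<delta> \<rho> N1 N3 A\<Theta> c0 C0 g"
    by (rule evolution_exists[OF g_nonneg gA])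
  then interpret evolution \<alpha> M K T ee \<delta> \<rho> N1 N3 A\<Theta> c0 C0 g .
  obtain H \<xi> where H: "H \<in> borel_measurable borel" "integrable lborel H" "\<forall>t. t \<notin> {0<..<T} \<longrightarrow> H t = 0"
    "\<forall>j. integrable lborel (\<lambda>\<tau>. K j (T - \<tau>) * coord (H \<tau>) j) \<and>
      coord \<xi> j = (\<integral>\<tau>. K j (T - \<tau>) * coord (H \<tau>) j \<partial>lborel)"
    and aeH: "AE t in lborel. t \<in> {0<..<T} \<longrightarrow> v t \<in> L2 \<Omega> \<and> H t = hat (F t (v t)) - k t *\<^sub>R hat (v t) \<and>
      (\<forall>j. integrable lborel (\<lambda>\<tau>. K j (t - \<tau>) * coord (H \<tau>) j) \<and>
           coord (hat (v t)) j = ee j t * coord (hat \<phi>) j + (\<integral>\<tau>. K j (t - \<tau>) * coord (H \<tau>) j \<partial>lborel) - ee j t * coord \<xi> j)"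
    by (rule mild_hat[OF v \<phi>])
  obtain H' \<xi>' where H': "H' \<in> borel_measurable borel" "integrable lborel H'" "\<forall>t. t \<notin> {0<..<T} \<longrightarrow> H' t = 0"
    "\<forall>j. integrable lborel (\<lambda>\<tau>. K j (T - \<tau>) * coord (H' \<tau>) j) \<and>
      coord \<xi>' j = (\<integral>\<tau>. K j (T - \<tau>) * coord (H' \<tau>) j \<partial>lborel)"
    and aeH': "AE t in lborel. t \<in> {0<..<T} \<longrightarrow> u t \<in> L2 \<Omega> \<and> H' t = hat (F t (u t)) - k t *\<^sub>R hat (u t) \<and>
      (\<forall>j. integrable lborel (\<lambda>\<tau>. K j (t - \<tau>) * coord (H' \<tau>) j) \<and>
           coord (hat (u t)) j = ee j t * coord (hat \<phi>) j + (\<integral>\<tau>. K j (t - \<tau>) * coord (H' \<tau>) j \<partial>lborel) - ee j t * coord \<xi>' j)"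
    by (rule mild_hat[OF u \<phi>])
  have "AE t in lborel. t \<in> {0<..<T} \<longrightarrow> hat (v t) - hat (u t) = 0"
  proof (rule uniqueness)
    show "(\<lambda>t. H t - H' t) \<in> borel_measurable borel" using H H' by measurable
    show "integrable lborel (\<lambda>t. H t - H' t)" using H H' by simp
    show "H t - H' t = 0" if "t \<notin> {0<..<T}" for t using H H' that by simp
    show "coord (\<xi> - \<xi>') j = (\<integral>\<tau>. K j (T - \<tau>) * coord (H \<tau> - H' \<tau>) j \<partial>lborel)" for j
      using H(4) H'(4) by (simp add: right_diff_distrib)
    show "AE t in lborel. t \<in> {0<..<T} \<longrightarrow> (\<forall>j. coord (hat (v t) - hat (u t)) j =
      (\<integral>\<tau>. K j (t - \<tau>) * coord (H \<tau> - H' \<tau>) j \<partial>lborel) - ee j t * coord (\<xi> - \<xi>') j)"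
      using aeH aeH' by eventually_elim (simp add: right_diff_distrib)
    show "AE t in lborel. t \<in> {0<..<T} \<longrightarrow> norm (H t - H' t) \<le> g * norm (hat (v t) - hat (u t))"
      using aeH aeH'
    proof eventually_elim
      case (elim t)
      show ?case
      proof
        assume t: "t \<in> {0<..<T}"
        define d where "d = hat (v t) - hat (u t)"
        have "H t - H' t = (hat (F t (v t)) - hat (F t (u t))) - k t *\<^sub>R d"
          using elim t by (simp add: d_def scaleR_diff_right)
        also have "norm \<dots> \<le> norm (hat (F t (v t)) - hat (F t (u t))) + \<bar>k t\<bar> * norm d"
          using norm_triangle_ineq4[of _ "k t *\<^sub>R d"] by simp
        also have "\<dots> \<le> \<Upsilon> * norm d + C_norm T k * norm d"
          using norm_hat_F_diff[OF t t, of "v t" "u t"] elim t k_le[of t]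
          by (intro add_mono mult_right_mono) (auto simp: d_def)
        finally show "norm (H t - H' t) \<le> g * norm (hat (v t) - hat (u t))" by (simp add: d_def distrib_right)
      qed
    qed
  qed
  with aeH aeH' show ?thesis
    unfolding AE_lebesgue_on_iff[OF borel_open[OF open_greaterThanLessThan]]
  proof eventually_elim
    case (elim t)
    then show ?case using hat_eq_iff[of "v t" "u t"] by auto
  qed
qed

text \<open>\<open>fnl\<close> is an isometry of \<open>ell2\<close> into \<open>D(L\<^bsup>-\<beta>q\<^esup>)\<close>; composed with \<open>Q\<close> it is the embedding of \<open>L\<^sub>2(\<Omega>)\<close>,
  see \<open>L2_inner_fnl\<close>.\<close>

definition pq_coeff :: "(real ^ 'n \<Rightarrow> real) \<Rightarrow> ell2" where
  "pq_coeff \<psi> = ell2_of (\<lambda>j. lam j powr (\<beta> * q) * L2_inner \<Omega> \<psi> (e j))"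

definition fnl :: "ell2 \<Rightarrow> (real ^ 'n \<Rightarrow> real) \<Rightarrow> real" where
  "fnl X \<psi> = inner X (pq_coeff \<psi>)"

abbreviation Q :: "ell2 \<Rightarrow> ell2" where
  "Q \<equiv> diag (\<lambda>j. (lam j powr \<beta>) powr (- q))"

lemma coord_pq_coeff: "\<psi> \<in> pow_dom \<Omega> lam e (\<beta> * q) \<Longrightarrow> coord (pq_coeff \<psi>) j = lam j powr (\<beta> * q) * L2_inner \<Omega> \<psi> (e j)"
  by (simp add: pq_coeff_def pow_dom_def coord_ell2_of)

lemma norm_pq_coeff: "\<psi> \<in> pow_dom \<Omega> lam e (\<beta> * q) \<Longrightarrow> norm (pq_coeff \<psi>) = pow_norm \<Omega> lam e (\<beta> * q) \<psi>"
  by (simp add: norm_ell2 pow_norm_def coord_pq_coeff)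

lemma e_pow_dom: "e j \<in> pow_dom \<Omega> lam e \<gamma>"
proof -
  have "summable (\<lambda>i. (lam i powr \<gamma> * L2_inner \<Omega> (e j) (e i))\<^sup>2)"
    by (rule summable_finite[of "{j}"]) (auto simp: e_orth)
  then show ?thesis by (simp add: pow_dom_def)
qed

lemma fnl_e: "fnl X (e j) = coord X j * lam j powr (\<beta> * q)"
proof -
  have "(\<Sum>i. coord X i * coord (pq_coeff (e j)) i) = (\<Sum>i\<in>{j}. coord X i * coord (pq_coeff (e j)) i)"
    by (rule suminf_finite) (auto simp: coord_pq_coeff[OF e_pow_dom] e_orth)
  then show ?thesis by (simp add: fnl_def inner_ell2_def coord_pq_coeff[OF e_pow_dom] e_orth)
qed

lemma fnl_dual: "fnl X \<in> dual_dom \<Omega> lam e (\<beta> * q)"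
proof -
  have "fnl X (\<lambda>x. a * u x + c * v x) = a * fnl X u + c * fnl X v"
    if u: "u \<in> pow_dom \<Omega> lam e (\<beta> * q)" and v: "v \<in> pow_dom \<Omega> lam e (\<beta> * q)" for u v a c
  proof -
    have "L2_inner \<Omega> (\<lambda>x. a * u x + c * v x) (e j) = a * L2_inner \<Omega> u (e j) + c * L2_inner \<Omega> v (e j)" for j
      using u v by (intro L2_inner_lincomb) (auto simp: pow_dom_def)
    then have "lam j powr (\<beta> * q) * L2_inner \<Omega> (\<lambda>x. a * u x + c * v x) (e j) = coord (a *\<^sub>R pq_coeff u + c *\<^sub>R pq_coeff v) j" for j
      using u v by (simp add: coord_pq_coeff algebra_simps)
    then have "pq_coeff (\<lambda>x. a * u x + c * v x) = a *\<^sub>R pq_coeff u + c *\<^sub>R pq_coeff v"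
      by (simp only: pq_coeff_def[of "\<lambda>x. a * u x + c * v x"] ell2_of_coord)
    then show ?thesis by (simp add: fnl_def inner_add_right)
  qed
  moreover have "\<bar>fnl X v\<bar> \<le> norm X * pow_norm \<Omega> lam e (\<beta> * q) v" if "v \<in> pow_dom \<Omega> lam e (\<beta> * q)" for v
    unfolding fnl_def norm_pq_coeff[OF that, symmetric] by (rule Cauchy_Schwarz_ineq2)
  ultimately show ?thesis unfolding dual_dom_def by blast
qed

text \<open>Only the values on the basis enter \<open>dual_norm\<close>. The functional w therefore
  need not be written as \<open>fnl X\<close>, which covers differences and difference quotients of
  functionals as well as functions of L2 paired with test functions.\<close>

lemma dual_norm_eq:
  assumes "\<And>j. w (e j) = coord X j * lam j powr (\<beta> * q)"
  shows "dual_norm lam e (\<beta> * q) w = norm X"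
proof -
  have "(w (e j))\<^sup>2 * lam j powr (- 2 * (\<beta> * q)) = (coord X j)\<^sup>2" for j
  proof -
    have "lam j powr (\<beta> * q) * lam j powr (\<beta> * q) * lam j powr (- 2 * (\<beta> * q)) = lam j powr (\<beta> * q + \<beta> * q + - 2 * (\<beta> * q))"
      by (simp only: powr_add)
    also have "\<dots> = 1" using lam_pos[of j] by simp
    finally have 1: "lam j powr (\<beta> * q) * lam j powr (\<beta> * q) * lam j powr (- 2 * (\<beta> * q)) = 1" .
    have "(w (e j))\<^sup>2 * lam j powr (- 2 * (\<beta> * q)) =
        (coord X j)\<^sup>2 * (lam j powr (\<beta> * q) * lam j powr (\<beta> * q) * lam j powr (- 2 * (\<beta> * q)))"
      unfolding assms power2_eq_square by (simp only: mult_ac)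
    then show ?thesis unfolding 1 by simp
  qed
  then show ?thesis unfolding dual_norm_def norm_ell2 by simp
qed

lemma Q_bd: "\<bar>(lam j powr \<beta>) powr (- q)\<bar> \<le> (lam 0 powr \<beta>) powr (- q)"
  using mu_neg_powr[of q j] pq by simp

lemma L2_inner_fnl:
  assumes v: "v \<in> L2 \<Omega>" and \<psi>: "\<psi> \<in> pow_dom \<Omega> lam e (\<beta> * q)"
  shows "L2_inner \<Omega> v \<psi> = fnl (Q (hat v)) \<psi>"
proof -
  have \<psi>': "\<psi> \<in> L2 \<Omega>" using \<psi> by (simp add: pow_dom_def)
  have "coord (hat v) j * coord (hat \<psi>) j = coord (Q (hat v)) j * coord (pq_coeff \<psi>) j" for j
  proof -
    have "(lam j powr \<beta>) powr (- q) * lam j powr (\<beta> * q) = 1"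
      using lam_pos[of j] by (simp add: powr_powr flip: powr_add)
    then have "coord (hat v) j * coord (hat \<psi>) j =
      ((lam j powr \<beta>) powr (- q) * lam j powr (\<beta> * q)) * (coord (hat v) j * coord (hat \<psi>) j)" by simp
    then show ?thesis
      unfolding coord_diag[OF Q_bd] coord_pq_coeff[OF \<psi>] coord_hat[OF \<psi>'] by (simp only: mult_ac)
  qed
  then have "inner (hat v) (hat \<psi>) = fnl (Q (hat v)) \<psi>" by (simp only: fnl_def inner_ell2_def)
  then show ?thesis by (simp add: inner_hat[OF v \<psi>'])
qed

text \<open>F is given for 0 < t < T only, while the Caputo derivative has to be continuous up to t
  = T. Joint Lipschitz continuity in time and state extends the map to the closed interval.
  Composition with \<open>hat\<close> and \<open>syn\<close> makes it a map of \<open>ell2\<close>;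
  by the Lipschitz bound the chosen representative is irrelevant.\<close>

lemma F_extension:
  obtains Fe :: "real \<Rightarrow> ell2 \<Rightarrow> ell2" where
    "\<forall>t\<in>{0<..<T}. \<forall>x. Fe t x = hat (F t (syn x))"
    "continuous_on ({0..T} \<times> UNIV) (\<lambda>(t, x). Fe t x)"
    "\<forall>t\<in>{0..T}. \<forall>x. norm (Fe t x) \<le> \<Upsilon> * norm x"
proof -
  have lip: "(2 * \<Upsilon>)-lipschitz_on ({0<..<T} \<times> UNIV) (\<lambda>z. hat (F (fst z) (syn (snd z))))"
  proof (rule lipschitz_onI)
    fix z w :: "real \<times> ell2" assume z: "z \<in> {0<..<T} \<times> UNIV" and w: "w \<in> {0<..<T} \<times> UNIV"
    have "norm (hat (F (fst z) (syn (snd z))) - hat (F (fst w) (syn (snd w)))) \<le>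
        \<Upsilon> * (\<bar>fst z - fst w\<bar> + norm (hat (syn (snd z)) - hat (syn (snd w))))"
      using z w by (intro norm_hat_F_diff) auto
    also have "\<dots> \<le> \<Upsilon> * (dist z w + dist z w)"
    proof (intro mult_left_mono add_mono)
      show "\<bar>fst z - fst w\<bar> \<le> dist z w" using dist_fst_le[of z w] by (simp add: dist_real_def)
      show "norm (hat (syn (snd z)) - hat (syn (snd w))) \<le> dist z w" using dist_snd_le[of z w] by (simp add: dist_norm)
    qed (use \<Upsilon> in auto)
    finally show "dist (hat (F (fst z) (syn (snd z)))) (hat (F (fst w) (syn (snd w)))) \<le> 2 * \<Upsilon> * dist z w"
      by (simp add: dist_norm)
  qed (use \<Upsilon> in auto)
  have cl: "closure ({0<..<T} \<times> (UNIV :: ell2 set)) = {0..T} \<times> UNIV" using T by (simp add: closure_Times)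
  obtain G where G: "(2 * \<Upsilon>)-lipschitz_on ({0..T} \<times> UNIV) G" "\<And>z. z \<in> {0<..<T} \<times> UNIV \<Longrightarrow> G z = hat (F (fst z) (syn (snd z)))"
    using lipschitz_extend_closure[OF lip] unfolding cl by blast
  have Gc: "continuous_on ({0..T} \<times> UNIV) G" by (rule lipschitz_on_continuous_on[OF G(1)])
  show thesis
  proof (rule that[of "\<lambda>t x. G (t, x)"])
    show "\<forall>t\<in>{0<..<T}. \<forall>x. G (t, x) = hat (F t (syn x))" using G(2) by simp
    show "continuous_on ({0..T} \<times> UNIV) (\<lambda>(t, x). G (t, x))" using Gc by simp
    show "\<forall>t\<in>{0..T}. \<forall>x. norm (G (t, x)) \<le> \<Upsilon> * norm x"
    proof (intro ballI allI)
      fix t x assume t: "t \<in> {0..T}"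
      have cl': "closure {0<..<T} = {0..T}" using T by simp
      show "norm (G (t, x)) \<le> \<Upsilon> * norm x"
      proof (rule continuous_on_closure_norm_le[of "{0<..<T}" "\<lambda>t. G (t, x)"])
        show "continuous_on (closure {0<..<T}) (\<lambda>t. G (t, x))"
          unfolding cl' by (rule continuous_on_compose2[OF Gc]) (auto intro!: continuous_intros)
        show "\<forall>t\<in>{0<..<T}. norm (G (t, x)) \<le> \<Upsilon> * norm x"
        proof
          fix t assume t: "t \<in> {0<..<T}"
          have "hat (F t (\<lambda>_. 0)) = hat (\<lambda>_. 0)"
            using hat_eq_iff[OF F_L2[OF t L2_zero] L2_zero] F_0[OF t] by simp
          then show "norm (G (t, x)) \<le> \<Upsilon> * norm x"
            using norm_hat_F_diff[OF t t syn_L2[of x] L2_zero] G(2)[of "(t, x)"] t by simp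
        qed
        show "t \<in> closure {0<..<T}" unfolding cl' by (rule t)
      qed
    qed
  qed
qed

text \<open>\<Phi> has the coefficients of L^(\<beta>p) \<phi>. The additional power qh is traded
  for a constant, since the eigenvalues are bounded below by \<open>lam 0\<close>.\<close>

lemma weighted_initial_data:
  assumes qh: "0 \<le> qh" and \<phi>: "\<phi> \<in> pow_dom \<Omega> lam e (\<beta> * (p + qh))"
  obtains \<Phi> where "\<forall>j. coord (hat \<phi>) j = (lam j powr \<beta>) powr (- p) * coord \<Phi> j"
    "norm \<Phi> \<le> lam 0 powr (- (\<beta> * qh)) * pow_norm \<Omega> lam e (\<beta> * (p + qh)) \<phi>"
proof -
  have \<phi>': "\<phi> \<in> L2 \<Omega>" using \<phi> by (simp add: pow_dom_def)
  define N where "N = ell2_of (\<lambda>j. lam j powr (\<beta> * (p + qh)) * L2_inner \<Omega> \<phi> (e j))"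
  have cN: "coord N j = lam j powr (\<beta> * (p + qh)) * coord (hat \<phi>) j" for j
    using \<phi> by (simp add: N_def pow_dom_def coord_ell2_of coord_hat)
  have nN: "norm N = pow_norm \<Omega> lam e (\<beta> * (p + qh)) \<phi>"
    by (simp add: norm_ell2 cN pow_norm_def coord_hat[OF \<phi>'])
  have b: "\<bar>lam j powr (- (\<beta> * qh))\<bar> \<le> lam 0 powr (- (\<beta> * qh))" for j
    using powr_mono2'[of "- (\<beta> * qh)" "lam 0" "lam j"] lam[of j] \<beta> qh by simp
  show thesis
  proof (rule that)
    show "\<forall>j. coord (hat \<phi>) j = (lam j powr \<beta>) powr (- p) * coord (diag (\<lambda>j. lam j powr (- (\<beta> * qh))) N) j"
    proof
      fix j
      have "(lam j powr \<beta>) powr (- p) * (lam j powr (- (\<beta> * qh)) * lam j powr (\<beta> * (p + qh))) =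
          lam j powr (- (\<beta> * p) + (- (\<beta> * qh) + \<beta> * (p + qh)))"
        by (simp only: powr_add powr_powr mult_minus_right)
      also have "- (\<beta> * p) + (- (\<beta> * qh) + \<beta> * (p + qh)) = 0" by (simp add: algebra_simps)
      finally have "(lam j powr \<beta>) powr (- p) * (lam j powr (- (\<beta> * qh)) * lam j powr (\<beta> * (p + qh))) = 1"
        using lam_pos[of j] by simp
      then show "coord (hat \<phi>) j = (lam j powr \<beta>) powr (- p) * coord (diag (\<lambda>j. lam j powr (- (\<beta> * qh))) N) j"
        unfolding coord_diag[OF b] cN by (metis mult.assoc mult_1)
    qed
    show "norm (diag (\<lambda>j. lam j powr (- (\<beta> * qh))) N) \<le> lam 0 powr (- (\<beta> * qh)) * pow_norm \<Omega> lam e (\<beta> * (p + qh)) \<phi>"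
      using norm_diag_le[OF b, where x = N] by (simp add: nN)
  qed
qed

section \<open>From the sequence space back to the nonlocal problem\<close>

lemma mild_solutionI:
  assumes \<phi>: "\<phi> \<in> L2 \<Omega>" and c: "c > 0" and Cu: "Cu \<ge> 0"
    and Uc: "continuous_on {0<..T} U" and U_bd: "\<And>t. t \<in> {0<..T} \<Longrightarrow> norm (U t) \<le> Cu * t powr (c - 1)"
    and Fe: "\<forall>t\<in>{0<..<T}. \<forall>x. Fe t x = hat (F t (syn x))" "continuous_on ({0..T} \<times> UNIV) (\<lambda>(t, x). Fe t x)"
      "\<forall>t\<in>{0..T}. \<forall>x. norm (Fe t x) \<le> \<Upsilon> * norm x"
    and U: "\<And>t j. t \<in> {0<..T} \<Longrightarrow> coord (U t) j = ee j t * coord (hat \<phi>) j +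
      coord (VC K (\<lambda>\<tau>. indicator {0<..<T} \<tau> *\<^sub>R (Fe \<tau> (U \<tau>) - k \<tau> *\<^sub>R U \<tau>)) t) j -
      ee j t * coord (VC K (\<lambda>\<tau>. indicator {0<..<T} \<tau> *\<^sub>R (Fe \<tau> (U \<tau>) - k \<tau> *\<^sub>R U \<tau>)) T) j"
  shows "mild_solution \<Omega> lam e \<alpha> \<beta> \<kappa> T \<phi> k F (\<lambda>t. syn (U t))"
proof -
  interpret multiplier \<alpha> M2 K by (rule multiplier_K) simp
  \<comment> \<open>A common statement for F(u), k u and u itself: all three are continuous in time
    and bounded by a multiple of the norm of U.\<close>
  have boch: "w \<in> Bochner_Lp T 1 \<Omega> 2"
    and rep: "represents (\<lambda>\<tau>. indicator {0<..<T} \<tau> *\<^sub>R f \<tau>) w"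
    and adm: "adm T c (B * Cu) (\<lambda>\<tau>. indicator {0<..<T} \<tau> *\<^sub>R f \<tau>)"
    if w: "\<And>t. t \<in> {0<..<T} \<Longrightarrow> w t \<in> L2 \<Omega> \<and> hat (w t) = f t" and f: "continuous_on {0<..T} f"
      and B: "B \<ge> 0" "\<And>t. t \<in> {0<..T} \<Longrightarrow> norm (f t) \<le> B * norm (U t)"
    for w and f :: "real \<Rightarrow> ell2" and B
  proof -
    have f': "continuous_on {0<..<T} f" by (rule continuous_on_subset[OF f]) auto
    show a: "adm T c (B * Cu) (\<lambda>\<tau>. indicator {0<..<T} \<tau> *\<^sub>R f \<tau>)"
    proof (intro admI f')
      show "norm (f t) \<le> B * Cu * t powr (c - 1)" if "t \<in> {0<..<T}" for t
      proof -
        have t: "t \<in> {0<..T}" using that by simp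
        show ?thesis using order_trans[OF B(2)[OF t] mult_left_mono[OF U_bd[OF t] B(1)]] by (simp add: mult.assoc)
      qed
    qed (use B Cu in auto)
    then show "represents (\<lambda>\<tau>. indicator {0<..<T} \<tau> *\<^sub>R f \<tau>) w"
      unfolding represents_def using w by (auto simp: adm_def)
    show "w \<in> Bochner_Lp T 1 \<Omega> 2"
    proof (rule Bochner_Lp_continuous[OF T])
      show "w t \<in> L2 \<Omega>" if "t \<in> {0<..<T}" for t using w that by simp
      show "continuous_on {0<..<T} (\<lambda>t. hat (w t))" using f' by (rule continuous_on_eq) (simp add: w)
      have i: "(\<lambda>\<tau>. indicator {0<..<T} \<tau> *\<^sub>R norm (hat (w \<tau>))) = (\<lambda>\<tau>. norm (indicator {0<..<T} \<tau> *\<^sub>R f \<tau>))"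
        using w by (auto simp: fun_eq_iff indicator_def)
      have "integrable lborel (\<lambda>\<tau>. norm (indicator {0<..<T} \<tau> *\<^sub>R f \<tau>))"
        by (intro integrable_norm adm_integrable[OF a c])
      then have "integrable lborel (\<lambda>\<tau>. indicator {0<..<T} \<tau> *\<^sub>R norm (hat (w \<tau>)))" unfolding i .
      moreover have "(\<lambda>\<tau>. indicator {0<..<T} \<tau> *\<^sub>R norm (hat (w \<tau>))) \<in> borel_measurable borel"
      proof -
        have "(\<lambda>\<tau>. indicator {0<..<T} \<tau> *\<^sub>R f \<tau>) \<in> borel_measurable borel" using a by (simp add: adm_def)
        then show ?thesis unfolding i by measurable
      qed
      ultimately show "integrable (lebesgue_on {0<..<T}) (\<lambda>t. norm (hat (w t)))"
        by (subst integrable_lebesgue_on_borel) auto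
    qed
  qed
  define h1 where "h1 = (\<lambda>\<tau>. indicator {0<..<T} \<tau> *\<^sub>R Fe \<tau> (U \<tau>))"
  define h2 where "h2 = (\<lambda>\<tau>. indicator {0<..<T} \<tau> *\<^sub>R (k \<tau> *\<^sub>R U \<tau>))"
  have Fec: "continuous_on {0<..T} (\<lambda>t. Fe t (U t))"
  proof -
    have "continuous_on {0<..T} (\<lambda>t. (t, U t))" by (intro continuous_intros Uc)
    moreover have "(\<lambda>t. (t, U t)) ` {0<..T} \<subseteq> {0..T} \<times> UNIV" by auto
    ultimately show ?thesis using continuous_on_compose2[OF Fe(2)] by fastforce
  qed
  have kUc: "continuous_on {0<..T} (\<lambda>t. k t *\<^sub>R U t)"
    by (intro continuous_intros Uc continuous_on_subset[OF k]) auto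
  have w1: "F t (syn (U t)) \<in> L2 \<Omega> \<and> hat (F t (syn (U t))) = Fe t (U t)" if "t \<in> {0<..<T}" for t
    using that Fe(1) by (simp add: F_L2)
  have w2: "(\<lambda>x. k t * syn (U t) x) \<in> L2 \<Omega> \<and> hat (\<lambda>x. k t * syn (U t) x) = k t *\<^sub>R U t" for t
    by (simp add: hat_cmult L2_cmult)
  have n1: "norm (Fe t (U t)) \<le> \<Upsilon> * norm (U t)" if "t \<in> {0<..T}" for t using Fe(3) that by simp
  have n2: "norm (k t *\<^sub>R U t) \<le> C_norm T k * norm (U t)" if "t \<in> {0<..T}" for t
    using k_le[of t] that by (auto intro: mult_right_mono)
  have \<Upsilon>0: "\<Upsilon> \<ge> 0" using \<Upsilon> by simp
  have p1: "(\<lambda>t. F t (syn (U t))) \<in> Bochner_Lp T 1 \<Omega> 2" "represents h1 (\<lambda>t. F t (syn (U t)))" "adm T c (\<Upsilon> * Cu) h1"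
  proof -
    show "(\<lambda>t. F t (syn (U t))) \<in> Bochner_Lp T 1 \<Omega> 2" by (rule boch[OF w1 Fec \<Upsilon>0 n1])
    show "represents h1 (\<lambda>t. F t (syn (U t)))" unfolding h1_def by (rule rep[OF w1 Fec \<Upsilon>0 n1])
    show "adm T c (\<Upsilon> * Cu) h1" unfolding h1_def by (rule adm[OF w1 Fec \<Upsilon>0 n1])
  qed
  have p2: "(\<lambda>t x. k t * syn (U t) x) \<in> Bochner_Lp T 1 \<Omega> 2" "represents h2 (\<lambda>t x. k t * syn (U t) x)" "adm T c (C_norm T k * Cu) h2"
  proof -
    show "(\<lambda>t x. k t * syn (U t) x) \<in> Bochner_Lp T 1 \<Omega> 2" by (rule boch[OF w2 kUc C_norm_nonneg n2])
    show "represents h2 (\<lambda>t x. k t * syn (U t) x)" unfolding h2_def by (rule rep[OF w2 kUc C_norm_nonneg n2])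
    show "adm T c (C_norm T k * Cu) h2" unfolding h2_def by (rule adm[OF w2 kUc C_norm_nonneg n2])
  qed
  have "(\<lambda>t. syn (U t)) \<in> Bochner_Lp T 1 \<Omega> 2"
    by (rule boch[of _ U 1]) (use Uc in auto)
  moreover have "\<exists>a1 a2 a3 a4 a5.
        has_G2 \<Omega> lam e \<alpha> \<beta> \<kappa> T t \<phi> a1 \<and>
        has_G1 \<Omega> lam e \<alpha> \<beta> t (\<lambda>\<tau>. F \<tau> (syn (U \<tau>))) a2 \<and>
        has_G3 \<Omega> lam e \<alpha> \<beta> \<kappa> T t (\<lambda>\<tau>. F \<tau> (syn (U \<tau>))) a3 \<and>
        has_G3 \<Omega> lam e \<alpha> \<beta> \<kappa> T t (\<lambda>\<tau> x. k \<tau> * syn (U \<tau>) x) a4 \<and>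
        has_G1 \<Omega> lam e \<alpha> \<beta> t (\<lambda>\<tau> x. k \<tau> * syn (U \<tau>) x) a5 \<and>
        (AE x in lebesgue_on \<Omega>. syn (U t) x = a1 x + a2 x + a3 x - a4 x - a5 x)" if t: "t \<in> {0<..<T}" for t
  proof -
    have t': "t \<in> {0<..T}" and T': "T \<in> {0<..T}" using t by auto
    obtain B where B: "\<And>j. \<bar>ee j t\<bar> \<le> B"
      using evolution_basics(3)[OF pq(3,4) t'] by blast
    define E where "E = diag (\<lambda>j. ee j t)"
    have cE: "coord (E x) j = ee j t * coord x j" for x j unfolding E_def by (rule coord_diag[OF B])
    have i1: "integrable lborel (\<lambda>\<tau>. K j (s - \<tau>) * coord (h1 \<tau>) j)" for j s
      using integrable_bounded_linear[OF bounded_linear_coord VC_integrable[OF p1(3) c, of s], of j] by (simp add: coord_m)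
    have i2: "integrable lborel (\<lambda>\<tau>. K j (s - \<tau>) * coord (h2 \<tau>) j)" for j s
      using integrable_bounded_linear[OF bounded_linear_coord VC_integrable[OF p2(3) c, of s], of j] by (simp add: coord_m)
    note v1 = VC_coord[OF p1(3) c] and v2 = VC_coord[OF p2(3) c]
    have hh: "(\<lambda>\<tau>. indicator {0<..<T} \<tau> *\<^sub>R (Fe \<tau> (U \<tau>) - k \<tau> *\<^sub>R U \<tau>)) = (\<lambda>\<tau>. h1 \<tau> - h2 \<tau>)"
      by (simp add: h1_def h2_def scaleR_diff_right)
    have "has_G2 \<Omega> lam e \<alpha> \<beta> \<kappa> T t \<phi> (syn (E (hat \<phi>)))"
      by (simp add: has_G2_iff[OF \<phi>] cE)
    moreover have "has_G1 \<Omega> lam e \<alpha> \<beta> t (\<lambda>\<tau>. F \<tau> (syn (U \<tau>))) (syn (VC K h1 t))"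
      by (simp add: has_G1_iff[OF p1(2) t'] v1 i1)
    moreover have "has_G1 \<Omega> lam e \<alpha> \<beta> t (\<lambda>\<tau> x. k \<tau> * syn (U \<tau>) x) (syn (VC K h2 t))"
      by (simp add: has_G1_iff[OF p2(2) t'] v2 i2)
    moreover have "has_G3 \<Omega> lam e \<alpha> \<beta> \<kappa> T t (\<lambda>\<tau>. F \<tau> (syn (U \<tau>))) (syn (- E (VC K h1 T)))"
      unfolding has_G3_iff[OF p1(2)] by (intro conjI exI[of _ "VC K h1 T"]) (simp_all add: v1 i1 cE)
    moreover have "has_G3 \<Omega> lam e \<alpha> \<beta> \<kappa> T t (\<lambda>\<tau> x. k \<tau> * syn (U \<tau>) x) (syn (- E (VC K h2 T)))"
      unfolding has_G3_iff[OF p2(2)] by (intro conjI exI[of _ "VC K h2 T"]) (simp_all add: v2 i2 cE)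
    moreover have "AE x in lebesgue_on \<Omega>. syn (U t) x = syn (E (hat \<phi>)) x + syn (VC K h1 t) x + syn (- E (VC K h1 T)) x -
        syn (- E (VC K h2 T)) x - syn (VC K h2 t) x"
    proof (subst hat_eq_iff[symmetric])
      have "U t = E (hat \<phi>) + VC K h1 t + - E (VC K h1 T) - - E (VC K h2 T) - VC K h2 t"
        by (rule ell2_eqI) (simp only: U[OF t'] hh VC_diff[OF p1(3) p2(3) c] coord_simps cE, simp add: algebra_simps)
      then show "hat (syn (U t)) = hat (\<lambda>x. syn (E (hat \<phi>)) x + syn (VC K h1 t) x + syn (- E (VC K h1 T)) x -
        syn (- E (VC K h2 T)) x - syn (VC K h2 t) x)"
        by (simp add: hat_diff hat_add L2_diff L2_add)
    qed (intro L2_diff L2_add syn_L2)+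
    ultimately show ?thesis by blast
  qed
  then have "AE t in lebesgue_on {0<..<T}. \<exists>a1 a2 a3 a4 a5.
        has_G2 \<Omega> lam e \<alpha> \<beta> \<kappa> T t \<phi> a1 \<and>
        has_G1 \<Omega> lam e \<alpha> \<beta> t (\<lambda>\<tau>. F \<tau> (syn (U \<tau>))) a2 \<and>
        has_G3 \<Omega> lam e \<alpha> \<beta> \<kappa> T t (\<lambda>\<tau>. F \<tau> (syn (U \<tau>))) a3 \<and>
        has_G3 \<Omega> lam e \<alpha> \<beta> \<kappa> T t (\<lambda>\<tau> x. k \<tau> * syn (U \<tau>) x) a4 \<and>
        has_G1 \<Omega> lam e \<alpha> \<beta> t (\<lambda>\<tau> x. k \<tau> * syn (U \<tau>) x) a5 \<and>
        (AE x in lebesgue_on \<Omega>. syn (U t) x = a1 x + a2 x + a3 x - a4 x - a5 x)"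
    unfolding AE_lebesgue_on_iff[OF borel_open[OF open_greaterThanLessThan]] by (intro AE_I2) blast
  ultimately show ?thesis
    unfolding mild_solution_def using p1(1) p2(1)
    by (intro conjI exI[of _ "1::real"] exI[of _ "2::real"]) auto
qed

lemma has_caputo_derivativeI:
  assumes lim: "((\<lambda>t. Q (U t)) \<longlongrightarrow> U0) (at_right 0)"
    and meas: "(\<lambda>\<tau>. indicator {0<..<T} \<tau> *\<^sub>R (Q (U \<tau>) - U0)) \<in> borel_measurable borel"
    and int: "\<And>t z. t \<in> {0<..T} \<Longrightarrow> integrable lborel
      (\<lambda>\<tau>. pk (1 - \<alpha>) (t - \<tau>) * inner (indicator {0<..<T} \<tau> *\<^sub>R (Q (U \<tau>) - U0)) z)"
    and J: "\<And>t z. t \<in> {0<..T} \<Longrightarrow> inner (J t) z = 1 / Gamma (1 - \<alpha>) *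
      cv (pk (1 - \<alpha>)) (\<lambda>\<tau>. inner (indicator {0<..<T} \<tau> *\<^sub>R (Q (U \<tau>) - U0)) z) t"
    and der: "\<And>t. t \<in> {0<..T} \<Longrightarrow> ((\<lambda>s. (J s - J t) /\<^sub>R (s - t)) \<longlongrightarrow> W t) (at t within {0<..T})"
  shows "has_caputo_derivative \<Omega> lam e (\<beta> * q) \<alpha> T (\<lambda>t. syn (U t)) (\<lambda>t. fnl (W t))"
  unfolding has_caputo_derivative_def
proof (intro conjI ballI bexI[of _ "fnl U0"] exI[of _ "\<lambda>t. fnl (J t)"] fnl_dual syn_L2)
  have in_eq: "L2_inner \<Omega> (syn (U t)) \<psi> - fnl U0 \<psi> = inner (Q (U t) - U0) (pq_coeff \<psi>)"
    if "\<psi> \<in> pow_dom \<Omega> lam e (\<beta> * q)" for t \<psi>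
    by (simp add: L2_inner_fnl[OF syn_L2 that] fnl_def inner_diff_left)
  have "dual_norm lam e (\<beta> * q) (\<lambda>\<psi>. L2_inner \<Omega> (syn (U t)) \<psi> - fnl U0 \<psi>) = norm (Q (U t) - U0)" for t
    by (rule dual_norm_eq) (simp only: in_eq[OF e_pow_dom], simp only: fnl_def[symmetric] fnl_e)
  then show "((\<lambda>t. dual_norm lam e (\<beta> * q) (\<lambda>\<psi>. L2_inner \<Omega> (syn (U t)) \<psi> - fnl U0 \<psi>)) \<longlongrightarrow> 0) (at_right 0)"
    using tendsto_norm_zero[OF LIM_zero[OF lim]] by simp
  show "((\<lambda>s. dual_norm lam e (\<beta> * q) (\<lambda>\<psi>. (fnl (J s) \<psi> - fnl (J t) \<psi>) / (s - t) - fnl (W t) \<psi>)) \<longlongrightarrow> 0)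
      (at t within {0<..T})" if t: "t \<in> {0<..T}" for t
  proof -
    have "dual_norm lam e (\<beta> * q) (\<lambda>\<psi>. (fnl (J s) \<psi> - fnl (J t) \<psi>) / (s - t) - fnl (W t) \<psi>) =
        norm ((J s - J t) /\<^sub>R (s - t) - W t)" for s
      by (rule dual_norm_eq) (simp add: fnl_e divide_inverse algebra_simps)
    then show ?thesis using tendsto_norm_zero[OF LIM_zero[OF der[OF t]]] by simp
  qed
  fix t \<psi> assume t: "t \<in> {0<..T}" and \<psi>: "\<psi> \<in> pow_dom \<Omega> lam e (\<beta> * q)"
  define y where "y \<tau> = inner (indicator {0<..<T} \<tau> *\<^sub>R (Q (U \<tau>) - U0)) (pq_coeff \<psi>)" for \<tau>
  have y: "y \<in> borel_measurable borel" unfolding y_def[abs_def]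
    by (rule borel_measurable_inner[OF meas]) simp
  have y0: "y s = 0" if "s \<le> 0" for s using that by (simp add: y_def)
  have yg: "L2_inner \<Omega> (syn (U s)) \<psi> - fnl U0 \<psi> = y s" if "s \<in> {0<..<t}" for s
    using that t by (simp add: in_eq[OF \<psi>] y_def)
  note fi = frac_integral_cv[OF y y0 yg]
  show "integrable (lebesgue_on {0<..<t}) (\<lambda>\<tau>. (t - \<tau>) powr (- \<alpha>) * (L2_inner \<Omega> (syn (U \<tau>)) \<psi> - fnl U0 \<psi>))"
    using fi(2)[where \<sigma> = "1 - \<alpha>"] int[OF t, of "pq_coeff \<psi>"] by (simp add: y_def)
  show "fnl (J t) \<psi> = frac_integral (1 - \<alpha>) (\<lambda>\<tau>. L2_inner \<Omega> (syn (U \<tau>)) \<psi> - fnl U0 \<psi>) t"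
    using fi(1)[where \<sigma> = "1 - \<alpha>"] J[OF t, of "pq_coeff \<psi>"] by (simp add: y_def[abs_def] fnl_def)
qed

lemma weighted_fnl:
  assumes W: "continuous_on {0<..T} W" and bd: "\<And>t. t \<in> {0<..T} \<Longrightarrow> norm (W t) \<le> D * t powr (- \<alpha>)"
  shows "(\<lambda>t. fnl (W t)) \<in> weighted_C T \<alpha> (dual_dom \<Omega> lam e (\<beta> * q)) (dual_norm lam e (\<beta> * q))"
    and "weighted_norm T \<alpha> (dual_norm lam e (\<beta> * q)) (\<lambda>t. fnl (W t)) \<le> D"
proof -
  have n: "dual_norm lam e (\<beta> * q) (fnl X) = norm X" for X
    by (rule dual_norm_eq) (rule fnl_e)
  have le: "t powr \<alpha> * dual_norm lam e (\<beta> * q) (fnl (W t)) \<le> D" if t: "t \<in> {0<..T}" for t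
  proof -
    have "t powr \<alpha> * norm (W t) \<le> t powr \<alpha> * (D * t powr (- \<alpha>))" by (rule mult_left_mono[OF bd[OF t]]) simp
    also have "\<dots> = D * (t powr \<alpha> * t powr (- \<alpha>))" by simp
    also have "t powr \<alpha> * t powr (- \<alpha>) = 1" using t by (simp flip: powr_add)
    finally show ?thesis by (simp add: n)
  qed
  show "(\<lambda>t. fnl (W t)) \<in> weighted_C T \<alpha> (dual_dom \<Omega> lam e (\<beta> * q)) (dual_norm lam e (\<beta> * q))"
    unfolding weighted_C_def
  proof (intro CollectI conjI ballI fnl_dual)
    fix t assume t: "t \<in> {0<..T}"
    have "dual_norm lam e (\<beta> * q) (\<lambda>\<psi>. fnl (W s) \<psi> - fnl (W t) \<psi>) = norm (W s - W t)" for s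
      by (rule dual_norm_eq) (simp add: fnl_e left_diff_distrib)
    moreover have "(W \<longlongrightarrow> W t) (at t within {0<..T})" using W t by (simp add: continuous_on_def)
    ultimately show "((\<lambda>s. dual_norm lam e (\<beta> * q) (\<lambda>\<psi>. fnl (W s) \<psi> - fnl (W t) \<psi>)) \<longlongrightarrow> 0) (at t within {0<..T})"
      using tendsto_norm_zero[OF LIM_zero] by simp
  next
    show "bdd_above ((\<lambda>t. t powr \<alpha> * dual_norm lam e (\<beta> * q) (fnl (W t))) ` {0<..T})"
      using le by (intro bdd_aboveI2)
  qed
  show "weighted_norm T \<alpha> (dual_norm lam e (\<beta> * q)) (\<lambda>t. fnl (W t)) \<le> D"
    unfolding weighted_norm_def using T le by (intro cSUP_least) auto
qed

theorem well_posedness: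
  assumes qh: "0 \<le> qh"
  shows "\<exists>C9>0. \<forall>\<phi>\<in>pow_dom \<Omega> lam e (\<beta> * (p + qh)).
           \<exists>u. mild_solution \<Omega> lam e \<alpha> \<beta> \<kappa> T \<phi> k F u \<and>
               (\<forall>v. mild_solution \<Omega> lam e \<alpha> \<beta> \<kappa> T \<phi> k F v \<longrightarrow>
                  (AE t in lebesgue_on {0<..<T}. AE x in lebesgue_on \<Omega>. v t x = u t x)) \<and>
               (\<exists>w. has_caputo_derivative \<Omega> lam e (\<beta> * q) \<alpha> T u w \<and>
                  w \<in> weighted_C T \<alpha> (dual_dom \<Omega> lam e (\<beta> * q)) (dual_norm lam e (\<beta> * q)) \<and>
                  weighted_norm T \<alpha> (dual_norm lam e (\<beta> * q)) w
                    \<le> C9 * pow_norm \<Omega> lam e (\<beta> * (p + qh)) \<phi>)"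
proof -
  obtain M \<delta> \<rho> N1 N3 c0 C0 where "evolution \<alpha> M K T ee \<delta> \<rho> N1 N3 A\<Theta> c0 C0 g"
    by (rule evolution_exists[OF g_nonneg gA])
  then interpret evolution \<alpha> M K T ee \<delta> \<rho> N1 N3 A\<Theta> c0 C0 g .
  obtain Fe where Fe: "\<forall>t\<in>{0<..<T}. \<forall>x. Fe t x = hat (F t (syn x))" "continuous_on ({0..T} \<times> UNIV) (\<lambda>(t, x). Fe t x)"
      "\<forall>t\<in>{0..T}. \<forall>x. norm (Fe t x) \<le> \<Upsilon> * norm x"
    by (rule F_extension)
  define f where "f t x = Fe t x - k t *\<^sub>R x" for t x
  have f_cont: "continuous_on ({0..T} \<times> UNIV) (\<lambda>(t, x). f t x)"
    unfolding f_def split_def using Fe(2) unfolding split_def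
    by (intro continuous_intros continuous_on_compose2[OF k]) auto
  have f_bd: "norm (f t x) \<le> g * norm x" if "t \<in> {0..T}" for t x
  proof -
    have "norm (f t x) \<le> norm (Fe t x) + \<bar>k t\<bar> * norm x"
      using norm_triangle_ineq4[of "Fe t x" "k t *\<^sub>R x"] by (simp add: f_def)
    also have "\<dots> \<le> \<Upsilon> * norm x + C_norm T k * norm x"
      using Fe(3) k_le[OF that] that by (intro add_mono mult_right_mono) auto
    finally show ?thesis by (simp add: distrib_right)
  qed
  have f_lip: "norm (f t x - f t y) \<le> g * norm (x - y)" if t: "t \<in> {0<..<T}" for t x y
  proof -
    have "f t x - f t y = (Fe t x - Fe t y) - k t *\<^sub>R (x - y)" by (simp add: f_def algebra_simps)
    also have "norm \<dots> \<le> norm (Fe t x - Fe t y) + \<bar>k t\<bar> * norm (x - y)"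
      using norm_triangle_ineq4[of "Fe t x - Fe t y" "k t *\<^sub>R (x - y)"] by simp
    also have "\<dots> \<le> \<Upsilon> * norm (x - y) + C_norm T k * norm (x - y)"
      using norm_hat_F_diff[OF t t, of "syn x" "syn y"] Fe(1) t k_le[of t]
      by (intro add_mono mult_right_mono) auto
    finally show ?thesis by (simp add: distrib_right)
  qed
  have f_0: "f t 0 = 0" if "t \<in> {0<..<T}" for t using f_bd[of t 0] that by simp
  have f_cont': "continuous_on ({0<..<T} \<times> UNIV) (\<lambda>(t, x). f t x)"
    by (rule continuous_on_subset[OF f_cont]) auto
  have q0: "0 \<le> q" "q < 1" using pq by auto
  have "\<exists>D\<ge>0. \<forall>\<psi> C. continuous_on {0<..T} \<psi> \<longrightarrow> C \<ge> 0 \<longrightarrow> (\<forall>t\<in>{0<..T}. norm (\<psi> t) \<le> C * t powr (- (\<alpha> * q))) \<longrightarrow>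
    (\<exists>u. continuous_on {0<..T} u \<and>
      (\<forall>t\<in>{0<..T}. u t = \<psi> t + G (\<lambda>\<tau>. indicator {0<..<T} \<tau> *\<^sub>R f \<tau> (u \<tau>)) t) \<and>
      (\<forall>t\<in>{0<..T}. norm (u t) \<le> D * C * t powr (- (\<alpha> * max q \<delta>))))"
    using f_0 f_lip by (intro existence[OF f_cont' _ _ q0])
  then obtain D where D: "D \<ge> 0" "\<And>\<psi> C. continuous_on {0<..T} \<psi> \<Longrightarrow> C \<ge> 0 \<Longrightarrow> \<forall>t\<in>{0<..T}. norm (\<psi> t) \<le> C * t powr (- (\<alpha> * q)) \<Longrightarrow>
    (\<exists>u. continuous_on {0<..T} u \<and>
      (\<forall>t\<in>{0<..T}. u t = \<psi> t + G (\<lambda>\<tau>. indicator {0<..<T} \<tau> *\<^sub>R f \<tau> (u \<tau>)) t) \<and>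
      (\<forall>t\<in>{0<..T}. norm (u t) \<le> D * C * t powr (- (\<alpha> * max q \<delta>))))"
    by blast
  \<comment> \<open>The free term is of order t^(-\<alpha>q) and the fixed point correction of order
    t^(-\<alpha>\<delta>); u inherits the worse order. Since q < 1 and \<delta> < 1, the strict
    inequality 1-\<alpha> < c required by \<open>caputo_regularity\<close> holds.\<close>
  define c where "c = 1 - \<alpha> * max q \<delta>"
  have c: "1 - \<alpha> < c" "c > 0"
  proof -
    have "\<alpha> * max q \<delta> < \<alpha> * 1" using \<alpha> q0 \<delta> by (intro mult_strict_left_mono) auto
    then show "1 - \<alpha> < c" by (simp add: c_def)
    then show "c > 0" using \<alpha> by linarith
  qed
  define D1 where "D1 = M\<theta> 1 + Df c * (g * (D * M\<theta> q))"
  have D1: "D1 \<ge> 0" using M\<theta>_nonneg Df_nonneg[OF c(2)] D(1) g_nonneg by (simp add: D1_def)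
  show ?thesis
  \<comment> \<open>D1 is the factor of the norm of \<Phi> in the bound on the derivative, with the
    solution bound inserted for the forcing term. Only D1 \<ge> 0 is established, so 1 is added to
    obtain a positive constant.\<close>
  proof (intro exI[of _ "D1 * lam 0 powr (- (\<beta> * qh)) + 1"] conjI ballI)
    show "0 < D1 * lam 0 powr (- (\<beta> * qh)) + 1" using D1 by (simp add: add_nonneg_pos)
    fix \<phi> assume \<phi>: "\<phi> \<in> pow_dom \<Omega> lam e (\<beta> * (p + qh))"
    have \<phi>': "\<phi> \<in> L2 \<Omega>" using \<phi> by (simp add: pow_dom_def)
    obtain \<Phi> where \<Phi>: "\<forall>j. coord (hat \<phi>) j = (lam j powr \<beta>) powr (- p) * coord \<Phi> j"
      "norm \<Phi> \<le> lam 0 powr (- (\<beta> * qh)) * pow_norm \<Omega> lam e (\<beta> * (p + qh)) \<phi>"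
      by (rule weighted_initial_data[OF qh \<phi>])
    define \<psi> where "\<psi> t = diag (\<lambda>j. ee j t) (hat \<phi>)" for t
    have \<psi>_bd: "norm (\<psi> t) \<le> M\<theta> q * norm \<Phi> * t powr (- (\<alpha> * q))" if t: "t \<in> {0<..T}" for t
    proof -
      \<comment> \<open>With \<theta> = q the factor \<open>ee j t\<close> costs \<mu>_j^(1-q) =
        \<mu>_j^p, which is cancelled by the factor \<mu>_j^(-p) in front of \<Phi>.\<close>
      have b: "\<bar>ee j t * (lam j powr \<beta>) powr (- p)\<bar> \<le> M\<theta> q * t powr (- (\<alpha> * q))" for j
      proof -
        have p: "1 - q = p" using pq by simp
        have "\<bar>ee j t\<bar> \<le> M\<theta> q * t powr (- (\<alpha> * q)) * (lam j powr \<beta>) powr p"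
          using ee_bound_powr[OF t, of q j] q0 unfolding M\<theta>_def p by simp
        then have "\<bar>ee j t\<bar> * (lam j powr \<beta>) powr (- p) \<le> M\<theta> q * t powr (- (\<alpha> * q)) * (lam j powr \<beta>) powr p * (lam j powr \<beta>) powr (- p)"
          by (rule mult_right_mono) simp
        also have "\<dots> = M\<theta> q * t powr (- (\<alpha> * q)) * ((lam j powr \<beta>) powr p * (lam j powr \<beta>) powr (- p))"
          by (simp only: mult.assoc)
        also have "(lam j powr \<beta>) powr p * (lam j powr \<beta>) powr (- p) = 1"
          unfolding powr_add[symmetric] using lam_pos[of j] by simp
        finally show ?thesis by (simp add: abs_mult)
      qed
      have "\<psi> t = diag (\<lambda>j. ee j t * (lam j powr \<beta>) powr (- p)) \<Phi>"
        by (rule ell2_eqI) (simp only: \<psi>_def coord_e[OF t] coord_diag[OF b] \<Phi>(1)[rule_format] mult.assoc)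
      then show ?thesis using norm_diag_le[OF b, where x = \<Phi>] by (simp only: mult_ac)
    qed
    have "continuous_on {0<..T} \<psi>" unfolding \<psi>_def by (rule diag_ee_cont)
    then obtain U where Uc: "continuous_on {0<..T} U"
      and U: "\<And>t. t \<in> {0<..T} \<Longrightarrow> U t = \<psi> t + G (\<lambda>\<tau>. indicator {0<..<T} \<tau> *\<^sub>R f \<tau> (U \<tau>)) t"
      and U_bd: "\<And>t. t \<in> {0<..T} \<Longrightarrow> norm (U t) \<le> D * (M\<theta> q * norm \<Phi>) * t powr (- (\<alpha> * max q \<delta>))"
      using D(2)[of \<psi> "M\<theta> q * norm \<Phi>"] \<psi>_bd M\<theta>_nonneg[of q] by auto
    have coordU: "coord (U t) j = ee j t * coord (hat \<phi>) j +
      coord (VC K (\<lambda>\<tau>. indicator {0<..<T} \<tau> *\<^sub>R f \<tau> (U \<tau>)) t) j -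
      ee j t * coord (VC K (\<lambda>\<tau>. indicator {0<..<T} \<tau> *\<^sub>R f \<tau> (U \<tau>)) T) j" if t: "t \<in> {0<..T}" for t j
      by (simp add: U[OF t] \<psi>_def G_def coord_e[OF t])
    have Cu: "D * (M\<theta> q * norm \<Phi>) \<ge> 0" using D(1) M\<theta>_nonneg[of q] by simp
    have U_bd': "norm (U t) \<le> D * (M\<theta> q * norm \<Phi>) * t powr (c - 1)" if "t \<in> {0<..T}" for t
      using U_bd[OF that] by (simp add: c_def)
    have mild: "mild_solution \<Omega> lam e \<alpha> \<beta> \<kappa> T \<phi> k F (\<lambda>t. syn (U t))"
      by (rule mild_solutionI[OF \<phi>' c(2) Cu Uc U_bd' Fe]) (use coordU in \<open>auto simp: f_def\<close>)
    have fUc: "continuous_on {0<..T} (\<lambda>t. f t (U t))"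
    proof -
      have "continuous_on {0<..T} (\<lambda>t. (t, U t))" by (intro continuous_intros Uc)
      moreover have "(\<lambda>t. (t, U t)) ` {0<..T} \<subseteq> {0..T} \<times> UNIV" by auto
      ultimately show ?thesis using continuous_on_compose2[OF f_cont] by fastforce
    qed
    define Cf where "Cf = g * (D * (M\<theta> q * norm \<Phi>))"
    have Cf: "Cf \<ge> 0" using Cu g_nonneg by (simp add: Cf_def)
    have fU: "norm (f t (U t)) \<le> Cf * t powr (c - 1)" if t: "t \<in> {0<..T}" for t
      using order_trans[OF f_bd mult_left_mono[OF U_bd'[OF t] g_nonneg], of t] t by (simp add: Cf_def mult.assoc)
    have coordU': "coord (U t) j = ee j t * ((lam j powr \<beta>) powr (- p) * coord \<Phi> j) +
      coord (VC K (\<lambda>\<tau>. indicator {0<..<T} \<tau> *\<^sub>R f \<tau> (U \<tau>)) t) j -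
      ee j t * coord (VC K (\<lambda>\<tau>. indicator {0<..<T} \<tau> *\<^sub>R f \<tau> (U \<tau>)) T) j" if t: "t \<in> {0<..T}" for t j
      unfolding coordU[OF t] \<Phi>(1)[rule_format] ..
    obtain U0 W J where cap: "((\<lambda>t. Q (U t)) \<longlongrightarrow> U0) (at_right 0)"
      "continuous_on {0<..T} W"
      "\<And>t. t \<in> {0<..T} \<Longrightarrow> norm (W t) \<le> (M\<theta> 1 * norm \<Phi> + Df c * Cf) * t powr (- \<alpha>)"
      "(\<lambda>\<tau>. indicator {0<..<T} \<tau> *\<^sub>R (Q (U \<tau>) - U0)) \<in> borel_measurable borel"
      "\<And>t z. t \<in> {0<..T} \<Longrightarrow> integrable lborel
        (\<lambda>\<tau>. pk (1 - \<alpha>) (t - \<tau>) * inner (indicator {0<..<T} \<tau> *\<^sub>R (Q (U \<tau>) - U0)) z)"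
      "\<And>t z. t \<in> {0<..T} \<Longrightarrow> inner (J t) z = 1 / Gamma (1 - \<alpha>) *
        cv (pk (1 - \<alpha>)) (\<lambda>\<tau>. inner (indicator {0<..<T} \<tau> *\<^sub>R (Q (U \<tau>) - U0)) z) t"
      "\<And>t. t \<in> {0<..T} \<Longrightarrow> ((\<lambda>s. (J s - J t) /\<^sub>R (s - t)) \<longlongrightarrow> W t) (at t within {0<..T})"
      using caputo_regularity[OF c(1) Cf fUc fU coordU'] by blast
    have "M\<theta> 1 * norm \<Phi> + Df c * Cf = D1 * norm \<Phi>" by (simp add: D1_def Cf_def algebra_simps)
    also have "\<dots> \<le> D1 * (lam 0 powr (- (\<beta> * qh)) * pow_norm \<Omega> lam e (\<beta> * (p + qh)) \<phi>)"
      by (rule mult_left_mono[OF \<Phi>(2) D1])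
    also have "\<dots> \<le> (D1 * lam 0 powr (- (\<beta> * qh)) + 1) * pow_norm \<Omega> lam e (\<beta> * (p + qh)) \<phi>"
    proof -
      have "0 \<le> (\<Sum>j. (lam j powr (\<beta> * (p + qh)) * L2_inner \<Omega> \<phi> (e j))\<^sup>2)"
        using \<phi> by (intro suminf_nonneg) (auto simp: pow_dom_def)
      then have "pow_norm \<Omega> lam e (\<beta> * (p + qh)) \<phi> \<ge> 0" by (simp add: pow_norm_def)
      then show ?thesis by (simp add: distrib_right)
    qed
    finally have fin: "M\<theta> 1 * norm \<Phi> + Df c * Cf \<le> (D1 * lam 0 powr (- (\<beta> * qh)) + 1) * pow_norm \<Omega> lam e (\<beta> * (p + qh)) \<phi>" .
    show "\<exists>u. mild_solution \<Omega> lam e \<alpha> \<beta> \<kappa> T \<phi> k F u \<and>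
               (\<forall>v. mild_solution \<Omega> lam e \<alpha> \<beta> \<kappa> T \<phi> k F v \<longrightarrow>
                  (AE t in lebesgue_on {0<..<T}. AE x in lebesgue_on \<Omega>. v t x = u t x)) \<and>
               (\<exists>w. has_caputo_derivative \<Omega> lam e (\<beta> * q) \<alpha> T u w \<and>
                  w \<in> weighted_C T \<alpha> (dual_dom \<Omega> lam e (\<beta> * q)) (dual_norm lam e (\<beta> * q)) \<and>
                  weighted_norm T \<alpha> (dual_norm lam e (\<beta> * q)) w
                    \<le> (D1 * lam 0 powr (- (\<beta> * qh)) + 1) * pow_norm \<Omega> lam e (\<beta> * (p + qh)) \<phi>)"
    proof (intro exI[of _ "\<lambda>t. syn (U t)"] exI[of _ "\<lambda>t. fnl (W t)"] conjI allI impI mild)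
      show "AE t in lebesgue_on {0<..<T}. AE x in lebesgue_on \<Omega>. v t x = syn (U t) x"
        if "mild_solution \<Omega> lam e \<alpha> \<beta> \<kappa> T \<phi> k F v" for v
        by (rule mild_unique[OF mild that \<phi>'])
      show "has_caputo_derivative \<Omega> lam e (\<beta> * q) \<alpha> T (\<lambda>t. syn (U t)) (\<lambda>t. fnl (W t))"
        by (rule has_caputo_derivativeI[OF cap(1,4-7)])
      show "(\<lambda>t. fnl (W t)) \<in> weighted_C T \<alpha> (dual_dom \<Omega> lam e (\<beta> * q)) (dual_norm lam e (\<beta> * q))"
        by (rule weighted_fnl(1)[OF cap(2,3)])
      show "weighted_norm T \<alpha> (dual_norm lam e (\<beta> * q)) (\<lambda>t. fnl (W t))
          \<le> (D1 * lam 0 powr (- (\<beta> * qh)) + 1) * pow_norm \<Omega> lam e (\<beta> * (p + qh)) \<phi>"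
        by (rule order_trans[OF weighted_fnl(2)[OF cap(2,3)] fin])
    qed
  qed
qed

end

theorem theorem8:
  fixes \<Omega> :: "(real ^ 'n) set"
    and A :: "real ^ 'n \<Rightarrow> real ^ 'n ^ 'n" and b :: "real ^ 'n \<Rightarrow> real" and L0 :: real
    and bc :: boundary_operator
    and lam :: "nat \<Rightarrow> real" and e :: "nat \<Rightarrow> real ^ 'n \<Rightarrow> real"
    and \<alpha> \<beta> T \<kappa> M2 C\<^sub>\<kappa> \<Upsilon> p q p' q' r qh ph rh :: real
    and k :: "real \<Rightarrow> real"
    and F :: "real \<Rightarrow> (real ^ 'n \<Rightarrow> real) \<Rightarrow> real ^ 'n \<Rightarrow> real"
  assumes "0 < \<alpha>" "\<alpha> < 1" and "0 < \<beta>" "\<beta> \<le> 1" and "T > 0"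
    and "open \<Omega>" "bounded \<Omega>"
    and "elliptic_coefficients \<Omega> A b L0"
    and "eigensystem \<Omega> A b bc lam e"
    and "M2 > 0"
    and "\<And>\<sigma> z. \<lbrakk>\<sigma> \<in> {\<alpha> - 1, \<alpha>, 1}; z \<ge> 0\<rbrakk> \<Longrightarrow> \<bar>mittag_leffler \<alpha> \<sigma> (- z)\<bar> \<le> M2 / (1 + z)"
    and "\<And>lam0. \<lbrakk>0 < \<kappa>; \<kappa> < 1; lam0 > 0;
           mittag_leffler \<alpha> 1 (- (lam0 powr \<beta> * T powr \<alpha>)) = \<kappa>\<rbrakk> \<Longrightarrow> \<forall>j. lam j \<noteq> lam0"
    and "C\<^sub>\<kappa> > 0"
    and "\<And>j. \<bar>Psi lam \<alpha> \<beta> \<kappa> T j\<bar> \<le> (if \<kappa> = 0 then C\<^sub>\<kappa> * lam j powr \<beta> * T powr \<alpha> else C\<^sub>\<kappa>)"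
    and "0 < p" "p < 1" "0 < q" "q < 1" "p + q = 1"
    and "0 < p'" "p' < p" "q' = 1 - p'" "0 < r" "r \<le> (1 - \<alpha> * q') / (\<alpha> * q')"
    and "0 \<le> qh" "qh < q" "ph = 1 - qh" "0 < rh" "rh \<le> (1 - \<alpha>) / \<alpha>"
    and "continuous_on {0..T} k"
    and "\<And>t v. \<lbrakk>t \<in> {0<..<T}; v \<in> L2 \<Omega>\<rbrakk> \<Longrightarrow> F t v \<in> L2 \<Omega>"
    and "\<And>t. t \<in> {0<..<T} \<Longrightarrow> AE x in lebesgue_on \<Omega>. F t (\<lambda>_. 0) x = 0"
    and "\<Upsilon> > 0"
    and "\<And>t1 t2 v1 v2. \<lbrakk>t1 \<in> {0<..<T}; t2 \<in> {0<..<T}; v1 \<in> L2 \<Omega>; v2 \<in> L2 \<Omega>\<rbrakk> \<Longrightarrow>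
           L2_norm \<Omega> (\<lambda>x. F t1 v1 x - F t2 v2 x) \<le>
             \<Upsilon> * (\<bar>t1 - t2\<bar> + L2_norm \<Omega> (\<lambda>x. v1 x - v2 x))"
    and "Theta \<alpha> \<beta> p q (lam 0) M2 C\<^sub>\<kappa> \<Upsilon> k T < 1"
  shows "\<exists>C9>0. \<forall>\<phi>\<in>pow_dom \<Omega> lam e (\<beta> * (p + qh)).
           \<exists>u. mild_solution \<Omega> lam e \<alpha> \<beta> \<kappa> T \<phi> k F u \<and>
               (\<forall>v. mild_solution \<Omega> lam e \<alpha> \<beta> \<kappa> T \<phi> k F v \<longrightarrow>
                  (AE t in lebesgue_on {0<..<T}. AE x in lebesgue_on \<Omega>. v t x = u t x)) \<and>
               (\<exists>w. has_caputo_derivative \<Omega> lam e (\<beta> * q) \<alpha> T u w \<and>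
                  w \<in> weighted_C T \<alpha> (dual_dom \<Omega> lam e (\<beta> * q)) (dual_norm lam e (\<beta> * q)) \<and>
                  weighted_norm T \<alpha> (dual_norm lam e (\<beta> * q)) w
                    \<le> C9 * pow_norm \<Omega> lam e (\<beta> * (p + qh)) \<phi>)"
proof -
  have lam: "0 < lam 0" "mono lam" and e: "orthonormal_basis \<Omega> e"
    using assms(9) by (auto simp: eigensystem_def)
  interpret L2_basis \<Omega> e by unfold_locales (rule e)
  interpret solution_operators \<alpha> T \<kappa> M2 C\<^sub>\<kappa> p q "\<lambda>j. lam j powr \<beta>" "Psi lam \<alpha> \<beta> \<kappa> T"
  proof
    show "lam 0 powr \<beta> \<le> lam j powr \<beta>" for j
      using lam assms(3) by (intro powr_mono2) (auto simp: mono_def)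
  qed (use assms(1,2,5,10,11,13,14,15-19) lam in auto)
  have gA: "(\<Upsilon> + C_norm T k) * A\<Theta> < 1"
  proof -
    have "lam 0 powr (\<beta> * p) = (lam 0 powr \<beta>) powr p" by (simp add: powr_powr)
    \<comment> \<open>Among the five summands in \<Theta>(T), four contain \<Upsilon> or ||k|| and
      combine to the first term. The summand \<open>C\<^sub>\<kappa>\<close> standing alone gives
      the second, which is nonnegative, so \<Theta>(T) < 1 bounds the first.\<close>
    then have "Theta \<alpha> \<beta> p q (lam 0) M2 C\<^sub>\<kappa> \<Upsilon> k T = (\<Upsilon> + C_norm T k) * A\<Theta> +
        M2 / lam 0 powr (\<beta> * p) * C\<^sub>\<kappa> * Beta (\<alpha> * q) (1 - \<alpha> * q)"
      unfolding Theta_def A\<Theta>_def by (simp add: powr_minus_divide algebra_simps add_divide_distrib)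
    moreover have "0 \<le> M2 / lam 0 powr (\<beta> * p) * C\<^sub>\<kappa> * Beta (\<alpha> * q) (1 - \<alpha> * q)"
      using assms(10,13) beta_nonneg by (intro mult_nonneg_nonneg divide_nonneg_nonneg) auto
    ultimately show ?thesis using assms(35) by linarith
  qed
  interpret nonlocal_problem \<Omega> e \<alpha> T \<kappa> M2 C\<^sub>\<kappa> p q lam \<beta> \<Upsilon> k F
  proof
    show "0 < lam 0 \<and> lam 0 \<le> lam j" for j using lam by (auto simp: mono_def)
  qed (use assms(3,6,30-34) gA in auto)
  show ?thesis by (rule well_posedness[OF assms(25)])
qed

end
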